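(* Let $\mathcal{C}$ be an upwards directed class of C*-algebras. Let $G$ be a finite abelian $2$-group, and let $\alpha \colon G \to \mathrm{Aut}(A)$ be an arbitrary action of $G$ on a C*-algebra $A$. (1) If $A$ is hereditarily in $\mathcal{C}$, then $C^*(G, A, \alpha)$ and $A^{\alpha}$ are hereditarily in $\mathcal{C}$. (2) If $A$ is residually hereditarily in $\mathcal{C}$, then $C^*(G, A, \alpha)$ and $A^{\alpha}$ are residually hereditarily in $\mathcal{C}$.
   Context: Ideals in C*-algebras are assumed to be closed and two-sided. $C^*(G,A,\alpha)$ denotes the crossed product and $A^{\alpha}$ the fixed point algebra. A finite $2$-group is a finite group whose order is a power of $2$. A class $\mathcal{C}$ of C*-algebras is upwards directed if whenever a C*-algebra $A$ contains a subalgebra isomorphic to an algebra in $\mathcal{C}$, then $A \in \mathcal{C}$. For such $\mathcal{C}$, a C*-algebra $A$ is hereditarily in $\mathcal{C}$ if every nonzero hereditary subalgebra of $A$ is in $\mathcal{C}$, and residually hereditarily in $\mathcal{C}$ if $A/I$ is hereditarily in $\mathcal{C}$ for every ideal $I \subset A$ with $I \neq A$. *)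

theory Defs
  imports
    "HOL-Analysis.Analysis"
    "HOL-Algebra.Module"
    "HOL-Algebra.QuotRing"
    "HOL-Algebra.Group_Action"
begin

section \<open>C*-algebras\<close>

text \<open>
  The record inherits the field \<open>one\<close> from \<open>monoid\<close>. C*-algebras are not assumed unital: no axiom
  below mentions \<open>one\<close>, homomorphisms need not preserve it, and it carries information only
  under the predicate \<open>unital\<close>.
\<close>

record 'a cstar = "(complex, 'a) module" +
  adj :: "'a \<Rightarrow> 'a"
  cnorm :: "'a \<Rightarrow> real"

text \<open>Outside the carrier the value is immaterial; \<^const>\<open>Metric_space.mcomplete\<close> and
  \<^const>\<open>Metric_space.mtopology\<close> expect a total function that is nonnegative and symmetric.\<close>

definition cdist :: "'a cstar \<Rightarrow> 'a \<Rightarrow> 'a \<Rightarrow> real" where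
  "cdist A x y = (if x \<in> carrier A \<and> y \<in> carrier A then cnorm A (x \<ominus>\<^bsub>A\<^esub> y) else 0)"

definition ctopology :: "'a cstar \<Rightarrow> 'a topology" where
  "ctopology A = Metric_space.mtopology (carrier A) (cdist A)"

locale cstar_algebra = abelian_group A for A :: "'a cstar" (structure) +
  assumes mult_closed: "\<lbrakk>x \<in> carrier A; y \<in> carrier A\<rbrakk> \<Longrightarrow> x \<otimes> y \<in> carrier A"
    and mult_assoc: "\<lbrakk>x \<in> carrier A; y \<in> carrier A; z \<in> carrier A\<rbrakk>
      \<Longrightarrow> (x \<otimes> y) \<otimes> z = x \<otimes> (y \<otimes> z)"
    and mult_l_distr: "\<lbrakk>x \<in> carrier A; y \<in> carrier A; z \<in> carrier A\<rbrakk>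
      \<Longrightarrow> (x \<oplus> y) \<otimes> z = x \<otimes> z \<oplus> y \<otimes> z"
    and mult_r_distr: "\<lbrakk>x \<in> carrier A; y \<in> carrier A; z \<in> carrier A\<rbrakk>
      \<Longrightarrow> z \<otimes> (x \<oplus> y) = z \<otimes> x \<oplus> z \<otimes> y"
    and smult_closed: "x \<in> carrier A \<Longrightarrow> c \<odot> x \<in> carrier A"
    and smult_l_distr: "x \<in> carrier A \<Longrightarrow> (c + d) \<odot> x = c \<odot> x \<oplus> d \<odot> x"
    and smult_r_distr: "\<lbrakk>x \<in> carrier A; y \<in> carrier A\<rbrakk> \<Longrightarrow> c \<odot> (x \<oplus> y) = c \<odot> x \<oplus> c \<odot> y"
    and smult_smult: "x \<in> carrier A \<Longrightarrow> (c * d) \<odot> x = c \<odot> (d \<odot> x)"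
    and smult_one: "x \<in> carrier A \<Longrightarrow> 1 \<odot> x = x"
    and smult_mult_l: "\<lbrakk>x \<in> carrier A; y \<in> carrier A\<rbrakk> \<Longrightarrow> (c \<odot> x) \<otimes> y = c \<odot> (x \<otimes> y)"
    and smult_mult_r: "\<lbrakk>x \<in> carrier A; y \<in> carrier A\<rbrakk> \<Longrightarrow> x \<otimes> (c \<odot> y) = c \<odot> (x \<otimes> y)"
    and adj_closed: "x \<in> carrier A \<Longrightarrow> adj A x \<in> carrier A"
    and adj_adj: "x \<in> carrier A \<Longrightarrow> adj A (adj A x) = x"
    and adj_add: "\<lbrakk>x \<in> carrier A; y \<in> carrier A\<rbrakk> \<Longrightarrow> adj A (x \<oplus> y) = adj A x \<oplus> adj A y"
    and adj_smult: "x \<in> carrier A \<Longrightarrow> adj A (c \<odot> x) = cnj c \<odot> adj A x"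
    and adj_mult: "\<lbrakk>x \<in> carrier A; y \<in> carrier A\<rbrakk> \<Longrightarrow> adj A (x \<otimes> y) = adj A y \<otimes> adj A x"
    and cnorm_nonneg: "x \<in> carrier A \<Longrightarrow> 0 \<le> cnorm A x"
    and cnorm_eq_0: "x \<in> carrier A \<Longrightarrow> cnorm A x = 0 \<longleftrightarrow> x = \<zero>"
    and cnorm_triangle: "\<lbrakk>x \<in> carrier A; y \<in> carrier A\<rbrakk>
      \<Longrightarrow> cnorm A (x \<oplus> y) \<le> cnorm A x + cnorm A y"
    and cnorm_smult: "x \<in> carrier A \<Longrightarrow> cnorm A (c \<odot> x) = cmod c * cnorm A x"
    and cnorm_mult: "\<lbrakk>x \<in> carrier A; y \<in> carrier A\<rbrakk>
      \<Longrightarrow> cnorm A (x \<otimes> y) \<le> cnorm A x * cnorm A y"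
    and cstar_identity: "x \<in> carrier A \<Longrightarrow> cnorm A (adj A x \<otimes> x) = (cnorm A x)\<^sup>2"
    and complete: "Metric_space.mcomplete (carrier A) (cdist A)"

definition unital :: "'a cstar \<Rightarrow> bool" where
  "unital A \<longleftrightarrow> \<one>\<^bsub>A\<^esub> \<in> carrier A \<and>
     (\<forall>x\<in>carrier A. \<one>\<^bsub>A\<^esub> \<otimes>\<^bsub>A\<^esub> x = x \<and> x \<otimes>\<^bsub>A\<^esub> \<one>\<^bsub>A\<^esub> = x)"

definition star_hom :: "'a cstar \<Rightarrow> 'b cstar \<Rightarrow> ('a \<Rightarrow> 'b) set" where
  "star_hom A B = {\<phi> \<in> carrier A \<rightarrow> carrier B.
     (\<forall>x\<in>carrier A. \<forall>y\<in>carrier A. \<phi> (x \<oplus>\<^bsub>A\<^esub> y) = \<phi> x \<oplus>\<^bsub>B\<^esub> \<phi> y \<and> \<phi> (x \<otimes>\<^bsub>A\<^esub> y) = \<phi> x \<otimes>\<^bsub>B\<^esub> \<phi> y) \<and>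
     (\<forall>x\<in>carrier A. (\<forall>c. \<phi> (c \<odot>\<^bsub>A\<^esub> x) = c \<odot>\<^bsub>B\<^esub> \<phi> x) \<and> \<phi> (adj A x) = adj B (\<phi> x))}"

definition cstar_iso :: "'a cstar \<Rightarrow> 'b cstar \<Rightarrow> bool" where
  "cstar_iso A B \<longleftrightarrow> (\<exists>\<phi> \<in> star_hom A B. bij_betw \<phi> (carrier A) (carrier B))"

text \<open>A subalgebra with underlying set \<open>S\<close> is the structure \<open>A\<lparr>carrier := S\<rparr>\<close>.\<close>

definition cstar_subalgebra :: "'a set \<Rightarrow> 'a cstar \<Rightarrow> bool" where
  "cstar_subalgebra S A \<longleftrightarrow> additive_subgroup S A \<and>
     (\<forall>x\<in>S. \<forall>y\<in>S. x \<otimes>\<^bsub>A\<^esub> y \<in> S) \<and> (\<forall>x\<in>S. \<forall>c. c \<odot>\<^bsub>A\<^esub> x \<in> S) \<and> (\<forall>x\<in>S. adj A x \<in> S) \<and>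
     closedin (ctopology A) S"

definition cpositive :: "'a cstar \<Rightarrow> 'a \<Rightarrow> bool" where
  "cpositive A a \<longleftrightarrow> (\<exists>x\<in>carrier A. a = adj A x \<otimes>\<^bsub>A\<^esub> x)"

definition hereditary_subalgebra :: "'a set \<Rightarrow> 'a cstar \<Rightarrow> bool" where
  "hereditary_subalgebra S A \<longleftrightarrow> cstar_subalgebra S A \<and>
     (\<forall>a\<in>carrier A. \<forall>b\<in>S. cpositive A a \<and> cpositive A (b \<ominus>\<^bsub>A\<^esub> a) \<longrightarrow> a \<in> S)"

section \<open>Ideals and quotients\<close>

definition closed_ideal :: "'a set \<Rightarrow> 'a cstar \<Rightarrow> bool" where
  "closed_ideal I A \<longleftrightarrow> additive_subgroup I A \<and>
     (\<forall>x\<in>I. \<forall>a\<in>carrier A. a \<otimes>\<^bsub>A\<^esub> x \<in> I \<and> x \<otimes>\<^bsub>A\<^esub> a \<in> I) \<and> (\<forall>x\<in>I. \<forall>c. c \<odot>\<^bsub>A\<^esub> x \<in> I) \<and>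
     closedin (ctopology A) I"

text \<open>Addition and multiplication are those of \<^const>\<open>FactRing\<close>. The scalar action and the
  involution are induced from representatives in the same style as \<^const>\<open>rcoset_mult\<close>; the
  norm is the quotient norm.\<close>

definition cquotient :: "'a cstar \<Rightarrow> 'a set \<Rightarrow> 'a set cstar" where
  "cquotient A I =
    \<lparr>carrier = a_rcosets\<^bsub>A\<^esub> I, mult = rcoset_mult A I, one = I +>\<^bsub>A\<^esub> \<one>\<^bsub>A\<^esub>,
     zero = I, add = set_add A,
     smult = (\<lambda>c X. \<Union>x\<in>X. I +>\<^bsub>A\<^esub> (c \<odot>\<^bsub>A\<^esub> x)),
     adj = (\<lambda>X. \<Union>x\<in>X. I +>\<^bsub>A\<^esub> adj A x),
     cnorm = (\<lambda>X. INF x\<in>X. cnorm A x)\<rparr>"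

section \<open>Classes of C*-algebras\<close>

text \<open>
  A class is represented by a set of structures over some type \<open>'c\<close>, and an algebra over any type
  is in the class when it is isomorphic to a member. Upwards directedness makes a class
  isomorphism-invariant (take the algebra itself as the subalgebra), so nothing is lost. All
  algebras derived from a given nonzero algebra \<open>A\<close> in the theorem (subalgebras, quotients, crossed
  products by finite groups) have cardinality at most that of \<open>A\<close>, so a proper class of
  C*-algebras may be replaced by its members over a type of that size.
\<close>

definition upwards_directed :: "'c cstar set \<Rightarrow> bool" where
  "upwards_directed \<C> \<longleftrightarrow> (\<forall>A\<in>\<C>. cstar_algebra A) \<and>
     (\<forall>A. cstar_algebra A \<and>
        (\<exists>S. cstar_subalgebra S A \<and> (\<exists>B\<in>\<C>. cstar_iso (A\<lparr>carrier := S\<rparr>) B)) \<longrightarrow> A \<in> \<C>)"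

definition in_class :: "'c cstar set \<Rightarrow> 'a cstar \<Rightarrow> bool" where
  "in_class \<C> A \<longleftrightarrow> (\<exists>B\<in>\<C>. cstar_iso A B)"

definition hereditarily_in :: "'c cstar set \<Rightarrow> 'a cstar \<Rightarrow> bool" where
  "hereditarily_in \<C> A \<longleftrightarrow> cstar_algebra A \<and>
     (\<forall>S. hereditary_subalgebra S A \<and> S \<noteq> {\<zero>\<^bsub>A\<^esub>} \<longrightarrow> in_class \<C> (A\<lparr>carrier := S\<rparr>))"

definition residually_hereditarily_in :: "'c cstar set \<Rightarrow> 'a cstar \<Rightarrow> bool" where
  "residually_hereditarily_in \<C> A \<longleftrightarrow> cstar_algebra A \<and>
     (\<forall>I. closed_ideal I A \<and> I \<noteq> carrier A \<longrightarrow> hereditarily_in \<C> (cquotient A I))"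

section \<open>Actions, fixed points and crossed products\<close>

text \<open>\<^const>\<open>group_action\<close> provides a homomorphism into the bijections of \<open>carrier A\<close>; with the second
  conjunct it takes values in the *-automorphisms.\<close>

definition cstar_action :: "('g, 'm) monoid_scheme \<Rightarrow> 'a cstar \<Rightarrow> ('g \<Rightarrow> 'a \<Rightarrow> 'a) \<Rightarrow> bool" where
  "cstar_action G A \<alpha> \<longleftrightarrow> group_action G (carrier A) \<alpha> \<and> (\<forall>g\<in>carrier G. \<alpha> g \<in> star_hom A A)"

definition fixed_point_algebra ::
  "('g, 'm) monoid_scheme \<Rightarrow> 'a cstar \<Rightarrow> ('g \<Rightarrow> 'a \<Rightarrow> 'a) \<Rightarrow> 'a cstar" where
  "fixed_point_algebra G A \<alpha> = A\<lparr>carrier := {a \<in> carrier A. \<forall>g\<in>carrier G. \<alpha> g a = a}\<rparr>"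

text \<open>A covariant representation \<open>(\<phi>, u)\<close> of \<open>(G, A, \<alpha>)\<close> in a unital C*-algebra \<open>B\<close>, with \<open>u\<close>
  a unitary representation. (Up to embedding \<open>B\<close> in some \<open>B(H)\<close>, these are the covariant
  representations on Hilbert spaces; \<open>\<phi>\<close> may be degenerate.)\<close>

definition covariant_rep ::
  "('g, 'm) monoid_scheme \<Rightarrow> 'a cstar \<Rightarrow> ('g \<Rightarrow> 'a \<Rightarrow> 'a) \<Rightarrow> 'b cstar \<Rightarrow> ('a \<Rightarrow> 'b) \<Rightarrow> ('g \<Rightarrow> 'b) \<Rightarrow> bool"
  where
  "covariant_rep G A \<alpha> B \<phi> u \<longleftrightarrow> cstar_algebra B \<and> unital B \<and> \<phi> \<in> star_hom A B \<and>
     u \<in> hom G B \<and>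
     (\<forall>g\<in>carrier G. adj B (u g) \<otimes>\<^bsub>B\<^esub> u g = \<one>\<^bsub>B\<^esub> \<and> u g \<otimes>\<^bsub>B\<^esub> adj B (u g) = \<one>\<^bsub>B\<^esub>) \<and>
     (\<forall>g\<in>carrier G. \<forall>a\<in>carrier A. u g \<otimes>\<^bsub>B\<^esub> \<phi> a \<otimes>\<^bsub>B\<^esub> adj B (u g) = \<phi> (\<alpha> g a))"

definition integrated_form ::
  "('g, 'm) monoid_scheme \<Rightarrow> 'b cstar \<Rightarrow> ('a \<Rightarrow> 'b) \<Rightarrow> ('g \<Rightarrow> 'b) \<Rightarrow> ('g \<Rightarrow> 'a) \<Rightarrow> 'b" where
  "integrated_form G B \<phi> u f = (\<Oplus>\<^bsub>B\<^esub>g\<in>carrier G. \<phi> (f g) \<otimes>\<^bsub>B\<^esub> u g)"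

text \<open>
  The universal norm: the supremum over all covariant representations. It suffices to let \<open>B\<close> range
  over algebras with underlying set in \<open>'a\<close>: if \<open>A\<close> is nonzero and \<open>G\<close> is finite, the unital
  C*-algebra generated by \<open>\<phi>(A)\<close> and \<open>u(G)\<close> is spanned by the sets \<open>\<phi>(A) u(g)\<close> and the \<open>u(g)\<close>, so it
  has at most the cardinality of \<open>A\<close>.
\<close>

definition universal_norm ::
  "('g, 'm) monoid_scheme \<Rightarrow> 'a cstar \<Rightarrow> ('g \<Rightarrow> 'a \<Rightarrow> 'a) \<Rightarrow> ('g \<Rightarrow> 'a) \<Rightarrow> real" where
  "universal_norm G A \<alpha> f =
     Sup {cnorm B (integrated_form G B \<phi> u f) | (B :: 'a cstar) \<phi> u. covariant_rep G A \<alpha> B \<phi> u}"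

text \<open>
  The crossed product by a finite group. Here \<open>C\<^sub>c(G, A)\<close> consists of all functions \<open>G \<rightarrow> A\<close>, with twisted
  convolution and involution. The norm topology is that of a finite power of \<open>A\<close>, hence the
  algebra is already complete and no completion is taken. (That \<open>crossed_product G A \<alpha>\<close> is a C*-algebra
  is part of the assertion \<open>hereditarily_in \<C> (crossed_product G A \<alpha>)\<close>.)
\<close>

definition crossed_product ::
  "('g, 'm) monoid_scheme \<Rightarrow> 'a cstar \<Rightarrow> ('g \<Rightarrow> 'a \<Rightarrow> 'a) \<Rightarrow> ('g \<Rightarrow> 'a) cstar" where
  "crossed_product G A \<alpha> =
    \<lparr>carrier = carrier G \<rightarrow>\<^sub>E carrier A,
     mult = (\<lambda>f h. \<lambda>t\<in>carrier G. \<Oplus>\<^bsub>A\<^esub>s\<in>carrier G. f s \<otimes>\<^bsub>A\<^esub> \<alpha> s (h (inv\<^bsub>G\<^esub> s \<otimes>\<^bsub>G\<^esub> t))),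
     one = (\<lambda>t\<in>carrier G. if t = \<one>\<^bsub>G\<^esub> then \<one>\<^bsub>A\<^esub> else \<zero>\<^bsub>A\<^esub>),
     zero = (\<lambda>t\<in>carrier G. \<zero>\<^bsub>A\<^esub>),
     add = (\<lambda>f h. \<lambda>t\<in>carrier G. f t \<oplus>\<^bsub>A\<^esub> h t),
     smult = (\<lambda>c f. \<lambda>t\<in>carrier G. c \<odot>\<^bsub>A\<^esub> f t),
     adj = (\<lambda>f. \<lambda>t\<in>carrier G. \<alpha> t (adj A (f (inv\<^bsub>G\<^esub> t)))),
     cnorm = universal_norm G A \<alpha>\<rparr>"

end

theory Submission
  imports Defs
begin

text \<open>The heart of the matter is one automorphism \<open>\<sigma>\<close> of order two. Let \<open>S\<close> be hereditarily in the class and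
  let \<open>B\<close> be a nonzero hereditary subalgebra of the fixed algebra \<open>S\<^sup>\<sigma>\<close>. Pick a nonzero positive \<open>b \<in> B\<close>
  and let \<open>K\<close> be the closure of \<open>b S b\<close>; it is hereditary in \<open>S\<close>, invariant under \<open>\<sigma>\<close>, and its fixed
  points lie in \<open>B\<close>. If \<open>\<sigma>\<close> is trivial on \<open>K\<close>, then \<open>K\<close> is contained in \<open>B\<close>. Otherwise \<open>K\<close> contains a
  nonzero self-adjoint \<open>z\<close> with \<open>\<sigma> z = - z\<close>, and \<open>a = \<bar>z\<bar> + z\<close> satisfies \<open>a * \<sigma> a = 0\<close>. The closure \<open>H\<close> of
  \<open>a K a\<close> is then orthogonal to its image under \<open>\<sigma>\<close>, so \<open>h \<mapsto> h + \<sigma> h\<close> embeds \<open>H\<close> into \<open>B\<close>. In both cases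
  \<open>B\<close> contains a copy of a hereditary subalgebra of \<open>S\<close>, and upwards directedness applies. This is
  \<open>hered_fixed_invol\<close>.

  For the residual version, an ideal \<open>J\<close> of \<open>S\<^sup>\<sigma>\<close> need not be induced by an ideal of \<open>S\<close>. It is induced by
  a \<open>\<sigma>\<close>-invariant ideal \<open>N\<close> as soon as \<open>S\<^sub>1 J S\<^sub>1 \<subseteq> J\<close>, where \<open>S\<^sub>1\<close> is the set of odd elements, and in that
  case \<open>S\<^sup>\<sigma> / J\<close> is the fixed algebra of \<open>S / N\<close>. In general put \<open>J' = {a. S\<^sub>1 a S\<^sub>1 \<subseteq> J}\<close>. Conjugation by odd
  elements exchanges \<open>J\<close> and \<open>J'\<close>, so \<open>J \<inter> J'\<close> and \<open>J + J'\<close> are induced. Now \<open>S\<^sup>\<sigma> / J\<close> is an extension of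
  \<open>S\<^sup>\<sigma> / (J + J')\<close> by \<open>(J + J') / J\<close>. The latter is isomorphic to an ideal of \<open>S\<^sup>\<sigma> / (J \<inter> J')\<close>,
  and hereditary membership passes to extensions (\<open>hered_extension\<close>, \<open>reshered_fixed_invol\<close>).

  A finite abelian 2-group acts by commuting automorphisms whose orders are powers of two, so its
  fixed algebra is reached by a finite chain of involutions (\<open>fixed_points_stable\<close>). The crossed
  product is the fixed algebra of the matrix algebra over \<open>A\<close> indexed by \<open>G\<close>, under the action
  \<open>(g x) s t = \<alpha> g (x (s g) (t g))\<close>. Matrix algebras inherit both properties because a nonzero
  hereditary subalgebra of a matrix algebra contains a copy of a nonzero hereditary subalgebra of a
  diagonal corner (\<open>hered_corners\<close>). The norm of the crossed product is the matrix norm: a covariant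
  representation integrates to a star-homomorphism of an algebra that is complete in the matrix norm,
  hence contracts it, and the regular representation attains it (\<open>universal_norm_eq\<close>).

  The basic C*-theory is developed from square roots alone: an element is positive when it is
  self-adjoint and \<open>norm (t - a) \<le> t\<close> for some \<open>t \<ge> 0\<close>, and roots are limits of the iteration
  \<open>y \<mapsto> (y\<^sup>2 + b) / 2\<close>. Structures on a carrier are replaced by closed subsets of a type. All C*-algebra
  structures over \<open>'a\<close> embed at once into the unitization of the algebra of bounded families indexed
  by these structures (\<open>star_embedding\<close>), and both properties of a structure can be read off from its image there.\<close>

section \<open>C*-algebras as types\<close>

text \<open>A C*-algebra whose carrier is the whole type; \<open>uc_star\<close> below is the unital version. Algebras
  without unit are handled as closed subalgebras of a unital one.\<close>
class nc_star = banach + real_normed_algebra +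
  fixes scaleC :: "complex \<Rightarrow> 'a \<Rightarrow> 'a" (infixr "*\<^sub>C" 75)
    and star :: "'a \<Rightarrow> 'a"
  assumes scaleC_add_right: "c *\<^sub>C (x + y) = c *\<^sub>C x + c *\<^sub>C y"
    and scaleC_add_left: "(c + d) *\<^sub>C x = c *\<^sub>C x + d *\<^sub>C x"
    and scaleC_scaleC: "c *\<^sub>C d *\<^sub>C x = (c * d) *\<^sub>C x"
    and scaleC_of_real: "complex_of_real r *\<^sub>C x = r *\<^sub>R x"
    and scaleC_mult_left: "(c *\<^sub>C x) * y = c *\<^sub>C (x * y)"
    and scaleC_mult_right: "x * (c *\<^sub>C y) = c *\<^sub>C (x * y)"
    and norm_scaleC: "norm (c *\<^sub>C x) = cmod c * norm x"
    and star_star: "star (star x) = x"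
    and star_add: "star (x + y) = star x + star y"
    and star_scaleC: "star (c *\<^sub>C x) = cnj c *\<^sub>C star x"
    and star_mult: "star (x * y) = star y * star x"
    and norm_star_mult: "norm (star x * x) = (norm x)\<^sup>2"

class uc_star = nc_star + real_normed_algebra_1

lemma scaleC_one [simp]: "1 *\<^sub>C (x::'a::nc_star) = x"
  using scaleC_of_real[of 1 x] by simp

lemma scaleC_zero_left [simp]: "0 *\<^sub>C (x::'a::nc_star) = 0"
  using scaleC_of_real[of 0 x] by simp

lemma scaleC_minus_one: "(-1) *\<^sub>C (x::'a::nc_star) = - x"
  using scaleC_of_real[of "-1" x] by simp

lemma scaleC_zero_right [simp]: "c *\<^sub>C (0::'a::nc_star) = 0"
  using scaleC_add_right[of c "0::'a" 0] by simp

lemma scaleC_minus_right [simp]: "c *\<^sub>C (- x) = - (c *\<^sub>C (x::'a::nc_star))"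
  by (metis add.right_inverse add_eq_0_iff scaleC_add_right scaleC_zero_right)

lemma scaleC_minus_left [simp]: "(- c) *\<^sub>C x = - (c *\<^sub>C (x::'a::nc_star))"
  by (metis add.right_inverse add_eq_0_iff scaleC_add_left scaleC_zero_left)

lemma scaleC_diff_right: "c *\<^sub>C (x - y) = c *\<^sub>C x - c *\<^sub>C (y::'a::nc_star)"
  using scaleC_add_right[of c x "-y"] by simp

lemma star_zero [simp]: "star (0::'a::nc_star) = 0"
  using star_add[of "0::'a" 0] by simp

lemma star_minus [simp]: "star (- x) = - star (x::'a::nc_star)"
  by (metis add.right_inverse add_eq_0_iff star_add star_zero)

lemma star_diff: "star (x - y) = star x - star (y::'a::nc_star)"
  using star_add[of x "-y"] by simp

lemma star_scaleR [simp]: "star (r *\<^sub>R x) = r *\<^sub>R star (x::'a::nc_star)"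
  by (metis complex_cnj_complex_of_real scaleC_of_real star_scaleC)

lemma star_one [simp]: "star (1::'a::uc_star) = 1"
  by (metis mult_1_left mult_1_right star_mult star_star)

lemma star_power: "star (x ^ n) = star (x::'a::uc_star) ^ n"
  by (induction n) (simp_all add: star_mult power_commutes)

lemma star_sum: "star (sum f I) = (\<Sum>i\<in>I. star (f i :: 'a::nc_star))"
  by (induction I rule: infinite_finite_induct) (simp_all add: star_add)

lemma norm_star [simp]: "norm (star x) = norm (x::'a::nc_star)"
proof -
  have le: "norm y \<le> norm (star y)" for y :: 'a
  proof (cases "y = 0")
    case False
    have "norm y * norm y \<le> norm (star y) * norm y"
      using norm_star_mult[of y] norm_mult_ineq[of "star y" y] by (simp add: power2_eq_square)
    then show ?thesis using False by simp
  qed simp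
  show ?thesis using le[of x] le[of "star x"] by (simp add: star_star)
qed

lemma norm_mult_star: "norm (x * star x) = (norm (x::'a::nc_star))\<^sup>2"
  using norm_star_mult[of "star x"] by (simp add: star_star)

lemma star_mult_eq_0: "star x * x = 0 \<longleftrightarrow> (x::'a::nc_star) = 0"
  using norm_star_mult[of x] by auto

lemma bounded_linear_star: "bounded_linear (star :: 'a::nc_star \<Rightarrow> 'a)"
  by (rule bounded_linear_intro[of _ 1]) (simp_all add: star_add)

lemma bounded_linear_scaleC: "bounded_linear (\<lambda>x::'a::nc_star. c *\<^sub>C x)"
proof (rule bounded_linear_intro[of _ "cmod c"])
  show "c *\<^sub>C (r *\<^sub>R x) = r *\<^sub>R c *\<^sub>C (x::'a)" for r x
    by (metis mult.commute scaleC_of_real scaleC_scaleC)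
qed (simp_all add: scaleC_add_right norm_scaleC)

lemmas tendsto_star [tendsto_intros] = bounded_linear.tendsto[OF bounded_linear_star]
lemmas tendsto_scaleC [tendsto_intros] = bounded_linear.tendsto[OF bounded_linear_scaleC]
lemmas continuous_on_star [continuous_intros] = bounded_linear.continuous_on[OF bounded_linear_star]
lemmas continuous_on_scaleC [continuous_intros] = bounded_linear.continuous_on[OF bounded_linear_scaleC]

section \<open>Positive elements\<close>

text \<open>The closure properties under which square roots are formed. Only squares occur among the products,
  so the set of self-adjoint elements qualifies as well as the commutant of an element.\<close>
definition sq_closed :: "'a::uc_star set \<Rightarrow> bool" where
  "sq_closed W \<longleftrightarrow> closed W \<and> 1 \<in> W \<and> (\<forall>x\<in>W. \<forall>y\<in>W. x + y \<in> W) \<and> (\<forall>x\<in>W. \<forall>r. r *\<^sub>R x \<in> W)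
     \<and> (\<forall>x\<in>W. x * x \<in> W)"

text \<open>The limit \<open>z\<close> of the iteration \<open>y \<mapsto> (y\<^sup>2 + b) / 2\<close> started at zero is \<open>1 - sqrt (1 - b)\<close>. The
  iterates and their increments are dominated by those of the same iteration over the reals with
  \<open>b = 1\<close>, which increases to 1. Every closed set that is invariant under the iteration contains the
  limit, and this is how membership, self-adjointness and commutation of roots are obtained.\<close>
lemma sq_root_iteration:
  fixes b :: "'a::uc_star"
  assumes b: "norm b \<le> 1"
  obtains z where "norm z \<le> 1" "(1 - z) * (1 - z) = 1 - b"
    "\<And>W. \<lbrakk>closed W; 0 \<in> W; \<And>y. y \<in> W \<Longrightarrow> (1/2) *\<^sub>R (y * y + b) \<in> W\<rbrakk> \<Longrightarrow> z \<in> W"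
proof -
  define Z where "Z = rec_nat 0 (\<lambda>_ y. (1/2) *\<^sub>R (y * y + b))"
  define q :: "nat \<Rightarrow> real" where "q = rec_nat 0 (\<lambda>_ y. (y * y + 1) / 2)"
  have Z0: "Z 0 = 0" and ZS: "Z (Suc n) = (1/2) *\<^sub>R (Z n * Z n + b)" for n by (simp_all add: Z_def)
  have q0: "q 0 = 0" and qS: "q (Suc n) = (q n * q n + 1) / 2" for n by (simp_all add: q_def)
  have q01: "0 \<le> q n \<and> q n \<le> 1" for n
  proof (induction n)
    case (Suc n)
    have "q n * q n \<le> 1 * 1" using Suc by (intro mult_mono) auto
    then show ?case using Suc by (simp add: qS)
  qed (simp add: q0)
  have Zq: "norm (Z n) \<le> q n" for n
  proof (induction n)
    case (Suc n)
    have "norm (Z n * Z n) \<le> q n * q n"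
      using norm_mult_ineq[of "Z n" "Z n"] Suc q01[of n] by (meson mult_mono norm_ge_zero order_trans)
    then have "norm (Z n * Z n + b) \<le> q n * q n + 1" using norm_triangle_le b by (metis add_mono)
    then show ?case by (simp add: ZS qS)
  qed (simp add: Z0 q0)
  have comm: "Z n * b = b * Z n" for n by (induction n) (simp_all add: Z0 ZS algebra_simps, metis mult.assoc)
  have commZ: "Z (Suc n) * Z n = Z n * Z (Suc n)" for n
    by (simp add: ZS algebra_simps comm)
  have step: "norm (Z (Suc n) - Z n) \<le> q (Suc n) - q n" for n
  proof (induction n)
    case 0 then show ?case using b by (simp add: Z0 ZS q0 qS)
  next
    case (Suc n)
    have "Z (Suc (Suc n)) - Z (Suc n) = (1/2) *\<^sub>R ((Z (Suc n) - Z n) * (Z (Suc n) + Z n))"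
    proof -
      have "Z (Suc (Suc n)) - Z (Suc n)
          = (1/2) *\<^sub>R (Z (Suc n) * Z (Suc n) + b) - (1/2) *\<^sub>R (Z n * Z n + b)"
        using ZS[of "Suc n"] ZS[of n] by argo
      also have "\<dots> = (1/2) *\<^sub>R (Z (Suc n) * Z (Suc n) - Z n * Z n)"
        by (simp add: scaleR_right_diff_distrib[symmetric])
      also have "Z (Suc n) * Z (Suc n) - Z n * Z n = (Z (Suc n) - Z n) * (Z (Suc n) + Z n)"
        using commZ[of n] by (simp add: distrib_left left_diff_distrib)
      finally show ?thesis .
    qed
    then have "norm (Z (Suc (Suc n)) - Z (Suc n)) \<le> (1/2) * (norm (Z (Suc n) - Z n) * norm (Z (Suc n) + Z n))"
      by (simp add: norm_mult_ineq)
    also have "\<dots> \<le> (1/2) * ((q (Suc n) - q n) * (q (Suc n) + q n))"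
      by (intro mult_mono Suc mult_nonneg_nonneg)
        (use Zq q01 Suc norm_triangle_mono[OF Zq Zq] order_trans[OF norm_ge_zero Suc] in \<open>auto simp: add_nonneg_nonneg\<close>)
    also have "\<dots> = q (Suc (Suc n)) - q (Suc n)" by (simp add: qS[of "Suc n"]) (simp add: qS[of n] field_simps)
    finally show ?case .
  qed
  have "incseq q" using step by (intro incseq_SucI) (meson diff_ge_0_iff_ge norm_ge_zero order_trans)
  then have "convergent q" using q01 by (meson Bseq_monoseq_convergent incseq_convergent convergentI)
  then have Cq: "Cauchy q" by (rule convergent_Cauchy)
  have dist: "norm (Z n - Z m) \<le> q n - q m" if "m \<le> n" for m n
    using that
  proof (induction rule: dec_induct)
    case (step n)
    have "norm (Z (Suc n) - Z m) \<le> norm (Z (Suc n) - Z n) + norm (Z n - Z m)"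
      using norm_triangle_ineq[of "Z (Suc n) - Z n" "Z n - Z m"] by simp
    then show ?case using \<open>\<And>n. norm (Z (Suc n) - Z n) \<le> q (Suc n) - q n\<close>[of n] step by simp
  qed simp
  have "Cauchy Z"
  proof (rule metric_CauchyI)
    fix e :: real assume "e > 0"
    then obtain M where M: "\<And>m n. m \<ge> M \<Longrightarrow> n \<ge> M \<Longrightarrow> dist (q m) (q n) < e"
      using Cq metric_CauchyD by blast
    have "dist (Z m) (Z n) < e" if "m \<ge> M" "n \<ge> M" for m n
    proof (cases "m \<le> n")
      case True then show ?thesis using dist[OF True] M[OF that]
        by (simp add: dist_norm norm_minus_commute dist_real_def)
    next
      case False then have "n \<le> m" by simp
      then show ?thesis using dist[of n m] M[OF that]
        by (simp add: dist_norm dist_real_def)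
    qed
    then show "\<exists>M. \<forall>m\<ge>M. \<forall>n\<ge>M. dist (Z m) (Z n) < e" by blast
  qed
  then obtain z where z: "Z \<longlonglongrightarrow> z" using Cauchy_convergent convergent_def by blast
  have "(\<lambda>n. Z (Suc n)) \<longlonglongrightarrow> (1/2) *\<^sub>R (z * z + b)"
    unfolding ZS by (intro tendsto_intros z)
  then have zz: "z = (1/2) *\<^sub>R (z * z + b)" using z LIMSEQ_Suc LIMSEQ_unique by blast
  then have "2 *\<^sub>R z = z * z + b" by (metis scaleR_half_double scaleR_2 scaleR_right.add field_sum_of_halves scaleR_left_distrib scaleR_one)
  then have "(1 - z) * (1 - z) = 1 - b" by (simp add: algebra_simps scaleR_2)
  moreover have "norm z \<le> 1"
    by (rule LIMSEQ_le_const2[OF tendsto_norm[OF z]]) (use Zq q01 order_trans in blast)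
  moreover have "z \<in> W" if "closed W" "0 \<in> W" "\<And>y. y \<in> W \<Longrightarrow> (1/2) *\<^sub>R (y * y + b) \<in> W" for W
  proof -
    have "Z n \<in> W" for n by (induction n) (use that in \<open>auto simp: Z0 ZS\<close>)
    then show ?thesis using closed_sequentially[OF \<open>closed W\<close> _ z] by blast
  qed
  ultimately show ?thesis using that by blast
qed

lemma closed_commutant: "closed {y. y * w = w * (y::'a::real_normed_algebra)}"
  by (intro closed_Collect_eq continuous_intros)

lemma closed_self_adjoint: "closed {y. star y = (y::'a::nc_star)}"
  by (intro closed_Collect_eq continuous_intros)

lemma sq_closed_commutant: "sq_closed {y. y * w = w * (y::'a::uc_star)}"
  unfolding sq_closed_def using closed_commutant[of w]
  by (auto simp: algebra_simps) (metis mult.assoc)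

lemma sq_closed_self_adjoint: "sq_closed {y. star y = (y::'a::uc_star)}"
  unfolding sq_closed_def using closed_self_adjoint
  by (auto simp: star_add star_mult)

text \<open>The element \<open>u = c + \<i> w\<close> satisfies \<open>star u * u = 1\<close>, and \<open>c\<close> is the mean of \<open>u\<close> and \<open>star u\<close>. The
  estimate takes the place of arguments with the spectral radius.\<close>
lemma norm_le_1_if_sq_sum_eq_1:
  fixes c w :: "'a::uc_star"
  assumes "star c = c" "star w = w" "c * w = w * c" "c * c + w * w = 1"
  shows "norm c \<le> 1"
proof -
  define u where "u = c + \<i> *\<^sub>C w"
  have su: "star u = c - \<i> *\<^sub>C w" using assms by (simp add: u_def star_add star_scaleC)
  have "star u * u = c * c + w * w"
    unfolding su unfolding u_def using assms(3)
    by (simp add: left_diff_distrib distrib_left right_diff_distrib scaleC_mult_left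
        scaleC_mult_right scaleC_scaleC scaleC_minus_one scaleC_diff_right scaleC_add_right)
  then have "norm u = 1" using norm_star_mult[of u] assms(4) by (simp add: power2_eq_1_iff) (smt (verit) norm_ge_zero)
  moreover have "2 *\<^sub>R c = u + star u" unfolding su unfolding u_def by (simp add: scaleR_2)
  ultimately have "norm (2 *\<^sub>R c) \<le> 2" using norm_triangle_ineq[of u "star u"] by simp
  then show ?thesis by simp
qed

lemma norm_one_minus_sq_le_1:
  fixes x :: "'a::uc_star"
  assumes x: "star x = x" "norm x \<le> 1"
  shows "norm (1 - x * x) \<le> 1"
proof -
  have "norm (x * x) \<le> 1"
    using norm_mult_ineq[of x x] x(2) mult_mono[of "norm x" 1 "norm x" 1] by simp
  then obtain z where z: "(1 - z) * (1 - z) = 1 - x * x"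
    "\<And>W. \<lbrakk>closed W; 0 \<in> W; \<And>y. y \<in> W \<Longrightarrow> (1/2) *\<^sub>R (y * y + x * x) \<in> W\<rbrakk> \<Longrightarrow> z \<in> W"
    using sq_root_iteration[of "x * x"] by metis
  have "z \<in> {y. star y = y}"
    by (rule z(2)[OF closed_self_adjoint]) (auto simp: star_add star_mult x(1))
  moreover have "z \<in> {y. y * x = x * y}"
    by (rule z(2)[OF closed_commutant]) (auto simp: algebra_simps, metis mult.assoc)
  moreover have "(1 - z) * (1 - z) + x * x = 1" by (simp add: z(1))
  ultimately have "norm (1 - z) \<le> 1"
    by (intro norm_le_1_if_sq_sum_eq_1[of _ x]) (auto simp: x star_diff left_diff_distrib right_diff_distrib)
  then show ?thesis
    unfolding z(1)[symmetric] using norm_mult_ineq[of "1-z" "1-z"] mult_mono[of "norm (1-z)" 1 "norm (1-z)" 1] by simp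
qed

text \<open>Positivity without spectra: for self-adjoint \<open>a\<close> the inequality says that the spectrum of \<open>a\<close> lies
  in \<open>{0..2 * t}\<close>.\<close>
definition pos :: "'a::uc_star \<Rightarrow> bool" where
  "pos a \<longleftrightarrow> star a = a \<and> (\<exists>t\<ge>0. norm (t *\<^sub>R 1 - a) \<le> t)"

lemma pos_star: "pos a \<Longrightarrow> star a = a" by (simp add: pos_def)

lemma pos_0 [simp]: "pos 0" by (auto simp: pos_def intro: exI[of _ 0])
lemma pos_1 [simp]: "pos 1" by (auto simp: pos_def intro: exI[of _ 1])

lemma pos_add: assumes "pos a" "pos b" shows "pos (a + b)"
proof -
  from assms obtain s t where st: "s \<ge> 0" "t \<ge> 0" "norm (s *\<^sub>R 1 - a) \<le> s" "norm (t *\<^sub>R 1 - b) \<le> t"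
    by (auto simp: pos_def)
  have "norm ((s + t) *\<^sub>R 1 - (a + b)) \<le> s + t"
    using norm_triangle_mono[OF st(3,4)] by (simp add: algebra_simps)
  then show ?thesis using st assms unfolding pos_def by (metis add_nonneg_nonneg star_add)
qed

lemma pos_scaleR: assumes "pos a" "0 \<le> r" shows "pos (r *\<^sub>R a)"
proof -
  from assms obtain t where t: "t \<ge> 0" "norm (t *\<^sub>R 1 - a) \<le> t" by (auto simp: pos_def)
  have "norm ((r * t) *\<^sub>R 1 - r *\<^sub>R a) = r * norm (t *\<^sub>R 1 - a)"
    by (metis abs_of_nonneg assms(2) norm_scaleR scaleR_right_diff_distrib scaleR_scaleR)
  also have "\<dots> \<le> r * t" using t assms by (simp add: mult_left_mono)
  finally have "norm ((r * t) *\<^sub>R 1 - r *\<^sub>R a) \<le> r * t" .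
  moreover have "0 \<le> r * t" using t assms by simp
  moreover have "star (r *\<^sub>R a) = r *\<^sub>R a" using assms by (simp add: pos_def)
  ultimately show ?thesis unfolding pos_def by blast
qed

lemma pos_sum: "(\<And>i. i \<in> I \<Longrightarrow> pos (f i)) \<Longrightarrow> pos (sum f I)"
  by (induction I rule: infinite_finite_induct) (simp_all add: pos_add)

lemma pos_sq: assumes x: "star x = x" shows "pos (x * x)"
proof (cases "x = 0")
  case False
  define y where "y = (1 / norm x) *\<^sub>R x"
  have y: "star y = y" "norm y \<le> 1" using x by (simp_all add: y_def)
  have "pos (y * y)"
    unfolding pos_def using norm_one_minus_sq_le_1[OF y] y(1) by (auto simp: star_mult intro!: exI[of _ 1])
  then have "pos ((norm x)\<^sup>2 *\<^sub>R (y * y))" by (simp add: pos_scaleR)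
  then show ?thesis using False by (simp add: y_def power2_eq_square)
qed simp

lemma pos_sqrt:
  fixes a :: "'a::uc_star"
  assumes a: "pos a"
  obtains r where "pos r" "r * r = a" "\<And>W. sq_closed W \<Longrightarrow> a \<in> W \<Longrightarrow> r \<in> W"
proof -
  from a obtain t where t: "t \<ge> 0" "norm (t *\<^sub>R 1 - a) \<le> t" by (auto simp: pos_def)
  show ?thesis
  proof (cases "t = 0")
    case True
    then have "a = 0" using t by simp
    then show ?thesis using that[of 0] by (auto simp: sq_closed_def)
  next
    case False
    then have tp: "t > 0" using t by simp
    define b where "b = 1 - (1/t) *\<^sub>R a"
    have "b = (1/t) *\<^sub>R (t *\<^sub>R 1 - a)" using tp by (simp add: b_def algebra_simps)
    then have nb: "norm b \<le> 1" using t tp by simp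
    obtain z where z: "norm z \<le> 1" "(1 - z) * (1 - z) = 1 - b"
      "\<And>W. \<lbrakk>closed W; 0 \<in> W; \<And>y. y \<in> W \<Longrightarrow> (1/2) *\<^sub>R (y * y + b) \<in> W\<rbrakk> \<Longrightarrow> z \<in> W"
      using sq_root_iteration[OF nb] by metis
    define r where "r = sqrt t *\<^sub>R (1 - z)"
    have inW: "r \<in> W" if W: "sq_closed W" "a \<in> W" for W
    proof -
      have cl: "x + y \<in> W" "c *\<^sub>R x \<in> W" "x * x \<in> W" "1 \<in> W" if "x \<in> W" "y \<in> W" for x y c
        using W that by (auto simp: sq_closed_def)
      have "b = 1 + (-1/t) *\<^sub>R a" by (simp add: b_def)
      then have "b \<in> W" using cl W(2) by metis
      moreover have "0 \<in> W" using cl(2)[OF W(2) W(2), of 0] by simp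
      ultimately have "z \<in> W" using W cl by (intro z(3)) (auto simp: sq_closed_def)
      moreover have "r = sqrt t *\<^sub>R (1 + (-1) *\<^sub>R z)" by (simp add: r_def)
      ultimately show ?thesis using cl by metis
    qed
    have "star r = r" using inW[OF sq_closed_self_adjoint] a pos_star by auto
    moreover have "norm (sqrt t *\<^sub>R 1 - r) \<le> sqrt t"
    proof -
      have "sqrt t *\<^sub>R 1 - r = sqrt t *\<^sub>R z" by (simp add: r_def algebra_simps)
      then show ?thesis using z(1) tp by (simp add: mult_left_le)
    qed
    ultimately have "pos r" using tp unfolding pos_def by (metis less_imp_le real_sqrt_ge_zero)
    moreover have "r * r = t *\<^sub>R ((1 - z) * (1 - z))" using tp by (simp add: r_def)
    then have "r * r = a" using tp by (simp add: z(2) b_def)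
    ultimately show ?thesis using that inW by blast
  qed
qed

lemma pos_sqrt_commute:
  assumes "pos a" "r * r = a" "\<And>W. sq_closed W \<Longrightarrow> a \<in> W \<Longrightarrow> r \<in> W" "a * w = w * a"
  shows "r * w = w * r"
  using assms(3)[OF sq_closed_commutant[of w]] assms(4) by auto

lemma pos_norm_minus:
  assumes a: "pos a" and t: "norm a \<le> t" shows "norm (t *\<^sub>R 1 - a) \<le> t"
proof (cases "t = 0")
  case False
  then have tp: "t > 0" using t norm_ge_zero[of a] by linarith
  obtain r where r: "pos r" "r * r = a" using pos_sqrt[OF a] by metis
  define y where "y = (1 / sqrt t) *\<^sub>R r"
  have "norm a = (norm r)\<^sup>2" using norm_star_mult[of r] r pos_star by metis
  then have "norm r \<le> sqrt t" using t real_le_rsqrt by simp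
  then have "norm y \<le> 1" using tp by (simp add: y_def)
  then have "norm (1 - y * y) \<le> 1" using norm_one_minus_sq_le_1[of y] r by (simp add: y_def pos_star)
  moreover have "y * y = (1/t) *\<^sub>R a" using r tp by (simp add: y_def)
  moreover have "t *\<^sub>R 1 - a = t *\<^sub>R (1 - (1/t) *\<^sub>R a)" using tp by (simp add: algebra_simps)
  ultimately show ?thesis using tp by (simp add: mult_left_le)
qed (use t in auto)

lemma pos_iff: "pos a \<longleftrightarrow> star a = a \<and> norm (norm a *\<^sub>R 1 - a) \<le> norm a"
  using pos_norm_minus[of a "norm a"] norm_ge_zero[of a] unfolding pos_def by blast

lemma closed_pos: "closed {a::'a::uc_star. pos a}"
proof -
  have "{a::'a. pos a} = {a. star a = a} \<inter> {a. norm (norm a *\<^sub>R 1 - a) \<le> norm a}"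
    by (auto simp: pos_iff)
  moreover have "closed {a::'a. norm (norm a *\<^sub>R 1 - a) \<le> norm a}"
    by (intro closed_Collect_le continuous_on_norm continuous_on_diff continuous_on_scaleR
        continuous_on_id continuous_on_const)
  ultimately show ?thesis using closed_Int[OF closed_self_adjoint] by simp
qed

lemma pos_norm_diff: "star a = a \<Longrightarrow> norm a \<le> t \<Longrightarrow> pos (t *\<^sub>R 1 - a)"
  unfolding pos_def using order_trans[OF norm_ge_zero[of a]] by (auto simp: star_diff intro!: exI[of _ t])

lemma pos_mult_commute:
  assumes "pos a" "pos b" "a * b = b * a" shows "pos (a * b)"
proof -
  obtain r where r: "pos r" "r * r = a" "\<And>W. sq_closed W \<Longrightarrow> a \<in> W \<Longrightarrow> r \<in> W" using pos_sqrt[OF assms(1)] by metis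
  obtain q where q: "pos q" "q * q = b" "\<And>W. sq_closed W \<Longrightarrow> b \<in> W \<Longrightarrow> q \<in> W" using pos_sqrt[OF assms(2)] by metis
  have "r * b = b * r" by (rule pos_sqrt_commute[OF assms(1) r(2,3) assms(3)])
  then have rq: "q * r = r * q" using pos_sqrt_commute[OF assms(2) q(2,3), of r] by simp
  then have "star (r * q) = r * q" using r q by (simp add: star_mult pos_star)
  then have "pos ((r * q) * (r * q))" by (rule pos_sq)
  moreover have "(r * q) * (r * q) = a * b" using rq r(2) q(2) by (metis mult.assoc)
  ultimately show ?thesis by simp
qed

text \<open>With \<open>t\<close> slightly above \<open>norm b\<close> the element \<open>t - a\<close> is positive. Its root and the root of \<open>a\<close> commute
  and have squares that add up to \<open>t\<close>.\<close>
lemma pos_le_norm_le: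
  assumes a: "pos a" and ab: "pos (b - a)" shows "norm a \<le> norm b"
proof (rule field_le_epsilon)
  fix e :: real assume "e > 0"
  define t where "t = norm b + e"
  have tp: "t > 0" using \<open>e > 0\<close> norm_ge_zero[of b] unfolding t_def by linarith
  have "star b = b" using pos_star[OF pos_add[OF a ab]] by simp
  then have "pos (t *\<^sub>R 1 - b)" using \<open>e > 0\<close> by (simp add: pos_norm_diff t_def)
  from pos_add[OF this ab] have "pos (t *\<^sub>R 1 - a)" by simp
  then obtain w where w: "pos w" "w * w = t *\<^sub>R 1 - a" "\<And>W. sq_closed W \<Longrightarrow> t *\<^sub>R 1 - a \<in> W \<Longrightarrow> w \<in> W"
    using pos_sqrt by metis
  obtain r where r: "pos r" "r * r = a" using pos_sqrt[OF a] by metis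
  have "(t *\<^sub>R 1 - a) * r = r * (t *\<^sub>R 1 - a)" using r(2) by (simp add: algebra_simps) (metis mult.assoc)
  then have wr: "w * r = r * w" using pos_sqrt_commute[OF \<open>pos (t *\<^sub>R 1 - a)\<close> w(2,3)] by blast
  define s where "s = 1 / sqrt t"
  have ss: "s * s * t = 1" using tp by (simp add: s_def)
  have "(s *\<^sub>R r) * (s *\<^sub>R r) + (s *\<^sub>R w) * (s *\<^sub>R w) = (s * s) *\<^sub>R (r * r + w * w)"
    by (simp add: algebra_simps)
  also have "\<dots> = 1" using ss by (simp add: w(2) r(2))
  finally have "norm (s *\<^sub>R r) \<le> 1"
    using w(1) r(1) wr by (intro norm_le_1_if_sq_sum_eq_1[of _ "s *\<^sub>R w"]) (auto simp: pos_star)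
  then have "norm r \<le> sqrt t" using tp by (simp add: s_def field_simps)
  then have "(norm r)\<^sup>2 \<le> t" using tp by (metis norm_ge_zero power_mono real_sqrt_pow2 less_imp_le)
  moreover have "norm a = (norm r)\<^sup>2" using norm_star_mult[of r] r pos_star by metis
  ultimately show "norm a \<le> norm b + e" by (simp add: t_def)
qed

lemma pos_antisym: "pos a \<Longrightarrow> pos (- a) \<Longrightarrow> a = 0"
  using pos_le_norm_le[of a 0] by simp

lemma pos_add_eq_0: assumes "pos a" "pos b" "a + b = 0" shows "a = 0"
proof -
  have "b = -a" using assms(3) by (simp add: add_eq_0_iff)
  then show ?thesis using pos_antisym assms by simp
qed

lemma pos_star_mult_add_mult_star: "pos (star y * y + y * star (y::'a::uc_star))"
proof -
  define h k where "h = y + star y" and "k = \<i> *\<^sub>C (y - star y)"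
  have "star h = h" "star k = k"
    by (simp_all add: h_def k_def star_add star_star star_scaleC star_diff scaleC_diff_right)
  then have "pos ((1/2) *\<^sub>R (h * h + k * k))" by (intro pos_scaleR pos_add pos_sq) auto
  moreover have "h * h + k * k = 2 *\<^sub>R (star y * y + y * star y)"
    by (simp add: h_def k_def scaleR_2 scaleC_mult_left scaleC_mult_right scaleC_scaleC scaleC_minus_one)
      (simp add: algebra_simps)
  ultimately show ?thesis by simp
qed

lemma mult_self_eq_0: "star x = x \<Longrightarrow> x * x = 0 \<longleftrightarrow> (x::'a::nc_star) = 0"
  using star_mult_eq_0[of x] by simp

text \<open>Kaplansky's argument. Let \<open>n\<close> be the negative part of \<open>a = star x * x\<close>. Then \<open>y = x * n\<close> satisfies
  \<open>star y * y = - n\<^sup>3 = - q\<^sup>2\<close> with \<open>q\<close> self-adjoint. For \<open>z = y * q\<close> both \<open>star z * z\<close> and \<open>z * star z\<close> are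
  negatives of squares, whereas their sum is always positive, being half the sum of the squares of
  two self-adjoint elements. Hence \<open>q\<close> and \<open>n\<close> vanish.\<close>
lemma pos_star_mult: "pos (star x * (x::'a::uc_star))"
proof -
  define a where "a = star x * x"
  have sa: "star a = a" by (simp add: a_def star_mult star_star)
  obtain m where m: "pos m" "m * m = a * a" "\<And>W. sq_closed W \<Longrightarrow> a * a \<in> W \<Longrightarrow> m \<in> W"
    using pos_sqrt[OF pos_sq[OF sa]] by metis
  have ma: "m * a = a * m"
    by (rule pos_sqrt_commute[OF pos_sq[OF sa] m(2,3)]) (simp_all add: mult.assoc)
  define n where "n = (1/2) *\<^sub>R (m - a)"
  have sn: "star n = n" by (simp add: n_def star_diff pos_star m sa)
  have nm: "m * n = n * m" using ma by (simp add: n_def algebra_simps)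
  have nn: "n * n = n * m"
  proof -
    have "(m - a) * (m - a) = 2 *\<^sub>R ((m - a) * m)"
      using ma m(2) by (simp add: algebra_simps scaleR_2)
    then have "(1/4) *\<^sub>R ((m - a) * (m - a)) = (1/4) *\<^sub>R 2 *\<^sub>R ((m - a) * m)" by simp
    then show ?thesis by (simp add: n_def)
  qed
  have a: "a = m - 2 *\<^sub>R n" by (simp add: n_def)
  obtain r where r: "pos r" "r * r = m" "\<And>W. sq_closed W \<Longrightarrow> m \<in> W \<Longrightarrow> r \<in> W"
    using pos_sqrt[OF m(1)] by metis
  have rn: "r * n = n * r" by (rule pos_sqrt_commute[OF m(1) r(2,3) nm])
  define q where "q = r * n"
  have sq: "star q = q" using rn by (simp add: q_def star_mult sn pos_star r)
  have qq: "q * q = n * n * n"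
  proof -
    have "q * q = n * (r * r) * n" by (simp add: q_def rn mult.assoc)
    then show ?thesis using r nn by (simp add: mult.assoc)
  qed
  define y where "y = x * n"
  have yy: "star y * y = - (q * q)"
  proof -
    have "star y * y = n * a * n" by (simp add: y_def a_def star_mult sn mult.assoc)
    also have "\<dots> = n * m * n - 2 *\<^sub>R (n * n * n)" by (simp add: a algebra_simps)
    also have "\<dots> = - (n * n * n)" by (simp add: nn[symmetric] scaleR_2)
    finally show ?thesis by (simp add: qq)
  qed
  define z where "z = y * q"
  have 1: "star z * z = - ((q * q) * (q * q))"
  proof -
    have "star z * z = q * (star y * y) * q" by (simp add: z_def star_mult sq mult.assoc)
    then show ?thesis by (simp add: yy mult.assoc)
  qed
  have 2: "z * star z = - ((y * star y) * (y * star y))"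
  proof -
    have "z * star z = y * (q * q) * star y" by (simp add: z_def star_mult sq mult.assoc)
    also have "q * q = - (star y * y)" by (simp add: yy)
    finally show ?thesis by (simp add: mult.assoc)
  qed
  have p: "pos ((q * q) * (q * q))" "pos ((y * star y) * (y * star y))"
    by (auto intro!: pos_sq simp: star_mult sq star_star)
  have "pos (- ((q * q) * (q * q) + (y * star y) * (y * star y)))"
    using pos_star_mult_add_mult_star[of z] unfolding 1 2 by simp
  then have "(q * q) * (q * q) + (y * star y) * (y * star y) = 0"
    using pos_antisym pos_add[OF p] by blast
  then have "(q * q) * (q * q) = 0" using pos_add_eq_0[OF p] by blast
  then have "q = 0" using mult_self_eq_0 sq by (metis star_mult)
  then have "n * n * n = 0" using qq by simp
  then have "(n * n) * (n * n) = 0" by (simp add: mult.assoc)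
  then have "n = 0" using mult_self_eq_0 sn by (metis star_mult)
  then show ?thesis using a m(1) by (simp add: a_def)
qed

lemma pos_mult_star: "pos (x * star (x::'a::uc_star))"
  using pos_star_mult[of "star x"] by (simp add: star_star)

lemma pos_conj: assumes "pos b" shows "pos (star x * b * x)"
proof -
  obtain r where r: "pos r" "r * r = b" using pos_sqrt[OF assms] by metis
  have "star x * b * x = star (r * x) * (r * x)" by (simp add: star_mult pos_star r mult.assoc flip: r(2))
  then show ?thesis using pos_star_mult by metis
qed

lemma pos_power: "pos b \<Longrightarrow> pos (b ^ n)"
  by (induction n) (auto intro!: pos_mult_commute simp: power_commutes)

text \<open>The operator form of \<open>n (1 - s) ^ n s \<le> 1\<close> on the unit interval: \<open>1 - (1 - b) ^ n\<close> is the sum of the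
  elements \<open>(1 - b) ^ k * b\<close> with \<open>k < n\<close>, each of which dominates \<open>(1 - b) ^ n * b\<close>.\<close>
lemma norm_pos_power_mult_le:
  fixes b :: "'a::uc_star"
  assumes b: "pos b" "norm b \<le> 1"
  shows "real n * norm ((1 - b) ^ n * b) \<le> 1"
proof -
  define g where "g = 1 - b"
  have g: "pos g" using pos_norm_diff[OF pos_star[OF b(1)] b(2)] by (simp add: g_def)
  have comm: "g ^ n * b = b * g ^ n" for n
    by (rule power_commuting_commutes) (simp add: g_def algebra_simps)
  have pb: "pos (g ^ n * b)" for n using pos_mult_commute[OF pos_power[OF g] b(1) comm] .
  have pbb: "pos (g ^ n * b * b)" for n
    by (rule pos_mult_commute[OF pb b(1)]) (simp add: comm mult.assoc)
  have "pos (1 - g ^ n - real n *\<^sub>R (g ^ n * b))"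
  proof (induction n)
    case (Suc n)
    have "pos ((1 - g ^ n - real n *\<^sub>R (g ^ n * b)) + real (Suc n) *\<^sub>R (g ^ n * b * b))"
      by (intro pos_add Suc pos_scaleR pbb) auto
    moreover have "g ^ Suc n = g ^ n - g ^ n * b"
      unfolding power_Suc2 by (subst (2) g_def) (simp add: algebra_simps)
    ultimately show ?case unfolding \<open>g ^ Suc n = _\<close> by (simp add: algebra_simps)
  qed simp
  from pos_add[OF this pos_power[OF g, of n]] have "pos (1 - real n *\<^sub>R (g ^ n * b))" by simp
  then have "norm (real n *\<^sub>R (g ^ n * b)) \<le> norm (1::'a)"
    by (intro pos_le_norm_le pos_scaleR pb) auto
  then show ?thesis by (simp add: g_def)
qed

text \<open>The elements \<open>1 - (1 - b) ^ n\<close> form an approximate unit for everything dominated by \<open>b\<close>. They are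
  polynomials in \<open>b\<close> without constant term, so they stay in any algebra or ideal containing \<open>b\<close>.\<close>
lemma approximate_unit_tendsto_0:
  fixes b :: "'a::uc_star"
  assumes b: "pos b" "norm b \<le> 1" and x: "pos (K *\<^sub>R b - star x * x)" and K: "K \<ge> 0"
  shows "(\<lambda>n. x * (1 - b) ^ n) \<longlonglongrightarrow> 0"
proof -
  define g where "g = 1 - b"
  have g: "pos g" using pos_norm_diff[OF pos_star[OF b(1)] b(2)] by (simp add: g_def)
  have ng: "norm (g ^ n) \<le> 1" for n
  proof -
    have "norm g \<le> 1" using pos_norm_minus[OF b] by (simp add: g_def)
    then show ?thesis by (metis norm_power_ineq order_trans power_le_one norm_ge_zero)
  qed
  have sg: "star (g ^ n) = g ^ n" for n using pos_star[OF pos_power[OF g]] .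
  have le: "(norm (x * g ^ n))\<^sup>2 \<le> K * inverse (real n)" if "n > 0" for n
  proof -
    have "(norm (x * g ^ n))\<^sup>2 = norm (g ^ n * (star x * x) * g ^ n)"
      using norm_star_mult[of "x * g ^ n"] by (simp add: star_mult sg mult.assoc)
    also have "\<dots> \<le> norm (g ^ n * (K *\<^sub>R b) * g ^ n)"
      using pos_conj[OF pos_star_mult[of x], of "g ^ n"] pos_conj[OF x, of "g ^ n"]
      by (intro pos_le_norm_le) (simp_all add: sg algebra_simps)
    also have "\<dots> \<le> K * norm (g ^ n * b)"
      using norm_mult_ineq[of "g ^ n * b" "g ^ n"] ng[of n] K
        mult_left_le[of "norm (g ^ n)" "norm (g ^ n * b)"]
      by (simp add: mult_left_mono)
    also have "\<dots> \<le> K * inverse (real n)"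
      using norm_pos_power_mult_le[OF b, of n] that K
      by (intro mult_left_mono) (simp_all add: g_def field_simps)
    finally show ?thesis .
  qed
  have "(\<lambda>n. K * inverse (real n)) \<longlonglongrightarrow> K * 0"
    by (intro tendsto_intros lim_inverse_n)
  then have l0: "(\<lambda>n. K * inverse (real n)) \<longlonglongrightarrow> 0" by simp
  have "(\<lambda>n. (norm (x * g ^ n))\<^sup>2) \<longlonglongrightarrow> 0"
  proof (rule tendsto_sandwich[OF _ _ tendsto_const l0])
    show "\<forall>\<^sub>F n in sequentially. (norm (x * g ^ n))\<^sup>2 \<le> K * inverse (real n)"
      by (rule eventually_mono[OF eventually_gt_at_top[of 0]]) (rule le)
  qed auto
  then have "(\<lambda>n. sqrt ((norm (x * g ^ n))\<^sup>2)) \<longlonglongrightarrow> sqrt 0" by (intro tendsto_intros)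
  then show ?thesis by (simp add: g_def tendsto_norm_zero_iff)
qed

lemma approximate_unit_tendsto:
  fixes b :: "'a::uc_star"
  assumes "pos b" "norm b \<le> 1" "pos (K *\<^sub>R b - star x * x)" "K \<ge> 0"
  shows "(\<lambda>n. x * (1 - (1 - b) ^ n)) \<longlonglongrightarrow> x"
  using tendsto_diff[OF tendsto_const approximate_unit_tendsto_0[OF assms], of x]
  by (simp add: right_diff_distrib)

section \<open>Closed subalgebras, ideals and hereditary subalgebras\<close>

text \<open>Closed star-subalgebras, closed two-sided ideals, and hereditary subalgebras. The hereditary ones are
  encoded by \<open>H S H \<subseteq> H\<close>, which is easier to check and to use than the order condition.\<close>
definition csub :: "'a::nc_star set \<Rightarrow> bool" where
  "csub S \<longleftrightarrow> closed S \<and> 0 \<in> S \<and> (\<forall>x\<in>S. \<forall>y\<in>S. x + y \<in> S \<and> x * y \<in> S) \<and>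
     (\<forall>x\<in>S. star x \<in> S \<and> (\<forall>c. c *\<^sub>C x \<in> S))"

definition cideal :: "'a::nc_star set \<Rightarrow> 'a set \<Rightarrow> bool" where
  "cideal I S \<longleftrightarrow> I \<subseteq> S \<and> closed I \<and> 0 \<in> I \<and> (\<forall>x\<in>I. \<forall>y\<in>I. x + y \<in> I) \<and>
     (\<forall>x\<in>I. (\<forall>c. c *\<^sub>C x \<in> I) \<and> (\<forall>a\<in>S. a * x \<in> I \<and> x * a \<in> I))"

definition her :: "'a::nc_star set \<Rightarrow> 'a set \<Rightarrow> bool" where
  "her H S \<longleftrightarrow> csub H \<and> H \<subseteq> S \<and> (\<forall>h\<in>H. \<forall>s\<in>S. \<forall>k\<in>H. h * s * k \<in> H)"

lemma csub_closed: "csub S \<Longrightarrow> closed S" and csub_0: "csub S \<Longrightarrow> 0 \<in> S"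
  and csub_add: "csub S \<Longrightarrow> x \<in> S \<Longrightarrow> y \<in> S \<Longrightarrow> x + y \<in> S"
  and csub_mult: "csub S \<Longrightarrow> x \<in> S \<Longrightarrow> y \<in> S \<Longrightarrow> x * y \<in> S"
  and csub_star: "csub S \<Longrightarrow> x \<in> S \<Longrightarrow> star x \<in> S"
  and csub_scaleC: "csub S \<Longrightarrow> x \<in> S \<Longrightarrow> c *\<^sub>C x \<in> S"
  by (auto simp: csub_def)

lemma csub_scaleR: "csub S \<Longrightarrow> x \<in> S \<Longrightarrow> r *\<^sub>R x \<in> S"
  using csub_scaleC[of S x "of_real r"] by (simp add: scaleC_of_real)

lemma csub_minus: "csub S \<Longrightarrow> x \<in> S \<Longrightarrow> - x \<in> S"
  using csub_scaleC[of S x "-1"] by (simp add: scaleC_minus_one)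

lemma csub_diff: "csub S \<Longrightarrow> x \<in> S \<Longrightarrow> y \<in> S \<Longrightarrow> x - y \<in> S"
  using csub_add[of S x "-y"] csub_minus by auto

lemma csub_sum: "csub S \<Longrightarrow> (\<And>i. i \<in> I \<Longrightarrow> f i \<in> S) \<Longrightarrow> sum f I \<in> S"
  by (induction I rule: infinite_finite_induct) (auto intro: csub_0 csub_add)

lemmas csub_mem = csub_0 csub_add csub_mult csub_star csub_scaleC csub_scaleR csub_minus csub_diff

lemma csub_limit: "csub S \<Longrightarrow> f \<longlonglongrightarrow> l \<Longrightarrow> (\<And>n. f n \<in> S) \<Longrightarrow> l \<in> S"
  by (rule closed_sequentially[OF csub_closed])

lemma approximate_unit_mem:
  fixes b :: "'a::uc_star"
  assumes "b \<in> S" "0 \<in> S" "\<And>x y. x \<in> S \<Longrightarrow> y \<in> S \<Longrightarrow> x + y \<in> S" "\<And>x. x \<in> S \<Longrightarrow> - (b * x) \<in> S"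
  shows "1 - (1 - b) ^ n \<in> S"
proof (induction n)
  case (Suc n)
  have "1 - (1 - b) ^ Suc n = (1 - (1 - b) ^ n) + (b + - (b * (1 - (1 - b) ^ n)))"
    by (simp add: algebra_simps)
  then show ?case using Suc assms by metis
qed (use assms in simp)

lemma csub_approximate_unit: "csub S \<Longrightarrow> b \<in> S \<Longrightarrow> 1 - (1 - b) ^ n \<in> (S::'a::uc_star set)"
  by (rule approximate_unit_mem) (auto intro: csub_mem)

lemma star_one_minus_power: "star b = b \<Longrightarrow> star (1 - (1 - b) ^ n) = 1 - (1 - (b::'a::uc_star)) ^ n"
  by (simp add: star_diff star_power)

text \<open>Rescales \<open>star x * x\<close> to a contraction, so that it generates an approximate unit for \<open>x\<close>.\<close>
lemma star_mult_normalized: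
  fixes x :: "'a::uc_star"
  obtains b r K where "b = r *\<^sub>R (star x * x)" "pos b" "norm b \<le> 1" "K \<ge> 0" "K *\<^sub>R b = star x * x"
proof (cases "x = 0")
  case True then show ?thesis using that[of 0 0 0] by simp
next
  case False
  have n: "(norm x)\<^sup>2 > 0" using False by simp
  show ?thesis
  proof (rule that[of "(1 / (norm x)\<^sup>2) *\<^sub>R (star x * x)"])
    show "norm ((1 / (norm x)\<^sup>2) *\<^sub>R (star x * x)) \<le> 1" using n by (simp add: norm_star_mult)
    show "(norm x)\<^sup>2 *\<^sub>R (1 / (norm x)\<^sup>2) *\<^sub>R (star x * x) = star x * x" using n by simp
  qed (use n in \<open>auto intro: pos_scaleR pos_star_mult\<close>)
qed

text \<open>An approximate unit generated by \<open>star x * x\<close> lies in the ideal and absorbs \<open>x\<close>. That ideals are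
  self-adjoint follows by applying this to \<open>star x\<close>.\<close>
lemma cideal_star_mult_mem:
  fixes S :: "'a::uc_star set"
  assumes I: "cideal I S" and x: "x \<in> S" "star x * x \<in> I"
  shows "x \<in> I"
proof -
  obtain b r K where b: "b = r *\<^sub>R (star x * x)" "pos b" "norm b \<le> 1" "K \<ge> 0" "K *\<^sub>R b = star x * x"
    using star_mult_normalized by metis
  have bI: "b \<in> I" using I x(2) b(1) unfolding cideal_def by (metis scaleC_of_real)
  have "1 - (1 - b) ^ n \<in> I" for n
  proof (rule approximate_unit_mem)
    show "- (b * y) \<in> I" if "y \<in> I" for y
      using I that bI unfolding cideal_def by (metis scaleC_minus_one subsetD)
  qed (use I bI in \<open>auto simp: cideal_def\<close>)
  then have "x * (1 - (1 - b) ^ n) \<in> I" for n using I x(1) by (auto simp: cideal_def)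
  moreover have "(\<lambda>n. x * (1 - (1 - b) ^ n)) \<longlonglongrightarrow> x"
    using approximate_unit_tendsto[of b K x] b by simp
  moreover have "closed I" using I by (simp add: cideal_def)
  ultimately show ?thesis using closed_sequentially by metis
qed

lemma cideal_star_mem:
  fixes S :: "'a::uc_star set"
  assumes S: "csub S" and I: "cideal I S" and x: "x \<in> I"
  shows "star x \<in> I"
proof (rule cideal_star_mult_mem[OF I])
  have "x \<in> S" using I x by (auto simp: cideal_def)
  then show "star x \<in> S" using S by (simp add: csub_mem)
  then show "star (star x) * star x \<in> I" using I x by (auto simp: cideal_def star_star)
qed

lemma cideal_csub: "csub S \<Longrightarrow> cideal I S \<Longrightarrow> csub (I::'a::uc_star set)"
  using cideal_star_mem[of S I] by (auto simp: csub_def cideal_def)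

lemma cideal_her: "csub S \<Longrightarrow> cideal I S \<Longrightarrow> her (I::'a::uc_star set) S"
  using cideal_csub[of S I] by (auto simp: her_def cideal_def)

lemma her_mem: "her H S \<Longrightarrow> h \<in> H \<Longrightarrow> s \<in> S \<Longrightarrow> k \<in> H \<Longrightarrow> h * s * k \<in> H"
  by (auto simp: her_def)

lemma her_self: "csub S \<Longrightarrow> her S S" by (auto simp: her_def csub_mem)

text \<open>Elements \<open>k, l\<close> of \<open>K\<close> are absorbed by approximate units \<open>f\<^sub>n, e\<^sub>n\<close> from \<open>K\<close>, so \<open>k s l\<close> is the limit of
  \<open>f\<^sub>n (k s l) e\<^sub>n\<close> with the middle factor in \<open>H\<close>.\<close>
lemma her_trans: "her K H \<Longrightarrow> her H S \<Longrightarrow> her K (S::'a::uc_star set)"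
proof -
  assume K: "her K H" and H: "her H S"
  have "k * s * l \<in> K" if k: "k \<in> K" and s: "s \<in> S" and l: "l \<in> K" for k s l
  proof -
    have KH: "K \<subseteq> H" and cK: "csub K" using K by (auto simp: her_def)
    obtain b r C where b: "b = r *\<^sub>R (star l * l)" "pos b" "norm b \<le> 1" "C \<ge> 0" "C *\<^sub>R b = star l * l"
      using star_mult_normalized by metis
    obtain b' r' C' where b': "b' = r' *\<^sub>R (star (star k) * star k)" "pos b'" "norm b' \<le> 1" "C' \<ge> 0"
      "C' *\<^sub>R b' = star (star k) * star k"
      using star_mult_normalized by metis
    have bK: "b \<in> K" "b' \<in> K" using cK k l b(1) b'(1) by (simp_all add: csub_mem)
    let ?e = "\<lambda>n. 1 - (1 - b) ^ n" and ?f = "\<lambda>n. 1 - (1 - b') ^ n"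
    have ef: "?e n \<in> K" "?f n \<in> K" for n using csub_approximate_unit[OF cK] bK by blast+
    have "(\<lambda>n. star k * ?f n) \<longlonglongrightarrow> star k" using approximate_unit_tendsto[of b' C' "star k"] b' by simp
    from tendsto_star[OF this] have "(\<lambda>n. ?f n * k) \<longlonglongrightarrow> k"
      by (simp add: star_mult star_star star_one_minus_power pos_star[OF b'(2)])
    moreover have "(\<lambda>n. l * ?e n) \<longlonglongrightarrow> l" using approximate_unit_tendsto[of b C l] b by simp
    ultimately have "(\<lambda>n. (?f n * k) * s * (l * ?e n)) \<longlonglongrightarrow> k * s * l" by (intro tendsto_intros)
    moreover have "(?f n * k) * s * (l * ?e n) \<in> K" for n
    proof -
      have "k * s * l \<in> H" using her_mem[OF H _ s] KH k l by blast
      then have "?f n * (k * s * l) * ?e n \<in> K" using her_mem[OF K] ef by blast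
      then show ?thesis by (simp add: mult.assoc)
    qed
    ultimately show ?thesis by (rule csub_limit[OF cK])
  qed
  then show ?thesis using K H by (auto simp: her_def)
qed

text \<open>Allows square roots to be located in the multipliers of \<open>S\<close> even when \<open>S\<close> has no unit.\<close>
lemma sq_closed_idealizer:
  assumes S: "csub S" shows "sq_closed {y::'a::uc_star. \<forall>s\<in>S. y * s \<in> S \<and> s * y \<in> S}"
proof -
  have "closed {y. y * s \<in> S}" "closed {y. s * y \<in> S}" for s
    using csub_closed[OF S]
    by (auto intro!: closed_vimage[of S, unfolded vimage_def] continuous_intros)
  then have "closed (\<Inter>s\<in>S. {y. y * s \<in> S} \<inter> {y. s * y \<in> S})" by (intro closed_INT) auto
  moreover have "(\<Inter>s\<in>S. {y. y * s \<in> S} \<inter> {y. s * y \<in> S}) = {y. \<forall>s\<in>S. y * s \<in> S \<and> s * y \<in> S}" by auto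
  ultimately show ?thesis using S unfolding sq_closed_def
    by (auto simp: csub_mem distrib_left distrib_right mult.assoc) (metis mult.assoc)
qed

text \<open>The root multiplies \<open>S\<close> into itself and is the limit of its products with an approximate unit from
  \<open>S\<close>.\<close>
lemma csub_pos_sqrt:
  fixes S :: "'a::uc_star set"
  assumes S: "csub S" and a: "a \<in> S" "pos a"
  obtains r where "r \<in> S" "pos r" "r * r = a" "\<And>W. sq_closed W \<Longrightarrow> a \<in> W \<Longrightarrow> r \<in> W"
proof -
  obtain r where r: "pos r" "r * r = a" "\<And>W. sq_closed W \<Longrightarrow> a \<in> W \<Longrightarrow> r \<in> W" using pos_sqrt[OF a(2)] by metis
  have "r \<in> {y. \<forall>s\<in>S. y * s \<in> S \<and> s * y \<in> S}"
    by (rule r(3)[OF sq_closed_idealizer[OF S]]) (use S a in \<open>auto intro: csub_mem\<close>)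
  then have rS: "r * s \<in> S" if "s \<in> S" for s using that by auto
  obtain b q K where b: "b = q *\<^sub>R (star r * r)" "pos b" "norm b \<le> 1" "K \<ge> 0" "K *\<^sub>R b = star r * r"
    using star_mult_normalized by metis
  have "b \<in> S" using b(1) r a S by (simp add: pos_star csub_mem)
  then have m: "r * (1 - (1 - b) ^ n) \<in> S" for n using rS csub_approximate_unit[OF S] by blast
  have "(\<lambda>n. r * (1 - (1 - b) ^ n)) \<longlonglongrightarrow> r"
    using approximate_unit_tendsto[of b K r] b by simp
  then have "r \<in> S" using m by (rule csub_limit[OF S])
  then show ?thesis using that r by blast
qed

text \<open>If \<open>H S H \<subseteq> H\<close> and \<open>star y * y \<le> b \<in> H\<close>, an approximate unit generated by \<open>b\<close> absorbs \<open>y\<close> and puts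
  \<open>star y * y\<close> into \<open>H\<close>. Conversely, order heredity puts \<open>e (1 + y)\<^sup>2 e\<close> into \<open>H\<close> for self-adjoint
  \<open>e \<in> H\<close> and \<open>y \<in> S\<close>, because it is dominated by a multiple of \<open>e\<^sup>2\<close>; linear combinations yield
  \<open>e y e\<close>, and approximate units yield \<open>h s k\<close>.\<close>
lemma her_iff_order_hereditary:
  fixes S :: "'a::uc_star set"
  assumes S: "csub S" and H: "csub H" "H \<subseteq> S"
  shows "her H S \<longleftrightarrow> (\<forall>y\<in>S. \<forall>z\<in>S. \<forall>b\<in>H. b - star y * y = star z * z \<longrightarrow> star y * y \<in> H)"
proof
  assume her: "her H S"
  show "\<forall>y\<in>S. \<forall>z\<in>S. \<forall>b\<in>H. b - star y * y = star z * z \<longrightarrow> star y * y \<in> H"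
  proof (intro ballI impI)
    fix y z b assume yz: "y \<in> S" "z \<in> S" and b: "b \<in> H" "b - star y * y = star z * z"
    have pb: "pos b" using pos_add[OF pos_star_mult[of z] pos_star_mult[of y]] b(2)[symmetric] by simp
    define t where "t = norm b + 1"
    have t: "t > 0" by (simp add: t_def add_nonneg_pos)
    define c where "c = (1/t) *\<^sub>R b"
    have c: "pos c" "c \<in> H" "t *\<^sub>R c = b" "norm c \<le> 1"
      using t pb H b(1) by (auto simp: c_def csub_mem pos_scaleR field_simps t_def)
    have "(\<lambda>n. y * (1 - (1 - c) ^ n)) \<longlonglongrightarrow> y"
      by (rule approximate_unit_tendsto[of c t]) (use c b t pos_star_mult[of z] in auto)
    from tendsto_mult[OF tendsto_star[OF this] this]
    have "(\<lambda>n. (1 - (1 - c) ^ n) * (star y * y) * (1 - (1 - c) ^ n)) \<longlonglongrightarrow> star y * y"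
      by (simp add: star_mult star_one_minus_power pos_star[OF c(1)] mult.assoc)
    moreover have "(1 - (1 - c) ^ n) * (star y * y) * (1 - (1 - c) ^ n) \<in> H" for n
      using yz S by (intro her_mem[OF her] csub_approximate_unit[OF H(1) c(2)] csub_mem)
    ultimately show "star y * y \<in> H" by (rule csub_limit[OF H(1)])
  qed
next
  assume ord: "\<forall>y\<in>S. \<forall>z\<in>S. \<forall>b\<in>H. b - star y * y = star z * z \<longrightarrow> star y * y \<in> H"
  have 1: "e * (1 + y) * (1 + y) * e \<in> H" if e: "e \<in> H" "star e = e" and y: "y \<in> S" "star y = y" for e y
  proof -
    define K where "K = norm ((1 + y) * (1 + y))"
    have K0: "K \<ge> 0" by (simp add: K_def)
    have "pos (K *\<^sub>R 1 - (1 + y) * (1 + y))"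
      unfolding K_def by (rule pos_norm_diff) (simp_all add: star_mult star_add y)
    then obtain s where s: "pos s" "s * s = K *\<^sub>R 1 - (1 + y) * (1 + y)"
      "\<And>W. sq_closed W \<Longrightarrow> K *\<^sub>R 1 - (1 + y) * (1 + y) \<in> W \<Longrightarrow> s \<in> W" using pos_sqrt by metis
    have eS: "e \<in> S" using e H by auto
    have "s \<in> {y. \<forall>s\<in>S. y * s \<in> S \<and> s * y \<in> S}"
    proof (rule s(3)[OF sq_closed_idealizer[OF S]])
      show "K *\<^sub>R 1 - (1 + y) * (1 + y) \<in> {y. \<forall>s\<in>S. y * s \<in> S \<and> s * y \<in> S}"
        using y S by (auto simp: algebra_simps intro!: csub_mem)
    qed
    then have "s * e \<in> S" using eS by auto
    moreover have "(1 + y) * e \<in> S" using eS y S by (simp add: distrib_right csub_mem)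
    moreover have "K *\<^sub>R (e * e) \<in> H" using e H by (simp add: csub_mem)
    moreover have "K *\<^sub>R (e * e) - star ((1 + y) * e) * ((1 + y) * e) = star (s * e) * (s * e)"
    proof -
      have "star (s * e) * (s * e) = e * (s * s) * e" by (simp add: star_mult e pos_star[OF s(1)] mult.assoc)
      also have "\<dots> = K *\<^sub>R (e * e) - star ((1 + y) * e) * ((1 + y) * e)"
        by (simp add: s(2) star_mult e y star_add left_diff_distrib right_diff_distrib mult.assoc)
      finally show ?thesis by simp
    qed
    ultimately have "star ((1 + y) * e) * ((1 + y) * e) \<in> H" using ord by blast
    then show ?thesis by (simp add: star_mult e y star_add mult.assoc)
  qed
  have 2: "e * y * e \<in> H" if e: "e \<in> H" "star e = e" and y: "y \<in> S" "star y = y" for e y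
  proof -
    have "e * (1 + y) * (1 + y) * e - e * (1 + - y) * (1 + - y) * e \<in> H"
      using 1[OF e y] 1[OF e, of "-y"] y S H by (intro csub_diff) (auto simp: csub_mem)
    moreover have "e * (1 + y) * (1 + y) * e - e * (1 + - y) * (1 + - y) * e = e * y * e + e * y * e + (e * y * e + e * y * e)"
      by (simp add: algebra_simps)
    ultimately have "(1/4) *\<^sub>R (e * y * e + e * y * e + (e * y * e + e * y * e)) \<in> H"
      using csub_scaleR[OF H(1)] by metis
    then show ?thesis by (simp flip: scaleR_2)
  qed
  have 3: "e * y * e \<in> H" if e: "e \<in> H" "star e = e" and y: "y \<in> S" for e y
  proof -
    define u v where "u = y + star y" and "v = \<i> *\<^sub>C (y - star y)"
    have "star u = u" "star v = v" "u \<in> S" "v \<in> S" using y S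
      by (auto simp: u_def v_def star_add star_star star_scaleC star_diff scaleC_diff_right csub_mem)
    then have "(1/2) *\<^sub>R (e * u * e + (- \<i>) *\<^sub>C (e * v * e)) \<in> H"
      using 2[OF e] H by (intro csub_scaleR csub_add csub_scaleC) auto
    moreover have "e * u * e + (- \<i>) *\<^sub>C (e * v * e) = 2 *\<^sub>R (e * y * e)"
      by (simp add: u_def v_def algebra_simps scaleC_mult_left scaleC_mult_right scaleC_scaleC scaleC_minus_one scaleC_diff_right scaleR_2)
    ultimately show ?thesis by simp
  qed
  have "h * s * k \<in> H" if h: "h \<in> H" and s: "s \<in> S" and k: "k \<in> H" for h s k
  proof -
    define p where "p = star k * k + h * star h"
    have pp: "pos p" unfolding p_def by (intro pos_add pos_star_mult pos_mult_star)
    define t where "t = norm p + 1"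
    have t: "t > 0" by (simp add: t_def add_nonneg_pos)
    define c where "c = (1/t) *\<^sub>R p"
    have pH: "p \<in> H" using h k H by (simp add: p_def csub_mem)
    have c: "pos c" "c \<in> H" "t *\<^sub>R c = p" "norm c \<le> 1"
      using t pp H pH by (auto simp: c_def csub_mem pos_scaleR field_simps t_def)
    let ?e = "\<lambda>n. 1 - (1 - c) ^ n"
    have eH: "?e n \<in> H" for n using csub_approximate_unit[OF H(1) c(2)] .
    have se: "star (?e n) = ?e n" for n using star_one_minus_power pos_star[OF c(1)] by blast
    have "(\<lambda>n. star h * ?e n) \<longlonglongrightarrow> star h"
      by (rule approximate_unit_tendsto[of c t]) (use c t pos_star_mult in \<open>auto simp: p_def star_star\<close>)
    from tendsto_star[OF this] have "(\<lambda>n. ?e n * h) \<longlonglongrightarrow> h" unfolding star_mult se star_star .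
    moreover have "(\<lambda>n. k * ?e n) \<longlonglongrightarrow> k"
      by (rule approximate_unit_tendsto[of c t]) (use c t pos_mult_star in \<open>auto simp: p_def\<close>)
    ultimately have "(\<lambda>n. (?e n * h) * s * (k * ?e n)) \<longlonglongrightarrow> h * s * k" by (intro tendsto_intros)
    moreover have "(?e n * h) * s * (k * ?e n) \<in> H" for n
    proof -
      have "h * s * k \<in> S" using h k s H S by (auto intro: csub_mem)
      from 3[OF eH se this, of n] show ?thesis by (simp add: mult.assoc)
    qed
    ultimately show ?thesis by (rule csub_limit[OF H(1)])
  qed
  then show "her H S" using H by (auto simp: her_def)
qed

text \<open>For self-adjoint \<open>b\<close> the hereditary subalgebra generated by \<open>b\<close>.\<close>
definition hclos :: "'a::nc_star \<Rightarrow> 'a set \<Rightarrow> 'a set" where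
  "hclos b S = closure ((\<lambda>s. b * s * b) ` S)"

lemma closure_binop:
  fixes f :: "'a::metric_space \<Rightarrow> 'b::metric_space \<Rightarrow> 'c::metric_space"
  assumes "x \<in> closure X" "y \<in> closure Y" "\<And>x y. x \<in> X \<Longrightarrow> y \<in> Y \<Longrightarrow> f x y \<in> Z"
    "\<And>u v. u \<longlonglongrightarrow> x \<Longrightarrow> v \<longlonglongrightarrow> y \<Longrightarrow> (\<lambda>n. f (u n) (v n)) \<longlonglongrightarrow> f x y"
  shows "f x y \<in> closure Z"
proof -
  obtain u where u: "\<And>n. u n \<in> X" "u \<longlonglongrightarrow> x" using assms(1) closure_sequential by metis
  obtain v where v: "\<And>n. v n \<in> Y" "v \<longlonglongrightarrow> y" using assms(2) closure_sequential by metis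
  have "\<And>n. f (u n) (v n) \<in> Z" using u v assms(3) by blast
  then show ?thesis using assms(4)[OF u(2) v(2)] closure_sequential
    by (metis (mono_tags, lifting))
qed

lemma closure_unop:
  fixes f :: "'a::metric_space \<Rightarrow> 'c::metric_space"
  assumes "x \<in> closure X" "\<And>x. x \<in> X \<Longrightarrow> f x \<in> Z" "\<And>u. u \<longlonglongrightarrow> x \<Longrightarrow> (\<lambda>n. f (u n)) \<longlonglongrightarrow> f x"
  shows "f x \<in> closure Z"
  using closure_binop[of x X x X "\<lambda>x y. f x" Z] assms by blast

lemma csub_closure:
  fixes X :: "'a::nc_star set"
  assumes "0 \<in> X" "\<And>x y. x \<in> X \<Longrightarrow> y \<in> X \<Longrightarrow> x + y \<in> X" "\<And>x y. x \<in> X \<Longrightarrow> y \<in> X \<Longrightarrow> x * y \<in> X"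
    "\<And>x. x \<in> X \<Longrightarrow> star x \<in> X" "\<And>x c. x \<in> X \<Longrightarrow> c *\<^sub>C x \<in> X"
  shows "csub (closure X)"
  unfolding csub_def
proof (intro conjI ballI allI)
  fix x y assume xy: "x \<in> closure X" "y \<in> closure X"
  show "x + y \<in> closure X" by (rule closure_binop[OF xy]) (auto intro: assms tendsto_intros)
  show "x * y \<in> closure X" by (rule closure_binop[OF xy]) (auto intro: assms tendsto_intros)
next
  fix x c assume x: "x \<in> closure X"
  show "star x \<in> closure X" by (rule closure_unop[OF x]) (auto intro: assms tendsto_intros)
  show "c *\<^sub>C x \<in> closure X" by (rule closure_unop[OF x]) (auto intro: assms tendsto_intros)
next
  show "0 \<in> closure X" using assms(1) closure_subset by blast
qed simp

lemma her_hclos: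
  assumes S: "csub S" and b: "b \<in> S" "star b = b"
  shows "her (hclos b S) S"
proof -
  let ?X = "(\<lambda>s. b * s * b) ` S"
  have XS: "?X \<subseteq> S" using S b by (auto intro: csub_mem)
  have "csub (hclos b S)" unfolding hclos_def
  proof (rule csub_closure)
    show "0 \<in> ?X" using csub_0[OF S] by force
    show "x + y \<in> ?X" if "x \<in> ?X" "y \<in> ?X" for x y
      using that csub_add[OF S] by (force simp: distrib_left[symmetric] distrib_right[symmetric])
    show "x * y \<in> ?X" if xy: "x \<in> ?X" "y \<in> ?X" for x y
    proof -
      from xy obtain s t where st: "s \<in> S" "t \<in> S" "x = b * s * b" "y = b * t * b" by auto
      then have "x * y = b * (s * b * b * t) * b" by (simp add: mult.assoc)
      then show ?thesis using st b S by (auto intro!: imageI csub_mult)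
    qed
    show "star x \<in> ?X" if x: "x \<in> ?X" for x
    proof -
      from x obtain s where s: "s \<in> S" "x = b * s * b" by auto
      then have "star x = b * star s * b" using b by (simp add: star_mult mult.assoc)
      then show ?thesis using s S by (auto intro!: imageI csub_star)
    qed
    show "c *\<^sub>C x \<in> ?X" if x: "x \<in> ?X" for x c
    proof -
      from x obtain s where s: "s \<in> S" "x = b * s * b" by auto
      then have "c *\<^sub>C x = b * (c *\<^sub>C s) * b" by (simp add: scaleC_mult_left scaleC_mult_right)
      then show ?thesis using s S by (auto intro!: imageI csub_scaleC)
    qed
  qed
  moreover have "hclos b S \<subseteq> S"
    unfolding hclos_def by (rule closure_minimal[OF XS csub_closed[OF S]])
  moreover have "h * s * k \<in> hclos b S" if h: "h \<in> hclos b S" and s: "s \<in> S" and k: "k \<in> hclos b S" for h s k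
    using h k unfolding hclos_def
  proof (rule closure_binop)
    fix x y assume "x \<in> ?X" "y \<in> ?X"
    then obtain t u where tu: "t \<in> S" "u \<in> S" "x = b * t * b" "y = b * u * b" by auto
    then have "x * s * y = b * (t * b * s * b * u) * b" by (simp add: mult.assoc)
    then show "x * s * y \<in> ?X" using tu b s S by (auto intro!: imageI csub_mult)
  qed (intro tendsto_intros)
  ultimately show ?thesis by (auto simp: her_def)
qed

lemma hclos_nonzero:
  assumes S: "csub S" and b: "b \<in> S" "star b = b" "b \<noteq> 0"
  shows "hclos b S \<noteq> {0}"
proof
  assume *: "hclos b S = {0}"
  have "b * b * b \<in> hclos b S" 
    unfolding hclos_def by (rule subsetD[OF closure_subset]) (use b(1) in auto)
  then have "(b * b) * (b * b) = 0" using * by (simp flip: mult.assoc)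
  then have "b = 0" using mult_self_eq_0 b(2) by (metis star_mult)
  then show False using b(3) by simp
qed

lemma hclos_subset:
  assumes H: "her H S" and b: "b \<in> H" shows "hclos b S \<subseteq> H"
  unfolding hclos_def using H b by (intro closure_minimal) (auto intro: her_mem simp: her_def csub_closed)

lemma her_nonzero_pos:
  assumes "csub H" "H \<noteq> {0}"
  obtains b where "b \<in> H" "b \<noteq> 0" "pos b" "star b = b"
proof -
  obtain x where "x \<in> H" "x \<noteq> 0" using assms csub_0 by blast
  then show ?thesis using that[of "star x * x"] assms
    by (auto simp: csub_mem pos_star_mult star_mult_eq_0 star_mult star_star)
qed

section \<open>Star homomorphisms\<close>

lemma sq_step_commute:
  fixes y :: "'a::real_normed_algebra"
  assumes "y * w = w * y" "b * w = w * b"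
  shows "((1/2) *\<^sub>R (y * y + b)) * w = w * ((1/2) *\<^sub>R (y * y + b))"
proof -
  have "y * y * w = w * (y * y)" using assms(1) by (metis mult.assoc)
  then show ?thesis using assms(2) by (simp add: distrib_left distrib_right)
qed

text \<open>Star-homomorphisms on a closed subalgebra. Only the algebraic laws are recorded; contractivity is a
  consequence.\<close>
definition chom :: "'a::nc_star set \<Rightarrow> ('a \<Rightarrow> 'b::nc_star) \<Rightarrow> bool" where
  "chom S \<phi> \<longleftrightarrow> (\<forall>x\<in>S. \<forall>y\<in>S. \<phi> (x + y) = \<phi> x + \<phi> y \<and> \<phi> (x * y) = \<phi> x * \<phi> y) \<and>
     (\<forall>x\<in>S. \<phi> (star x) = star (\<phi> x) \<and> (\<forall>c. \<phi> (c *\<^sub>C x) = c *\<^sub>C \<phi> x))"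

lemma chom_add: "chom S \<phi> \<Longrightarrow> x \<in> S \<Longrightarrow> y \<in> S \<Longrightarrow> \<phi> (x + y) = \<phi> x + \<phi> y"
  and chom_mult: "chom S \<phi> \<Longrightarrow> x \<in> S \<Longrightarrow> y \<in> S \<Longrightarrow> \<phi> (x * y) = \<phi> x * \<phi> y"
  and chom_star: "chom S \<phi> \<Longrightarrow> x \<in> S \<Longrightarrow> \<phi> (star x) = star (\<phi> x)"
  and chom_scaleC: "chom S \<phi> \<Longrightarrow> x \<in> S \<Longrightarrow> \<phi> (c *\<^sub>C x) = c *\<^sub>C \<phi> x"
  by (auto simp: chom_def)

lemma chom_scaleR: "chom S \<phi> \<Longrightarrow> x \<in> S \<Longrightarrow> \<phi> (r *\<^sub>R x) = r *\<^sub>R \<phi> x"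
  using chom_scaleC[of S \<phi> x "of_real r"] by (simp add: scaleC_of_real)

lemma chom_minus: "chom S \<phi> \<Longrightarrow> x \<in> S \<Longrightarrow> \<phi> (- x) = - \<phi> x"
  using chom_scaleC[of S \<phi> x "-1"] by (simp add: scaleC_minus_one)

lemma chom_diff: "csub S \<Longrightarrow> chom S \<phi> \<Longrightarrow> x \<in> S \<Longrightarrow> y \<in> S \<Longrightarrow> \<phi> (x - y) = \<phi> x - \<phi> y"
  using chom_add[of S \<phi> x "-y"] chom_minus[of S \<phi> y] csub_minus[of S y] by simp

lemma chom_0: "csub S \<Longrightarrow> chom S \<phi> \<Longrightarrow> \<phi> 0 = 0"
  using chom_scaleC[of S \<phi> 0 0] csub_0 by auto

lemma chom_subset: "chom S \<phi> \<Longrightarrow> T \<subseteq> S \<Longrightarrow> chom T \<phi>"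
  by (auto simp: chom_def subset_iff)

lemma chom_comp: "chom S \<phi> \<Longrightarrow> chom T \<psi> \<Longrightarrow> \<phi> ` S \<subseteq> T \<Longrightarrow> chom S (\<psi> \<circ> \<phi>)"
  by (auto simp: chom_def image_subset_iff)

lemma chom_id: "chom S (\<lambda>x. x)" by (auto simp: chom_def)

lemma chom_sum: "csub S \<Longrightarrow> chom S \<phi> \<Longrightarrow> (\<And>i. i \<in> I \<Longrightarrow> f i \<in> S) \<Longrightarrow> \<phi> (sum f I) = (\<Sum>i\<in>I. \<phi> (f i))"
  by (induction I rule: infinite_finite_induct) (auto simp: chom_0 chom_add csub_sum)

text \<open>For self-adjoint \<open>x\<close> of norm at most one, \<open>z = 1 - sqrt (1 - x\<^sup>2)\<close> lies in \<open>S\<close>, so the relation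
  \<open>(1 - z)\<^sup>2 + x\<^sup>2 = 1\<close> is transported by \<open>\<phi>\<close> and bounds the norm of \<open>\<phi> x\<close>.\<close>
lemma chom_norm_le:
  fixes \<phi> :: "'a::uc_star \<Rightarrow> 'b::uc_star"
  assumes S: "csub S" and h: "chom S \<phi>" and x: "x \<in> S"
  shows "norm (\<phi> x) \<le> norm x"
proof -
  have 1: "norm (\<phi> x) \<le> 1" if x: "x \<in> S" "star x = x" "norm x \<le> 1" for x
  proof -
    have "norm (x * x) \<le> 1" using norm_mult_ineq[of x x] x(3) mult_mono[of "norm x" 1 "norm x" 1] by simp
    then obtain z where z: "(1 - z) * (1 - z) = 1 - x * x"
      "\<And>W. \<lbrakk>closed W; 0 \<in> W; \<And>y. y \<in> W \<Longrightarrow> (1/2) *\<^sub>R (y * y + x * x) \<in> W\<rbrakk> \<Longrightarrow> z \<in> W"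
      using sq_root_iteration[of "x * x"] by metis
    have zS: "z \<in> S" by (rule z(2)[OF csub_closed[OF S]]) (use S x in \<open>auto intro: csub_mem\<close>)
    have sz: "z \<in> {y. star y = y}"
      by (rule z(2)[OF closed_self_adjoint]) (auto simp: star_add star_mult x)
    have "z \<in> {y. y * x = x * y}"
      by (rule z(2)[OF closed_commutant]) (auto intro!: sq_step_commute simp: mult.assoc simp del: mult_scaleR_left mult_scaleR_right)
    then have "z * x = x * z" by simp
    then have cz: "\<phi> z * \<phi> x = \<phi> x * \<phi> z" by (simp flip: chom_mult[OF h zS x(1)] chom_mult[OF h x(1) zS])
    have "z + z - z * z = x * x" using z(1) by (simp add: algebra_simps)
    moreover have "\<phi> (z + z - z * z) = \<phi> z + \<phi> z - \<phi> z * \<phi> z"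
      using zS S by (simp add: chom_diff[OF S h] chom_add[OF h] chom_mult[OF h] csub_mem)
    ultimately have e: "\<phi> x * \<phi> x = \<phi> z + \<phi> z - \<phi> z * \<phi> z" using chom_mult[OF h x(1) x(1)] by simp
    show ?thesis
      by (rule norm_le_1_if_sq_sum_eq_1[of _ "1 - \<phi> z"])
        (use sz zS x h in \<open>auto simp: e cz algebra_simps star_diff simp flip: chom_star\<close>)
  qed
  have 2: "norm (\<phi> x) \<le> norm x" if x: "x \<in> S" "star x = x" for x
  proof (cases "x = 0")
    case False
    then have "norm (\<phi> ((1 / norm x) *\<^sub>R x)) \<le> 1" using x S by (intro 1) (auto simp: csub_mem)
    then show ?thesis using False x by (simp add: chom_scaleR[OF h] field_simps)
  qed (simp add: chom_0[OF S h])
  have "(norm (\<phi> x))\<^sup>2 = norm (\<phi> (star x * x))"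
    using x S by (simp add: chom_mult[OF h] chom_star[OF h] csub_mem norm_star_mult)
  also have "\<dots> \<le> norm (star x * x)" using x S by (intro 2) (auto simp: csub_mem star_mult star_star)
  finally show ?thesis by (simp add: norm_star_mult)
qed

lemma pos_sq_unique:
  fixes p q :: "'a::uc_star"
  assumes p: "pos p" and q: "pos q" and "p * q = q * p" "p * p = q * q"
  shows "p = q"
proof -
  define d where "d = p - q"
  have sd: "star d = d" using p q by (simp add: d_def star_diff pos_star)
  have pd: "pos (d * p * d)" "pos (d * q * d)" using pos_conj[of p d] pos_conj[of q d] p q by (simp_all add: sd)
  have "d * (p + q) = 0" using assms by (simp add: d_def algebra_simps)
  then have "d * p * d + d * q * d = 0" by (metis distrib_left distrib_right mult_zero_left)
  then have "d * p * d = 0" "d * q * d = 0"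
    using pos_add_eq_0[OF pd] pos_add_eq_0[OF pd(2,1)] by (simp_all add: add.commute)
  then have "d * d * d = 0" by (subst (2) d_def) (simp add: algebra_simps)
  then have "(d * d) * (d * d) = 0" by (simp flip: mult.assoc)
  then have "d = 0" using mult_self_eq_0 sd by (metis star_mult)
  then show ?thesis by (simp add: d_def)
qed

lemma norm_one_minus_double_le_1:
  fixes e :: "'a::uc_star"
  assumes e: "pos e" "norm e \<le> 1"
  shows "norm (1 - 2 *\<^sub>R e) \<le> 1"
proof -
  define y where "y = 4 *\<^sub>R (e * (1 - e))"
  have p: "pos (1 - e)" using pos_norm_diff[OF pos_star[OF e(1)] e(2)] by simp
  have py: "pos y" unfolding y_def
    by (intro pos_scaleR pos_mult_commute e p) (simp_all add: algebra_simps)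
  have s: "star (1 - 2 *\<^sub>R e) = 1 - 2 *\<^sub>R e" using e by (simp add: star_diff pos_star)
  have eq: "(1 - 2 *\<^sub>R e) * (1 - 2 *\<^sub>R e) = 1 - y"
  proof -
    have "y = 4 *\<^sub>R e - 4 *\<^sub>R (e * e)"
      by (simp add: y_def right_diff_distrib scaleR_right_diff_distrib)
    moreover have "4 *\<^sub>R e = 2 *\<^sub>R e + 2 *\<^sub>R e" by (simp flip: scaleR_left_distrib)
    ultimately show ?thesis by (simp add: left_diff_distrib right_diff_distrib scaleR_right_diff_distrib)
  qed
  have "pos (1 - y)" using pos_sq[OF s] eq by simp
  then have "norm y \<le> 1" using pos_le_norm_le[OF py, of 1] by simp
  then have "norm (1 - y) \<le> 1" using pos_norm_minus[OF py, of 1] by simp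
  moreover have "(norm (1 - 2 *\<^sub>R e))\<^sup>2 = norm (1 - y)" using norm_star_mult[of "1 - 2 *\<^sub>R e"] s eq by simp
  ultimately show ?thesis 
    using power2_le_imp_le[of "norm (1 - 2 *\<^sub>R e)" 1] by simp
qed

text \<open>Otherwise there is a positive \<open>u\<close> with \<open>1 < norm u \<le> 2\<close> and \<open>norm (\<phi> u) \<le> 1\<close>. Put
  \<open>z = 1 - \<bar>1 - u\<bar>\<close>, so \<open>norm z \<le> 1\<close>. Both \<open>1 - \<phi> z\<close> and \<open>1 - \<phi> u\<close> are positive with the same square, so
  \<open>\<phi> z = \<phi> u\<close>; injectivity gives \<open>z = u\<close>, which contradicts the norms.\<close>
lemma chom_inj_isometric:
  fixes \<phi> :: "'a::uc_star \<Rightarrow> 'b::uc_star"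
  assumes S: "csub S" and h: "chom S \<phi>" and inj: "inj_on \<phi> S" and x: "x \<in> S"
  shows "norm (\<phi> x) = norm x"
proof -
  have 1: "1 \<le> norm (\<phi> a)" if a: "a \<in> S" "pos a" "norm a = 1" for a
  proof (rule ccontr)
    assume "\<not> 1 \<le> norm (\<phi> a)"
    define s where "s = max (1/2) (norm (\<phi> a))"
    have s: "s < 1" "1/2 \<le> s" "norm (\<phi> a) \<le> s" using \<open>\<not> _\<close> by (auto simp: s_def)
    define u where "u = (1/s) *\<^sub>R a"
    have us: "u \<in> S" "star u = u" "norm u > 1" using a s S by (auto simp: u_def csub_mem pos_star)
    have "norm (1 - 2 *\<^sub>R ((1/2) *\<^sub>R u)) \<le> 1"
      using a s by (intro norm_one_minus_double_le_1) (auto simp: u_def intro!: pos_scaleR)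
    then have n1: "norm (1 - u) \<le> 1" by simp
    have n2: "norm (1 - (1 - u) * (1 - u)) \<le> 1"
      by (rule norm_one_minus_sq_le_1) (use us n1 in \<open>auto simp: star_diff\<close>)
    obtain z where z: "norm z \<le> 1" "(1 - z) * (1 - z) = (1 - u) * (1 - u)"
      "\<And>W. \<lbrakk>closed W; 0 \<in> W; \<And>y. y \<in> W \<Longrightarrow> (1/2) *\<^sub>R (y * y + (1 - (1 - u) * (1 - u))) \<in> W\<rbrakk> \<Longrightarrow> z \<in> W"
      using sq_root_iteration[OF n2] by auto
    have ue: "1 - (1 - u) * (1 - u) = u + u - u * u" by (simp add: algebra_simps)
    have zS: "z \<in> S"
      by (rule z(3)[OF csub_closed[OF S]]) (use S us in \<open>auto intro!: csub_scaleR csub_add csub_diff csub_mult csub_0 simp: ue\<close>)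
    have sz: "z \<in> {y. star y = y}"
      by (rule z(3)[OF closed_self_adjoint]) (use us in \<open>auto simp: ue star_add star_diff star_mult\<close>)
    have cz: "z \<in> {y. y * u = u * y}"
      by (rule z(3)[OF closed_commutant])
        (auto intro!: sq_step_commute simp: ue distrib_left distrib_right right_diff_distrib left_diff_distrib mult.assoc
          simp del: mult_scaleR_left mult_scaleR_right)
    have e: "\<phi> z + \<phi> z - \<phi> z * \<phi> z = \<phi> u + \<phi> u - \<phi> u * \<phi> u"
    proof -
      have "z + z - z * z = u + u - u * u" using z(2) by (simp add: algebra_simps)
      then have "\<phi> (z + z - z * z) = \<phi> (u + u - u * u)" by simp
      then show ?thesis using zS us S by (simp add: chom_diff[OF S h] chom_add[OF h] chom_mult[OF h] csub_mem)
    qed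
    have "1 - \<phi> z = 1 - \<phi> u"
    proof (rule pos_sq_unique)
      have "norm (\<phi> z) \<le> 1" using chom_norm_le[OF S h zS] z(1) by simp
      then show "pos (1 - \<phi> z)"
        using pos_norm_diff[of "\<phi> z" 1] sz zS chom_star[OF h zS] by auto
      have "norm (\<phi> u) \<le> 1" using s a by (simp add: u_def chom_scaleR[OF h])
      then show "pos (1 - \<phi> u)" using pos_norm_diff[of "\<phi> u" 1] us chom_star[OF h us(1)] by auto
      have "\<phi> z * \<phi> u = \<phi> u * \<phi> z" 
        using cz by (simp flip: chom_mult[OF h zS us(1)] chom_mult[OF h us(1) zS])
      then show "(1 - \<phi> z) * (1 - \<phi> u) = (1 - \<phi> u) * (1 - \<phi> z)" by (simp add: algebra_simps)
      show "(1 - \<phi> z) * (1 - \<phi> z) = (1 - \<phi> u) * (1 - \<phi> u)" using e by (simp add: algebra_simps)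
    qed
    then have "\<phi> z = \<phi> u" by simp
    then have "z = u" using inj zS us(1) by (simp add: inj_on_eq_iff)
    then show False using z(1) us(3) by simp
  qed
  have 2: "norm a \<le> norm (\<phi> a)" if a: "a \<in> S" "pos a" for a
  proof (cases "a = 0")
    case False
    then have "1 \<le> norm (\<phi> ((1 / norm a) *\<^sub>R a))" using a S by (intro 1) (auto simp: csub_mem intro!: pos_scaleR)
    then show ?thesis using False a by (simp add: chom_scaleR[OF h] field_simps)
  qed simp
  have "(norm x)\<^sup>2 \<le> norm (\<phi> (star x * x))"
    using 2[of "star x * x"] x S by (simp add: csub_mem norm_star_mult pos_star_mult)
  also have "\<dots> = (norm (\<phi> x))\<^sup>2"
    using x S by (simp add: chom_mult[OF h] chom_star[OF h] csub_mem norm_star_mult)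
  finally have "norm x \<le> norm (\<phi> x)" by simp
  then show ?thesis using chom_norm_le[OF S h x] by simp
qed

lemma chom_image_csub:
  fixes \<phi> :: "'a::nc_star \<Rightarrow> 'b::nc_star"
  assumes S: "csub S" and h: "chom S \<phi>" and bd: "\<And>x. x \<in> S \<Longrightarrow> norm x \<le> norm (\<phi> x)"
    "\<And>x. x \<in> S \<Longrightarrow> norm (\<phi> x) \<le> C * norm x"
  shows "csub (\<phi> ` S)"
proof -
  have "closed (\<phi> ` S)"
  proof (subst closed_sequential_limits, intro allI impI, elim conjE)
    fix y l assume y: "\<forall>n. y n \<in> \<phi> ` S" and l: "y \<longlonglongrightarrow> l"
    obtain x where x: "\<And>n. x n \<in> S" "\<And>n. y n = \<phi> (x n)" using y unfolding image_iff Bex_def by metis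
    have "Cauchy y" using l LIMSEQ_imp_Cauchy by blast
    have "Cauchy x"
    proof (rule metric_CauchyI)
      fix e :: real assume "e > 0"
      then obtain M where M: "\<And>m n. m \<ge> M \<Longrightarrow> n \<ge> M \<Longrightarrow> dist (y m) (y n) < e"
        using \<open>Cauchy y\<close> metric_CauchyD by blast
      have "dist (x m) (x n) \<le> dist (y m) (y n)" for m n
        using bd(1)[of "x m - x n"] x S by (simp add: dist_norm csub_mem chom_diff[OF S h])
      then show "\<exists>M. \<forall>m\<ge>M. \<forall>n\<ge>M. dist (x m) (x n) < e" using M order.strict_trans1 by blast
    qed
    then obtain k where k: "x \<longlonglongrightarrow> k" using Cauchy_convergent convergent_def by blast
    have kS: "k \<in> S" by (rule csub_limit[OF S k x(1)])
    have "y \<longlonglongrightarrow> \<phi> k"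
    proof (rule LIM_zero_cancel, rule tendsto_norm_zero_cancel,
        rule tendsto_sandwich[of "\<lambda>_. 0" _ _ "\<lambda>n. C * norm (x n - k)"])
      show "\<forall>\<^sub>F n in sequentially. norm (y n - \<phi> k) \<le> C * norm (x n - k)"
        using bd(2) x S kS by (simp add: csub_mem flip: chom_diff[OF S h])
      have "(\<lambda>n. C * norm (x n - k)) \<longlonglongrightarrow> C * norm (k - k)" by (intro tendsto_intros k)
      then show "(\<lambda>n. C * norm (x n - k)) \<longlonglongrightarrow> 0" by simp
    qed auto
    then show "l \<in> \<phi> ` S" using LIMSEQ_unique[OF l] kS by blast
  qed
  moreover have "0 \<in> \<phi> ` S" using chom_0[OF S h] csub_0[OF S] by force
  moreover have "x + y \<in> \<phi> ` S" "x * y \<in> \<phi> ` S" if "x \<in> \<phi> ` S" "y \<in> \<phi> ` S" for x y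
    using that S by (auto simp flip: chom_add[OF h] chom_mult[OF h] intro: csub_mem)
  moreover have "star x \<in> \<phi> ` S" "c *\<^sub>C x \<in> \<phi> ` S" if "x \<in> \<phi> ` S" for x c
    using that S by (auto simp flip: chom_star[OF h] chom_scaleC[OF h] intro: csub_mem)
  ultimately show ?thesis by (auto simp: csub_def)
qed

lemma chom_inj_image_csub:
  fixes \<phi> :: "'a::uc_star \<Rightarrow> 'b::uc_star"
  assumes "csub S" "chom S \<phi>" "inj_on \<phi> S"
  shows "csub (\<phi> ` S)"
  using chom_image_csub[OF assms(1,2), of 1] chom_inj_isometric[OF assms] by simp

lemma chom_inj_onI:
  assumes "csub S" "chom S \<phi>" "\<And>x. x \<in> S \<Longrightarrow> \<phi> x = 0 \<Longrightarrow> x = 0"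
  shows "inj_on \<phi> S"
  using assms(3) chom_diff[OF assms(1,2)] csub_diff[OF assms(1)] by (intro inj_onI) (metis right_minus_eq)

lemma chom_kernel_cideal:
  fixes \<phi> :: "'a::uc_star \<Rightarrow> 'b::uc_star"
  assumes S: "csub S" and h: "chom S \<phi>" shows "cideal {x\<in>S. \<phi> x = 0} S"
proof -
  have "closed {x\<in>S. \<phi> x = 0}"
  proof (subst closed_sequential_limits, intro allI impI, elim conjE)
    fix x l assume x: "\<forall>n. x n \<in> {x\<in>S. \<phi> x = 0}" and l: "x \<longlonglongrightarrow> l"
    have lS: "l \<in> S" by (rule csub_limit[OF S l]) (use x in auto)
    have "norm (\<phi> l) \<le> norm (x n - l)" for n
    proof -
      have "\<phi> (l - x n) = \<phi> l" using x lS by (simp add: chom_diff[OF S h])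
      then show ?thesis using chom_norm_le[OF S h, of "l - x n"] x lS S
        by (simp add: csub_mem norm_minus_commute)
    qed
    moreover have "(\<lambda>n. norm (x n - l)) \<longlonglongrightarrow> norm (l - l)" by (intro tendsto_intros l)
    ultimately have "norm (\<phi> l) \<le> norm (l - l)" by (intro LIMSEQ_le_const) auto
    then show "l \<in> {x\<in>S. \<phi> x = 0}" using lS by simp
  qed
  then show ?thesis
    using S by (auto simp: cideal_def csub_mem chom_0[OF S h] chom_add[OF h] chom_mult[OF h] chom_scaleC[OF h])
qed

context cstar_algebra
begin

lemma smult_zero_left: "x \<in> carrier A \<Longrightarrow> 0 \<odot> x = \<zero>"
  using smult_l_distr[of x 0 0] smult_closed[of x 0] add.l_cancel_one' by (metis add_0)

lemma smult_minus_one: assumes "x \<in> carrier A" shows "(-1) \<odot> x = \<ominus> x"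
proof (rule sym, rule minus_equality)
  show "(-1) \<odot> x \<oplus> x = \<zero>"
    using smult_l_distr[OF assms, of "-1" 1] smult_one[OF assms] smult_zero_left[OF assms] by simp
qed (use assms smult_closed in auto)

lemma cnorm_minus: "x \<in> carrier A \<Longrightarrow> cnorm A (\<ominus> x) = cnorm A x"
  using cnorm_smult[of x "-1"] smult_minus_one by simp

lemma cnorm_minus_commute:
  assumes "x \<in> carrier A" "y \<in> carrier A" shows "cnorm A (x \<ominus> y) = cnorm A (y \<ominus> x)"
proof -
  have "\<ominus> (y \<ominus> x) = x \<ominus> y" using assms by (simp add: minus_eq minus_add a_comm)
  then show ?thesis using cnorm_minus[of "y \<ominus> x"] assms by simp
qed

lemma eq_if_minus_eq_zero:
  assumes "x \<in> carrier A" "y \<in> carrier A" "x \<oplus> \<ominus> y = \<zero>" shows "x = y"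
  using minus_equality[of "x" "\<ominus> y"] assms by simp

lemma minus_triangle:
  assumes "x \<in> carrier A" "y \<in> carrier A" "z \<in> carrier A"
  shows "x \<ominus> z = (x \<ominus> y) \<oplus> (y \<ominus> z)"
proof -
  have "(x \<ominus> y) \<oplus> (y \<ominus> z) = x \<oplus> ((\<ominus> y \<oplus> y) \<oplus> \<ominus> z)"
    using assms by (simp only: minus_eq a_assoc a_inv_closed a_closed)
  also have "\<dots> = x \<ominus> z" using assms by (simp add: minus_eq l_neg)
  finally show ?thesis by simp
qed

lemma cnorm_minus_triangle:
  assumes "x \<in> carrier A" "y \<in> carrier A" "z \<in> carrier A"
  shows "cnorm A (x \<ominus> z) \<le> cnorm A (x \<ominus> y) + cnorm A (y \<ominus> z)"
  unfolding minus_triangle[OF assms] using assms by (intro cnorm_triangle minus_closed)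

lemma Metric_space_cdist: "Metric_space (carrier A) (cdist A)"
proof
  show "cdist A x y = 0 \<longleftrightarrow> x = y" if "x \<in> carrier A" "y \<in> carrier A" for x y
    
    using that cnorm_eq_0[of "x \<ominus> y"] r_neg[of x] eq_if_minus_eq_zero[of x y]
    by (auto simp: cdist_def minus_eq)
  show "cdist A x z \<le> cdist A x y + cdist A y z" if "x \<in> carrier A" "y \<in> carrier A" "z \<in> carrier A" for x y z
    using that cnorm_minus_triangle by (simp add: cdist_def)
qed (auto simp: cdist_def cnorm_minus_commute cnorm_nonneg)

lemma cnorm_zero [simp]: "cnorm A \<zero> = 0"
  using cnorm_eq_0[of \<zero>] by simp

lemma cauchy_converges:
  assumes f: "\<And>n::nat. f n \<in> carrier A"
    and C: "\<And>e. e > 0 \<Longrightarrow> \<exists>N. \<forall>m\<ge>N. \<forall>n\<ge>N. cnorm A (f m \<ominus> f n) < e"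
  obtains x where "x \<in> carrier A" "\<And>e. e > 0 \<Longrightarrow> \<exists>N. \<forall>n\<ge>N. cnorm A (f n \<ominus> x) < e"
proof -
  interpret M: Metric_space "carrier A" "cdist A" by (rule Metric_space_cdist)
  have "M.MCauchy f" using f C by (auto simp: M.MCauchy_def cdist_def)
  then obtain x where "limitin M.mtopology f x sequentially"
    using complete M.mcomplete_def by blast
  then have x: "x \<in> carrier A" "(\<lambda>n. cdist A (f n) x) \<longlonglongrightarrow> 0"
    by (auto simp: M.limitin_metric_dist_null)
  have "\<exists>N. \<forall>n\<ge>N. cnorm A (f n \<ominus> x) < e" if "e > 0" for e
    using metric_LIMSEQ_D[OF x(2) that] f x(1) cnorm_nonneg by (simp add: cdist_def)
  then show ?thesis using that x(1) by blast
qed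

end

lemma mcompleteI:
  assumes "Metric_space (carrier A) (cdist A)"
    and "\<And>f. \<lbrakk>\<And>n::nat. f n \<in> carrier A; \<And>e. e > 0 \<Longrightarrow> \<exists>N. \<forall>m\<ge>N. \<forall>n\<ge>N. cnorm A (f m \<ominus>\<^bsub>A\<^esub> f n) < e\<rbrakk>
       \<Longrightarrow> \<exists>x\<in>carrier A. (\<lambda>n. cnorm A (f n \<ominus>\<^bsub>A\<^esub> x)) \<longlonglongrightarrow> 0"
  shows "Metric_space.mcomplete (carrier A) (cdist A)"
proof -
  interpret M: Metric_space "carrier A" "cdist A" by (rule assms(1))
  show ?thesis unfolding M.mcomplete_def
  proof (intro allI impI)
    fix f assume f: "M.MCauchy f"
    then have fA: "f n \<in> carrier A" for n by (auto simp: M.MCauchy_def)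
    have "\<exists>x\<in>carrier A. (\<lambda>n. cnorm A (f n \<ominus>\<^bsub>A\<^esub> x)) \<longlonglongrightarrow> 0"
      using f fA by (intro assms(2)) (auto simp: M.MCauchy_def cdist_def)
    then obtain x where x: "x \<in> carrier A" "(\<lambda>n. cnorm A (f n \<ominus>\<^bsub>A\<^esub> x)) \<longlonglongrightarrow> 0" by blast
    then have "limitin M.mtopology f x sequentially"
      using fA by (simp add: M.limitin_metric_dist_null cdist_def)
    then show "\<exists>x. limitin M.mtopology f x sequentially" by blast
  qed
qed

text \<open>A default C*-algebra on any type, used for records that are not C*-algebras and for representations
  of the zero algebra.\<close>
definition zero_cstar :: "'a cstar" where
  "zero_cstar = \<lparr>carrier = {undefined}, mult = \<lambda>_ _. undefined, one = undefined, zero = undefined,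
     add = \<lambda>_ _. undefined, smult = \<lambda>_ _. undefined, adj = \<lambda>_. undefined, cnorm = \<lambda>_. 0\<rparr>"

lemma cstar_algebra_zero_cstar: "cstar_algebra (zero_cstar :: 'a cstar)"
proof -
  have ab: "abelian_group (zero_cstar :: 'a cstar)"
    by (rule abelian_groupI) (auto simp: zero_cstar_def)
  have M: "Metric_space (carrier (zero_cstar :: 'a cstar)) (cdist zero_cstar)"
    by standard (auto simp: zero_cstar_def cdist_def)
  have "Metric_space.mcomplete (carrier (zero_cstar :: 'a cstar)) (cdist zero_cstar)"
    by (rule mcompleteI[OF M]) (simp add: zero_cstar_def)
  then show ?thesis
    using ab by (auto simp: cstar_algebra_def cstar_algebra_axioms_def zero_cstar_def)
qed

definition cdom :: "'a cstar \<Rightarrow> 'a cstar" where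
  "cdom A = (if cstar_algebra A then A else zero_cstar)"

lemma cstar_cdom: "cstar_algebra (cdom A)"
  by (simp add: cdom_def cstar_algebra_zero_cstar)

interpretation cdom: cstar_algebra "cdom A" for A by (rule cstar_cdom)

text \<open>The bounded families indexed by all C*-algebra structures on \<open>'a\<close>: the product in which each
  structure is a direct summand.\<close>
typedef 'a prodc = "{f :: 'a cstar \<Rightarrow> 'a. (\<forall>A. f A \<in> carrier (cdom A)) \<and>
    (\<exists>c. \<forall>A. cnorm (cdom A) (f A) \<le> c)}"
  by (auto intro!: exI[of _ "\<lambda>A. \<zero>\<^bsub>cdom A\<^esub>"] exI[of _ 0])

setup_lifting type_definition_prodc

lemma cdom_cnorm_minus_le:
  assumes "x \<in> carrier (cdom A)" "y \<in> carrier (cdom A)"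
  shows "cnorm (cdom A) (x \<ominus>\<^bsub>cdom A\<^esub> y) \<le> cnorm (cdom A) x + cnorm (cdom A) y"
  using cdom.cnorm_triangle[of x A "\<ominus>\<^bsub>cdom A\<^esub> y"] assms by (simp add: cdom.minus_eq cdom.cnorm_minus)

lift_definition prodc_scale :: "complex \<Rightarrow> 'a prodc \<Rightarrow> 'a prodc" is "\<lambda>c f A. c \<odot>\<^bsub>cdom A\<^esub> f A"
proof -
  fix k and f :: "'a cstar \<Rightarrow> 'a"
  assume "(\<forall>A. f A \<in> carrier (cdom A)) \<and> (\<exists>c. \<forall>A. cnorm (cdom A) (f A) \<le> c)"
  then obtain c where f: "\<And>A. f A \<in> carrier (cdom A)" "\<And>A. cnorm (cdom A) (f A) \<le> c" by blast
  have le: "cnorm (cdom A) (k \<odot>\<^bsub>cdom A\<^esub> f A) \<le> cmod k * c" for A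
    by (simp add: cdom.cnorm_smult f mult_left_mono)
  show "(\<forall>A. k \<odot>\<^bsub>cdom A\<^esub> f A \<in> carrier (cdom A)) \<and>
      (\<exists>c. \<forall>A. cnorm (cdom A) (k \<odot>\<^bsub>cdom A\<^esub> f A) \<le> c)"
    by (intro conjI allI exI[of _ "cmod k * c"] cdom.smult_closed f(1) le)
qed

instantiation prodc :: (type) real_normed_algebra
begin

lift_definition zero_prodc :: "'a prodc" is "\<lambda>A. \<zero>\<^bsub>cdom A\<^esub>"
  by (auto intro: exI[of _ 0])

lift_definition plus_prodc :: "'a prodc \<Rightarrow> 'a prodc \<Rightarrow> 'a prodc" is "\<lambda>f g A. f A \<oplus>\<^bsub>cdom A\<^esub> g A"
proof -
  fix f g :: "'a cstar \<Rightarrow> 'a"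
  assume "(\<forall>A. f A \<in> carrier (cdom A)) \<and> (\<exists>c. \<forall>A. cnorm (cdom A) (f A) \<le> c)"
    and "(\<forall>A. g A \<in> carrier (cdom A)) \<and> (\<exists>c. \<forall>A. cnorm (cdom A) (g A) \<le> c)"
  then obtain c d where f: "\<And>A. f A \<in> carrier (cdom A)" "\<And>A. cnorm (cdom A) (f A) \<le> c"
    and g: "\<And>A. g A \<in> carrier (cdom A)" "\<And>A. cnorm (cdom A) (g A) \<le> d" by blast
  have le: "cnorm (cdom A) (f A \<oplus>\<^bsub>cdom A\<^esub> g A) \<le> c + d" for A using cdom.cnorm_triangle[OF f(1) g(1), of A] f(2)[of A] g(2)[of A] by linarith
  show "(\<forall>A. f A \<oplus>\<^bsub>cdom A\<^esub> g A \<in> carrier (cdom A)) \<and>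
      (\<exists>c. \<forall>A. cnorm (cdom A) (f A \<oplus>\<^bsub>cdom A\<^esub> g A) \<le> c)"
    by (intro conjI allI exI[of _ "c + d"] cdom.add.m_closed f(1) g(1) le)
qed

lift_definition minus_prodc :: "'a prodc \<Rightarrow> 'a prodc \<Rightarrow> 'a prodc" is "\<lambda>f g A. f A \<ominus>\<^bsub>cdom A\<^esub> g A"
proof -
  fix f g :: "'a cstar \<Rightarrow> 'a"
  assume "(\<forall>A. f A \<in> carrier (cdom A)) \<and> (\<exists>c. \<forall>A. cnorm (cdom A) (f A) \<le> c)"
    and "(\<forall>A. g A \<in> carrier (cdom A)) \<and> (\<exists>c. \<forall>A. cnorm (cdom A) (g A) \<le> c)"
  then obtain c d where f: "\<And>A. f A \<in> carrier (cdom A)" "\<And>A. cnorm (cdom A) (f A) \<le> c"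
    and g: "\<And>A. g A \<in> carrier (cdom A)" "\<And>A. cnorm (cdom A) (g A) \<le> d" by blast
  have le: "cnorm (cdom A) (f A \<ominus>\<^bsub>cdom A\<^esub> g A) \<le> c + d" for A using cdom_cnorm_minus_le[OF f(1) g(1), of A] f(2)[of A] g(2)[of A] by linarith
  show "(\<forall>A. f A \<ominus>\<^bsub>cdom A\<^esub> g A \<in> carrier (cdom A)) \<and>
      (\<exists>c. \<forall>A. cnorm (cdom A) (f A \<ominus>\<^bsub>cdom A\<^esub> g A) \<le> c)"
    by (intro conjI allI exI[of _ "c + d"] cdom.minus_closed f(1) g(1) le)
qed

lift_definition uminus_prodc :: "'a prodc \<Rightarrow> 'a prodc" is "\<lambda>f A. \<ominus>\<^bsub>cdom A\<^esub> f A"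
  by (simp add: cdom.cnorm_minus)

lift_definition times_prodc :: "'a prodc \<Rightarrow> 'a prodc \<Rightarrow> 'a prodc" is "\<lambda>f g A. f A \<otimes>\<^bsub>cdom A\<^esub> g A"
proof -
  fix f g :: "'a cstar \<Rightarrow> 'a"
  assume "(\<forall>A. f A \<in> carrier (cdom A)) \<and> (\<exists>c. \<forall>A. cnorm (cdom A) (f A) \<le> c)"
    and "(\<forall>A. g A \<in> carrier (cdom A)) \<and> (\<exists>c. \<forall>A. cnorm (cdom A) (g A) \<le> c)"
  then obtain c d where f: "\<And>A. f A \<in> carrier (cdom A)" "\<And>A. cnorm (cdom A) (f A) \<le> c"
    and g: "\<And>A. g A \<in> carrier (cdom A)" "\<And>A. cnorm (cdom A) (g A) \<le> d" by blast
  have le: "cnorm (cdom A) (f A \<otimes>\<^bsub>cdom A\<^esub> g A) \<le> c * d" for A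
  proof -
    have "0 \<le> c" using f(2)[of A] cdom.cnorm_nonneg[OF f(1), of A] by linarith
    then have "cnorm (cdom A) (f A) * cnorm (cdom A) (g A) \<le> c * d"
      by (intro mult_mono f g cdom.cnorm_nonneg)
    then show ?thesis using cdom.cnorm_mult[OF f(1) g(1), of A] by linarith
  qed
  show "(\<forall>A. f A \<otimes>\<^bsub>cdom A\<^esub> g A \<in> carrier (cdom A)) \<and>
      (\<exists>c. \<forall>A. cnorm (cdom A) (f A \<otimes>\<^bsub>cdom A\<^esub> g A) \<le> c)"
    by (intro conjI allI exI[of _ "c * d"] cdom.mult_closed f(1) g(1) le)
qed

definition scaleR_prodc :: "real \<Rightarrow> 'a prodc \<Rightarrow> 'a prodc" where
  "scaleR_prodc r x = prodc_scale (complex_of_real r) x"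

lift_definition norm_prodc :: "'a prodc \<Rightarrow> real" is "\<lambda>f. SUP A. cnorm (cdom A) (f A)" .

definition dist_prodc :: "'a prodc \<Rightarrow> 'a prodc \<Rightarrow> real" where "dist_prodc x y = norm (x - y)"
definition sgn_prodc :: "'a prodc \<Rightarrow> 'a prodc" where "sgn_prodc x = inverse (norm x) *\<^sub>R x"
definition uniformity_prodc :: "('a prodc \<times> 'a prodc) filter" where
  "uniformity_prodc = (INF e\<in>{0<..}. principal {(x, y). dist x y < e})"
definition open_prodc :: "'a prodc set \<Rightarrow> bool" where
  "open_prodc U = (\<forall>x\<in>U. eventually (\<lambda>(x', y). x' = x \<longrightarrow> y \<in> U) uniformity)"

lemma prodc_mem [simp]: "Rep_prodc x A \<in> carrier (cdom A)"
  using Rep_prodc[of x] by auto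

lemma prodc_norm_ge: "cnorm (cdom A) (Rep_prodc x A) \<le> norm x"
  unfolding norm_prodc.rep_eq using Rep_prodc[of x] by (intro cSUP_upper) (auto simp: bdd_above_def)

lemma prodc_norm_le: "(\<And>A. cnorm (cdom A) (Rep_prodc x A) \<le> c) \<Longrightarrow> norm x \<le> c"
  unfolding norm_prodc.rep_eq by (intro cSUP_least) auto

lemma prodc_eqI: "(\<And>A. Rep_prodc x A = Rep_prodc y A) \<Longrightarrow> x = y"
  by (simp add: Rep_prodc_inject[symmetric] fun_eq_iff)

lemmas prodc_rep = zero_prodc.rep_eq plus_prodc.rep_eq minus_prodc.rep_eq uminus_prodc.rep_eq
  times_prodc.rep_eq prodc_scale.rep_eq

lemma prodc_norm_nonneg: "0 \<le> norm (x :: 'a prodc)"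
  by (rule order_trans[OF cdom.cnorm_nonneg[OF prodc_mem] prodc_norm_ge])

lemma norm_prodc_scale: "norm (prodc_scale c (x :: 'a prodc)) = cmod c * norm x"
proof -
  have C3: "prodc_scale c (prodc_scale d x) = prodc_scale (c * d) x" for c d
    by (rule prodc_eqI) (simp add: prodc_rep cdom.smult_smult)
  have C4: "prodc_scale 1 x = x" by (rule prodc_eqI) (simp add: prodc_rep cdom.smult_one)
  have sc: "norm (prodc_scale c x) \<le> cmod c * norm x" for c and x :: "'a prodc"
    by (rule prodc_norm_le) (simp add: prodc_rep cdom.cnorm_smult mult_left_mono prodc_norm_ge)
  show ?thesis
  proof (cases "c = 0")
    case True then show ?thesis using sc[of 0 x] prodc_norm_nonneg[of "prodc_scale 0 x"] by simp
  next
    case False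
    have "prodc_scale 1 x = prodc_scale (inverse c) (prodc_scale c x)" using False by (simp add: C3)
    then have "norm x \<le> cmod (inverse c) * norm (prodc_scale c x)" using sc C4 by metis
    then have "cmod c * norm x \<le> norm (prodc_scale c x)" 
      using mult_left_mono[of "norm x" _ "cmod c"] False
      by (smt (verit) mult.assoc mult_cancel_right1 norm_ge_zero norm_mult norm_one right_inverse)
    then show ?thesis using sc[of c x] by simp
  qed
qed

instance
proof
  fix x y z :: "'a prodc" and r s :: real and c d :: complex
  show "x + y + z = x + (y + z)" by (rule prodc_eqI) (simp add: prodc_rep cdom.a_assoc)
  show "x + y = y + x" by (rule prodc_eqI) (simp add: prodc_rep cdom.a_comm)
  show "0 + x = x" by (rule prodc_eqI) (simp add: prodc_rep)
  show "- x + x = 0" by (rule prodc_eqI) (simp add: prodc_rep cdom.l_neg)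
  show "x - y = x + - y" by (rule prodc_eqI) (simp add: prodc_rep cdom.minus_eq)
  have C1: "prodc_scale c (x + y) = prodc_scale c x + prodc_scale c y" for c
    by (rule prodc_eqI) (simp add: prodc_rep cdom.smult_r_distr)
  have C2: "prodc_scale (c + d) x = prodc_scale c x + prodc_scale d x" for c d
    by (rule prodc_eqI) (simp add: prodc_rep cdom.smult_l_distr)
  have C3: "prodc_scale c (prodc_scale d x) = prodc_scale (c * d) x" for c d
    by (rule prodc_eqI) (simp add: prodc_rep cdom.smult_smult)
  have C4: "prodc_scale 1 x = x" by (rule prodc_eqI) (simp add: prodc_rep cdom.smult_one)
  show "r *\<^sub>R (x + y) = r *\<^sub>R x + r *\<^sub>R y" by (simp add: scaleR_prodc_def C1)
  show "(r + s) *\<^sub>R x = r *\<^sub>R x + s *\<^sub>R x" by (simp add: scaleR_prodc_def C2)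
  show "r *\<^sub>R s *\<^sub>R x = (r * s) *\<^sub>R x" by (simp add: scaleR_prodc_def C3)
  show "1 *\<^sub>R x = x" by (simp add: scaleR_prodc_def C4)
  show "x * y * z = x * (y * z)" by (rule prodc_eqI) (simp add: prodc_rep cdom.mult_assoc)
  show "(x + y) * z = x * z + y * z" by (rule prodc_eqI) (simp add: prodc_rep cdom.mult_l_distr)
  show "x * (y + z) = x * y + x * z" by (rule prodc_eqI) (simp add: prodc_rep cdom.mult_r_distr)
  have M1: "prodc_scale c x * y = prodc_scale c (x * y)" for c by (rule prodc_eqI) (simp add: prodc_rep cdom.smult_mult_l)
  have M2: "x * prodc_scale c y = prodc_scale c (x * y)" for c by (rule prodc_eqI) (simp add: prodc_rep cdom.smult_mult_r)
  show "r *\<^sub>R x * y = r *\<^sub>R (x * y)" by (simp add: scaleR_prodc_def M1)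
  show "x * r *\<^sub>R y = r *\<^sub>R (x * y)" by (simp add: scaleR_prodc_def M2)
  show "dist x y = norm (x - y)" by (rule dist_prodc_def)
  show "sgn x = inverse (norm x) *\<^sub>R x" by (rule sgn_prodc_def)
  show "(uniformity :: ('a prodc \<times> 'a prodc) filter) = (INF e\<in>{0<..}. principal {(x, y). dist x y < e})"
    by (rule uniformity_prodc_def)
  show "open U = (\<forall>x\<in>U. eventually (\<lambda>(x', y). x' = x \<longrightarrow> y \<in> U) uniformity)" for U :: "'a prodc set"
    by (rule open_prodc_def)
  show "norm x = 0 \<longleftrightarrow> x = 0"
  proof
    assume "norm x = 0"
    then have "cnorm (cdom A) (Rep_prodc x A) = 0" for A
      using prodc_norm_ge[of A x] cdom.cnorm_nonneg[OF prodc_mem[of x A]] by simp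
    then show "x = 0" by (intro prodc_eqI) (simp add: prodc_rep cdom.cnorm_eq_0)
  next
    assume "x = 0"
    then have "norm x \<le> 0" by (intro prodc_norm_le) (simp add: prodc_rep cdom.cnorm_eq_0)
    then show "norm x = 0" using prodc_norm_nonneg[of x] by simp
  qed
  show "norm (x + y) \<le> norm x + norm y"
  proof (rule prodc_norm_le)
    fix A
    show "cnorm (cdom A) (Rep_prodc (x + y) A) \<le> norm x + norm y"
      using cdom.cnorm_triangle[OF prodc_mem[of x A] prodc_mem[of y A]] prodc_norm_ge[of A x] prodc_norm_ge[of A y]
      by (simp add: prodc_rep)
  qed
  note C = norm_prodc_scale
  show "norm (r *\<^sub>R x) = \<bar>r\<bar> * norm x" by (simp add: scaleR_prodc_def C)
  show "norm (x * y) \<le> norm x * norm y"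
  proof (rule prodc_norm_le)
    fix A
    have "cnorm (cdom A) (Rep_prodc x A \<otimes>\<^bsub>cdom A\<^esub> Rep_prodc y A)
        \<le> cnorm (cdom A) (Rep_prodc x A) * cnorm (cdom A) (Rep_prodc y A)" by (rule cdom.cnorm_mult) auto
    also have "\<dots> \<le> norm x * norm y"
      by (intro mult_mono prodc_norm_ge prodc_norm_nonneg cdom.cnorm_nonneg) auto
    finally show "cnorm (cdom A) (Rep_prodc (x * y) A) \<le> norm x * norm y" by (simp add: prodc_rep)
  qed
qed

end

instance prodc :: (type) banach
proof
  fix X :: "nat \<Rightarrow> 'a prodc" assume X: "Cauchy X"
  have d: "dist x y = norm (x - y)" for x y :: "'a prodc" by (rule dist_prodc_def)
  have unif: "\<exists>N. \<forall>m\<ge>N. \<forall>n\<ge>N. norm (X m - X n) < e" if "e > 0" for e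
    using X that by (simp add: Cauchy_def d)
  have "\<exists>l. l \<in> carrier (cdom A) \<and> (\<forall>e>0. \<exists>N. \<forall>n\<ge>N. cnorm (cdom A) (Rep_prodc (X n) A \<ominus>\<^bsub>cdom A\<^esub> l) < e)" for A
  proof (rule cdom.cauchy_converges[of "\<lambda>n. Rep_prodc (X n) A" A])
    fix e :: real assume "e > 0"
    then obtain N where "\<forall>m\<ge>N. \<forall>n\<ge>N. norm (X m - X n) < e" using unif by blast
    then show "\<exists>N. \<forall>m\<ge>N. \<forall>n\<ge>N. cnorm (cdom A) (Rep_prodc (X m) A \<ominus>\<^bsub>cdom A\<^esub> Rep_prodc (X n) A) < e"
      using order.strict_trans1[OF prodc_norm_ge[of A "X _ - X _"]] by (intro exI[of _ N]) (simp add: prodc_rep)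
  qed auto
  then obtain l where l: "\<And>A. l A \<in> carrier (cdom A)"
    "\<And>A e. e > 0 \<Longrightarrow> \<exists>N. \<forall>n\<ge>N. cnorm (cdom A) (Rep_prodc (X n) A \<ominus>\<^bsub>cdom A\<^esub> l A) < e" by metis
  have unif': "\<exists>N. \<forall>n\<ge>N. \<forall>A. cnorm (cdom A) (Rep_prodc (X n) A \<ominus>\<^bsub>cdom A\<^esub> l A) \<le> e" if e: "e > 0" for e
  proof -
    obtain N where N: "\<forall>m\<ge>N. \<forall>n\<ge>N. norm (X m - X n) < e" using unif e by blast
    have "cnorm (cdom A) (Rep_prodc (X n) A \<ominus>\<^bsub>cdom A\<^esub> l A) \<le> e" if n: "n \<ge> N" for n A
    proof (rule field_le_epsilon)
      fix d :: real assume "d > 0"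
      then obtain M where M: "\<forall>n\<ge>M. cnorm (cdom A) (Rep_prodc (X n) A \<ominus>\<^bsub>cdom A\<^esub> l A) < d" using l(2) by blast
      let ?m = "max M N"
      have "cnorm (cdom A) (Rep_prodc (X n) A \<ominus>\<^bsub>cdom A\<^esub> l A)
          \<le> cnorm (cdom A) (Rep_prodc (X n) A \<ominus>\<^bsub>cdom A\<^esub> Rep_prodc (X ?m) A)
            + cnorm (cdom A) (Rep_prodc (X ?m) A \<ominus>\<^bsub>cdom A\<^esub> l A)"
        by (rule cdom.cnorm_minus_triangle) (auto simp: l)
      also have "cnorm (cdom A) (Rep_prodc (X n) A \<ominus>\<^bsub>cdom A\<^esub> Rep_prodc (X ?m) A) \<le> norm (X n - X ?m)"
        using prodc_norm_ge[of A "X n - X ?m"] by (simp add: prodc_rep)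
      also have "norm (X n - X ?m) \<le> e" using N n by (simp add: less_imp_le)
      also have "cnorm (cdom A) (Rep_prodc (X ?m) A \<ominus>\<^bsub>cdom A\<^esub> l A) \<le> d" using M by (simp add: less_imp_le)
      finally show "cnorm (cdom A) (Rep_prodc (X n) A \<ominus>\<^bsub>cdom A\<^esub> l A) \<le> e + d" by simp
    qed
    then show ?thesis by blast
  qed
  obtain N where N: "\<forall>n\<ge>N. \<forall>A. cnorm (cdom A) (Rep_prodc (X n) A \<ominus>\<^bsub>cdom A\<^esub> l A) \<le> 1"
    using unif'[of 1] by auto
  have "cnorm (cdom A) (l A) \<le> 1 + norm (X N)" for A
  proof -
    let ?x = "Rep_prodc (X N) A"
    have "l A = (l A \<ominus>\<^bsub>cdom A\<^esub> ?x) \<oplus>\<^bsub>cdom A\<^esub> ?x"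
      using l(1) by (simp add: cdom.minus_eq cdom.a_assoc cdom.l_neg)
    then have "cnorm (cdom A) (l A) \<le> cnorm (cdom A) (l A \<ominus>\<^bsub>cdom A\<^esub> ?x) + cnorm (cdom A) ?x"
      using cdom.cnorm_triangle[of "l A \<ominus>\<^bsub>cdom A\<^esub> ?x" A ?x] l(1) by simp
    also have "\<dots> \<le> 1 + norm (X N)"
      using N l(1) by (intro add_mono prodc_norm_ge) (simp add: cdom.cnorm_minus_commute)
    finally show ?thesis .
  qed
  then have L: "Rep_prodc (Abs_prodc l) = l" using l(1) by (intro Abs_prodc_inverse) blast
  have "X \<longlonglongrightarrow> Abs_prodc l"
    unfolding LIMSEQ_def
  proof (intro allI impI)
    fix e :: real assume "e > 0"
    then obtain N where N: "\<forall>n\<ge>N. \<forall>A. cnorm (cdom A) (Rep_prodc (X n) A \<ominus>\<^bsub>cdom A\<^esub> l A) \<le> e / 2"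
      using unif'[of "e / 2"] by auto
    have "norm (X n - Abs_prodc l) \<le> e / 2" if "n \<ge> N" for n
      using N that by (intro prodc_norm_le) (simp add: prodc_rep L)
    then show "\<exists>N. \<forall>n\<ge>N. dist (X n) (Abs_prodc l) < e"
      unfolding d using \<open>e > 0\<close> by (intro exI[of _ N]) (smt (verit) field_sum_of_halves)
  qed
  then show "convergent X" by (auto simp: convergent_def)
qed


lemma cdom_norm_adj: "x \<in> carrier (cdom A) \<Longrightarrow> cnorm (cdom A) (adj (cdom A) x) = cnorm (cdom A) x"
proof -
  have le: "cnorm (cdom A) x \<le> cnorm (cdom A) (adj (cdom A) x)" if x: "x \<in> carrier (cdom A)" for x
  proof (cases "cnorm (cdom A) x = 0")
    case False
    then have "cnorm (cdom A) x > 0" using cdom.cnorm_nonneg[OF x] by simp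
    moreover have "cnorm (cdom A) x * cnorm (cdom A) x \<le> cnorm (cdom A) (adj (cdom A) x) * cnorm (cdom A) x"
      using cdom.cstar_identity[OF x] cdom.cnorm_mult[OF cdom.adj_closed[OF x] x] by (simp add: power2_eq_square)
    ultimately show ?thesis by simp
  qed (use x in \<open>simp add: cdom.cnorm_nonneg cdom.adj_closed\<close>)
  assume "x \<in> carrier (cdom A)"
  then show ?thesis using le[of x] le[of "adj (cdom A) x"] by (simp add: cdom.adj_adj cdom.adj_closed)
qed

instantiation prodc :: (type) nc_star
begin

definition scaleC_prodc :: "complex \<Rightarrow> 'a prodc \<Rightarrow> 'a prodc" where "scaleC_prodc = prodc_scale"

lift_definition star_prodc :: "'a prodc \<Rightarrow> 'a prodc" is "\<lambda>f A. adj (cdom A) (f A)"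
  by (simp add: cdom.adj_closed cdom_norm_adj)

lemmas prodc_star_rep = prodc_rep star_prodc.rep_eq

instance
proof
  fix x y z :: "'a prodc" and r :: real and c d :: complex
  show "c *\<^sub>C (x + y) = c *\<^sub>C x + c *\<^sub>C y" 
    by (rule prodc_eqI) (simp add: prodc_rep scaleC_prodc_def cdom.smult_r_distr)
  show "(c + d) *\<^sub>C x = c *\<^sub>C x + d *\<^sub>C x" 
    by (rule prodc_eqI) (simp add: prodc_rep scaleC_prodc_def cdom.smult_l_distr)
  show "c *\<^sub>C d *\<^sub>C x = (c * d) *\<^sub>C x" 
    by (rule prodc_eqI) (simp add: prodc_rep scaleC_prodc_def cdom.smult_smult)
  show "complex_of_real r *\<^sub>C x = r *\<^sub>R x" by (simp add: scaleR_prodc_def scaleC_prodc_def)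
  show "c *\<^sub>C x * y = c *\<^sub>C (x * y)" by (rule prodc_eqI) (simp add: prodc_rep scaleC_prodc_def cdom.smult_mult_l)
  show "x * c *\<^sub>C y = c *\<^sub>C (x * y)" by (rule prodc_eqI) (simp add: prodc_rep scaleC_prodc_def cdom.smult_mult_r)
  show "norm (c *\<^sub>C x) = cmod c * norm x" by (simp add: scaleC_prodc_def norm_prodc_scale)
  show "star (star x) = x" by (rule prodc_eqI) (simp add: prodc_star_rep scaleC_prodc_def cdom.adj_adj)
  show "star (x + y) = star x + star y" by (rule prodc_eqI) (simp add: prodc_star_rep scaleC_prodc_def cdom.adj_add)
  show "star (c *\<^sub>C x) = cnj c *\<^sub>C star x" by (rule prodc_eqI) (simp add: prodc_star_rep scaleC_prodc_def cdom.adj_smult)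
  show "star (x * y) = star y * star x" by (rule prodc_eqI) (simp add: prodc_star_rep scaleC_prodc_def cdom.adj_mult)
  show "norm (star x * x) = (norm x)\<^sup>2"
  proof (rule antisym)
    show "norm (star x * x) \<le> (norm x)\<^sup>2"
      by (rule prodc_norm_le) (simp add: prodc_star_rep scaleC_prodc_def cdom.cstar_identity power_mono prodc_norm_ge cdom.cnorm_nonneg)
    have "norm x \<le> sqrt (norm (star x * x))"
    proof (rule prodc_norm_le)
      fix A
      have "(cnorm (cdom A) (Rep_prodc x A))\<^sup>2 \<le> norm (star x * x)"
        using prodc_norm_ge[of A "star x * x"] by (simp add: prodc_star_rep scaleC_prodc_def cdom.cstar_identity)
      then show "cnorm (cdom A) (Rep_prodc x A) \<le> sqrt (norm (star x * x))" by (rule real_le_rsqrt)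
    qed
    then show "(norm x)\<^sup>2 \<le> norm (star x * x)"
      using prodc_norm_nonneg[of x] prodc_norm_nonneg[of "star x * x"]
      by (metis power_mono real_sqrt_pow2)
  qed
qed

end

section \<open>Unitization\<close>

datatype 'b unitz = Unitz (nonunital_part: 'b) (scalar_part: complex)

text \<open>The unitization of an algebra acts on the algebra by left multiplication. Its norm is the maximum of
  the operator norm of this action and the modulus of the scalar part, which is a C*-norm also when
  the algebra already has a unit.\<close>
definition uact :: "'b::nc_star unitz \<Rightarrow> 'b \<Rightarrow> 'b" where
  "uact x y = nonunital_part x * y + scalar_part x *\<^sub>C y"

lemma bounded_linear_uact: "bounded_linear (uact x)"
  unfolding uact_def
  by (intro bounded_linear_add bounded_linear_mult_right bounded_linear_scaleC)

definition unitz_scale :: "complex \<Rightarrow> 'a::nc_star unitz \<Rightarrow> 'a unitz" where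
  "unitz_scale c x = Unitz (c *\<^sub>C nonunital_part x) (c * scalar_part x)"

definition unitz_star :: "'a::nc_star unitz \<Rightarrow> 'a unitz" where
  "unitz_star x = Unitz (star (nonunital_part x)) (cnj (scalar_part x))"

instantiation unitz :: (nc_star) real_normed_algebra_1
begin

definition "0 = Unitz 0 0"
definition "1 = Unitz 0 1"
definition "x + y = Unitz (nonunital_part x + nonunital_part y) (scalar_part x + scalar_part y)"
definition "x - y = Unitz (nonunital_part x - nonunital_part y) (scalar_part x - scalar_part y)"
definition "- x = Unitz (- nonunital_part x) (- scalar_part x)"
definition "x * y = Unitz (nonunital_part x * nonunital_part y + scalar_part x *\<^sub>C nonunital_part y
   + scalar_part y *\<^sub>C nonunital_part x) (scalar_part x * scalar_part y)"
definition "r *\<^sub>R x = unitz_scale (complex_of_real r) x"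
definition "norm x = max (cmod (scalar_part x)) (onorm (uact x))"
definition "dist x y = norm (x - y :: 'a unitz)"
definition "sgn x = inverse (norm x) *\<^sub>R (x :: 'a unitz)"
definition uniformity_unitz :: "('a unitz \<times> 'a unitz) filter" where
  "uniformity_unitz = (INF e\<in>{0<..}. principal {(x, y). dist x y < e})"
definition open_unitz :: "'a unitz set \<Rightarrow> bool" where
  "open_unitz U = (\<forall>x\<in>U. eventually (\<lambda>(x', y). x' = x \<longrightarrow> y \<in> U) uniformity)"

lemmas unitz_defs = zero_unitz_def one_unitz_def plus_unitz_def minus_unitz_def uminus_unitz_def
  times_unitz_def scaleR_unitz_def unitz_scale_def unitz_star_def

lemma norm_uact_le: "norm (uact x y) \<le> norm x * norm y"
proof -
  have "norm (uact x y) \<le> onorm (uact x) * norm y" by (rule onorm[OF bounded_linear_uact])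
  also have "\<dots> \<le> norm x * norm y" by (intro mult_right_mono) (auto simp: norm_unitz_def)
  finally show ?thesis .
qed

lemma cmod_scalar_part_le: "cmod (scalar_part x) \<le> norm x"
  by (simp add: norm_unitz_def)

lemma unitz_norm_le:
  assumes "cmod (scalar_part x) \<le> c" "\<And>y. norm (uact x y) \<le> c * norm y" "0 \<le> c"
  shows "norm x \<le> c"
  using assms onorm_bound[of c "uact x"] by (simp add: norm_unitz_def)

lemma unitz_norm_nonneg: "0 \<le> norm (x :: 'a unitz)"
  by (rule order_trans[OF norm_ge_zero cmod_scalar_part_le])

lemma uact_simps: "uact (x + y) z = uact x z + uact y z" "uact (x * y) z = uact x (uact y z)"
  "uact (unitz_scale c x) z = c *\<^sub>C uact x z" "uact 0 z = 0" "uact 1 z = z"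
  by (simp_all add: uact_def unitz_defs scaleC_add_left scaleC_add_right scaleC_scaleC
      scaleC_mult_left scaleC_mult_right distrib_left distrib_right mult.assoc scaleR_add_right
      flip: scaleC_of_real)

lemma star_uact_mult: "star (uact x y) * z = star y * uact (unitz_star x) z"
  by (simp add: uact_def unitz_defs star_add star_mult star_scaleC distrib_left distrib_right
      scaleC_mult_left scaleC_mult_right mult.assoc)

lemma norm_unitz_scale: "norm (unitz_scale c (x :: 'a unitz)) = cmod c * norm x"
proof -
  have sc: "norm (unitz_scale c x) \<le> cmod c * norm x" for c and x :: "'a unitz"
  proof (rule unitz_norm_le)
    show "cmod (scalar_part (unitz_scale c x)) \<le> cmod c * norm x"
      using cmod_scalar_part_le[of x] by (simp add: unitz_defs norm_mult mult_left_mono)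
    show "norm (uact (unitz_scale c x) z) \<le> (cmod c * norm x) * norm z" for z
      using norm_uact_le[of x z] by (simp add: uact_simps norm_scaleC mult_left_mono mult.assoc)
  qed (use unitz_norm_nonneg[of x] in auto)
  show ?thesis
  proof (cases "c = 0")
    case True then show ?thesis using sc[of 0 x] unitz_norm_nonneg[of "unitz_scale 0 x"] by simp
  next
    case False
    have "x = unitz_scale (inverse c) (unitz_scale c x)" using False by (cases x) (simp add: unitz_defs scaleC_scaleC)
    then have "norm x \<le> cmod (inverse c) * norm (unitz_scale c x)" using sc by metis
    then have "cmod c * norm x \<le> norm (unitz_scale c x)" 
      using mult_left_mono[of "norm x" _ "cmod c"] False
      by (smt (verit) mult.assoc mult_cancel_right1 norm_ge_zero norm_mult norm_one right_inverse)
    then show ?thesis using sc[of c x] by simp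
  qed
qed

instance
proof
  fix x y z :: "'a unitz" and r s :: real and c d :: complex
  show "x + y + z = x + (y + z)" "x + y = y + x" "0 + x = x" "- x + x = 0" "x - y = x + - y"
    by (simp_all add: unitz_defs)
  show "r *\<^sub>R (x + y) = r *\<^sub>R x + r *\<^sub>R y" "(r + s) *\<^sub>R x = r *\<^sub>R x + s *\<^sub>R x"
    "r *\<^sub>R s *\<^sub>R x = (r * s) *\<^sub>R x" "1 *\<^sub>R x = x"
    by (simp_all add: unitz_defs scaleC_add_right scaleC_add_left scaleC_scaleC algebra_simps)
  show "x * y * z = x * (y * z)" "(x + y) * z = x * z + y * z" "x * (y + z) = x * y + x * z"
    by (simp_all add: unitz_defs scaleC_add_right scaleC_add_left scaleC_scaleC scaleC_mult_left
        scaleC_mult_right algebra_simps)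
  show "r *\<^sub>R x * y = r *\<^sub>R (x * y)" "x * r *\<^sub>R y = r *\<^sub>R (x * y)"
    by (simp_all add: unitz_defs scaleC_add_right scaleC_scaleC scaleC_mult_left scaleC_mult_right mult_ac)
  show "1 * x = x" "x * 1 = x" by (simp_all add: unitz_defs)
  show "(0 :: 'a unitz) \<noteq> 1" by (simp add: unitz_defs)
  show "dist x y = norm (x - y)" by (rule dist_unitz_def)
  show "sgn x = inverse (norm x) *\<^sub>R x" by (rule sgn_unitz_def)
  show "(uniformity :: ('a unitz \<times> 'a unitz) filter) = (INF e\<in>{0<..}. principal {(x, y). dist x y < e})"
    by (rule uniformity_unitz_def)
  show "open U = (\<forall>x\<in>U. eventually (\<lambda>(x', y). x' = x \<longrightarrow> y \<in> U) uniformity)" for U :: "'a unitz set"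
    by (rule open_unitz_def)
  show "norm x = 0 \<longleftrightarrow> x = 0"
  proof
    assume n: "norm x = 0"
    have c: "scalar_part x = 0" using cmod_scalar_part_le[of x] n by simp
    have "nonunital_part x * star (nonunital_part x) = 0"
      using norm_uact_le[of x "star (nonunital_part x)"] n c by (simp add: uact_def)
    then have "nonunital_part x = 0" using star_mult_eq_0[of "star (nonunital_part x)"]
      by (metis star_star star_zero)
    then show "x = 0" using c by (cases x) (simp add: unitz_defs)
  next
    assume "x = 0"
    then have "norm x \<le> 0" by (intro unitz_norm_le) (simp_all add: uact_simps, simp add: unitz_defs)
    then show "norm x = 0" using unitz_norm_nonneg[of x] by simp
  qed
  show "norm (x + y) \<le> norm x + norm y"
  proof (rule unitz_norm_le)
    show "cmod (scalar_part (x + y)) \<le> norm x + norm y"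
      using norm_triangle_mono[OF cmod_scalar_part_le cmod_scalar_part_le, of x y] by (simp add: unitz_defs)
    show "norm (uact (x + y) z) \<le> (norm x + norm y) * norm z" for z
      using norm_triangle_mono[OF norm_uact_le norm_uact_le, of x z y z] by (simp add: uact_simps distrib_right)
  qed (use unitz_norm_nonneg in auto)
  note C = norm_unitz_scale
  show "norm (r *\<^sub>R x) = \<bar>r\<bar> * norm x"
    using C[of "of_real r"] by (simp add: scaleR_unitz_def)
  show "norm (x * y) \<le> norm x * norm y"
  proof (rule unitz_norm_le)
    show "cmod (scalar_part (x * y)) \<le> norm x * norm y"
      using mult_mono[OF cmod_scalar_part_le[of x] cmod_scalar_part_le[of y]] unitz_norm_nonneg[of x]
      by (simp add: unitz_defs norm_mult)
    fix z
    have "norm (uact x (uact y z)) \<le> norm x * norm (uact y z)" by (rule norm_uact_le)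
    also have "\<dots> \<le> norm x * (norm y * norm z)" by (intro mult_left_mono norm_uact_le unitz_norm_nonneg)
    finally show "norm (uact (x * y) z) \<le> (norm x * norm y) * norm z" by (simp add: uact_simps mult.assoc)
  qed (simp add: unitz_norm_nonneg)
  show "norm (1 :: 'a unitz) = 1"
  proof (rule antisym)
    show "norm (1 :: 'a unitz) \<le> 1" by (rule unitz_norm_le) (simp_all add: uact_simps, simp add: unitz_defs)
    show "1 \<le> norm (1 :: 'a unitz)" using cmod_scalar_part_le[of 1] by (simp add: unitz_defs)
  qed
qed

end

instance unitz :: (nc_star) banach
proof
  fix X :: "nat \<Rightarrow> 'a unitz" assume X: "Cauchy X"
  have d: "dist x y = norm (x - y)" for x y :: "'a unitz" by (rule dist_unitz_def)
  have lower: "norm (nonunital_part x) \<le> 2 * norm x" for x :: "'a unitz"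
  proof (cases "nonunital_part x = 0")
    case False
    define a where "a = nonunital_part x"
    have "norm a * norm a = norm (a * star a)" by (simp add: norm_mult_star power2_eq_square)
    also have "a * star a = uact x (star a) - scalar_part x *\<^sub>C star a" by (simp add: uact_def a_def)
    also have "norm \<dots> \<le> norm x * norm (star a) + cmod (scalar_part x) * norm (star a)"
      using norm_triangle_ineq4[of "uact x (star a)" "scalar_part x *\<^sub>C star a"] norm_uact_le[of x "star a"]
      by (simp add: norm_scaleC)
    also have "\<dots> \<le> norm x * norm a + norm x * norm a"
      using mult_right_mono[OF cmod_scalar_part_le[of x], of "norm a"] by (simp add: mult.commute)
    finally have "norm a * norm a \<le> (2 * norm x) * norm a" by (simp add: mult_ac)
    then show ?thesis using False unfolding a_def by simp
  qed (simp add: unitz_norm_nonneg)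
  have upper: "norm x \<le> norm (nonunital_part x) + cmod (scalar_part x)" for x :: "'a unitz"
  proof (rule unitz_norm_le)
    show "norm (uact x z) \<le> (norm (nonunital_part x) + cmod (scalar_part x)) * norm z" for z
      unfolding uact_def distrib_right
      by (rule norm_triangle_mono) (simp_all add: norm_mult_ineq norm_scaleC)
  qed auto
  have "Cauchy (\<lambda>n. nonunital_part (X n))"
  proof (rule metric_CauchyI)
    fix e :: real assume "e > 0"
    then obtain M where M: "\<forall>m\<ge>M. \<forall>n\<ge>M. norm (X m - X n) < e / 2"
      using X half_gt_zero[of e] unfolding Cauchy_def d by blast
    have "dist (nonunital_part (X m)) (nonunital_part (X n)) < e" if "m \<ge> M" "n \<ge> M" for m n
      using M that lower[of "X m - X n"] by (force simp: unitz_defs dist_norm)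
    then show "\<exists>M. \<forall>m\<ge>M. \<forall>n\<ge>M. dist (nonunital_part (X m)) (nonunital_part (X n)) < e" by blast
  qed
  moreover have "Cauchy (\<lambda>n. scalar_part (X n))"
  proof (rule metric_CauchyI)
    fix e :: real assume "e > 0"
    then obtain M where M: "\<forall>m\<ge>M. \<forall>n\<ge>M. norm (X m - X n) < e"
      using X unfolding Cauchy_def d by blast
    have "dist (scalar_part (X m)) (scalar_part (X n)) < e" if "m \<ge> M" "n \<ge> M" for m n
      using M that cmod_scalar_part_le[of "X m - X n"] by (force simp: unitz_defs dist_norm)
    then show "\<exists>M. \<forall>m\<ge>M. \<forall>n\<ge>M. dist (scalar_part (X m)) (scalar_part (X n)) < e" by blast
  qed
  ultimately obtain a c where ac: "(\<lambda>n. nonunital_part (X n)) \<longlonglongrightarrow> a" "(\<lambda>n. scalar_part (X n)) \<longlonglongrightarrow> c"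
    by (metis Cauchy_convergent convergent_def)
  have "(\<lambda>n. norm (nonunital_part (X n) - a) + cmod (scalar_part (X n) - c)) \<longlonglongrightarrow> norm (a - a) + cmod (c - c)"
    by (intro tendsto_intros ac)
  then have l: "(\<lambda>n. norm (nonunital_part (X n) - a) + cmod (scalar_part (X n) - c)) \<longlonglongrightarrow> 0" by simp
  have "X \<longlonglongrightarrow> Unitz a c"
    unfolding LIMSEQ_def
  proof (intro allI impI)
    fix e :: real assume "e > 0"
    then obtain N where N: "\<forall>n\<ge>N. norm (norm (nonunital_part (X n) - a) + cmod (scalar_part (X n) - c) - 0) < e"
      using LIMSEQ_D[OF l] by blast
    have "norm (X n - Unitz a c) < e" if "n \<ge> N" for n
      using N that upper[of "X n - Unitz a c"] by (force simp: unitz_defs)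
    then show "\<exists>N. \<forall>n\<ge>N. dist (X n) (Unitz a c) < e" unfolding d by blast
  qed
  then show "convergent X" by (auto simp: convergent_def)
qed


instantiation unitz :: (nc_star) uc_star
begin

definition "c *\<^sub>C x = unitz_scale c x"
definition "star x = unitz_star x"

lemmas unitz_star_defs = unitz_defs scaleC_unitz_def star_unitz_def

instance
proof
  fix x y z :: "'a unitz" and r s :: real and c d :: complex
  show "c *\<^sub>C (x + y) = c *\<^sub>C x + c *\<^sub>C y" "(c + d) *\<^sub>C x = c *\<^sub>C x + d *\<^sub>C x"
    "c *\<^sub>C d *\<^sub>C x = (c * d) *\<^sub>C x" "complex_of_real r *\<^sub>C x = r *\<^sub>R x"
    by (simp_all add: unitz_star_defs scaleC_add_right scaleC_add_left scaleC_scaleC scaleC_of_real algebra_simps)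
  show "c *\<^sub>C x * y = c *\<^sub>C (x * y)" "x * c *\<^sub>C y = c *\<^sub>C (x * y)"
    by (simp_all add: unitz_star_defs scaleC_add_right scaleC_scaleC scaleC_mult_left scaleC_mult_right mult_ac)
  show "star (star x) = x" "star (x + y) = star x + star y" "star (c *\<^sub>C x) = cnj c *\<^sub>C star x"
    "star (x * y) = star y * star x"
    by (simp_all add: unitz_star_defs star_star star_add star_scaleC star_mult algebra_simps)
  have ge: "(norm x)\<^sup>2 \<le> norm (star x * x)" for x :: "'a unitz"
  proof -
    have "norm x \<le> sqrt (norm (star x * x))"
    proof (rule unitz_norm_le)
      have "(cmod (scalar_part x))\<^sup>2 \<le> norm (star x * x)"
        using cmod_scalar_part_le[of "star x * x"] by (simp add: unitz_star_defs norm_mult power2_eq_square)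
      then show "cmod (scalar_part x) \<le> sqrt (norm (star x * x))" by (rule real_le_rsqrt)
      show "norm (uact x z) \<le> sqrt (norm (star x * x)) * norm z" for z
      proof -
        have "(norm (uact x z))\<^sup>2 = norm (star z * uact (star x * x) z)"
          by (simp add: star_uact_mult star_unitz_def uact_simps flip: norm_star_mult)
        also have "\<dots> \<le> norm z * (norm (star x * x) * norm z)"
          using norm_mult_ineq[of "star z" "uact (star x * x) z"] norm_uact_le[of "star x * x" z]
          by (smt (verit) mult_left_mono norm_ge_zero norm_star)
        finally have "(norm (uact x z))\<^sup>2 \<le> norm (star x * x) * (norm z)\<^sup>2" by (simp add: power2_eq_square mult_ac)
        then have "norm (uact x z) \<le> sqrt (norm (star x * x) * (norm z)\<^sup>2)" by (rule real_le_rsqrt)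
        then show ?thesis by (simp add: real_sqrt_mult)
      qed
    qed (simp add: unitz_norm_nonneg)
    then have "(norm x)\<^sup>2 \<le> (sqrt (norm (star x * x)))\<^sup>2" by (intro power_mono unitz_norm_nonneg)
    then show ?thesis by (simp add: unitz_norm_nonneg)
  qed
  have ns: "norm x \<le> norm (star x)" for x :: "'a unitz"
  proof (cases "norm x = 0")
    case False
    then have "norm x > 0" using norm_ge_zero[of x] by simp
    moreover have "norm x * norm x \<le> norm (star x) * norm x"
      using ge[of x] norm_mult_ineq[of "star x" x] by (simp add: power2_eq_square)
    ultimately show ?thesis by simp
  qed (simp add: unitz_norm_nonneg)
  have "norm (star x) \<le> norm x" using ns[of "star x"] by (simp add: unitz_star_defs star_star)
  then show "norm (star x * x) = (norm x)\<^sup>2"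
    using ge[of x] norm_mult_ineq[of "star x" x] mult_right_mono[of "norm (star x)" "norm x" "norm x"] norm_ge_zero[of x]
    by (simp add: power2_eq_square)
  show "norm (c *\<^sub>C x) = cmod c * norm x" by (simp add: scaleC_unitz_def norm_unitz_scale)
qed

end

lemma norm_Unitz_0: "norm (Unitz a 0) = norm (a :: 'b::nc_star)"
proof (rule antisym)
  show "norm (Unitz a 0) \<le> norm a"
    by (rule unitz_norm_le) (simp_all add: uact_def norm_mult_ineq)
  have "norm a * norm a = norm (uact (Unitz a 0) (star a))"
    by (simp add: uact_def norm_mult_star power2_eq_square)
  also have "\<dots> \<le> norm (Unitz a 0) * norm a" using norm_uact_le[of "Unitz a 0" "star a"] by simp
  finally show "norm a \<le> norm (Unitz a 0)" by (cases "a = 0") auto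
qed

section \<open>Embedding structures into a type\<close>

type_synonym 'a uni = "'a prodc unitz"

text \<open>The summand of the structure \<open>A\<close> inside the product, viewed in the unitization.\<close>
definition emb :: "'a cstar \<Rightarrow> 'a \<Rightarrow> 'a uni" where
  "emb A x = Unitz (Abs_prodc (\<lambda>B. if B = A then x else \<zero>\<^bsub>cdom B\<^esub>)) 0"

context cstar_algebra
begin

lemma smult_zero: "c \<odot> \<zero> = \<zero>"
  using cnorm_smult[of \<zero> c] cnorm_eq_0[OF smult_closed[of \<zero> c]] by simp

lemma mult_zero: "\<zero> \<otimes> \<zero> = \<zero>"
  using cnorm_mult[of \<zero> \<zero>] cnorm_nonneg[OF mult_closed[of \<zero> \<zero>]]
    cnorm_eq_0[OF mult_closed[of \<zero> \<zero>]] by simp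

lemma adj_zero: "adj A \<zero> = \<zero>"
  using adj_smult[of \<zero> 0] smult_zero_left[of \<zero>] smult_zero_left[of "adj A \<zero>"] adj_closed[of \<zero>] by simp

end

lemma Rep_prodc_emb:
  assumes A: "cstar_algebra A" and x: "x \<in> carrier A"
  shows "Rep_prodc (nonunital_part (emb A x)) B = (if B = A then x else \<zero>\<^bsub>cdom B\<^esub>)"
proof -
  have d: "cdom A = A" using A by (simp add: cdom_def)
  have "(\<forall>B. (if B = A then x else \<zero>\<^bsub>cdom B\<^esub>) \<in> carrier (cdom B)) \<and>
    (\<exists>c. \<forall>B. cnorm (cdom B) (if B = A then x else \<zero>\<^bsub>cdom B\<^esub>) \<le> c)"
    using x d cstar_algebra.cnorm_nonneg[OF A x] by (auto intro!: exI[of _ "cnorm A x"])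
  then show ?thesis by (simp add: emb_def Abs_prodc_inverse)
qed

context
  fixes A :: "'a cstar"
  assumes A: "cstar_algebra A"
begin

interpretation A: cstar_algebra A by (rule A)

lemma cdom_self: "cdom A = A" using A by (simp add: cdom_def)

lemma emb_eqI:
  assumes "scalar_part y = 0" "Rep_prodc (nonunital_part y) A = x" "x \<in> carrier A"
    "\<And>B. B \<noteq> A \<Longrightarrow> Rep_prodc (nonunital_part y) B = \<zero>\<^bsub>cdom B\<^esub>"
  shows "y = emb A x"
proof -
  have "nonunital_part y = nonunital_part (emb A x)"
    using assms by (intro prodc_eqI) (simp add: Rep_prodc_emb[OF A])
  then show ?thesis using assms(1) by (cases y) (simp add: emb_def)
qed

lemma scalar_part_emb [simp]: "scalar_part (emb A x) = 0" by (simp add: emb_def)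

lemma norm_emb: assumes x: "x \<in> carrier A" shows "norm (emb A x) = cnorm A x"
proof -
  have n: "norm (emb A x) = norm (nonunital_part (emb A x))"
    by (simp add: emb_def norm_Unitz_0)
  show ?thesis unfolding n
  proof (rule antisym)
    show "norm (nonunital_part (emb A x)) \<le> cnorm A x"
      by (rule prodc_norm_le) (simp add: Rep_prodc_emb[OF A x] cdom_self A.cnorm_nonneg x)
    show "cnorm A x \<le> norm (nonunital_part (emb A x))"
      using prodc_norm_ge[of A "nonunital_part (emb A x)"] by (simp add: Rep_prodc_emb[OF A x] cdom_self)
  qed
qed

lemma emb_add: "x \<in> carrier A \<Longrightarrow> y \<in> carrier A \<Longrightarrow> emb A (x \<oplus>\<^bsub>A\<^esub> y) = emb A x + emb A y"
  by (rule sym, rule emb_eqI) (simp_all add: unitz_star_defs prodc_star_rep Rep_prodc_emb[OF A] cdom_self)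

lemma emb_mult: "x \<in> carrier A \<Longrightarrow> y \<in> carrier A \<Longrightarrow> emb A (x \<otimes>\<^bsub>A\<^esub> y) = emb A x * emb A y"
  by (rule sym, rule emb_eqI)
    (simp_all add: unitz_star_defs prodc_star_rep Rep_prodc_emb[OF A] cdom_self A.mult_closed cdom.mult_zero)

lemma emb_star: "x \<in> carrier A \<Longrightarrow> emb A (adj A x) = star (emb A x)"
  by (rule sym, rule emb_eqI)
    (simp_all add: unitz_star_defs prodc_star_rep Rep_prodc_emb[OF A] cdom_self A.adj_closed cdom.adj_zero)

lemma emb_scaleC: "x \<in> carrier A \<Longrightarrow> emb A (c \<odot>\<^bsub>A\<^esub> x) = c *\<^sub>C emb A x"
  by (rule sym, rule emb_eqI)
    (simp_all add: unitz_star_defs prodc_star_rep scaleC_prodc_def Rep_prodc_emb[OF A] cdom_self A.smult_closed cdom.smult_zero)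

end

lemma inj_on_emb: "cstar_algebra A \<Longrightarrow> inj_on (emb A) (carrier A)"
  by (rule inj_onI) (metis Rep_prodc_emb)

lemma LIMSEQ_norm_iff: "X \<longlonglongrightarrow> (l::'a::real_normed_vector) \<longleftrightarrow> (\<forall>e>0. \<exists>N. \<forall>n\<ge>N. norm (X n - l) < e)"
  by (simp add: LIMSEQ_def dist_norm)

text \<open>Identifies a structure with a closed subalgebra of a type. The C*-axioms of the structure are then
  pulled back along the embedding (\<open>star_embedding_cstar_algebra\<close>).\<close>
definition star_embedding :: "'a cstar \<Rightarrow> ('a \<Rightarrow> 'b::nc_star) \<Rightarrow> bool" where
  "star_embedding A f \<longleftrightarrow> inj_on f (carrier A) \<and> csub (f ` carrier A) \<and>
    \<zero>\<^bsub>A\<^esub> \<in> carrier A \<and> f \<zero>\<^bsub>A\<^esub> = 0 \<and>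
    (\<forall>x\<in>carrier A. \<forall>y\<in>carrier A. x \<oplus>\<^bsub>A\<^esub> y \<in> carrier A \<and> x \<otimes>\<^bsub>A\<^esub> y \<in> carrier A \<and>
       f (x \<oplus>\<^bsub>A\<^esub> y) = f x + f y \<and> f (x \<otimes>\<^bsub>A\<^esub> y) = f x * f y) \<and>
    (\<forall>x\<in>carrier A. adj A x \<in> carrier A \<and> (\<forall>c. c \<odot>\<^bsub>A\<^esub> x \<in> carrier A) \<and>
       f (adj A x) = star (f x) \<and> (\<forall>c. f (c \<odot>\<^bsub>A\<^esub> x) = c *\<^sub>C f x) \<and> cnorm A x = norm (f x))"

lemma star_embeddingD:
  assumes "star_embedding A f"
  shows "inj_on f (carrier A)" "csub (f ` carrier A)" "\<zero>\<^bsub>A\<^esub> \<in> carrier A" "f \<zero>\<^bsub>A\<^esub> = 0"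
    "\<And>x y. x \<in> carrier A \<Longrightarrow> y \<in> carrier A \<Longrightarrow> x \<oplus>\<^bsub>A\<^esub> y \<in> carrier A"
    "\<And>x y. x \<in> carrier A \<Longrightarrow> y \<in> carrier A \<Longrightarrow> x \<otimes>\<^bsub>A\<^esub> y \<in> carrier A"
    "\<And>x y. x \<in> carrier A \<Longrightarrow> y \<in> carrier A \<Longrightarrow> f (x \<oplus>\<^bsub>A\<^esub> y) = f x + f y"
    "\<And>x y. x \<in> carrier A \<Longrightarrow> y \<in> carrier A \<Longrightarrow> f (x \<otimes>\<^bsub>A\<^esub> y) = f x * f y"
    "\<And>x. x \<in> carrier A \<Longrightarrow> adj A x \<in> carrier A" "\<And>x c. x \<in> carrier A \<Longrightarrow> c \<odot>\<^bsub>A\<^esub> x \<in> carrier A"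
    "\<And>x. x \<in> carrier A \<Longrightarrow> f (adj A x) = star (f x)" "\<And>x c. x \<in> carrier A \<Longrightarrow> f (c \<odot>\<^bsub>A\<^esub> x) = c *\<^sub>C f x"
    "\<And>x. x \<in> carrier A \<Longrightarrow> cnorm A x = norm (f x)"
  using assms by (simp_all add: star_embedding_def)

lemma emb_zero: assumes A: "cstar_algebra A" shows "emb A \<zero>\<^bsub>A\<^esub> = 0"
proof -
  interpret A: cstar_algebra A by (rule A)
  show ?thesis using norm_emb[OF A, of "\<zero>\<^bsub>A\<^esub>"] by simp
qed

lemma star_embedding_emb:
  assumes A: "cstar_algebra A" shows "star_embedding A (emb A)"
proof -
  interpret A: cstar_algebra A by (rule A)
  let ?S = "emb A ` carrier A"
  note e = emb_add[OF A] emb_mult[OF A] emb_star[OF A] emb_scaleC[OF A]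
  have em: "emb A (\<ominus>\<^bsub>A\<^esub> x) = - emb A x" if "x \<in> carrier A" for x
    using e(4)[OF that, of "-1"] A.smult_minus_one[OF that] by (simp add: scaleC_minus_one)
  have ed: "emb A (x \<ominus>\<^bsub>A\<^esub> y) = emb A x - emb A y" if "x \<in> carrier A" "y \<in> carrier A" for x y
    using that by (simp add: A.minus_eq e(1) em)
  have nd: "cnorm A (x \<ominus>\<^bsub>A\<^esub> y) = norm (emb A x - emb A y)" if "x \<in> carrier A" "y \<in> carrier A" for x y
    using that norm_emb[OF A, of "x \<ominus>\<^bsub>A\<^esub> y"] by (simp add: ed)
  have cl: "closed ?S"
  proof (subst closed_sequential_limits, intro allI impI, elim conjE)
    fix y l assume y: "\<forall>n. y n \<in> ?S" and l: "y \<longlonglongrightarrow> l"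
    obtain x where x: "\<And>n. x n \<in> carrier A" "\<And>n. y n = emb A (x n)"
      using y unfolding image_iff Bex_def by metis
    have "Cauchy y" using l LIMSEQ_imp_Cauchy by blast
    have C: "\<exists>N. \<forall>m\<ge>N. \<forall>n\<ge>N. cnorm A (x m \<ominus>\<^bsub>A\<^esub> x n) < e" if "e > 0" for e
      using \<open>Cauchy y\<close> that unfolding Cauchy_def dist_norm x(2) by (simp add: nd x(1))
    obtain k where k: "k \<in> carrier A" "\<And>e. e > 0 \<Longrightarrow> \<exists>N. \<forall>n\<ge>N. cnorm A (x n \<ominus>\<^bsub>A\<^esub> k) < e"
      using A.cauchy_converges[OF x(1) C] by metis
    have "y \<longlonglongrightarrow> emb A k" unfolding LIMSEQ_norm_iff x(2) using k nd x(1) by simp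
    then show "l \<in> ?S" using LIMSEQ_unique[OF l] k(1) by blast
  qed
  have "csub ?S"
    unfolding csub_def
  proof (intro conjI ballI allI cl)
    show "0 \<in> ?S" using emb_zero[OF A] A.zero_closed by (metis imageI)
    fix x assume x: "x \<in> ?S"
    show "star x \<in> ?S" using x by (auto simp flip: e(3) intro: A.adj_closed)
    show "c *\<^sub>C x \<in> ?S" for c using x by (auto simp flip: e(4) intro: A.smult_closed)
    fix y assume y: "y \<in> ?S"
    show "x + y \<in> ?S" using x y by (auto simp flip: e(1))
    show "x * y \<in> ?S" using x y by (auto simp flip: e(2) intro: A.mult_closed)
  qed
  then show ?thesis
    by (simp add: star_embedding_def inj_on_emb[OF A] emb_zero[OF A] e norm_emb[OF A]
        A.mult_closed A.adj_closed A.smult_closed)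
qed

lemma star_embedding_minus:
  assumes f: "star_embedding A f"
  shows "x \<in> carrier A \<Longrightarrow> (-1) \<odot>\<^bsub>A\<^esub> x \<oplus>\<^bsub>A\<^esub> x = \<zero>\<^bsub>A\<^esub>"
  using star_embeddingD[OF f] by (auto intro!: inj_onD[OF star_embeddingD(1)[OF f]] simp: scaleC_minus_one)

lemma star_embedding_abelian_group:
  assumes f: "star_embedding A f"
  shows "abelian_group A"
proof -
  note D = star_embeddingD[OF f] and I = inj_onD[OF star_embeddingD(1)[OF f]]
  show ?thesis
  proof (rule abelian_groupI)
    fix x y z assume "x \<in> carrier A" "y \<in> carrier A" "z \<in> carrier A"
    then show "x \<oplus>\<^bsub>A\<^esub> y \<oplus>\<^bsub>A\<^esub> z = x \<oplus>\<^bsub>A\<^esub> (y \<oplus>\<^bsub>A\<^esub> z)" by (intro I) (simp_all add: D(5,7) add.assoc)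
  next
    fix x y assume "x \<in> carrier A" "y \<in> carrier A"
    then show "x \<oplus>\<^bsub>A\<^esub> y = y \<oplus>\<^bsub>A\<^esub> x" by (intro I) (simp_all add: D(5,7) add.commute)
  next
    fix x assume x: "x \<in> carrier A"
    then show "\<zero>\<^bsub>A\<^esub> \<oplus>\<^bsub>A\<^esub> x = x" by (intro I) (simp_all add: D(3,4,5,7))
    show "\<exists>y\<in>carrier A. y \<oplus>\<^bsub>A\<^esub> x = \<zero>\<^bsub>A\<^esub>" using star_embedding_minus[OF f x] D(10)[OF x] by blast
  qed (use D in auto)
qed

lemma star_embedding_diff:
  assumes f: "star_embedding A f" and x: "x \<in> carrier A" "y \<in> carrier A"
  shows "x \<ominus>\<^bsub>A\<^esub> y \<in> carrier A" "f (x \<ominus>\<^bsub>A\<^esub> y) = f x - f y"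
proof -
  interpret abelian_group A by (rule star_embedding_abelian_group[OF f])
  note D = star_embeddingD[OF f]
  have "\<ominus>\<^bsub>A\<^esub> y = (-1) \<odot>\<^bsub>A\<^esub> y" using star_embedding_minus[OF f x(2)] D(10) x by (intro minus_equality) auto
  then show "f (x \<ominus>\<^bsub>A\<^esub> y) = f x - f y"
    using x D(10,12)[of y] by (simp add: minus_eq D(7) scaleC_minus_one)
  show "x \<ominus>\<^bsub>A\<^esub> y \<in> carrier A" using x by simp
qed

lemma star_embedding_cdist:
  assumes f: "star_embedding A f" and x: "x \<in> carrier A" "y \<in> carrier A"
  shows "cdist A x y = dist (f x) (f y)"
  using star_embedding_diff[OF f x] star_embeddingD(13)[OF f] x by (simp add: cdist_def dist_norm)

lemma star_embedding_Metric_space: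
  assumes f: "star_embedding A f" shows "Metric_space (carrier A) (cdist A)"
proof
  show "0 \<le> cdist A x y" for x y
    using star_embedding_cdist[OF f, of x y] by (cases "x \<in> carrier A \<and> y \<in> carrier A") (auto simp: cdist_def)
  show "cdist A x y = cdist A y x" for x y
    using star_embedding_cdist[OF f, of x y] star_embedding_cdist[OF f, of y x]
    by (cases "x \<in> carrier A \<and> y \<in> carrier A") (auto simp: dist_commute, auto simp: cdist_def)
qed (use star_embeddingD(1)[OF f] in \<open>auto simp: star_embedding_cdist[OF f] inj_on_eq_iff dist_triangle\<close>)

lemma star_embedding_cstar_algebra:
  assumes f: "star_embedding A f"
  shows "cstar_algebra A"
proof -
  note D = star_embeddingD[OF f] and I = inj_onD[OF star_embeddingD(1)[OF f]]
  have "Metric_space.mcomplete (carrier A) (cdist A)"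
  proof (rule mcompleteI[OF star_embedding_Metric_space[OF f]])
    fix x :: "nat \<Rightarrow> 'a" assume x: "\<And>n. x n \<in> carrier A"
      and C: "\<And>e. e > 0 \<Longrightarrow> \<exists>N. \<forall>m\<ge>N. \<forall>n\<ge>N. cnorm A (x m \<ominus>\<^bsub>A\<^esub> x n) < e"
    have nd: "cnorm A (a \<ominus>\<^bsub>A\<^esub> b) = norm (f a - f b)" if "a \<in> carrier A" "b \<in> carrier A" for a b
      using star_embedding_diff[OF f that] D(13) by simp
    have "Cauchy (\<lambda>n. f (x n))" unfolding Cauchy_def dist_norm using C x by (simp add: nd)
    then obtain l where l: "(\<lambda>n. f (x n)) \<longlonglongrightarrow> l" using Cauchy_convergent convergent_def by blast
    have "l \<in> f ` carrier A" by (rule csub_limit[OF D(2) l]) (use x in auto)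
    then obtain k where k: "k \<in> carrier A" "l = f k" by blast
    have "(\<lambda>n. norm (f (x n) - f k)) \<longlonglongrightarrow> 0" using l k(2) LIM_zero tendsto_norm_zero by blast
    then have "(\<lambda>n. cnorm A (x n \<ominus>\<^bsub>A\<^esub> k)) \<longlonglongrightarrow> 0" using x k(1) by (simp add: nd)
    then show "\<exists>k\<in>carrier A. (\<lambda>n. cnorm A (x n \<ominus>\<^bsub>A\<^esub> k)) \<longlonglongrightarrow> 0" using k(1) by blast
  qed
  then show ?thesis
    unfolding cstar_algebra_def cstar_algebra_axioms_def
  proof (intro conjI allI impI star_embedding_abelian_group[OF f])
    fix x y assume "x \<in> carrier A" "y \<in> carrier A"
    then show "cnorm A (x \<oplus>\<^bsub>A\<^esub> y) \<le> cnorm A x + cnorm A y" "cnorm A (x \<otimes>\<^bsub>A\<^esub> y) \<le> cnorm A x * cnorm A y"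
      by (simp_all add: D norm_triangle_ineq norm_mult_ineq)
  next
    fix x assume x: "x \<in> carrier A"
    then show "cnorm A x = 0 \<longleftrightarrow> x = \<zero>\<^bsub>A\<^esub>" using I[of x "\<zero>\<^bsub>A\<^esub>"] by (auto simp: D)
    show "cnorm A (adj A x \<otimes>\<^bsub>A\<^esub> x) = (cnorm A x)\<^sup>2" using x by (simp add: D norm_star_mult)
  qed (auto simp: D norm_scaleC star_star mult.assoc distrib_left distrib_right scaleC_add_left
      scaleC_add_right scaleC_scaleC scaleC_mult_left scaleC_mult_right star_add star_mult star_scaleC intro!: I)
qed

lemma star_embedding_closedin:
  assumes f: "star_embedding A f" and H: "H \<subseteq> carrier A"
  shows "closedin (ctopology A) H \<longleftrightarrow> closed (f ` H)"
proof -
  interpret M: Metric_space "carrier A" "cdist A" by (rule star_embedding_Metric_space[OF f])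
  note D = star_embeddingD[OF f]
  have lim: "limitin M.mtopology x l sequentially \<longleftrightarrow> (\<lambda>n. f (x n)) \<longlonglongrightarrow> f l"
    if "\<And>n. x n \<in> carrier A" "l \<in> carrier A" for x l
    using that by (simp add: M.limitin_metric_dist_null star_embedding_cdist[OF f] tendsto_dist_iff[of _ "f l"])
  show ?thesis
  proof
    assume "closedin (ctopology A) H"
    then have cl: "\<And>x l. range x \<subseteq> H \<Longrightarrow> limitin M.mtopology x l sequentially \<Longrightarrow> l \<in> H"
      unfolding ctopology_def M.metric_closedin_iff_sequentially_closed by blast
    show "closed (f ` H)"
    proof (subst closed_sequential_limits, intro allI impI, elim conjE)
      fix y l assume y: "\<forall>n. y n \<in> f ` H" and l: "y \<longlonglongrightarrow> l"
      obtain x where x: "\<And>n. x n \<in> H" "\<And>n. y n = f (x n)" using y unfolding image_iff Bex_def by metis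
      have xA: "x n \<in> carrier A" for n using x(1) H by auto
      have "l \<in> f ` carrier A" by (rule csub_limit[OF D(2) l]) (use x xA in auto)
      then obtain k where k: "k \<in> carrier A" "l = f k" by blast
      have "y = (\<lambda>n. f (x n))" using x(2) by auto
      then have "limitin M.mtopology x k sequentially" using l k xA by (simp add: lim)
      then have "k \<in> H" using cl x(1) by blast
      then show "l \<in> f ` H" using k by blast
    qed
  next
    assume cl: "closed (f ` H)"
    show "closedin (ctopology A) H"
      unfolding ctopology_def M.metric_closedin_iff_sequentially_closed
    proof (intro conjI H allI impI, elim conjE)
      fix x l assume x: "range x \<subseteq> H" and l: "limitin M.mtopology x l sequentially"
      have xA: "x n \<in> carrier A" for n using x H by auto
      have lA: "l \<in> carrier A" using l by (simp add: M.limitin_metric)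
      have lf: "(\<lambda>n. f (x n)) \<longlonglongrightarrow> f l" using l lim[OF xA lA] by simp
      have "f (x n) \<in> f ` H" for n using x by (simp add: image_subset_iff)
      from closed_sequentially[OF cl this lf] have "f l \<in> f ` H" .
      then obtain h where "h \<in> H" "f h = f l" by auto
      then show "l \<in> H" using inj_onD[OF D(1), of h l] lA H by auto
    qed
  qed
qed

text \<open>A closed subset of a type as a structure.\<close>
definition crec :: "'t::nc_star set \<Rightarrow> 't cstar" where
  "crec S = \<lparr>carrier = S, mult = (*), one = 0, zero = 0, add = (+), smult = scaleC, adj = star, cnorm = norm\<rparr>"

lemma crec_simps [simp]:
  "carrier (crec S) = S" "x \<otimes>\<^bsub>crec S\<^esub> y = x * y" "\<zero>\<^bsub>crec S\<^esub> = 0" "x \<oplus>\<^bsub>crec S\<^esub> y = x + y"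
  "c \<odot>\<^bsub>crec S\<^esub> x = c *\<^sub>C x" "adj (crec S) x = star x" "cnorm (crec S) x = norm x"
  "(crec S)\<lparr>carrier := H\<rparr> = crec H"
  by (simp_all add: crec_def)

lemma star_embedding_crec: "csub S \<Longrightarrow> star_embedding (crec S) (\<lambda>x. x)"
  by (auto simp: star_embedding_def csub_mem)

lemma star_embedding_restrict:
  assumes f: "star_embedding A f" and H: "H \<subseteq> carrier A" "csub (f ` H)"
  shows "star_embedding (A\<lparr>carrier := H\<rparr>) f"
proof -
  note D = star_embeddingD[OF f]
  have mem: "x \<in> H" if "x \<in> carrier A" "f x \<in> f ` H" for x
    using that inj_on_image_mem_iff[OF D(1) _ H(1)] by blast
  have sub: "x \<in> H \<Longrightarrow> x \<in> carrier A" for x using H by auto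
  have z: "\<zero>\<^bsub>A\<^esub> \<in> H" by (rule mem) (use D csub_0[OF H(2)] in auto)
  have ad: "x \<oplus>\<^bsub>A\<^esub> y \<in> H" "x \<otimes>\<^bsub>A\<^esub> y \<in> H" if "x \<in> H" "y \<in> H" for x y
    using that by (auto intro!: mem csub_mem[OF H(2)] simp: D sub)
  have st: "adj A x \<in> H" "c \<odot>\<^bsub>A\<^esub> x \<in> H" if "x \<in> H" for x c
    using that by (auto intro!: mem csub_mem[OF H(2)] simp: D sub)
  show ?thesis
    unfolding star_embedding_def using z ad st H(2) by (simp add: D sub inj_on_subset[OF D(1) H(1)])
qed

lemma star_embedding_uminus:
  assumes f: "star_embedding A f" and x: "x \<in> carrier A"
  shows "\<ominus>\<^bsub>A\<^esub> x = (-1) \<odot>\<^bsub>A\<^esub> x"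
proof -
  interpret abelian_group A by (rule star_embedding_abelian_group[OF f])
  show ?thesis using star_embedding_minus[OF f x] star_embeddingD(10)[OF f x] x by (intro minus_equality) auto
qed

lemma star_embedding_additive_subgroup:
  assumes f: "star_embedding A f"
    and H: "H \<subseteq> carrier A" "\<zero>\<^bsub>A\<^esub> \<in> H" "\<And>x y. x \<in> H \<Longrightarrow> y \<in> H \<Longrightarrow> x \<oplus>\<^bsub>A\<^esub> y \<in> H"
      "\<And>x c. x \<in> H \<Longrightarrow> c \<odot>\<^bsub>A\<^esub> x \<in> H"
  shows "additive_subgroup H A"
proof (rule additive_subgroupI, unfold_locales)
  fix x assume x: "x \<in> H"
  have "\<ominus>\<^bsub>A\<^esub> x \<in> H" using star_embedding_uminus[OF f] x H by auto
  then show "inv\<^bsub>add_monoid A\<^esub> x \<in> H" by (simp add: a_inv_def)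
qed (use H in auto)

lemma cstar_subalgebra_iff:
  assumes f: "star_embedding A f"
  shows "cstar_subalgebra H A \<longleftrightarrow> H \<subseteq> carrier A \<and> csub (f ` H)"
proof
  assume H: "cstar_subalgebra H A"
  then have ag: "additive_subgroup H A" by (simp add: cstar_subalgebra_def)
  note D = star_embeddingD[OF f]
  have HA: "H \<subseteq> carrier A" using additive_subgroup.a_subset[OF ag] .
  then have sub: "x \<in> H \<Longrightarrow> x \<in> carrier A" for x by auto
  have "closed (f ` H)" using H star_embedding_closedin[OF f HA] by (simp add: cstar_subalgebra_def)
  moreover have "0 \<in> f ` H" using additive_subgroup.zero_closed[OF ag] D(4) by force
  moreover have "x + y \<in> f ` H" "x * y \<in> f ` H" if "x \<in> f ` H" "y \<in> f ` H" for x y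
    using that H additive_subgroup.a_closed[OF ag]
    by (auto simp: cstar_subalgebra_def sub simp flip: D(7,8))
  moreover have "star x \<in> f ` H" "c *\<^sub>C x \<in> f ` H" if "x \<in> f ` H" for x c
    using that H by (auto simp: cstar_subalgebra_def sub simp flip: D(11,12))
  ultimately show "H \<subseteq> carrier A \<and> csub (f ` H)" using HA by (auto simp: csub_def)
next
  assume H: "H \<subseteq> carrier A \<and> csub (f ` H)"
  note R = star_embeddingD[OF star_embedding_restrict[OF f, of H]]
  have "additive_subgroup H A"
    by (rule star_embedding_additive_subgroup[OF f]) (use H R(3,5,10) in auto)
  moreover have "closedin (ctopology A) H" using star_embedding_closedin[OF f, of H] H by (simp add: csub_closed)
  ultimately show "cstar_subalgebra H A"
    using H R(6,9,10) by (auto simp: cstar_subalgebra_def)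
qed

lemma closed_ideal_iff:
  assumes f: "star_embedding A f"
  shows "closed_ideal I A \<longleftrightarrow> I \<subseteq> carrier A \<and> cideal (f ` I) (f ` carrier A)"
proof
  note D = star_embeddingD[OF f]
  {
    assume I: "closed_ideal I A"
    then have ag: "additive_subgroup I A" by (simp add: closed_ideal_def)
    have IA: "I \<subseteq> carrier A" using additive_subgroup.a_subset[OF ag] .
    then have sub: "x \<in> I \<Longrightarrow> x \<in> carrier A" for x by auto
    have "closed (f ` I)" using I star_embedding_closedin[OF f IA] by (simp add: closed_ideal_def)
    moreover have "0 \<in> f ` I" using additive_subgroup.zero_closed[OF ag] D(4) by force
    moreover have "x + y \<in> f ` I" if "x \<in> f ` I" "y \<in> f ` I" for x y
      using that additive_subgroup.a_closed[OF ag] by (auto simp: sub simp flip: D(7))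
    moreover have "c *\<^sub>C x \<in> f ` I" if "x \<in> f ` I" for x c
      using that I by (auto simp: closed_ideal_def sub simp flip: D(12))
    moreover have "a * x \<in> f ` I" "x * a \<in> f ` I" if "x \<in> f ` I" "a \<in> f ` carrier A" for x a
      using that I by (auto simp: closed_ideal_def sub simp flip: D(8))
    ultimately show "I \<subseteq> carrier A \<and> cideal (f ` I) (f ` carrier A)" using IA by (auto simp: cideal_def)
  next
    assume I: "I \<subseteq> carrier A \<and> cideal (f ` I) (f ` carrier A)"
    then have IA: "I \<subseteq> carrier A" by blast
    then have sub: "x \<in> I \<Longrightarrow> x \<in> carrier A" for x by auto
    have mem: "x \<in> I" if "x \<in> carrier A" "f x \<in> f ` I" for x
      using that inj_on_image_mem_iff[OF D(1) _ IA] by blast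
    have C: "0 \<in> f ` I" "closed (f ` I)" "\<And>x y. x \<in> f ` I \<Longrightarrow> y \<in> f ` I \<Longrightarrow> x + y \<in> f ` I"
      "\<And>x c. x \<in> f ` I \<Longrightarrow> c *\<^sub>C x \<in> f ` I"
      "\<And>x a. x \<in> f ` I \<Longrightarrow> a \<in> f ` carrier A \<Longrightarrow> a * x \<in> f ` I"
      "\<And>x a. x \<in> f ` I \<Longrightarrow> a \<in> f ` carrier A \<Longrightarrow> x * a \<in> f ` I"
      using I by (auto simp: cideal_def)
    have sm: "c \<odot>\<^bsub>A\<^esub> x \<in> I" if "x \<in> I" for x c using that by (intro mem) (auto simp: D sub C)
    have "additive_subgroup I A"
    proof (rule star_embedding_additive_subgroup[OF f IA _ _ sm])
      show "\<zero>\<^bsub>A\<^esub> \<in> I" by (rule mem) (auto simp: D C)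
      show "x \<oplus>\<^bsub>A\<^esub> y \<in> I" if "x \<in> I" "y \<in> I" for x y using that by (intro mem) (auto simp: D sub C)
    qed
    moreover have "closedin (ctopology A) I" using star_embedding_closedin[OF f IA] C by simp
    moreover have "a \<otimes>\<^bsub>A\<^esub> x \<in> I" "x \<otimes>\<^bsub>A\<^esub> a \<in> I" if "x \<in> I" "a \<in> carrier A" for a x
      using that by (auto intro!: mem simp: D sub C)
    ultimately show "closed_ideal I A" using sm by (auto simp: closed_ideal_def)
  }
qed

lemma hereditary_subalgebra_iff:
  fixes f :: "'a \<Rightarrow> 't::uc_star"
  assumes f: "star_embedding A f"
  shows "hereditary_subalgebra H A \<longleftrightarrow> H \<subseteq> carrier A \<and> her (f ` H) (f ` carrier A)"
proof (cases "H \<subseteq> carrier A \<and> csub (f ` H)")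
  case True
  note D = star_embeddingD[OF f]
  have sub: "x \<in> H \<Longrightarrow> x \<in> carrier A" for x using True by auto
  have ms: "x \<ominus>\<^bsub>A\<^esub> y \<in> carrier A" "f (x \<ominus>\<^bsub>A\<^esub> y) = f x - f y" if "x \<in> carrier A" "y \<in> carrier A" for x y
    using star_embedding_diff[OF f that] by auto
  have eq: "x = y \<longleftrightarrow> f x = f y" if "x \<in> carrier A" "y \<in> carrier A" for x y
    using that inj_on_eq_iff[OF D(1)] by simp
  have "(\<forall>a\<in>carrier A. \<forall>b\<in>H. cpositive A a \<and> cpositive A (b \<ominus>\<^bsub>A\<^esub> a) \<longrightarrow> a \<in> H) \<longleftrightarrow>
    (\<forall>y\<in>f ` carrier A. \<forall>z\<in>f ` carrier A. \<forall>b\<in>f ` H. b - star y * y = star z * z \<longrightarrow> star y * y \<in> f ` H)"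
    (is "?L \<longleftrightarrow> ?R")
  proof
    assume L: ?L
    show ?R
    proof (intro ballI impI)
      fix y z b assume "y \<in> f ` carrier A" "z \<in> f ` carrier A" "b \<in> f ` H" and e: "b - star y * y = star z * z"
      then obtain u v c where u: "u \<in> carrier A" "v \<in> carrier A" "c \<in> H" "y = f u" "z = f v" "b = f c" by auto
      let ?a = "adj A u \<otimes>\<^bsub>A\<^esub> u"
      have a: "?a \<in> carrier A" using u D by simp
      have "c \<ominus>\<^bsub>A\<^esub> ?a = adj A v \<otimes>\<^bsub>A\<^esub> v"
        using e u sub by (subst eq) (simp_all add: ms D)
      then have "cpositive A ?a" "cpositive A (c \<ominus>\<^bsub>A\<^esub> ?a)" using u unfolding cpositive_def by auto
      then have "?a \<in> H" using L a u(3) by blast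
      moreover have "f ?a = star y * y" using u D by simp
      ultimately show "star y * y \<in> f ` H" by (metis imageI)
    qed
  next
    assume R: ?R
    show ?L
    proof (intro ballI impI, elim conjE)
      fix a b assume ab: "a \<in> carrier A" "b \<in> H" "cpositive A a" "cpositive A (b \<ominus>\<^bsub>A\<^esub> a)"
      then obtain u v where uv: "u \<in> carrier A" "v \<in> carrier A" "a = adj A u \<otimes>\<^bsub>A\<^esub> u" "b \<ominus>\<^bsub>A\<^esub> a = adj A v \<otimes>\<^bsub>A\<^esub> v"
        by (auto simp: cpositive_def)
      have fa: "f a = star (f u) * f u" using uv D by simp
      have "f b - star (f u) * f u = star (f v) * f v"
        using ms(2)[of b a] uv D ab sub fa by simp
      then have "f a \<in> f ` H" using R uv ab(2) unfolding fa by blast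
      then show "a \<in> H" using inj_on_image_mem_iff[OF D(1) ab(1)] True by blast
    qed
  qed
  moreover have "f ` H \<subseteq> f ` carrier A" using True by auto
  ultimately show ?thesis
    using her_iff_order_hereditary[OF D(2), of "f ` H"] True
    by (simp add: hereditary_subalgebra_def cstar_subalgebra_iff[OF f])
qed (auto simp: hereditary_subalgebra_def cstar_subalgebra_iff[OF f] her_def)

section \<open>Hereditary membership in a class\<close>

lemma cstar_iso_trans: "cstar_iso A B \<Longrightarrow> cstar_iso B C \<Longrightarrow> cstar_iso A C"
proof -
  assume "cstar_iso A B" "cstar_iso B C"
  then obtain f g where f: "f \<in> star_hom A B" "bij_betw f (carrier A) (carrier B)"
    and g: "g \<in> star_hom B C" "bij_betw g (carrier B) (carrier C)" by (auto simp: cstar_iso_def)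
  have m: "f x \<in> carrier B" if "x \<in> carrier A" for x using f(1) that by (auto simp: star_hom_def)
  have "g \<circ> f \<in> star_hom A C"
    using f(1) g(1) m unfolding star_hom_def by (auto simp: Pi_iff)
  moreover have "bij_betw (g \<circ> f) (carrier A) (carrier C)" by (rule bij_betw_trans[OF f(2) g(2)])
  ultimately show ?thesis by (auto simp: cstar_iso_def)
qed

lemma cstar_iso_sym:
  assumes A: "star_embedding A e" and "cstar_iso A B" shows "cstar_iso B A"
proof -
  from assms(2) obtain f where f: "f \<in> star_hom A B" "bij_betw f (carrier A) (carrier B)" by (auto simp: cstar_iso_def)
  note D = star_embeddingD[OF A]
  define g where "g = inv_into (carrier A) f"
  have g: "bij_betw g (carrier B) (carrier A)" unfolding g_def by (rule bij_betw_inv_into[OF f(2)])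
  have gf: "g (f x) = x" if "x \<in> carrier A" for x unfolding g_def by (rule bij_betw_inv_into_left[OF f(2) that])
  have B: "carrier B = f ` carrier A" using f(2) by (simp add: bij_betw_def)
  have "g \<in> star_hom B A"
  proof -
    have h: "f (x \<oplus>\<^bsub>A\<^esub> y) = f x \<oplus>\<^bsub>B\<^esub> f y" "f (x \<otimes>\<^bsub>A\<^esub> y) = f x \<otimes>\<^bsub>B\<^esub> f y"
      "f (c \<odot>\<^bsub>A\<^esub> x) = c \<odot>\<^bsub>B\<^esub> f x" "f (adj A x) = adj B (f x)"
      if "x \<in> carrier A" "y \<in> carrier A" for x y c using that f(1) by (auto simp: star_hom_def)
    show ?thesis unfolding star_hom_def B
      using D by (auto simp: gf simp flip: h)
  qed
  then show ?thesis using g by (auto simp: cstar_iso_def)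
qed

lemma cstar_iso_star_embedding: "star_embedding A f \<Longrightarrow> cstar_iso A (crec (f ` carrier A))"
  unfolding cstar_iso_def by (rule bexI[of _ f]) (auto simp: star_embedding_def star_hom_def bij_betw_def)

lemma cstar_iso_crec:
  assumes S: "csub S" and h: "chom S \<phi>" "inj_on \<phi> S"
  shows "cstar_iso (crec S) (crec (\<phi> ` S))"
  unfolding cstar_iso_def using assms
  by (intro bexI[of _ \<phi>]) (auto simp: star_hom_def bij_betw_def chom_def)

lemma in_class_iso: "cstar_iso A B \<Longrightarrow> in_class \<C> B \<Longrightarrow> in_class \<C> A"
  unfolding in_class_def using cstar_iso_trans by blast

lemma in_class_iso_iff:
  assumes "star_embedding A e" "cstar_iso A B" shows "in_class \<C> A \<longleftrightarrow> in_class \<C> B"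
  using in_class_iso[OF assms(2), of \<C>] in_class_iso[OF cstar_iso_sym[OF assms], of \<C>] by (rule iffI[rotated])

lemma in_class_crec_iff:
  assumes "csub S" "chom S \<phi>" "inj_on \<phi> S"
  shows "in_class \<C> (crec S) \<longleftrightarrow> in_class \<C> (crec (\<phi> ` S))"
  by (rule in_class_iso_iff[OF star_embedding_crec cstar_iso_crec]) (use assms in auto)

text \<open>Hereditary membership for closed subalgebras of a type.\<close>
definition hered :: "'c cstar set \<Rightarrow> 't::uc_star set \<Rightarrow> bool" where
  "hered \<C> S \<longleftrightarrow> csub S \<and> (\<forall>H. her H S \<and> H \<noteq> {0} \<longrightarrow> in_class \<C> (crec H))"

lemma hereditarily_in_iff:
  fixes f :: "'a \<Rightarrow> 't::uc_star"
  assumes f: "star_embedding A f"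
  shows "hereditarily_in \<C> A \<longleftrightarrow> hered \<C> (f ` carrier A)"
proof -
  note D = star_embeddingD[OF f]
  have cls: "in_class \<C> (A\<lparr>carrier := H\<rparr>) \<longleftrightarrow> in_class \<C> (crec (f ` H))"
    if H: "H \<subseteq> carrier A" "her (f ` H) (f ` carrier A)" for H
  proof -
    have "star_embedding (A\<lparr>carrier := H\<rparr>) f" using star_embedding_restrict[OF f H(1)] H(2) by (simp add: her_def)
    from in_class_iso_iff[OF this cstar_iso_star_embedding[OF this]] show ?thesis by simp
  qed
  have z: "H = {\<zero>\<^bsub>A\<^esub>} \<longleftrightarrow> f ` H = {0}" if "H \<subseteq> carrier A" for H
    using inj_on_image_eq_iff[OF D(1) that, of "{\<zero>\<^bsub>A\<^esub>}"] D(3,4) by simp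
  show ?thesis
  proof
    assume h: "hereditarily_in \<C> A"
    have "in_class \<C> (crec K)" if K: "her K (f ` carrier A)" "K \<noteq> {0}" for K
    proof -
      obtain H where H: "H \<subseteq> carrier A" "K = f ` H"
        using K(1) unfolding her_def by (meson subset_imageE)
      then have "hereditary_subalgebra H A" "H \<noteq> {\<zero>\<^bsub>A\<^esub>}" using hereditary_subalgebra_iff[OF f] K z[OF H(1)] by auto
      then have "in_class \<C> (A\<lparr>carrier := H\<rparr>)" using h by (simp add: hereditarily_in_def)
      then show ?thesis using cls[OF H(1)] K(1) H(2) by simp
    qed
    then show "hered \<C> (f ` carrier A)" using D(2) by (simp add: hered_def)
  next
    assume h: "hered \<C> (f ` carrier A)"
    have "in_class \<C> (A\<lparr>carrier := H\<rparr>)" if H: "hereditary_subalgebra H A" "H \<noteq> {\<zero>\<^bsub>A\<^esub>}" for H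
    proof -
      have 1: "H \<subseteq> carrier A" "her (f ` H) (f ` carrier A)" using H(1) hereditary_subalgebra_iff[OF f] by auto
      then have "f ` H \<noteq> {0}" using H(2) z by blast
      then show ?thesis using cls[OF 1] h 1(2) by (simp add: hered_def)
    qed
    then show "hereditarily_in \<C> A" by (simp add: hereditarily_in_def star_embedding_cstar_algebra[OF f])
  qed
qed

lemma hered_csub: "hered \<C> S \<Longrightarrow> csub S" by (simp add: hered_def)

lemma her_preimage:
  assumes S: "csub S" and h: "chom S \<phi>" "continuous_on S \<phi>" and K: "her K (\<phi> ` S)"
  shows "her {x\<in>S. \<phi> x \<in> K} S"
proof -
  have cK: "csub K" using K by (simp add: her_def)
  have "closed {x\<in>S. \<phi> x \<in> K}"
    using continuous_closed_preimage[OF h(2) csub_closed[OF S] csub_closed[OF cK]]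
    by (simp add: vimage_def Int_def)
  then have "csub {x\<in>S. \<phi> x \<in> K}"
    using S cK by (auto simp: csub_def chom_0[OF S h(1)] chom_add[OF h(1)] chom_mult[OF h(1)] chom_star[OF h(1)] chom_scaleC[OF h(1)])
  moreover have "h * s * k \<in> {x\<in>S. \<phi> x \<in> K}" if "h \<in> {x\<in>S. \<phi> x \<in> K}" "s \<in> S" "k \<in> {x\<in>S. \<phi> x \<in> K}" for h s k
    using that her_mem[OF K, of "\<phi> h" "\<phi> s" "\<phi> k"] S by (auto simp: chom_mult[OF h(1)] csub_mem)
  ultimately show ?thesis by (auto simp: her_def)
qed

lemma chom_continuous_on:
  fixes \<phi> :: "'a::uc_star \<Rightarrow> 'b::uc_star"
  assumes S: "csub S" and h: "chom S \<phi>" shows "continuous_on S \<phi>"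
proof (rule continuous_onI)
  fix x e assume x: "x \<in> S" and e: "(e::real) > 0"
  have "dist (\<phi> y) (\<phi> x) \<le> dist y x" if "y \<in> S" for y
    using chom_norm_le[OF S h, of "y - x"] that x S by (simp add: dist_norm csub_mem chom_diff[OF S h])
  then show "\<exists>d>0. \<forall>x'\<in>S. dist x' x < d \<longrightarrow> dist (\<phi> x') (\<phi> x) \<le> e" using e by (meson less_imp_le order_trans)
qed

lemma hered_inj_image:
  fixes \<phi> :: "'a::uc_star \<Rightarrow> 'b::uc_star"
  assumes S: "hered \<C> S" and h: "chom S \<phi>" "inj_on \<phi> S"
  shows "hered \<C> (\<phi> ` S)"
proof -
  have cS: "csub S" using S by (rule hered_csub)
  have "in_class \<C> (crec K)" if K: "her K (\<phi> ` S)" "K \<noteq> {0}" for K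
  proof -
    define H where "H = {x\<in>S. \<phi> x \<in> K}"
    have H: "her H S" unfolding H_def by (rule her_preimage[OF cS h(1) chom_continuous_on[OF cS h(1)] K(1)])
    have KH: "K = \<phi> ` H" using K(1) by (auto simp: H_def her_def)
    have "H \<noteq> {0}" using KH K(2) chom_0[OF cS h(1)] by auto
    then have "in_class \<C> (crec H)" using S H by (simp add: hered_def)
    then show ?thesis unfolding KH
      using in_class_crec_iff[of H \<phi>] H h chom_subset[of S \<phi> H] inj_on_subset[of \<phi> S H] by (auto simp: her_def)
  qed
  then show ?thesis using chom_inj_image_csub[OF cS h] by (simp add: hered_def)
qed

lemma hered_her: "hered \<C> S \<Longrightarrow> her H S \<Longrightarrow> hered \<C> H"
proof -
  assume S: "hered \<C> S" and H: "her H S"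
  have "in_class \<C> (crec K)" if "her K H" "K \<noteq> {0}" for K
    using S her_trans[OF that(1) H] that(2) by (simp add: hered_def)
  then show "hered \<C> H" using H by (simp add: hered_def her_def)
qed

lemma hered_trivial: "hered \<C> {0}"
  by (auto simp: hered_def csub_def her_def)

section \<open>Transport along an injection\<close>

text \<open>Members of a class live on a fixed type; a subalgebra of another type is copied there along an
  injection. The parameter \<open>e\<close> becomes the unit.\<close>
definition transport :: "('t::nc_star \<Rightarrow> 'c) \<Rightarrow> 't set \<Rightarrow> 't \<Rightarrow> 'c cstar" where
  "transport \<iota> S e = (let g = inv_into S \<iota> in
     \<lparr>carrier = \<iota> ` S, mult = \<lambda>x y. \<iota> (g x * g y), one = \<iota> e, zero = \<iota> 0, add = \<lambda>x y. \<iota> (g x + g y),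
      smult = \<lambda>c x. \<iota> (c *\<^sub>C g x), adj = \<lambda>x. \<iota> (star (g x)), cnorm = \<lambda>x. norm (g x)\<rparr>)"

lemma star_embedding_transport:
  assumes S: "csub S" and i: "inj_on \<iota> S"
  shows "star_embedding (transport \<iota> S e) (inv_into S \<iota>)"
proof -
  have g: "inv_into S \<iota> (\<iota> x) = x" if "x \<in> S" for x using inv_into_f_f[OF i that] .
  have "inv_into S \<iota> ` \<iota> ` S = S" using g by (force simp: image_iff)
  then show ?thesis
    using S by (auto simp: star_embedding_def transport_def Let_def g csub_mem inj_on_def)
qed

text \<open>Upwards directedness in usable form. The injection \<open>\<iota>\<close> expresses that \<open>H\<close> is small enough to have a
  copy on the type of the class.\<close>
lemma in_class_if_contains:
  fixes \<phi> :: "'s::uc_star \<Rightarrow> 't::uc_star" and \<iota> :: "'t \<Rightarrow> 'c" and \<C> :: "'c cstar set"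
  assumes C: "upwards_directed \<C>" and H: "csub H" "inj_on \<iota> H"
    and K: "in_class \<C> (crec K)" "csub K" "chom K \<phi>" "inj_on \<phi> K" "\<phi> ` K \<subseteq> H"
  shows "in_class \<C> (crec H)"
proof -
  define B where "B = transport \<iota> H 0"
  define g where "g = inv_into H \<iota>"
  have e: "star_embedding B g" unfolding B_def g_def by (rule star_embedding_transport[OF H])
  have B: "carrier B = \<iota> ` H" by (simp add: B_def transport_def Let_def)
  have gi: "g (\<iota> x) = x" if "x \<in> H" for x unfolding g_def by (rule inv_into_f_f[OF H(2) that])
  have gH: "g ` carrier B = H" using gi B by (force simp: image_iff)
  define T where "T = \<iota> ` \<phi> ` K"
  have T: "T \<subseteq> carrier B" using K(5) by (auto simp: T_def B)
  have gT: "g ` T = \<phi> ` K" using K(5) gi by (force simp: T_def image_iff)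
  have cT: "csub (g ` T)" unfolding gT by (rule chom_inj_image_csub[OF K(2-4)])
  have sub: "cstar_subalgebra T B" using cstar_subalgebra_iff[OF e] T cT by blast
  have eT: "star_embedding (B\<lparr>carrier := T\<rparr>) g" by (rule star_embedding_restrict[OF e T cT])
  have "in_class \<C> (crec (g ` T))" using iffD1[OF in_class_crec_iff[OF K(2-4)] K(1)] gT by simp
  then have "in_class \<C> (B\<lparr>carrier := T\<rparr>)" using in_class_iso[OF cstar_iso_star_embedding[OF eT]] by simp
  then obtain B' where "B' \<in> \<C>" "cstar_iso (B\<lparr>carrier := T\<rparr>) B'" by (auto simp: in_class_def)
  then have "B \<in> \<C>" using C sub star_embedding_cstar_algebra[OF e] unfolding upwards_directed_def by blast
  moreover have "cstar_iso (crec H) B" using cstar_iso_sym[OF e cstar_iso_star_embedding[OF e]] gH by simp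
  ultimately show ?thesis by (auto simp: in_class_def)
qed

lemma in_class_inj:
  fixes \<C> :: "'c cstar set" and A :: "'a cstar"
  assumes "in_class \<C> A"
  obtains \<iota> :: "'a \<Rightarrow> 'c" where "inj_on \<iota> (carrier A)"
  using assms by (auto simp: in_class_def cstar_iso_def bij_betw_def)

section \<open>Quotients\<close>

text \<open>Cosets as they occur in the quotient structure. The order \<open>h + x\<close> matches \<^const>\<open>a_r_coset\<close>.\<close>
definition icoset :: "'t::nc_star set \<Rightarrow> 't \<Rightarrow> 't set" where
  "icoset I x = (\<lambda>h. h + x) ` I"

definition qnorm :: "'t::nc_star set \<Rightarrow> 't \<Rightarrow> real" where
  "qnorm I x = (INF y\<in>icoset I x. norm y)"

context
  fixes S I :: "'t::uc_star set"
  assumes S: "csub S" and I: "cideal I S"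
begin

lemma I_csub: "csub I" by (rule cideal_csub[OF S I])
lemma I_sub: "x \<in> I \<Longrightarrow> x \<in> S" using I by (auto simp: cideal_def)
lemma I_absorb: "x \<in> I \<Longrightarrow> a \<in> S \<Longrightarrow> a * x \<in> I" "x \<in> I \<Longrightarrow> a \<in> S \<Longrightarrow> x * a \<in> I"
  using I by (auto simp: cideal_def)

lemma cos_mem: "y \<in> icoset I x \<longleftrightarrow> y - x \<in> I"
  unfolding icoset_def by (auto simp: image_iff intro!: bexI[of _ "y - x"])

lemma cos_self: "x \<in> icoset I x" using csub_0[OF I_csub] by (simp add: cos_mem)

lemma cos_nonempty [simp]: "icoset I x \<noteq> {}" using cos_self by blast

lemma bdd_below_norm [simp]: "bdd_below (norm ` (X :: 't set))" by (rule bdd_belowI[of _ 0]) auto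

lemma cos_in_S: "x \<in> S \<Longrightarrow> y \<in> icoset I x \<Longrightarrow> y \<in> S"
  using csub_add[OF S I_sub, of "y - x" x] by (simp add: cos_mem)

lemma cos_eq: "icoset I x = icoset I y \<longleftrightarrow> x - y \<in> I"
proof
  assume "icoset I x = icoset I y" then show "x - y \<in> I" using cos_self[of x] by (simp add: cos_mem)
next
  assume xy: "x - y \<in> I"
  have "z - x \<in> I \<longleftrightarrow> z - y \<in> I" for z
    using csub_add[OF I_csub _ xy, of "z - x"] csub_diff[OF I_csub _ xy, of "z - y"] by auto
  then show "icoset I x = icoset I y" by (auto simp: cos_mem)
qed

lemma r_coset_eq: "I +>\<^bsub>crec S\<^esub> x = icoset I x"
  by (auto simp: a_r_coset_def r_coset_def icoset_def crec_def)

lemma quotient_carrier: "carrier (cquotient (crec S) I) = icoset I ` S"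
  by (auto simp: cquotient_def A_RCOSETS_def RCOSETS_def icoset_def r_coset_def crec_def)

lemma quotient_add: "icoset I x \<oplus>\<^bsub>cquotient (crec S) I\<^esub> icoset I y = icoset I (x + y)"
proof -
  have "icoset I x \<oplus>\<^bsub>cquotient (crec S) I\<^esub> icoset I y = {a + b | a b. a \<in> icoset I x \<and> b \<in> icoset I y}"
    by (auto simp: cquotient_def set_add_def set_mult_def crec_def)
  also have "\<dots> = icoset I (x + y)"
  proof (intro Set.set_eqI iffI)
    fix z assume "z \<in> {a + b | a b. a \<in> icoset I x \<and> b \<in> icoset I y}"
    then obtain a b where "z = a + b" "a - x \<in> I" "b - y \<in> I" by (auto simp: cos_mem)
    then show "z \<in> icoset I (x + y)" using csub_add[OF I_csub, of "a - x" "b - y"] by (simp add: cos_mem algebra_simps)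
  next
    fix z assume "z \<in> icoset I (x + y)"
    then have "z - y \<in> icoset I x" by (simp add: cos_mem algebra_simps)
    then show "z \<in> {a + b | a b. a \<in> icoset I x \<and> b \<in> icoset I y}" using cos_self[of y] by force
  qed
  finally show ?thesis .
qed

lemma UN_eq_const: "a \<in> X \<Longrightarrow> (\<And>a. a \<in> X \<Longrightarrow> f a = C) \<Longrightarrow> (\<Union>a\<in>X. f a) = C" by auto

lemma quotient_mult:
  assumes x: "x \<in> S" "y \<in> S"
  shows "icoset I x \<otimes>\<^bsub>cquotient (crec S) I\<^esub> icoset I y = icoset I (x * y)"
proof -
  have "icoset I x \<otimes>\<^bsub>cquotient (crec S) I\<^esub> icoset I y = (\<Union>a\<in>icoset I x. \<Union>b\<in>icoset I y. icoset I (a * b))"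
    by (simp add: cquotient_def rcoset_mult_def r_coset_eq)
  moreover have "icoset I (a * b) = icoset I (x * y)" if "a \<in> icoset I x" "b \<in> icoset I y" for a b
  proof -
    have "a - x \<in> I" "b - y \<in> I" "b \<in> S" using that cos_in_S[OF x(2)] by (auto simp: cos_mem)
    then have "(a - x) * b + x * (b - y) \<in> I" using x I_absorb csub_add[OF I_csub] by auto
    then show ?thesis by (simp add: cos_eq algebra_simps)
  qed
  ultimately show ?thesis by (simp add: UN_eq_const[OF cos_self] del: UN_simps)
qed

lemma quotient_smult: "c \<odot>\<^bsub>cquotient (crec S) I\<^esub> icoset I x = icoset I (c *\<^sub>C x)"
proof -
  have "c \<odot>\<^bsub>cquotient (crec S) I\<^esub> icoset I x = (\<Union>a\<in>icoset I x. icoset I (c *\<^sub>C a))"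
    by (simp add: cquotient_def r_coset_eq)
  moreover have "icoset I (c *\<^sub>C a) = icoset I (c *\<^sub>C x)" if "a \<in> icoset I x" for a
    using that csub_scaleC[OF I_csub, of "a - x" c] by (simp add: cos_eq cos_mem scaleC_diff_right)
  ultimately show ?thesis by (simp add: UN_eq_const[OF cos_self] del: UN_simps)
qed

lemma quotient_adj: "adj (cquotient (crec S) I) (icoset I x) = icoset I (star x)"
proof -
  have "adj (cquotient (crec S) I) (icoset I x) = (\<Union>a\<in>icoset I x. icoset I (star a))"
    by (simp add: cquotient_def r_coset_eq)
  moreover have "icoset I (star a) = icoset I (star x)" if "a \<in> icoset I x" for a
    using that csub_star[OF I_csub, of "a - x"] by (simp add: cos_eq cos_mem star_diff)
  ultimately show ?thesis by (simp add: UN_eq_const[OF cos_self] del: UN_simps)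
qed

lemma quotient_norm: "cnorm (cquotient (crec S) I) (icoset I x) = qnorm I x"
  by (simp add: cquotient_def qnorm_def)

lemma quotient_zero: "\<zero>\<^bsub>cquotient (crec S) I\<^esub> = icoset I 0"
  by (simp add: cquotient_def icoset_def)

lemma qnorm_le: "y - x \<in> I \<Longrightarrow> qnorm I x \<le> norm y"
  unfolding qnorm_def by (rule cINF_lower) (auto simp: cos_mem intro!: bdd_belowI[of _ 0])

lemma qnorm_nonneg: "0 \<le> qnorm I x"
  unfolding qnorm_def using cos_self[of x] by (intro cINF_greatest) auto

lemma qnorm_approx:
  assumes "e > 0" obtains y where "y - x \<in> I" "norm y < qnorm I x + e"
proof -
  have "\<exists>y\<in>icoset I x. norm y < qnorm I x + e"
    using cINF_less_iff[of "icoset I x" norm "qnorm I x + e"] assms by (simp add: qnorm_def)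
  then show ?thesis using that by (auto simp: cos_mem)
qed

lemma qnorm_ge: assumes "\<And>y. y - x \<in> I \<Longrightarrow> c \<le> norm y" shows "c \<le> qnorm I x"
  unfolding qnorm_def using assms by (intro cINF_greatest) (simp_all add: cos_mem)

lemma qnorm_zero: "qnorm I x = 0 \<longleftrightarrow> x \<in> I"
proof
  assume q: "qnorm I x = 0"
  have "\<exists>y\<in>I. dist y x < e" if e: "e > 0" for e
  proof -
    obtain y where y: "y - x \<in> I" "norm y < e" using qnorm_approx[OF e, of x] q by auto
    have "x - y \<in> I" using csub_minus[OF I_csub y(1)] by simp
    then show ?thesis using y(2) by (intro bexI[of _ "x - y"]) (simp_all add: dist_norm)
  qed
  then have "x \<in> closure I" by (simp add: closure_approachable)
  then show "x \<in> I" using csub_closed[OF I_csub] by simp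
next
  assume "x \<in> I"
  then show "qnorm I x = 0" using qnorm_le[of 0 x] csub_minus[OF I_csub] qnorm_nonneg[of x] by fastforce
qed

lemma qnorm_triangle: "qnorm I (x + y) \<le> qnorm I x + qnorm I y"
proof (rule field_le_epsilon)
  fix e :: real assume "e > 0"
  then obtain a b where a: "a - x \<in> I" "norm a < qnorm I x + e / 2" and b: "b - y \<in> I" "norm b < qnorm I y + e / 2"
    using qnorm_approx[of "e/2"] by (metis half_gt_zero)
  have "qnorm I (x + y) \<le> norm (a + b)"
    using csub_add[OF I_csub a(1) b(1)] by (intro qnorm_le) (simp add: algebra_simps)
  then show "qnorm I (x + y) \<le> qnorm I x + qnorm I y + e" using a b norm_triangle_ineq[of a b] by linarith
qed

lemma qnorm_scaleC: "qnorm I (c *\<^sub>C x) = cmod c * qnorm I x"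
proof -
  have le: "qnorm I (c *\<^sub>C x) \<le> cmod c * qnorm I x" for c x
  proof (cases "c = 0")
    case False
    have "qnorm I (c *\<^sub>C x) / cmod c \<le> qnorm I x"
    proof (rule qnorm_ge)
      fix y assume "y - x \<in> I"
      then have "c *\<^sub>C y - c *\<^sub>C x \<in> I" using csub_scaleC[OF I_csub, of "y - x" c] by (simp add: scaleC_diff_right)
      from qnorm_le[OF this] show "qnorm I (c *\<^sub>C x) / cmod c \<le> norm y" using False by (simp add: norm_scaleC field_simps)
    qed
    then show ?thesis using False by (simp add: field_simps)
  qed (use qnorm_zero[of 0] csub_0[OF I_csub] in simp)
  show ?thesis
  proof (cases "c = 0")
    case False
    have "qnorm I x \<le> cmod (inverse c) * qnorm I (c *\<^sub>C x)"
      using le[of "inverse c" "c *\<^sub>C x"] False by (simp add: scaleC_scaleC)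
    then have "cmod c * qnorm I x \<le> qnorm I (c *\<^sub>C x)" 
      using mult_left_mono[of "qnorm I x" _ "cmod c"] False
      by (smt (verit) mult.assoc mult_cancel_right1 norm_ge_zero norm_mult norm_one right_inverse)
    then show ?thesis using le[of c x] by simp
  qed (use qnorm_zero[of 0] csub_0[OF I_csub] in simp)
qed

lemma qnorm_mult: assumes x: "x \<in> S" "y \<in> S" shows "qnorm I (x * y) \<le> qnorm I x * qnorm I y"
proof -
  have "qnorm I (x * y) \<le> norm a * norm b" if ab: "a - x \<in> I" "b - y \<in> I" for a b
  proof -
    have "b \<in> S" using cos_in_S[OF x(2)] ab by (simp add: cos_mem)
    then have "(a - x) * b + x * (b - y) \<in> I" using x ab I_absorb csub_add[OF I_csub] by auto
    then have "qnorm I (x * y) \<le> norm (a * b)" by (intro qnorm_le) (simp add: algebra_simps)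
    then show ?thesis using norm_mult_ineq order_trans by blast
  qed
  note le = this
  have 1: "qnorm I (x * y) \<le> norm a * qnorm I y" if a: "a - x \<in> I" for a
  proof (cases "norm a = 0")
    case True then show ?thesis using le[OF a, of y] csub_0[OF I_csub] by simp
  next
    case False
    then have "qnorm I (x * y) / norm a \<le> qnorm I y"
      by (intro qnorm_ge) (use le[OF a] in \<open>simp add: field_simps\<close>)
    then show ?thesis using False by (simp add: field_simps)
  qed
  show ?thesis
  proof (cases "qnorm I y = 0")
    case True then show ?thesis using 1[of x] csub_0[OF I_csub] by simp
  next
    case False
    then have pos: "qnorm I y > 0" using qnorm_nonneg[of y] by simp
    then have "qnorm I (x * y) / qnorm I y \<le> qnorm I x"
      by (intro qnorm_ge) (use 1 in \<open>simp add: field_simps\<close>)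
    then show ?thesis using pos by (simp add: field_simps)
  qed
qed

lemma qnorm_star: "qnorm I (star x) = qnorm I x"
proof -
  have le: "qnorm I (star x) \<le> qnorm I x" for x
  proof (rule qnorm_ge)
    fix y assume "y - x \<in> I"
    then have "star y - star x \<in> I" using csub_star[OF I_csub, of "y - x"] by (simp add: star_diff)
    from qnorm_le[OF this] show "qnorm I (star x) \<le> norm y" by simp
  qed
  show ?thesis using le[of x] le[of "star x"] by (simp add: star_star)
qed

text \<open>If \<open>y = star x * x + i\<close> with \<open>i \<in> I\<close> and \<open>g\<^sub>n = (1 - b) ^ n\<close>, where \<open>1 - g\<^sub>n\<close> is an approximate unit
  generated by \<open>i\<close>, then \<open>x g\<^sub>n\<close> represents the coset of \<open>x\<close>, and \<open>(norm (x g\<^sub>n))\<^sup>2\<close> is at most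
  \<open>norm y + norm (i g\<^sub>n)\<close>, where the second term tends to zero.\<close>
lemma qnorm_star_mult:
  assumes x: "x \<in> S" shows "qnorm I (star x * x) = (qnorm I x)\<^sup>2"
proof (rule antisym)
  show "qnorm I (star x * x) \<le> (qnorm I x)\<^sup>2"
    using qnorm_mult[OF csub_star[OF S x] x] by (simp add: qnorm_star power2_eq_square)
  show "(qnorm I x)\<^sup>2 \<le> qnorm I (star x * x)"
  proof (rule qnorm_ge)
    fix y assume y: "y - star x * x \<in> I"
    define i where "i = y - star x * x"
    have iI: "i \<in> I" using y by (simp add: i_def)
    obtain b r K where b: "b = r *\<^sub>R (star i * i)" "pos b" "norm b \<le> 1" "K \<ge> 0" "K *\<^sub>R b = star i * i"
      using star_mult_normalized by metis
    have bI: "b \<in> I" using iI I_csub b(1) by (simp add: csub_mem)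
    let ?g = "\<lambda>n. (1 - b) ^ n"
    have ng: "norm (?g n) \<le> 1" for n
    proof -
      have "norm (1 - b) \<le> 1" using pos_norm_minus[OF b(2,3)] by simp
      then show ?thesis by (metis norm_power_ineq order_trans power_le_one norm_ge_zero)
    qed
    have sg: "star (?g n) = ?g n" for n by (simp add: star_power star_diff pos_star[OF b(2)])
    have le: "(qnorm I x)\<^sup>2 \<le> norm y + norm (i * ?g n)" for n
    proof -
      have "x * (1 - ?g n) \<in> I" using csub_approximate_unit[OF I_csub bI] x I_absorb by blast
      then have "x * ?g n - x \<in> I" using csub_minus[OF I_csub] by (simp add: algebra_simps) (metis minus_diff_eq)
      then have "qnorm I x \<le> norm (x * ?g n)" by (rule qnorm_le)
      then have "(qnorm I x)\<^sup>2 \<le> (norm (x * ?g n))\<^sup>2" by (intro power_mono qnorm_nonneg)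
      also have "\<dots> = norm (?g n * (star x * x * ?g n))"
        using norm_star_mult[of "x * ?g n"] by (simp add: star_mult sg mult.assoc)
      also have "\<dots> \<le> norm (star x * x * ?g n)"
        using norm_mult_ineq[of "?g n" "star x * x * ?g n"] ng[of n]
          mult_right_mono[of "norm (?g n)" 1 "norm (star x * x * ?g n)"] by simp
      also have "star x * x * ?g n = y * ?g n - i * ?g n" by (simp add: i_def algebra_simps)
      also have "norm \<dots> \<le> norm (y * ?g n) + norm (i * ?g n)" by (rule norm_triangle_ineq4)
      also have "norm (y * ?g n) \<le> norm y"
        using norm_mult_ineq[of y "?g n"] mult_left_le[OF ng[of n], of "norm y"] by simp
      finally show ?thesis by simp
    qed
    have "(\<lambda>n. i * ?g n) \<longlonglongrightarrow> 0" using approximate_unit_tendsto_0[of b K i] b by simp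
    then have "(\<lambda>n. norm y + norm (i * ?g n)) \<longlonglongrightarrow> norm y + norm (0::'t)" by (intro tendsto_intros)
    then have "(qnorm I x)\<^sup>2 \<le> norm y + norm (0::'t)" by (rule LIMSEQ_le_const) (use le in blast)
    then show "(qnorm I x)\<^sup>2 \<le> norm y" by simp
  qed
qed

lemma qnorm_complete:
  assumes x: "\<And>n::nat. x n \<in> S" and C: "\<And>e. e > 0 \<Longrightarrow> \<exists>N. \<forall>m\<ge>N. \<forall>n\<ge>N. qnorm I (x m - x n) < e"
  shows "\<exists>l\<in>S. (\<lambda>n. qnorm I (x n - l)) \<longlonglongrightarrow> 0"
proof -
  obtain N where N: "\<And>k m n. m \<ge> N k \<Longrightarrow> n \<ge> N k \<Longrightarrow> qnorm I (x m - x n) < (1/2) ^ k"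
  proof -
    have "\<exists>N. \<forall>m\<ge>N. \<forall>n\<ge>N. qnorm I (x m - x n) < (1/2) ^ k" for k :: nat by (rule C) simp
    then show ?thesis using that by metis
  qed
  define r where "r k = k + (\<Sum>j\<le>k. N j)" for k
  have rN: "N k \<le> r k" for k unfolding r_def using member_le_sum[of k "{..k}" N] by simp
  have rS: "N k \<le> r (Suc k)" for k using rN[of k] by (simp add: r_def)
  have "\<exists>d. d - (x (r (Suc k)) - x (r k)) \<in> I \<and> norm d < (1/2) ^ k" for k
  proof -
    let ?q = "qnorm I (x (r (Suc k)) - x (r k))"
    have q: "(1/2) ^ k - ?q > 0" using N[OF rS rN, of k] by simp
    show ?thesis using qnorm_approx[OF q, of "x (r (Suc k)) - x (r k)"] by auto
  qed
  then obtain d where d: "\<And>k. d k - (x (r (Suc k)) - x (r k)) \<in> I" "\<And>k. norm (d k) < (1/2) ^ k" by metis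
  have "summable d"
    by (rule summable_norm_cancel, rule summable_comparison_test[of _ "\<lambda>k. (1/2) ^ k"])
      (auto intro!: exI[of _ 0] less_imp_le[OF d(2)] summable_geometric)
  then have sd: "(\<lambda>n. \<Sum>k<n. d k) \<longlonglongrightarrow> suminf d" by (rule summable_LIMSEQ)
  define l where "l = x (r 0) + suminf d"
  have yl: "(\<lambda>n. x (r 0) + (\<Sum>k<n. d k)) \<longlonglongrightarrow> l" unfolding l_def by (intro tendsto_intros sd)
  have yI: "x (r 0) + (\<Sum>k<n. d k) - x (r n) \<in> I" for n
  proof (induction n)
    case (Suc n)
    have "x (r 0) + (\<Sum>k<Suc n. d k) - x (r (Suc n))
      = (x (r 0) + (\<Sum>k<n. d k) - x (r n)) + (d n - (x (r (Suc n)) - x (r n)))" by simp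
    then show ?case using csub_add[OF I_csub Suc d(1)[of n]] by metis
  qed (simp add: csub_0[OF I_csub])
  have dS: "d k \<in> S" for k
    using cos_in_S[of "x (r (Suc k)) - x (r k)" "d k"] d(1) x csub_diff[OF S] by (simp add: cos_mem)
  have lS: "l \<in> S" by (rule csub_limit[OF S yl]) (auto intro!: csub_add[OF S] csub_sum[OF S] x dS)
  have "(\<lambda>n. qnorm I (x n - l)) \<longlonglongrightarrow> 0"
    unfolding LIMSEQ_def
  proof (intro allI impI)
    fix e :: real assume e: "e > 0"
    obtain M where M: "\<forall>m\<ge>M. \<forall>n\<ge>M. qnorm I (x m - x n) < e / 2" using C[of "e/2"] e by auto
    have "(\<lambda>n. norm (x (r 0) + (\<Sum>k<n. d k) - l)) \<longlonglongrightarrow> norm (l - l)" by (intro tendsto_intros yl)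
    then have "\<forall>\<^sub>F n in sequentially. norm (x (r 0) + (\<Sum>k<n. d k) - l) < e / 2"
      by (rule order_tendstoD) (use e in simp)
    then obtain P where P: "\<And>n. n \<ge> P \<Longrightarrow> norm (x (r 0) + (\<Sum>k<n. d k) - l) < e / 2"
      by (auto simp: eventually_sequentially)
    define n where "n = max P M"
    have rn: "M \<le> r n" by (simp add: r_def n_def)
    have "qnorm I (x m - l) < e" if "m \<ge> M" for m
    proof -
      have "qnorm I (x m - l) \<le> qnorm I (x m - x (r n)) + qnorm I (x (r n) - l)"
        using qnorm_triangle[of "x m - x (r n)" "x (r n) - l"] by simp
      also have "qnorm I (x m - x (r n)) < e / 2" using M that rn by blast
      also have "qnorm I (x (r n) - l) \<le> norm (x (r 0) + (\<Sum>k<n. d k) - l)"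
        using yI[of n] by (intro qnorm_le) (simp add: algebra_simps)
      also have "\<dots> < e / 2" by (rule P) (simp add: n_def)
      finally show ?thesis by simp
    qed
    then show "\<exists>no. \<forall>n\<ge>no. dist (qnorm I (x n - l)) 0 < e" by (auto simp: qnorm_nonneg)
  qed
  then show ?thesis using lS by blast
qed

lemma quotient_uminus:
  assumes "x \<in> S" "abelian_group (cquotient (crec S) I)"
  shows "\<ominus>\<^bsub>cquotient (crec S) I\<^esub> icoset I x = icoset I (- x)"
  by (rule abelian_group.minus_equality[OF assms(2)])
    (use assms S in \<open>auto simp: quotient_add quotient_zero quotient_carrier csub_mem\<close>)

lemma cstar_algebra_quotient: "cstar_algebra (cquotient (crec S) I)"
proof -
  let ?Q = "cquotient (crec S) I"
  note q = quotient_add quotient_mult quotient_smult quotient_adj quotient_norm quotient_zero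
  have ab: "abelian_group ?Q"
  proof (rule abelian_groupI)
    fix X assume "X \<in> carrier ?Q"
    then obtain x where x: "x \<in> S" "X = icoset I x" by (auto simp: quotient_carrier)
    then show "\<zero>\<^bsub>?Q\<^esub> \<oplus>\<^bsub>?Q\<^esub> X = X" by (simp add: q)
    show "\<exists>Y\<in>carrier ?Q. Y \<oplus>\<^bsub>?Q\<^esub> X = \<zero>\<^bsub>?Q\<^esub>"
      using x S by (intro bexI[of _ "icoset I (- x)"]) (auto simp: q quotient_carrier csub_mem)
  qed (use S in \<open>auto simp: quotient_carrier q csub_mem ac_simps intro!: imageI\<close>)
  have dist: "icoset I x \<ominus>\<^bsub>?Q\<^esub> icoset I y = icoset I (x - y)" if "x \<in> S" "y \<in> S" for x y
    using that abelian_group.minus_eq[OF ab] by (simp add: quotient_uminus[OF _ ab] q)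
  have cd: "cdist ?Q (icoset I x) (icoset I y) = qnorm I (x - y)" if "x \<in> S" "y \<in> S" for x y
    using that dist[OF that] by (auto simp: cdist_def quotient_carrier q)
  have qsym: "qnorm I (x - y) = qnorm I (y - x)" for x y
    using qnorm_scaleC[of "-1" "x - y"] by (simp add: scaleC_minus_one)
  have M: "Metric_space (carrier ?Q) (cdist ?Q)"
  proof
    show "0 \<le> cdist ?Q X Y" for X Y
      by (auto simp: cdist_def quotient_carrier dist q qnorm_nonneg)
    show "cdist ?Q X Y = cdist ?Q Y X" for X Y
      using qsym by (auto simp: cdist_def quotient_carrier dist q)
    show "cdist ?Q X Y = 0 \<longleftrightarrow> X = Y" if "X \<in> carrier ?Q" "Y \<in> carrier ?Q" for X Y
    proof -
      obtain x y where "x \<in> S" "X = icoset I x" "y \<in> S" "Y = icoset I y"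
        using \<open>X \<in> carrier ?Q\<close> \<open>Y \<in> carrier ?Q\<close> by (auto simp: quotient_carrier)
      then show ?thesis by (simp add: cd qnorm_zero cos_eq)
    qed
    show "cdist ?Q X Z \<le> cdist ?Q X Y + cdist ?Q Y Z"
      if "X \<in> carrier ?Q" "Y \<in> carrier ?Q" "Z \<in> carrier ?Q" for X Y Z
    proof -
      obtain x y z where "x \<in> S" "X = icoset I x" "y \<in> S" "Y = icoset I y" "z \<in> S" "Z = icoset I z"
        using \<open>X \<in> carrier ?Q\<close> \<open>Y \<in> carrier ?Q\<close> \<open>Z \<in> carrier ?Q\<close> by (auto simp: quotient_carrier)
      then show ?thesis using qnorm_triangle[of "x - y" "y - z"] by (simp add: cd)
    qed
  qed
  have comp: "Metric_space.mcomplete (carrier ?Q) (cdist ?Q)"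
  proof (rule mcompleteI[OF M])
    fix X :: "nat \<Rightarrow> 't set" assume X: "\<And>n. X n \<in> carrier ?Q"
      and C: "\<And>e. e > 0 \<Longrightarrow> \<exists>N. \<forall>m\<ge>N. \<forall>n\<ge>N. cnorm ?Q (X m \<ominus>\<^bsub>?Q\<^esub> X n) < e"
    obtain x where x: "\<And>n. x n \<in> S" "\<And>n. X n = icoset I (x n)"
      using X unfolding quotient_carrier image_iff Bex_def by metis
    have "\<exists>l\<in>S. (\<lambda>n. qnorm I (x n - l)) \<longlonglongrightarrow> 0"
      by (rule qnorm_complete[OF x(1)]) (use C in \<open>simp add: x dist q\<close>)
    then obtain l where "l \<in> S" "(\<lambda>n. qnorm I (x n - l)) \<longlonglongrightarrow> 0" by blast
    then show "\<exists>Y\<in>carrier ?Q. (\<lambda>n. cnorm ?Q (X n \<ominus>\<^bsub>?Q\<^esub> Y)) \<longlonglongrightarrow> 0"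
      by (intro bexI[of _ "icoset I l"]) (simp_all add: x dist q quotient_carrier)
  qed
  show ?thesis
    unfolding cstar_algebra_def cstar_algebra_axioms_def
  proof (intro conjI allI impI ab comp)
    fix X Y assume "X \<in> carrier ?Q" "Y \<in> carrier ?Q"
    then obtain x y where "x \<in> S" "y \<in> S" "X = icoset I x" "Y = icoset I y" by (auto simp: quotient_carrier)
    then show "cnorm ?Q (X \<oplus>\<^bsub>?Q\<^esub> Y) \<le> cnorm ?Q X + cnorm ?Q Y" "cnorm ?Q (X \<otimes>\<^bsub>?Q\<^esub> Y) \<le> cnorm ?Q X * cnorm ?Q Y"
      by (simp_all add: q qnorm_triangle qnorm_mult)
  next
    fix X assume "X \<in> carrier ?Q"
    then obtain x where x: "x \<in> S" "X = icoset I x" by (auto simp: quotient_carrier)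
    then show "cnorm ?Q X = 0 \<longleftrightarrow> X = \<zero>\<^bsub>?Q\<^esub>" by (simp add: q qnorm_zero cos_eq)
    show "cnorm ?Q (adj ?Q X \<otimes>\<^bsub>?Q\<^esub> X) = (cnorm ?Q X)\<^sup>2" using x S by (simp add: q csub_mem qnorm_star_mult)
  qed (use S in \<open>auto simp: quotient_carrier q csub_mem qnorm_scaleC qnorm_nonneg star_star mult.assoc distrib_left
      distrib_right scaleC_add_left scaleC_add_right scaleC_scaleC scaleC_mult_left scaleC_mult_right star_add
      star_mult star_scaleC intro!: imageI\<close>)
qed

end

text \<open>The quotient map with values in a type again.\<close>
definition qhom :: "'t::uc_star set \<Rightarrow> 't set \<Rightarrow> 't \<Rightarrow> 't set uni" where
  "qhom S I x = emb (cquotient (crec S) I) (icoset I x)"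

lemma
  assumes S: "csub S" and I: "cideal I S"
  shows chom_qhom: "chom S (qhom S I)" and qhom_eq_0: "x \<in> S \<Longrightarrow> qhom S I x = 0 \<longleftrightarrow> x \<in> I"
    and csub_qhom: "csub (qhom S I ` S)"
proof -
  let ?Q = "cquotient (crec S) I"
  have e: "star_embedding ?Q (emb ?Q)" by (rule star_embedding_emb[OF cstar_algebra_quotient[OF S I]])
  note D = star_embeddingD[OF e]
  note q = quotient_add[OF S I] quotient_mult[OF S I] quotient_smult[OF S I] quotient_adj[OF S I]
  have c: "icoset I x \<in> carrier ?Q" if "x \<in> S" for x using that by (simp add: quotient_carrier[OF S I])
  show "chom S (qhom S I)"
    using c D(7,8,11,12) by (simp add: chom_def qhom_def flip: q)
  show "csub (qhom S I ` S)"
    using D(2) unfolding quotient_carrier[OF S I] qhom_def image_image .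
  show "qhom S I x = 0 \<longleftrightarrow> x \<in> I" if x: "x \<in> S"
  proof -
    have "qhom S I x = 0 \<longleftrightarrow> icoset I x = icoset I 0"
      using inj_on_eq_iff[OF D(1) c[OF x] c[OF csub_0[OF S]]] D(4)
      by (simp add: qhom_def quotient_zero[OF S I])
    then show ?thesis by (simp add: cos_eq[OF S I])
  qed
qed

lemma chom_factor:
  fixes \<phi> :: "'a::uc_star \<Rightarrow> 'b::uc_star" and \<pi> :: "'a \<Rightarrow> 'd::uc_star"
  assumes S: "csub S" and h: "chom S \<phi>" "chom S \<pi>" and k: "\<And>x. x \<in> S \<Longrightarrow> \<pi> x = 0 \<Longrightarrow> \<phi> x = 0"
  obtains \<psi> where "chom (\<pi> ` S) \<psi>" "\<And>x. x \<in> S \<Longrightarrow> \<psi> (\<pi> x) = \<phi> x"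
proof -
  define \<psi> where "\<psi> y = \<phi> (inv_into S \<pi> y)" for y
  have e: "\<psi> (\<pi> x) = \<phi> x" if x: "x \<in> S" for x
  proof -
    define y where "y = inv_into S \<pi> (\<pi> x)"
    have y: "y \<in> S" "\<pi> y = \<pi> x" using x by (auto simp: y_def inv_into_into f_inv_into_f)
    then have "\<phi> (y - x) = 0" using x S by (intro k) (auto simp: csub_mem chom_diff[OF S h(2)])
    then show ?thesis using x y(1) by (simp add: chom_diff[OF S h(1)] \<psi>_def y_def)
  qed
  have "chom (\<pi> ` S) \<psi>"
    unfolding chom_def using S
    by (auto simp: e csub_mem chom_add[OF h(1)] chom_mult[OF h(1)] chom_star[OF h(1)] chom_scaleC[OF h(1)]
        simp flip: chom_add[OF h(2)] chom_mult[OF h(2)] chom_star[OF h(2)] chom_scaleC[OF h(2)])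
  then show ?thesis using that e by blast
qed

lemma chom_image_iso:
  fixes \<phi> :: "'a::uc_star \<Rightarrow> 'b::uc_star" and \<pi> :: "'a \<Rightarrow> 'd::uc_star"
  assumes S: "csub S" and h: "chom S \<phi>" "chom S \<pi>" and k: "\<And>x. x \<in> S \<Longrightarrow> \<pi> x = 0 \<longleftrightarrow> \<phi> x = 0"
    and c: "csub (\<pi> ` S)"
  obtains \<psi> where "chom (\<pi> ` S) \<psi>" "\<And>x. x \<in> S \<Longrightarrow> \<psi> (\<pi> x) = \<phi> x" "inj_on \<psi> (\<pi> ` S)" "\<psi> ` \<pi> ` S = \<phi> ` S"
proof -
  obtain \<psi> where \<psi>: "chom (\<pi> ` S) \<psi>" "\<And>x. x \<in> S \<Longrightarrow> \<psi> (\<pi> x) = \<phi> x"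
    using chom_factor[OF S h] k by metis
  have "inj_on \<psi> (\<pi> ` S)" by (rule chom_inj_onI[OF c \<psi>(1)]) (use k \<psi>(2) in auto)
  moreover have "\<psi> ` \<pi> ` S = \<phi> ` S" using \<psi>(2) by (auto simp: image_image)
  ultimately show ?thesis using that \<psi> by blast
qed

text \<open>The image is an isometric copy of the quotient by the kernel, hence complete.\<close>
lemma csub_image:
  fixes \<phi> :: "'a::uc_star \<Rightarrow> 'b::uc_star"
  assumes S: "csub S" and h: "chom S \<phi>" shows "csub (\<phi> ` S)"
proof -
  define I where "I = {x\<in>S. \<phi> x = 0}"
  have I: "cideal I S" unfolding I_def by (rule chom_kernel_cideal[OF S h])
  have k: "qhom S I x = 0 \<longleftrightarrow> \<phi> x = 0" if "x \<in> S" for x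
    unfolding qhom_eq_0[OF S I that] using that by (simp add: I_def)
  obtain \<psi> where \<psi>: "chom (qhom S I ` S) \<psi>" "inj_on \<psi> (qhom S I ` S)" "\<psi> ` qhom S I ` S = \<phi> ` S"
    using chom_image_iso[OF S h chom_qhom[OF S I] k csub_qhom[OF S I]] by metis
  show ?thesis using chom_inj_image_csub[OF csub_qhom[OF S I] \<psi>(1,2)] \<psi>(3) by simp
qed

lemma hered_image_iff_kernel:
  fixes \<phi> :: "'a::uc_star \<Rightarrow> 'b::uc_star" and \<pi> :: "'a \<Rightarrow> 'd::uc_star"
  assumes S: "csub S" and h: "chom S \<phi>" "chom S \<pi>" and k: "\<And>x. x \<in> S \<Longrightarrow> \<pi> x = 0 \<longleftrightarrow> \<phi> x = 0"
    and "hered \<C> (\<pi> ` S)"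
  shows "hered \<C> (\<phi> ` S)"
proof -
  obtain \<psi> where \<psi>: "chom (\<pi> ` S) \<psi>" "\<And>x. x \<in> S \<Longrightarrow> \<psi> (\<pi> x) = \<phi> x" "inj_on \<psi> (\<pi> ` S)" "\<psi> ` \<pi> ` S = \<phi> ` S"
    using chom_image_iso[OF S h k hered_csub[OF assms(5)]] by metis
  show ?thesis using hered_inj_image[OF assms(5) \<psi>(1,3)] \<psi>(4) by simp
qed

text \<open>Residual hereditary membership for closed subalgebras of a type.\<close>
definition reshered :: "'c cstar set \<Rightarrow> 't::uc_star set \<Rightarrow> bool" where
  "reshered \<C> S \<longleftrightarrow> csub S \<and> (\<forall>J. cideal J S \<and> J \<noteq> S \<longrightarrow> hered \<C> (qhom S J ` S))"

lemma reshered_csub: "reshered \<C> S \<Longrightarrow> csub S" by (simp add: reshered_def)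

lemma reshered_image:
  fixes \<phi> :: "'a::uc_star \<Rightarrow> 'b::uc_star"
  assumes S: "reshered \<C> S" and h: "chom S \<phi>" shows "hered \<C> (\<phi> ` S)"
proof -
  have cS: "csub S" using S by (rule reshered_csub)
  define I where "I = {x\<in>S. \<phi> x = 0}"
  have I: "cideal I S" unfolding I_def by (rule chom_kernel_cideal[OF cS h])
  show ?thesis
  proof (cases "I = S")
    case True
    then have "\<phi> ` S = {0}" using csub_0[OF cS] by (force simp: I_def)
    then show ?thesis by (simp add: hered_trivial)
  next
    case False
    then have "hered \<C> (qhom S I ` S)" using S I by (simp add: reshered_def)
    moreover have "qhom S I x = 0 \<longleftrightarrow> \<phi> x = 0" if "x \<in> S" for x
      unfolding qhom_eq_0[OF cS I that] using that by (simp add: I_def)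
    ultimately show ?thesis using hered_image_iff_kernel[OF cS h chom_qhom[OF cS I]] by simp
  qed
qed

lemma reshered_hered: "reshered \<C> S \<Longrightarrow> hered \<C> S"
  using reshered_image[OF _ chom_id] by simp

lemma star_embedding_comp:
  assumes e: "star_embedding Q e" and F: "inj_on F (carrier B)" "F ` carrier B = carrier Q"
    and z: "\<zero>\<^bsub>B\<^esub> \<in> carrier B" "F \<zero>\<^bsub>B\<^esub> = \<zero>\<^bsub>Q\<^esub>"
    and a: "\<And>x y. x \<in> carrier B \<Longrightarrow> y \<in> carrier B \<Longrightarrow> x \<oplus>\<^bsub>B\<^esub> y \<in> carrier B \<and> F (x \<oplus>\<^bsub>B\<^esub> y) = F x \<oplus>\<^bsub>Q\<^esub> F y"
    and m: "\<And>x y. x \<in> carrier B \<Longrightarrow> y \<in> carrier B \<Longrightarrow> x \<otimes>\<^bsub>B\<^esub> y \<in> carrier B \<and> F (x \<otimes>\<^bsub>B\<^esub> y) = F x \<otimes>\<^bsub>Q\<^esub> F y"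
    and s: "\<And>x c. x \<in> carrier B \<Longrightarrow> c \<odot>\<^bsub>B\<^esub> x \<in> carrier B \<and> F (c \<odot>\<^bsub>B\<^esub> x) = c \<odot>\<^bsub>Q\<^esub> F x"
    and j: "\<And>x. x \<in> carrier B \<Longrightarrow> adj B x \<in> carrier B \<and> F (adj B x) = adj Q (F x) \<and> cnorm B x = cnorm Q (F x)"
  shows "star_embedding B (\<lambda>x. e (F x))"
proof -
  note D = star_embeddingD[OF e]
  have FQ: "F x \<in> carrier Q" if "x \<in> carrier B" for x using F(2) that by auto
  have "inj_on (\<lambda>x. e (F x)) (carrier B)" using comp_inj_on[OF F(1), of e] D(1) F(2) by (simp add: comp_def)
  moreover have "csub ((\<lambda>x. e (F x)) ` carrier B)" using D(2) F(2) by (simp add: image_image[symmetric])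
  ultimately show ?thesis
    unfolding star_embedding_def using z a m s j by (simp add: FQ D)
qed

text \<open>Reduces the quotient of an arbitrary structure to the quotient of its image in a type.\<close>
lemma star_embedding_cquotient:
  assumes f: "star_embedding A f" and I: "I \<subseteq> carrier A" "cideal (f ` I) (f ` carrier A)"
  defines "S \<equiv> f ` carrier A" and "J \<equiv> f ` I"
  shows "star_embedding (cquotient A I) (\<lambda>X. emb (cquotient (crec S) J) (f ` X))"
    and "(\<lambda>X. emb (cquotient (crec S) J) (f ` X)) ` carrier (cquotient A I) = qhom S J ` S"
proof -
  note D = star_embeddingD[OF f]
  have S: "csub S" using D(2) by (simp add: S_def)
  have J: "cideal J S" using I(2) by (simp add: S_def J_def)
  let ?Q = "cquotient (crec S) J" and ?B = "cquotient A I"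
  have IA: "x \<in> I \<Longrightarrow> x \<in> carrier A" for x using I by auto
  have cosub: "I +>\<^bsub>A\<^esub> x \<subseteq> carrier A" if "x \<in> carrier A" for x
    using that D(5) IA by (auto simp: a_r_coset_def r_coset_def)
  have fcos: "f ` (I +>\<^bsub>A\<^esub> x) = icoset J (f x)" if "x \<in> carrier A" for x
    using that D(7) IA by (auto simp: a_r_coset_def r_coset_def icoset_def J_def image_iff)
  have cB: "carrier ?B = (\<lambda>x. I +>\<^bsub>A\<^esub> x) ` carrier A"
    by (auto simp: cquotient_def A_RCOSETS_def RCOSETS_def a_r_coset_def)
  have sub: "X \<subseteq> carrier A" if "X \<in> carrier ?B" for X using that cosub by (auto simp: cB)
  have img: "(`) f ` carrier ?B = carrier ?Q"
    unfolding cB quotient_carrier[OF S J] unfolding S_def image_image by (rule image_cong[OF refl fcos])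
  have inj: "inj_on ((`) f) (carrier ?B)"
    using inj_on_image_eq_iff[OF D(1)] sub by (intro inj_onI) blast
  have mem: "X \<in> carrier ?B" if X: "X \<subseteq> carrier A" "f ` X \<in> carrier ?Q" for X
  proof -
    obtain Y where "Y \<in> carrier ?B" "f ` X = f ` Y" using X(2) unfolding img[symmetric] by auto
    then show ?thesis using inj_on_image_eq_iff[OF D(1) X(1)] sub by metis
  qed
  have eQ: "star_embedding ?Q (emb ?Q)" by (rule star_embedding_emb[OF cstar_algebra_quotient[OF S J]])
  note Q = star_embeddingD[OF eQ]
  have fQ: "f ` X \<in> carrier ?Q" if "X \<in> carrier ?B" for X using img that by auto
  have add: "X \<oplus>\<^bsub>?B\<^esub> Y \<subseteq> carrier A \<and> f ` (X \<oplus>\<^bsub>?B\<^esub> Y) = f ` X \<oplus>\<^bsub>?Q\<^esub> f ` Y"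
    if "X \<in> carrier ?B" "Y \<in> carrier ?B" for X Y
  proof -
    have "X \<oplus>\<^bsub>?B\<^esub> Y = (\<Union>a\<in>X. \<Union>b\<in>Y. {a \<oplus>\<^bsub>A\<^esub> b})" by (simp add: cquotient_def set_add_def set_mult_def)
    moreover have "f ` X \<oplus>\<^bsub>?Q\<^esub> f ` Y = (\<Union>a\<in>X. \<Union>b\<in>Y. {f a + f b})"
      by (simp add: cquotient_def set_add_def set_mult_def crec_def)
    ultimately show ?thesis using D(5,7) sub[OF that(1)] sub[OF that(2)]
      by (auto simp: subset_iff image_UN)
  qed
  have mul: "X \<otimes>\<^bsub>?B\<^esub> Y \<subseteq> carrier A \<and> f ` (X \<otimes>\<^bsub>?B\<^esub> Y) = f ` X \<otimes>\<^bsub>?Q\<^esub> f ` Y"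
    if "X \<in> carrier ?B" "Y \<in> carrier ?B" for X Y
  proof -
    have 1: "X \<otimes>\<^bsub>?B\<^esub> Y = (\<Union>a\<in>X. \<Union>b\<in>Y. I +>\<^bsub>A\<^esub> (a \<otimes>\<^bsub>A\<^esub> b))" by (simp add: cquotient_def rcoset_mult_def)
    have 2: "f ` X \<otimes>\<^bsub>?Q\<^esub> f ` Y = (\<Union>a\<in>X. \<Union>b\<in>Y. icoset J (f a * f b))"
      by (simp add: cquotient_def rcoset_mult_def r_coset_eq[OF S J])
    have 3: "f ` (I +>\<^bsub>A\<^esub> (a \<otimes>\<^bsub>A\<^esub> b)) = icoset J (f a * f b)" "I +>\<^bsub>A\<^esub> (a \<otimes>\<^bsub>A\<^esub> b) \<subseteq> carrier A" if "a \<in> X" "b \<in> Y" for a b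
    proof -
      have "a \<in> carrier A" "b \<in> carrier A" using that sub \<open>X \<in> carrier ?B\<close> \<open>Y \<in> carrier ?B\<close> by auto
      then show "f ` (I +>\<^bsub>A\<^esub> (a \<otimes>\<^bsub>A\<^esub> b)) = icoset J (f a * f b)" "I +>\<^bsub>A\<^esub> (a \<otimes>\<^bsub>A\<^esub> b) \<subseteq> carrier A"
        using fcos cosub D(6,8) by auto
    qed
    show ?thesis unfolding 1 2 by (simp add: image_UN UN_subset_iff 3 cong: SUP_cong)
  qed
  have sm: "c \<odot>\<^bsub>?B\<^esub> X \<subseteq> carrier A \<and> f ` (c \<odot>\<^bsub>?B\<^esub> X) = c \<odot>\<^bsub>?Q\<^esub> f ` X" if "X \<in> carrier ?B" for X c
  proof -
    have 1: "c \<odot>\<^bsub>?B\<^esub> X = (\<Union>a\<in>X. I +>\<^bsub>A\<^esub> (c \<odot>\<^bsub>A\<^esub> a))" by (simp add: cquotient_def)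
    have 2: "c \<odot>\<^bsub>?Q\<^esub> f ` X = (\<Union>a\<in>X. icoset J (c *\<^sub>C f a))" by (simp add: cquotient_def r_coset_eq[OF S J])
    have 3: "f ` (I +>\<^bsub>A\<^esub> (c \<odot>\<^bsub>A\<^esub> a)) = icoset J (c *\<^sub>C f a)" "I +>\<^bsub>A\<^esub> (c \<odot>\<^bsub>A\<^esub> a) \<subseteq> carrier A" if "a \<in> X" for a
    proof -
      have aA: "a \<in> carrier A" using that sub[OF \<open>X \<in> carrier ?B\<close>] by auto
      show "f ` (I +>\<^bsub>A\<^esub> (c \<odot>\<^bsub>A\<^esub> a)) = icoset J (c *\<^sub>C f a)" "I +>\<^bsub>A\<^esub> (c \<odot>\<^bsub>A\<^esub> a) \<subseteq> carrier A"
        by (simp_all add: fcos cosub D aA)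
    qed
    show ?thesis unfolding 1 2 by (simp add: image_UN UN_subset_iff 3 cong: SUP_cong)
  qed
  have ad: "adj ?B X \<subseteq> carrier A \<and> f ` (adj ?B X) = adj ?Q (f ` X)" if "X \<in> carrier ?B" for X
  proof -
    have 1: "adj ?B X = (\<Union>a\<in>X. I +>\<^bsub>A\<^esub> (adj A a))" by (simp add: cquotient_def)
    have 2: "adj ?Q (f ` X) = (\<Union>a\<in>X. icoset J (star (f a)))" by (simp add: cquotient_def r_coset_eq[OF S J])
    have 3: "f ` (I +>\<^bsub>A\<^esub> (adj A a)) = icoset J (star (f a))" "I +>\<^bsub>A\<^esub> (adj A a) \<subseteq> carrier A" if "a \<in> X" for a
    proof -
      have aA: "a \<in> carrier A" using that sub[OF \<open>X \<in> carrier ?B\<close>] by auto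
      show "f ` (I +>\<^bsub>A\<^esub> (adj A a)) = icoset J (star (f a))" "I +>\<^bsub>A\<^esub> (adj A a) \<subseteq> carrier A"
        by (simp_all add: fcos cosub D aA)
    qed
    show ?thesis unfolding 1 2 by (simp add: image_UN UN_subset_iff 3 cong: SUP_cong)
  qed
  have no: "cnorm ?B X = cnorm ?Q (f ` X)" if "X \<in> carrier ?B" for X
  proof -
    have "cnorm A ` X = norm ` f ` X" using D(13) sub[OF that] by (auto simp: image_image intro!: image_cong)
    then show ?thesis by (simp add: cquotient_def)
  qed
  have ze: "f ` \<zero>\<^bsub>?B\<^esub> = \<zero>\<^bsub>?Q\<^esub>" by (simp add: cquotient_def J_def)
  have zc: "\<zero>\<^bsub>?B\<^esub> \<subseteq> carrier A" using I(1) by (simp add: cquotient_def)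
  show "star_embedding ?B (\<lambda>X. emb ?Q (f ` X))"
    using add mul sm ad ze zc no Q(3,5,6,9,10) fQ
    by (intro star_embedding_comp[OF eQ inj img] conjI mem) auto
  show "(\<lambda>X. emb ?Q (f ` X)) ` carrier ?B = qhom S J ` S"
    using arg_cong[OF img, of "(`) (emb ?Q)"]
    by (simp only: qhom_def[abs_def] quotient_carrier[OF S J] image_image)
qed

lemma residually_hereditarily_in_iff:
  fixes f :: "'a \<Rightarrow> 't::uc_star"
  assumes f: "star_embedding A f"
  shows "residually_hereditarily_in \<C> A \<longleftrightarrow> reshered \<C> (f ` carrier A)"
proof -
  let ?S = "f ` carrier A"
  note D = star_embeddingD[OF f]
  have eq: "hereditarily_in \<C> (cquotient A I) \<longleftrightarrow> hered \<C> (qhom ?S (f ` I) ` ?S)"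
    if I: "I \<subseteq> carrier A" "cideal (f ` I) ?S" for I
    using hereditarily_in_iff[OF star_embedding_cquotient(1)[OF f I]] star_embedding_cquotient(2)[OF f I] by simp
  have ne: "I = carrier A \<longleftrightarrow> f ` I = ?S" if "I \<subseteq> carrier A" for I
    using inj_on_image_eq_iff[OF D(1) that, of "carrier A"] by auto
  show ?thesis
  proof
    assume r: "residually_hereditarily_in \<C> A"
    have "hered \<C> (qhom ?S J ` ?S)" if J: "cideal J ?S" "J \<noteq> ?S" for J
    proof -
      obtain I where I: "I \<subseteq> carrier A" "J = f ` I" using J(1) unfolding cideal_def by (meson subset_imageE)
      have "closed_ideal I A" "I \<noteq> carrier A" using closed_ideal_iff[OF f] I J by auto
      then show ?thesis using r eq[OF I(1)] J(1) unfolding I(2) residually_hereditarily_in_def by blast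
    qed
    then show "reshered \<C> ?S" using D(2) by (simp add: reshered_def)
  next
    assume r: "reshered \<C> ?S"
    have "hereditarily_in \<C> (cquotient A I)" if "closed_ideal I A" "I \<noteq> carrier A" for I
    proof -
      have I: "I \<subseteq> carrier A" "cideal (f ` I) ?S" using closed_ideal_iff[OF f] that(1) by auto
      then show ?thesis using eq[OF I] r ne that(2) by (simp add: reshered_def)
    qed
    then show "residually_hereditarily_in \<C> A"
      using star_embedding_cstar_algebra[OF f] by (simp add: residually_hereditarily_in_def)
  qed
qed

section \<open>Fixed points of an involution\<close>

definition fixed :: "('t \<Rightarrow> 't) \<Rightarrow> 't set \<Rightarrow> 't set" where
  "fixed \<sigma> S = {x\<in>S. \<sigma> x = x}"

definition invol :: "('t::uc_star \<Rightarrow> 't) \<Rightarrow> 't set \<Rightarrow> bool" where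
  "invol \<sigma> S \<longleftrightarrow> csub S \<and> chom S \<sigma> \<and> (\<forall>x\<in>S. \<sigma> x \<in> S \<and> \<sigma> (\<sigma> x) = x)"

lemma chom_tendsto:
  fixes \<phi> :: "'a::uc_star \<Rightarrow> 'b::uc_star"
  assumes S: "csub S" and h: "chom S \<phi>" and x: "\<And>n. x n \<in> S" "x \<longlonglongrightarrow> l"
  shows "(\<lambda>n. \<phi> (x n)) \<longlonglongrightarrow> \<phi> l"
  by (rule continuous_on_tendsto_compose[OF chom_continuous_on[OF S h] x(2)])
    (use csub_limit[OF S x(2,1)] x(1) in auto)

lemma csub_fixed:
  assumes S: "csub S" and h: "chom S \<sigma>" shows "csub (fixed \<sigma> (S::'t::uc_star set))"
proof -
  have "closed (fixed \<sigma> S)"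
  proof (subst closed_sequential_limits, intro allI impI, elim conjE)
    fix x l assume x: "\<forall>n. x n \<in> fixed \<sigma> S" and l: "x \<longlonglongrightarrow> l"
    have xS: "\<And>n. x n \<in> S" using x by (simp add: fixed_def)
    have "(\<lambda>n. \<sigma> (x n)) \<longlonglongrightarrow> \<sigma> l" by (rule chom_tendsto[OF S h xS l])
    then have "x \<longlonglongrightarrow> \<sigma> l" using x by (simp add: fixed_def)
    from LIMSEQ_unique[OF l this] have "\<sigma> l = l" by (rule sym)
    then show "l \<in> fixed \<sigma> S" using csub_limit[OF S l xS] by (simp add: fixed_def)
  qed
  then show ?thesis using S
    by (auto simp: csub_def fixed_def chom_0[OF S h] chom_add[OF h] chom_mult[OF h] chom_star[OF h] chom_scaleC[OF h])
qed

lemma chom_pos: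
  fixes \<phi> :: "'a::uc_star \<Rightarrow> 'b::uc_star"
  assumes S: "csub S" and h: "chom S \<phi>" and a: "a \<in> S" "pos a"
  shows "pos (\<phi> a)"
proof -
  obtain r where r: "r \<in> S" "pos r" "r * r = a" using csub_pos_sqrt[OF S a] by metis
  have "\<phi> a = star (\<phi> r) * \<phi> r" using r by (simp add: chom_mult[OF h] pos_star flip: chom_star[OF h] r(3))
  then show ?thesis using pos_star_mult by metis
qed

lemma invol_facts:
  assumes "invol \<sigma> S"
  shows "csub S" "chom S \<sigma>" "\<And>x. x \<in> S \<Longrightarrow> \<sigma> x \<in> S" "\<And>x. x \<in> S \<Longrightarrow> \<sigma> (\<sigma> x) = x"
  using assms by (auto simp: invol_def)

text \<open>The difference \<open>y = x - \<sigma> x\<close> is odd. Its real part is self-adjoint and odd; when that vanishes,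
  \<open>\<i> y\<close> is self-adjoint.\<close>
lemma odd_self_adjoint:
  assumes s: "invol \<sigma> K" and x: "x \<in> K" "\<sigma> x \<noteq> x"
  obtains z where "z \<in> K" "star z = z" "\<sigma> z = - z" "z \<noteq> 0"
proof -
  note I = invol_facts[OF s]
  note h = chom_add[OF I(2)] chom_diff[OF I(1,2)] chom_star[OF I(2)] chom_scaleC[OF I(2)]
  define y where "y = x - \<sigma> x"
  have y: "y \<in> K" "\<sigma> y = - y" "y \<noteq> 0" using x I by (simp_all add: y_def csub_mem h)
  show ?thesis
  proof (cases "y + star y = 0")
    case False
    show ?thesis by (rule that[of "y + star y"]) (use y False I(1) in \<open>auto simp: h csub_mem star_add star_star\<close>)
  next
    case True
    then have sy: "star y = - y" by (simp add: add_eq_0_iff)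
    have "\<i> *\<^sub>C y \<noteq> 0"
      using y(3) scaleC_scaleC[of "-\<i>" \<i> y] by auto
    then show ?thesis
      by (intro that[of "\<i> *\<^sub>C y"]) (use y sy I(1) in \<open>auto simp: h csub_mem star_scaleC\<close>)
  qed
qed

text \<open>The absolute value \<open>m = \<bar>z\<bar>\<close> is fixed because roots are unique, so \<open>a = m + z\<close> has \<open>\<sigma> a = m - z\<close> and
  \<open>a * \<sigma> a = m\<^sup>2 - z\<^sup>2 = 0\<close>.\<close>
lemma orthogonal_to_image:
  fixes K :: "'t::uc_star set"
  assumes s: "invol \<sigma> K" and z: "z \<in> K" "star z = z" "\<sigma> z = - z" "z \<noteq> 0"
  obtains a where "a \<in> K" "star a = a" "a \<noteq> 0" "a * \<sigma> a = 0"
proof -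
  note I = invol_facts[OF s]
  have zz: "z * z \<in> K" using z I by (simp add: csub_mem)
  obtain m where m: "m \<in> K" "pos m" "m * m = z * z" "\<And>W. sq_closed W \<Longrightarrow> z * z \<in> W \<Longrightarrow> m \<in> W"
    using csub_pos_sqrt[OF I(1) zz pos_sq[OF z(2)]] by metis
  have mz: "m * z = z * m"
    by (rule pos_sqrt_commute[OF pos_sq[OF z(2)] m(3,4)]) (simp_all add: mult.assoc)
  have sq: "\<sigma> m * \<sigma> m = m * m"
    using m(1,3) z by (simp flip: chom_mult[OF I(2)]) (simp add: chom_mult[OF I(2)])
  have "z * z * \<sigma> m = \<sigma> m * (z * z)"
    unfolding m(3)[symmetric] sq[symmetric] by (simp add: mult.assoc)
  \<comment> \<open>\<open>m\<close> and \<open>\<sigma> m\<close> are commuting positive roots of the same element\<close>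
  then have "m * \<sigma> m = \<sigma> m * m" using pos_sqrt_commute[OF pos_sq[OF z(2)] m(3,4)] by metis
  then have sm: "\<sigma> m = m"
    using pos_sq_unique[OF chom_pos[OF I(1,2) m(1,2)] m(2)] sq by simp
  show ?thesis
  proof (rule that[of "m + z"])
    show "m + z \<in> K" "star (m + z) = m + z" using m z I by (simp_all add: csub_mem star_add pos_star)
    have sa: "\<sigma> (m + z) = m - z" using m z sm by (simp add: chom_add[OF I(2)])
    show "(m + z) * \<sigma> (m + z) = 0" unfolding sa using mz m(3) by (simp add: algebra_simps)
    show "m + z \<noteq> 0"
    proof
      assume 0: "m + z = 0"
      then have "m - z = 0" using sa chom_0[OF I(1,2)] by simp
      then have "2 *\<^sub>R z = 0" using 0 by (simp add: scaleR_2)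
      then show False using z(4) by simp
    qed
  qed
qed

lemma invol_hclos:
  assumes s: "invol \<sigma> S" and b: "b \<in> S" "star b = b" "\<sigma> b = b"
  shows "invol \<sigma> (hclos b S)" and "fixed \<sigma> (hclos b S) \<subseteq> hclos b (fixed \<sigma> S)"
proof -
  note I = invol_facts[OF s]
  have her: "her (hclos b S) S" by (rule her_hclos[OF I(1) b(1,2)])
  then have K: "csub (hclos b S)" "hclos b S \<subseteq> S" by (auto simp: her_def)
  have seq: "\<exists>u. (\<forall>n. u n \<in> S) \<and> (\<lambda>n. b * u n * b) \<longlonglongrightarrow> x \<and> (\<lambda>n. b * \<sigma> (u n) * b) \<longlonglongrightarrow> \<sigma> x"
    if x: "x \<in> hclos b S" for x
  proof -
    obtain v where v: "\<And>n. v n \<in> (\<lambda>s. b * s * b) ` S" "v \<longlonglongrightarrow> x"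
      using x closure_sequential unfolding hclos_def by metis
    then obtain u where u: "\<And>n. u n \<in> S" "\<And>n. v n = b * u n * b" unfolding image_iff Bex_def by metis
    have vu: "v = (\<lambda>n. b * u n * b)" using u(2) by auto
    have vS: "v n \<in> S" for n using u b I by (simp add: csub_mem)
    have "(\<lambda>n. \<sigma> (v n)) \<longlonglongrightarrow> \<sigma> x" by (rule chom_tendsto[OF I(1,2) vS v(2)])
    moreover have "\<sigma> (v n) = b * \<sigma> (u n) * b" for n
      using u b I by (simp add: chom_mult[OF I(2)] csub_mem)
    ultimately show ?thesis using u(1) v(2) unfolding vu by auto
  qed
  have "\<sigma> x \<in> hclos b S" if x: "x \<in> hclos b S" for x
  proof -
    obtain u where u: "\<forall>n. u n \<in> S" "(\<lambda>n. b * \<sigma> (u n) * b) \<longlonglongrightarrow> \<sigma> x" using seq[OF x] by metis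
    have "\<forall>n. b * \<sigma> (u n) * b \<in> (\<lambda>s. b * s * b) ` S" using u(1) I(3) by simp
    then show ?thesis unfolding hclos_def closure_sequential
      by (intro exI[of _ "\<lambda>n. b * \<sigma> (u n) * b"] conjI u(2))
  qed
  then show "invol \<sigma> (hclos b S)" using K chom_subset[OF I(2) K(2)] I(4) by (auto simp: invol_def)
  show "fixed \<sigma> (hclos b S) \<subseteq> hclos b (fixed \<sigma> S)"
  proof
    fix x assume "x \<in> fixed \<sigma> (hclos b S)"
    then have x: "x \<in> hclos b S" "\<sigma> x = x" by (auto simp: fixed_def)
    obtain u where u: "\<And>n. u n \<in> S" "(\<lambda>n. b * u n * b) \<longlonglongrightarrow> x" "(\<lambda>n. b * \<sigma> (u n) * b) \<longlonglongrightarrow> \<sigma> x"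
      using seq[OF x(1)] by metis
    define w where "w n = (1/2) *\<^sub>R (u n + \<sigma> (u n))" for n
    have "(\<lambda>n. (1/2) *\<^sub>R (b * u n * b + b * \<sigma> (u n) * b)) \<longlonglongrightarrow> (1/2) *\<^sub>R (x + \<sigma> x)"
      by (intro tendsto_intros u)
    then have "(\<lambda>n. b * w n * b) \<longlonglongrightarrow> x"
      using x(2) by (simp add: w_def distrib_left distrib_right scaleR_2[symmetric])
    moreover have "w n \<in> fixed \<sigma> S" for n
      using u(1)[of n] I by (auto simp: w_def fixed_def csub_mem chom_scaleR[OF I(2)] chom_add[OF I(2)] add.commute)
    ultimately show "x \<in> hclos b (fixed \<sigma> S)" unfolding hclos_def closure_sequential
      by (intro exI[of _ "\<lambda>n. b * w n * b"] conjI) auto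
  qed
qed

text \<open>The closure of \<open>a K a\<close> is orthogonal to its image under \<open>\<sigma>\<close>, so the mixed terms in
  \<open>(h + \<sigma> h) (k + \<sigma> k)\<close> vanish.\<close>
lemma chom_add_orthogonal_image:
  fixes K :: "'t::uc_star set"
  assumes s: "invol \<sigma> K" and a: "a \<in> K" "star a = a" "a * \<sigma> a = 0"
  shows "chom (hclos a K) (\<lambda>h. h + \<sigma> h)" "inj_on (\<lambda>h. h + \<sigma> h) (hclos a K)"
    "(\<lambda>h. h + \<sigma> h) ` hclos a K \<subseteq> fixed \<sigma> K"
proof -
  note I = invol_facts[OF s]
  define H where "H = hclos a K"
  have her: "her H K" unfolding H_def by (rule her_hclos[OF I(1) a(1,2)])
  then have H: "csub H" "H \<subseteq> K" by (auto simp: her_def)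
  have sub: "x \<in> K" if "x \<in> H" for x using that H by auto
  have 1: "h * \<sigma> (a * v * a) = 0" if h: "h \<in> H" and v: "v \<in> K" for h v
  proof -
    have "closed {x. x * \<sigma> (a * v * a) = 0}" by (intro closed_Collect_eq continuous_intros)
    moreover have "(a * u * a) * \<sigma> (a * v * a) = a * u * (a * \<sigma> a) * \<sigma> v * \<sigma> a" if "u \<in> K" for u
    proof -
      have "a * (\<sigma> a * w) = 0" for w using a(3) by (metis mult.assoc mult_zero_left)
      then show ?thesis using that v a I by (simp add: chom_mult[OF I(2)] csub_mem mult.assoc)
    qed
    ultimately have "closure ((\<lambda>s. a * s * a) ` K) \<subseteq> {x. x * \<sigma> (a * v * a) = 0}"
      using a(3) by (intro closure_minimal) auto
    then show ?thesis using h by (auto simp: H_def hclos_def)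
  qed
  have orth': "\<sigma> h * k = 0" if h: "h \<in> H" and k: "k \<in> H" for h k
  proof -
    have "closed {y. \<sigma> h * y = 0}" by (intro closed_Collect_eq continuous_intros)
    moreover have "\<sigma> h * (a * v * a) = 0" if v: "v \<in> K" for v
    proof -
      have "\<sigma> h * (a * v * a) = \<sigma> (h * \<sigma> (a * v * a))"
        using sub[OF h] v a I by (simp add: chom_mult[OF I(2)] csub_mem)
      then show ?thesis using 1[OF h v] chom_0[OF I(1,2)] by simp
    qed
    ultimately have "closure ((\<lambda>s. a * s * a) ` K) \<subseteq> {y. \<sigma> h * y = 0}" by (intro closure_minimal) auto
    then show ?thesis using k by (auto simp: H_def hclos_def)
  qed
  have orth: "h * \<sigma> k = 0" if h: "h \<in> H" and k: "k \<in> H" for h k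
  proof -
    have "star (h * \<sigma> k) = \<sigma> (star k) * star h"
      using sub[OF k] by (simp add: star_mult chom_star[OF I(2)])
    then have "star (h * \<sigma> k) = 0" using orth'[of "star k" "star h"] h k H(1) by (simp add: csub_mem)
    then show ?thesis by (metis star_star star_zero)
  qed
  show "chom (hclos a K) (\<lambda>h. h + \<sigma> h)"
    unfolding H_def[symmetric] chom_def
    using orth orth' by (auto simp: sub chom_add[OF I(2)] chom_mult[OF I(2)] chom_star[OF I(2)] chom_scaleC[OF I(2)]
        distrib_left distrib_right star_add scaleC_add_right)
  then have hh: "chom H (\<lambda>h. h + \<sigma> h)" by (simp add: H_def)
  have "h = 0" if h: "h \<in> H" "h + \<sigma> h = 0" for h
  proof -
    have "star h * (h + \<sigma> h) = star h * h" using orth[of "star h" h] h(1) H(1) by (simp add: csub_mem distrib_left)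
    then show ?thesis using h(2) star_mult_eq_0[of h] by simp
  qed
  then have "inj_on (\<lambda>h. h + \<sigma> h) H" by (rule chom_inj_onI[OF H(1) hh])
  then show "inj_on (\<lambda>h. h + \<sigma> h) (hclos a K)" by (simp add: H_def)
  show "(\<lambda>h. h + \<sigma> h) ` hclos a K \<subseteq> fixed \<sigma> K"
    unfolding H_def[symmetric] using sub I
    by (auto simp: fixed_def csub_mem chom_add[OF I(2)] add.commute)
qed

text \<open>A nonzero hereditary subalgebra of the fixed algebra contains either a \<open>\<sigma>\<close>-fixed hereditary
  subalgebra of \<open>S\<close> or the diagonal copy of one that is orthogonal to its image.\<close>
theorem hered_fixed_invol:
  fixes S :: "'t::uc_star set" and \<C> :: "'c cstar set"
  assumes C: "upwards_directed \<C>" and s: "invol \<sigma> S" and S: "hered \<C> S"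
  shows "hered \<C> (fixed \<sigma> S)"
proof -
  note I = invol_facts[OF s]
  have "in_class \<C> (crec B)" if B: "her B (fixed \<sigma> S)" "B \<noteq> {0}" for B
  proof -
    have cB: "csub B" and BS: "B \<subseteq> fixed \<sigma> S" using B(1) by (auto simp: her_def)
    obtain b where b: "b \<in> B" "b \<noteq> 0" "star b = b" using her_nonzero_pos[OF cB B(2)] by metis
    have bS: "b \<in> S" "\<sigma> b = b" using b(1) BS by (auto simp: fixed_def)
    have "S \<noteq> {0}" using bS b(2) by auto
    then have "in_class \<C> (crec S)" using S her_self[OF I(1)] by (simp add: hered_def)
    then obtain \<iota> :: "'t \<Rightarrow> 'c" where "inj_on \<iota> (carrier (crec S))" by (rule in_class_inj)
    then have "inj_on \<iota> S" by simp
    then have i: "inj_on \<iota> B" by (rule inj_on_subset) (use BS in \<open>auto simp: fixed_def\<close>)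
    define K where "K = hclos b S"
    have K: "her K S" "K \<noteq> {0}" unfolding K_def using her_hclos[OF I(1) bS(1) b(3)] hclos_nonzero[OF I(1) bS(1) b(3,2)] by auto
    have cK: "csub K" using K(1) by (simp add: her_def)
    have Ki: "invol \<sigma> K" unfolding K_def by (rule invol_hclos(1)[OF s bS(1) b(3) bS(2)])
    have KB: "fixed \<sigma> K \<subseteq> B"
      using invol_hclos(2)[OF s bS(1) b(3) bS(2)] hclos_subset[OF B(1) b(1)] unfolding K_def by blast
    show ?thesis
    proof (cases "\<forall>x\<in>K. \<sigma> x = x")
      case True
      then have "(\<lambda>x. x) ` K \<subseteq> B" using KB by (auto simp: fixed_def)
      moreover have "in_class \<C> (crec K)" using S K by (simp add: hered_def)
      ultimately show ?thesis using in_class_if_contains[OF C cB i _ cK chom_id] by simp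
    next
      case False
      then obtain x where "x \<in> K" "\<sigma> x \<noteq> x" by blast
      then obtain z where "z \<in> K" "star z = z" "\<sigma> z = - z" "z \<noteq> 0" using odd_self_adjoint[OF Ki] by metis
      then obtain a where a: "a \<in> K" "star a = a" "a \<noteq> 0" "a * \<sigma> a = 0" using orthogonal_to_image[OF Ki] by metis
      define H where "H = hclos a K"
      have H: "her H K" "H \<noteq> {0}" unfolding H_def using her_hclos[OF cK a(1,2)] hclos_nonzero[OF cK a(1-3)] by auto
      have iH: "in_class \<C> (crec H)" using S her_trans[OF H(1) K(1)] H(2) by (simp add: hered_def)
      have cH: "csub H" using H(1) by (simp add: her_def)
      note h = chom_add_orthogonal_image[OF Ki a(1,2,4), folded H_def]
      show ?thesis by (rule in_class_if_contains[OF C cB i iH cH h(1,2) subset_trans[OF h(3) KB]])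
    qed
  qed
  then show ?thesis using csub_fixed[OF I(1,2)] by (simp add: hered_def)
qed

section \<open>Extensions and residual membership\<close>

lemma csub_Int: "csub S \<Longrightarrow> csub T \<Longrightarrow> csub (S \<inter> T)"
  by (auto simp: csub_def)

text \<open>A nonzero hereditary \<open>B\<close> either meets the ideal \<open>T\<close> in a nonzero hereditary subalgebra of \<open>T\<close>, or is
  mapped isomorphically onto a hereditary subalgebra of the quotient.\<close>
lemma hered_extension:
  fixes Q :: "'t::uc_star set" and \<pi> :: "'t \<Rightarrow> 's::uc_star" and \<C> :: "'c cstar set" and \<iota> :: "'t \<Rightarrow> 'c"
  assumes C: "upwards_directed \<C>" and Q: "csub Q" "inj_on \<iota> Q" and T: "cideal T Q" "hered \<C> T"
    and h: "chom Q \<pi>" "\<And>x. x \<in> Q \<Longrightarrow> \<pi> x = 0 \<Longrightarrow> x \<in> T" "hered \<C> (\<pi> ` Q)"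
  shows "hered \<C> Q"
proof -
  have "in_class \<C> (crec B)" if B: "her B Q" "B \<noteq> {0}" for B
  proof -
    have cB: "csub B" and BQ: "B \<subseteq> Q" using B(1) by (auto simp: her_def)
    have i: "inj_on \<iota> B" by (rule inj_on_subset[OF Q(2) BQ])
    have cT: "csub T" by (rule cideal_csub[OF Q(1) T(1)])
    show ?thesis
    proof (cases "B \<inter> T = {0}")
      case False
      have cBT: "csub (B \<inter> T)" by (rule csub_Int[OF cB cT])
      have "h * t * k \<in> B \<inter> T" if "h \<in> B \<inter> T" "t \<in> T" "k \<in> B \<inter> T" for h t k
        using that her_mem[OF B(1), of h t k] T(1) csub_mult[OF cT] by (auto simp: cideal_def)
      then have "her (B \<inter> T) T" using cBT by (auto simp: her_def)
      then have "in_class \<C> (crec (B \<inter> T))" using T(2) False by (simp add: hered_def)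
      then show ?thesis using in_class_if_contains[OF C cB i _ cBT chom_id] by simp
    next
      case True
      have hB: "chom B \<pi>" by (rule chom_subset[OF h(1) BQ])
      have inj: "inj_on \<pi> B" by (rule chom_inj_onI[OF cB hB]) (use True h(2) BQ in auto)
      have "csub (\<pi> ` B)" by (rule chom_inj_image_csub[OF cB hB inj])
      moreover have "x * s * y \<in> \<pi> ` B" if "x \<in> \<pi> ` B" "s \<in> \<pi> ` Q" "y \<in> \<pi> ` B" for x s y
      proof -
        from that obtain u v w where u: "u \<in> B" "v \<in> Q" "w \<in> B" "x = \<pi> u" "s = \<pi> v" "y = \<pi> w" by auto
        then have "x * s * y = \<pi> (u * v * w)" using BQ Q(1) by (auto simp: chom_mult[OF h(1)] csub_mem subset_iff)
        then show ?thesis using her_mem[OF B(1) u(1-3)] by auto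
      qed
      ultimately have "her (\<pi> ` B) (\<pi> ` Q)" using BQ by (auto simp: her_def)
      moreover have "\<pi> ` B \<noteq> {0}"
      proof
        assume *: "\<pi> ` B = {0}"
        have "x = 0" if "x \<in> B" for x
        proof (rule inj_onD[OF inj _ that csub_0[OF cB]])
          show "\<pi> x = \<pi> 0" using * that chom_0[OF cB hB] by auto
        qed
        then have "B \<subseteq> {0}" by auto
        then show False using B(2) csub_0[OF cB] by auto
      qed
      ultimately have "in_class \<C> (crec (\<pi> ` B))" using h(3) by (simp add: hered_def)
      then show ?thesis by (rule iffD2[OF in_class_crec_iff[OF cB hB inj]])
    qed
  qed
  then show ?thesis using Q(1) by (simp add: hered_def)
qed

definition odd_part :: "('t::uc_star \<Rightarrow> 't) \<Rightarrow> 't set \<Rightarrow> 't set" where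
  "odd_part \<sigma> S = {x\<in>S. \<sigma> x = - x}"

text \<open>The components of \<open>x\<close> in the eigenspaces of \<open>\<sigma>\<close>.\<close>
definition ev :: "('t::uc_star \<Rightarrow> 't) \<Rightarrow> 't \<Rightarrow> 't" where "ev \<sigma> x = (1/2) *\<^sub>R (x + \<sigma> x)"
definition od :: "('t::uc_star \<Rightarrow> 't) \<Rightarrow> 't \<Rightarrow> 't" where "od \<sigma> x = (1/2) *\<^sub>R (x - \<sigma> x)"

lemma ev_add_od: "ev \<sigma> x + od \<sigma> x = x"
  by (simp add: ev_def od_def scaleR_add_right[symmetric] scaleR_2[symmetric])

lemma even_odd_mult:
  assumes s: "invol \<sigma> S"
  shows "x \<in> fixed \<sigma> S \<Longrightarrow> y \<in> odd_part \<sigma> S \<Longrightarrow> x * y \<in> odd_part \<sigma> S"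
    "x \<in> odd_part \<sigma> S \<Longrightarrow> y \<in> fixed \<sigma> S \<Longrightarrow> x * y \<in> odd_part \<sigma> S"
    "x \<in> odd_part \<sigma> S \<Longrightarrow> y \<in> odd_part \<sigma> S \<Longrightarrow> x * y \<in> fixed \<sigma> S"
    "x \<in> odd_part \<sigma> S \<Longrightarrow> star x \<in> odd_part \<sigma> S"
  using invol_facts[OF s]
  by (auto simp: fixed_def odd_part_def csub_mem chom_mult[OF invol_facts(2)[OF s]] chom_star[OF invol_facts(2)[OF s]])

text \<open>The \<open>\<sigma>\<close>-invariant ideal of \<open>S\<close> with even part \<open>J\<close> and odd part the odd \<open>x\<close> with \<open>S\<^sub>1 x \<subseteq> J\<close>.\<close>
definition induced_ideal :: "('t::uc_star \<Rightarrow> 't) \<Rightarrow> 't set \<Rightarrow> 't set \<Rightarrow> 't set" where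
  "induced_ideal \<sigma> S J = {x\<in>S. ev \<sigma> x \<in> J \<and> (\<forall>y\<in>odd_part \<sigma> S. y * od \<sigma> x \<in> J)}"

context
  fixes \<sigma> :: "'t::uc_star \<Rightarrow> 't" and S J :: "'t set"
  assumes s: "invol \<sigma> S" and J: "cideal J (fixed \<sigma> S)"
    and inv: "\<And>x y j. x \<in> odd_part \<sigma> S \<Longrightarrow> y \<in> odd_part \<sigma> S \<Longrightarrow> j \<in> J \<Longrightarrow> x * j * y \<in> J"
begin

text \<open>The odd part of the set is defined by multiplication from the left; the point is that it also absorbs
  from the right. Let \<open>w = x a\<close> with \<open>a\<close> and \<open>x\<close> odd such that \<open>S\<^sub>1 x \<subseteq> J\<close>. Then \<open>star x * x \<in> J\<close>, and
  invariance under conjugation by odd elements places \<open>(w * star w)\<^sup>2 = x (a * star a * star x * x * a * star a) star x\<close>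
  in \<open>J\<close>. Passing to roots twice gives \<open>w \<in> J\<close>.\<close>
lemma cideal_induced_ideal: "cideal (induced_ideal \<sigma> S J) S"
proof -
  note I = invol_facts[OF s] and eo = even_odd_mult[OF s]
  note h = chom_add[OF I(2)] chom_diff[OF I(1,2)] chom_mult[OF I(2)] chom_scaleR[OF I(2)] chom_scaleC[OF I(2)]
  let ?S0 = "fixed \<sigma> S" and ?S1 = "odd_part \<sigma> S" and ?N = "induced_ideal \<sigma> S J"
  have cJ: "csub J" by (rule cideal_csub[OF csub_fixed[OF I(1,2)] J])
  have JS: "J \<subseteq> ?S0" using J by (simp add: cideal_def)
  have Jl: "a * x \<in> J" "x * a \<in> J" if "x \<in> J" "a \<in> ?S0" for a x using J that by (auto simp: cideal_def)
  have evS: "ev \<sigma> x \<in> ?S0" "od \<sigma> x \<in> ?S1" if "x \<in> S" for x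
    using that I by (auto simp: fixed_def odd_part_def ev_def od_def csub_mem h scaleR_minus_right[symmetric] add.commute simp del: scaleR_minus_right)
  have prod: "ev \<sigma> (a * x) = ev \<sigma> a * ev \<sigma> x + od \<sigma> a * od \<sigma> x" "od \<sigma> (a * x) = ev \<sigma> a * od \<sigma> x + od \<sigma> a * ev \<sigma> x"
    if "a \<in> S" "x \<in> S" for a x
  proof -
    have A: "\<sigma> (ev \<sigma> a) = ev \<sigma> a" "\<sigma> (od \<sigma> a) = - od \<sigma> a" "\<sigma> (ev \<sigma> x) = ev \<sigma> x" "\<sigma> (od \<sigma> x) = - od \<sigma> x"
      using evS that by (auto simp: fixed_def odd_part_def)
    have "ev \<sigma> a \<in> S" "od \<sigma> a \<in> S" "ev \<sigma> x \<in> S" "od \<sigma> x \<in> S" using evS that by (auto simp: fixed_def odd_part_def)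
    then have B: "\<sigma> ((ev \<sigma> a + od \<sigma> a) * (ev \<sigma> x + od \<sigma> x)) = (ev \<sigma> a - od \<sigma> a) * (ev \<sigma> x - od \<sigma> x)"
      using I(1) A by (simp add: h csub_mem)
    have C: "a * x = (ev \<sigma> a + od \<sigma> a) * (ev \<sigma> x + od \<sigma> x)" by (simp add: ev_add_od)
    have "a * x + \<sigma> (a * x) = 2 *\<^sub>R (ev \<sigma> a * ev \<sigma> x + od \<sigma> a * od \<sigma> x)"
      unfolding C B by (simp add: algebra_simps scaleR_2)
    then show "ev \<sigma> (a * x) = ev \<sigma> a * ev \<sigma> x + od \<sigma> a * od \<sigma> x" unfolding ev_def[of \<sigma> "a * x"] by simp
    have "a * x - \<sigma> (a * x) = 2 *\<^sub>R (ev \<sigma> a * od \<sigma> x + od \<sigma> a * ev \<sigma> x)"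
      unfolding C B by (simp add: algebra_simps scaleR_2)
    then show "od \<sigma> (a * x) = ev \<sigma> a * od \<sigma> x + od \<sigma> a * ev \<sigma> x" unfolding od_def[of \<sigma> "a * x"] by simp
  qed
  have N1: "x * a \<in> J" if x: "x \<in> ?S1" "\<forall>y\<in>?S1. y * x \<in> J" and a: "a \<in> ?S1" for x a
  proof -
    let ?w = "x * a"
    have w: "?w \<in> ?S0" "star ?w \<in> ?S0" using eo(3)[OF x(1) a] csub_star[OF csub_fixed[OF I(1,2)]] by auto
    have "star x * x \<in> J" using x eo(4) by blast
    then have "(a * star a) * (star x * x) * (a * star a) \<in> J" using Jl eo(3)[OF a eo(4)[OF a]] by blast
    then have "x * ((a * star a) * (star x * x) * (a * star a)) * star x \<in> J" by (rule inv[OF x(1) eo(4)[OF x(1)]])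
    then have "star (?w * star ?w) * (?w * star ?w) \<in> J" by (simp add: star_mult star_star mult.assoc)
    then have "star (star ?w) * star ?w \<in> J"
      unfolding star_star using cideal_star_mult_mem[OF J csub_mult[OF csub_fixed[OF I(1,2)] w]] by blast
    then have "star ?w \<in> J" using cideal_star_mult_mem[OF J w(2)] by blast
    then show ?thesis using csub_star[OF cJ] star_star by metis
  qed
  have cl: "closed ?N"
  proof (subst closed_sequential_limits, intro allI impI, elim conjE)
    fix x l assume x: "\<forall>n. x n \<in> ?N" and l: "x \<longlonglongrightarrow> l"
    have xS: "x n \<in> S" for n using x by (simp add: induced_ideal_def)
    have lS: "l \<in> S" by (rule csub_limit[OF I(1) l xS])
    have sl: "(\<lambda>n. \<sigma> (x n)) \<longlonglongrightarrow> \<sigma> l" by (rule chom_tendsto[OF I(1,2) xS l])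
    have "(\<lambda>n. ev \<sigma> (x n)) \<longlonglongrightarrow> ev \<sigma> l" unfolding ev_def by (intro tendsto_intros l sl)
    then have 1: "ev \<sigma> l \<in> J" by (rule csub_limit[OF cJ]) (use x in \<open>simp add: induced_ideal_def\<close>)
    have "y * od \<sigma> l \<in> J" if "y \<in> ?S1" for y
    proof -
      have "(\<lambda>n. y * od \<sigma> (x n)) \<longlonglongrightarrow> y * od \<sigma> l" unfolding od_def by (intro tendsto_intros l sl)
      then show ?thesis by (rule csub_limit[OF cJ]) (use x that in \<open>simp add: induced_ideal_def\<close>)
    qed
    then show "l \<in> ?N" using 1 lS by (simp add: induced_ideal_def)
  qed
  have lin: "ev \<sigma> (x + y) = ev \<sigma> x + ev \<sigma> y" "od \<sigma> (x + y) = od \<sigma> x + od \<sigma> y"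
    "ev \<sigma> (c *\<^sub>C x) = c *\<^sub>C ev \<sigma> x" "od \<sigma> (c *\<^sub>C x) = c *\<^sub>C od \<sigma> x" if "x \<in> S" "y \<in> S" for x y c
    using that by (simp_all add: ev_def od_def h algebra_simps scaleC_add_right scaleC_diff_right mult.commute
        scaleC_scaleC flip: scaleC_of_real)
  show ?thesis
    unfolding cideal_def
  proof (intro conjI ballI allI cl)
    show "?N \<subseteq> S" by (auto simp: induced_ideal_def)
    show "0 \<in> ?N" using I(1) cJ by (simp add: induced_ideal_def ev_def od_def chom_0[OF I(1,2)] csub_0)
    fix x assume x: "x \<in> ?N"
    then have x': "x \<in> S" "ev \<sigma> x \<in> J" "\<And>y. y \<in> ?S1 \<Longrightarrow> y * od \<sigma> x \<in> J" by (auto simp: induced_ideal_def)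
    show "x + y \<in> ?N" if "y \<in> ?N" for y
      using x' that I(1) cJ by (auto simp: induced_ideal_def lin csub_mem distrib_left)
    show "c *\<^sub>C x \<in> ?N" for c
      using x' I(1) cJ by (auto simp: induced_ideal_def lin[OF x'(1,1)] csub_mem scaleC_mult_right)
    fix a assume a: "a \<in> S"
    note xe = evS[OF x'(1)] and ae = evS[OF a]
    have xa: "od \<sigma> x * od \<sigma> a \<in> J" by (rule N1[OF xe(2) _ ae(2)]) (use x'(3) in blast)
    show "a * x \<in> ?N"
      unfolding induced_ideal_def
    proof (intro CollectI conjI ballI)
      show "a * x \<in> S" using a x' I(1) by (simp add: csub_mem)
      show "ev \<sigma> (a * x) \<in> J"
        unfolding prod[OF a x'(1)] by (intro csub_add[OF cJ] Jl x' ae)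
      fix y assume y: "y \<in> ?S1"
      have "(y * ev \<sigma> a) * od \<sigma> x \<in> J" by (rule x'(3)[OF eo(2)[OF y ae(1)]])
      moreover have "(y * od \<sigma> a) * ev \<sigma> x \<in> J" by (rule Jl(1)[OF x'(2) eo(3)[OF y ae(2)]])
      ultimately show "y * od \<sigma> (a * x) \<in> J"
        unfolding prod[OF a x'(1)] by (simp add: distrib_left csub_add[OF cJ] mult.assoc)
    qed
    show "x * a \<in> ?N"
      unfolding induced_ideal_def
    proof (intro CollectI conjI ballI)
      show "x * a \<in> S" using a x' I(1) by (simp add: csub_mem)
      show "ev \<sigma> (x * a) \<in> J"
        unfolding prod[OF x'(1) a] by (intro csub_add[OF cJ] Jl x' ae xa)
      fix y assume y: "y \<in> ?S1"
      have "y * ev \<sigma> x * od \<sigma> a \<in> J" by (rule inv[OF y ae(2) x'(2)])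
      moreover have "(y * od \<sigma> x) * ev \<sigma> a \<in> J" by (rule Jl(2)[OF x'(3)[OF y] ae(1)])
      ultimately show "y * od \<sigma> (x * a) \<in> J"
        unfolding prod[OF x'(1) a] by (simp add: distrib_left csub_add[OF cJ] mult.assoc)
    qed
  qed
qed

lemma induced_ideal_fixed: "x \<in> fixed \<sigma> S \<Longrightarrow> x \<in> induced_ideal \<sigma> S J \<longleftrightarrow> x \<in> J"
  using J by (auto simp: induced_ideal_def fixed_def ev_def od_def scaleR_2[symmetric] cideal_def)

text \<open>When \<open>J\<close> is invariant under odd conjugation, \<open>S\<^sup>\<sigma> / J\<close> is the fixed algebra of the involution induced on
  \<open>S / N\<close>, \<open>N\<close> being the induced ideal; averaging over \<open>\<sigma>\<close> lifts fixed points.\<close>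
lemma hered_quotient_invariant:
  fixes \<psi> :: "'t \<Rightarrow> 'v::uc_star" and \<C> :: "'c cstar set"
  assumes C: "upwards_directed \<C>" and S: "reshered \<C> S"
    and p: "chom (fixed \<sigma> S) \<psi>" "\<And>x. x \<in> fixed \<sigma> S \<Longrightarrow> \<psi> x = 0 \<longleftrightarrow> x \<in> J"
  shows "hered \<C> (\<psi> ` fixed \<sigma> S)"
proof -
  note I = invol_facts[OF s]
  define N where "N = induced_ideal \<sigma> S J"
  have N: "cideal N S" unfolding N_def by (rule cideal_induced_ideal)
  define \<pi> where "\<pi> = qhom S N"
  have pi: "chom S \<pi>" "\<And>x. x \<in> S \<Longrightarrow> \<pi> x = 0 \<longleftrightarrow> x \<in> N" "csub (\<pi> ` S)"
    using chom_qhom[OF I(1) N] qhom_eq_0[OF I(1) N] csub_qhom[OF I(1) N] by (auto simp: \<pi>_def)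
  have sN: "\<sigma> x \<in> N" if "x \<in> N" for x
  proof -
    have x: "x \<in> S" using that N by (auto simp: cideal_def)
    then have "ev \<sigma> (\<sigma> x) = ev \<sigma> x" "od \<sigma> (\<sigma> x) = - od \<sigma> x"
      using I by (simp_all add: ev_def od_def add.commute flip: scaleR_minus_right)
    then show ?thesis using that x I(3) cideal_csub[OF csub_fixed[OF I(1,2)] J] by (auto simp: N_def induced_ideal_def csub_mem)
  qed
  have ps: "chom S (\<pi> \<circ> \<sigma>)" by (rule chom_comp[OF I(2) pi(1)]) (use I(3) in auto)
  have k: "(\<pi> \<circ> \<sigma>) x = 0" if "x \<in> S" "\<pi> x = 0" for x using that sN pi(2) I(3) by simp
  obtain \<tau> where tau: "chom (\<pi> ` S) \<tau>" "\<And>x. x \<in> S \<Longrightarrow> \<tau> (\<pi> x) = \<pi> (\<sigma> x)"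
    using chom_factor[OF I(1) ps pi(1) k] by (metis comp_apply)
  have ti: "invol \<tau> (\<pi> ` S)" using tau pi(3) I(3,4) by (auto simp: invol_def)
  have fx: "fixed \<tau> (\<pi> ` S) = \<pi> ` fixed \<sigma> S"
  proof
    show "\<pi> ` fixed \<sigma> S \<subseteq> fixed \<tau> (\<pi> ` S)" using tau(2) by (auto simp: fixed_def)
    show "fixed \<tau> (\<pi> ` S) \<subseteq> \<pi> ` fixed \<sigma> S"
    proof
      fix y assume "y \<in> fixed \<tau> (\<pi> ` S)"
      then obtain x where x: "x \<in> S" "y = \<pi> x" "\<pi> (\<sigma> x) = \<pi> x" using tau(2) by (auto simp: fixed_def)
      have "\<pi> (ev \<sigma> x) = y"
        using x I by (simp add: ev_def chom_scaleR[OF pi(1)] chom_add[OF pi(1)] csub_mem scaleR_2[symmetric])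
      moreover have "ev \<sigma> x \<in> fixed \<sigma> S"
        using x I by (simp add: ev_def fixed_def csub_mem chom_scaleR[OF I(2)] chom_add[OF I(2)] add.commute)
      ultimately show "y \<in> \<pi> ` fixed \<sigma> S" by blast
    qed
  qed
  have "hered \<C> (\<pi> ` S)" by (rule reshered_image[OF S pi(1)])
  then have h: "hered \<C> (\<pi> ` fixed \<sigma> S)" using hered_fixed_invol[OF C ti] fx by simp
  show ?thesis
  proof (rule hered_image_iff_kernel[OF csub_fixed[OF I(1,2)] p(1) _ _ h])
    show "chom (fixed \<sigma> S) \<pi>" by (rule chom_subset[OF pi(1)]) (auto simp: fixed_def)
    show "\<pi> x = 0 \<longleftrightarrow> \<psi> x = 0" if "x \<in> fixed \<sigma> S" for x
      using that pi(2)[of x] p(2)[OF that] induced_ideal_fixed[OF that] by (simp add: N_def fixed_def)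
  qed
qed

end

lemma cideal_image:
  fixes \<phi> :: "'a::uc_star \<Rightarrow> 'b::uc_star"
  assumes S: "csub S" and h: "chom S \<phi>" and I: "cideal I S" shows "cideal (\<phi> ` I) (\<phi> ` S)"
proof -
  have IS: "I \<subseteq> S" using I by (simp add: cideal_def)
  have "csub (\<phi> ` I)" by (rule csub_image[OF cideal_csub[OF S I] chom_subset[OF h IS]])
  moreover have "\<phi> a * \<phi> x \<in> \<phi> ` I" "\<phi> x * \<phi> a \<in> \<phi> ` I" if "a \<in> S" "x \<in> I" for a x
  proof -
    have "x \<in> S" "a * x \<in> I" "x * a \<in> I" using that I by (auto simp: cideal_def)
    then show "\<phi> a * \<phi> x \<in> \<phi> ` I" "\<phi> x * \<phi> a \<in> \<phi> ` I" using that(1) by (auto simp flip: chom_mult[OF h])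
  qed
  ultimately show ?thesis using IS by (auto simp: cideal_def csub_def)
qed

lemma inj_on_comp_inv_into:
  assumes "inj_on \<iota> T" shows "inj_on (\<iota> \<circ> inv_into T \<pi>) (\<pi> ` T)"
  by (rule comp_inj_on[OF inj_on_inv_into[OF order_refl] inj_on_subset[OF assms]]) (auto intro: inv_into_into)

text \<open>Every quotient of the fixed algebra is an extension of two pieces coming from ideals invariant under
  odd conjugation.\<close>
theorem reshered_fixed_invol:
  fixes S :: "'t::uc_star set" and \<C> :: "'c cstar set"
  assumes C: "upwards_directed \<C>" and s: "invol \<sigma> S" and S: "reshered \<C> S"
  shows "reshered \<C> (fixed \<sigma> S)"
proof -
  note I = invol_facts[OF s] and eo = even_odd_mult[OF s]
  let ?S0 = "fixed \<sigma> S" and ?S1 = "odd_part \<sigma> S"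
  have c0: "csub ?S0" by (rule csub_fixed[OF I(1,2)])
  have "hered \<C> (qhom ?S0 J ` ?S0)" if J: "cideal J ?S0" and ne: "J \<noteq> ?S0" for J
  proof -
    have cJ: "csub J" by (rule cideal_csub[OF c0 J])
    have JS: "J \<subseteq> ?S0" using J by (simp add: cideal_def)
    have Jl: "a * x \<in> J" "x * a \<in> J" if "x \<in> J" "a \<in> ?S0" for a x using J that by (auto simp: cideal_def)
    \<comment> \<open>the partner of \<open>J\<close> under conjugation by odd elements\<close>
    define J' where "J' = {a\<in>?S0. \<forall>x\<in>?S1. \<forall>y\<in>?S1. x * a * y \<in> J}"
    have J'S: "J' \<subseteq> ?S0" by (auto simp: J'_def)
    have cl: "closed J'"
    proof -
      have "closed {a. x * a * y \<in> J}" for x y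
        using csub_closed[OF cJ] by (auto intro!: closed_vimage[of J, unfolded vimage_def] continuous_intros)
      then have "closed (?S0 \<inter> (\<Inter>x\<in>?S1. \<Inter>y\<in>?S1. {a. x * a * y \<in> J}))"
        using csub_closed[OF c0] by (intro closed_Int closed_INT) auto
      moreover have "?S0 \<inter> (\<Inter>x\<in>?S1. \<Inter>y\<in>?S1. {a. x * a * y \<in> J}) = J'" by (auto simp: J'_def)
      ultimately show ?thesis by simp
    qed
    have J': "cideal J' ?S0"
      unfolding cideal_def
    proof (intro conjI ballI allI J'S cl)
      show "0 \<in> J'" using csub_0[OF c0] csub_0[OF cJ] by (simp add: J'_def)
      fix a assume a: "a \<in> J'"
      show "a + b \<in> J'" if "b \<in> J'" for b
        using a that csub_add[OF c0] csub_add[OF cJ] by (auto simp: J'_def distrib_left distrib_right)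
      show "c *\<^sub>C a \<in> J'" for c
        using a csub_scaleC[OF c0] csub_scaleC[OF cJ] by (auto simp: J'_def scaleC_mult_left scaleC_mult_right)
      fix c assume c: "c \<in> ?S0"
      have "x * (c * a) * y \<in> J" "x * (a * c) * y \<in> J" if "x \<in> ?S1" "y \<in> ?S1" for x y
      proof -
        have "(x * c) * a * y \<in> J" "x * a * (c * y) \<in> J" using a that eo(1,2) c by (auto simp: J'_def)
        then show "x * (c * a) * y \<in> J" "x * (a * c) * y \<in> J" by (simp_all add: mult.assoc)
      qed
      then show "c * a \<in> J'" "a * c \<in> J'" using a c csub_mult[OF c0] by (auto simp: J'_def)
    qed
    define \<pi> where "\<pi> = qhom ?S0 J"
    have pi: "chom ?S0 \<pi>" "\<And>x. x \<in> ?S0 \<Longrightarrow> \<pi> x = 0 \<longleftrightarrow> x \<in> J" "csub (\<pi> ` ?S0)"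
      using chom_qhom[OF c0 J] qhom_eq_0[OF c0 J] csub_qhom[OF c0 J] by (auto simp: \<pi>_def)
    define T where "T = \<pi> ` J'"
    have T: "cideal T (\<pi> ` ?S0)" unfolding T_def by (rule cideal_image[OF c0 pi(1) J'])
    have swap: "y * j * z \<in> J'" if "j \<in> J" "y \<in> ?S1" "z \<in> ?S1" for j y z
    proof -
      have "u * (y * j * z) * v \<in> J" if "u \<in> ?S1" "v \<in> ?S1" for u v
      proof -
        have "(u * y) * j * (z * v) \<in> J"
          using Jl \<open>j \<in> J\<close> eo(3)[OF that(1) \<open>y \<in> ?S1\<close>] eo(3)[OF \<open>z \<in> ?S1\<close> that(2)] by blast
        then show ?thesis by (simp add: mult.assoc)
      qed
      moreover have "y * j * z \<in> ?S0" using that JS eo(2,3) by blast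
      ultimately show ?thesis by (simp add: J'_def)
    qed
    have J'swap: "y * j * z \<in> J" if "j \<in> J'" "y \<in> ?S1" "z \<in> ?S1" for j y z using that by (auto simp: J'_def)
    \<comment> \<open>\<open>T = (J + J') / J\<close> is isomorphic to \<open>J' / (J \<inter> J')\<close>, an ideal of a quotient by an invariant ideal\<close>
    have hT: "hered \<C> T"
    proof -
      have K: "cideal (J \<inter> J') ?S0" using J J' by (auto simp: cideal_def)
      define \<rho> where "\<rho> = qhom ?S0 (J \<inter> J')"
      have rho: "chom ?S0 \<rho>" "\<And>x. x \<in> ?S0 \<Longrightarrow> \<rho> x = 0 \<longleftrightarrow> x \<in> J \<inter> J'" "csub (\<rho> ` ?S0)"
        unfolding \<rho>_def by (rule chom_qhom[OF c0 K], erule qhom_eq_0[OF c0 K], rule csub_qhom[OF c0 K])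
      have "hered \<C> (\<rho> ` ?S0)"
        by (rule hered_quotient_invariant[OF s K _ C S rho(1,2)]) (use swap J'swap in blast)+
      then have "hered \<C> (\<rho> ` J')"
        by (rule hered_her[OF _ cideal_her[OF rho(3) cideal_image[OF c0 rho(1) J']]])
      then show ?thesis
        unfolding T_def using J'S rho(2) pi(2)
        by (intro hered_image_iff_kernel[OF cideal_csub[OF c0 J'] chom_subset[OF pi(1) J'S] chom_subset[OF rho(1) J'S]]) auto
    qed
    define \<rho> where "\<rho> = qhom (\<pi> ` ?S0) T"
    have rho: "chom (\<pi> ` ?S0) \<rho>" "\<And>x. x \<in> \<pi> ` ?S0 \<Longrightarrow> \<rho> x = 0 \<longleftrightarrow> x \<in> T"
      unfolding \<rho>_def by (rule chom_qhom[OF pi(3) T], erule qhom_eq_0[OF pi(3) T])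
    have rp: "chom ?S0 (\<rho> \<circ> \<pi>)" by (rule chom_comp[OF pi(1) rho(1)]) simp
    \<comment> \<open>the preimage of \<open>T\<close>, that is \<open>J + J'\<close>\<close>
    define L where "L = {x\<in>?S0. (\<rho> \<circ> \<pi>) x = 0}"
    have L: "cideal L ?S0" unfolding L_def by (rule chom_kernel_cideal[OF c0 rp])
    have Leq: "x \<in> L \<longleftrightarrow> x \<in> ?S0 \<and> \<pi> x \<in> T" for x using rho(2) by (auto simp: L_def)
    have JL: "J \<subseteq> L" "J' \<subseteq> L"
    proof -
      have "0 \<in> T" using T by (simp add: cideal_def)
      moreover have "\<pi> x = 0" if "x \<in> J" for x using pi(2)[of x] that JS by auto
      ultimately show "J \<subseteq> L" using JS by (auto simp: Leq subset_iff)
      show "J' \<subseteq> L" using J'S by (auto simp: Leq T_def)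
    qed
    have "y * x * z \<in> L" if x: "x \<in> L" and yz: "y \<in> ?S1" "z \<in> ?S1" for x y z
    proof -
      obtain j' where j': "j' \<in> J'" "\<pi> x = \<pi> j'" using x by (auto simp: Leq T_def)
      have "x - j' \<in> J" using pi(2)[of "x - j'"] x j' J'S c0 by (auto simp: Leq chom_diff[OF c0 pi(1)] csub_mem)
      then have "y * (x - j') * z \<in> L" "y * j' * z \<in> L" using swap J'swap j' yz JL by blast+
      then have "y * (x - j') * z + y * j' * z \<in> L" using L by (auto simp: cideal_def)
      then show ?thesis by (simp add: algebra_simps)
    qed
    then have "hered \<C> ((\<rho> \<circ> \<pi>) ` ?S0)"
      by (rule hered_quotient_invariant[OF s L _ C S rp]) (auto simp: L_def)
    then have hQ: "hered \<C> (\<rho> ` \<pi> ` ?S0)" by (simp add: image_comp)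
    have "S \<noteq> {0}" using ne JS csub_0[OF cJ] by (auto simp: fixed_def)
    then have "in_class \<C> (crec S)" using reshered_hered[OF S] her_self[OF I(1)] by (simp add: hered_def)
    then obtain \<iota> :: "'t \<Rightarrow> 'c" where "inj_on \<iota> (carrier (crec S))" by (rule in_class_inj)
    then have "inj_on \<iota> ?S0" by (rule inj_on_subset) (auto simp: fixed_def)
    then have "inj_on (\<iota> \<circ> inv_into ?S0 \<pi>) (\<pi> ` ?S0)" by (rule inj_on_comp_inv_into)
    from hered_extension[OF C pi(3) this T hT rho(1) _ hQ] rho(2) show ?thesis by (simp add: \<pi>_def)
  qed
  then show ?thesis using c0 by (simp add: reshered_def)
qed

section \<open>Matrix algebras and the operator norm\<close>

text \<open>The inner product of the Hilbert module of vectors with entries in the algebra.\<close>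
definition ip :: "'i set \<Rightarrow> ('i \<Rightarrow> 't::uc_star) \<Rightarrow> ('i \<Rightarrow> 't) \<Rightarrow> 't" where
  "ip I \<xi> \<eta> = (\<Sum>i\<in>I. star (\<xi> i) * \<eta> i)"

definition mv :: "'i set \<Rightarrow> ('i \<Rightarrow> 'i \<Rightarrow> 't::uc_star) \<Rightarrow> ('i \<Rightarrow> 't) \<Rightarrow> 'i \<Rightarrow> 't" where
  "mv I x \<xi> i = (\<Sum>j\<in>I. x i j * \<xi> j)"

definition madj :: "('i \<Rightarrow> 'i \<Rightarrow> 't::uc_star) \<Rightarrow> 'i \<Rightarrow> 'i \<Rightarrow> 't" where
  "madj x i j = star (x j i)"

definition mmul :: "'i set \<Rightarrow> ('i \<Rightarrow> 'i \<Rightarrow> 't::uc_star) \<Rightarrow> ('i \<Rightarrow> 'i \<Rightarrow> 't) \<Rightarrow> 'i \<Rightarrow> 'i \<Rightarrow> 't" where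
  "mmul I x y i j = (\<Sum>k\<in>I. x i k * y k j)"

text \<open>The operator inequality \<open>norm x \<le> t\<close> for \<open>x\<close> acting on the Hilbert module, stated in the algebra
  itself so that no representation on a Hilbert space is required.\<close>
definition mle :: "'i set \<Rightarrow> real \<Rightarrow> ('i \<Rightarrow> 'i \<Rightarrow> 't::uc_star) \<Rightarrow> bool" where
  "mle I t x \<longleftrightarrow> (\<forall>\<xi>. pos (t\<^sup>2 *\<^sub>R ip I \<xi> \<xi> - ip I (mv I x \<xi>) (mv I x \<xi>)))"

definition mnorm :: "'i set \<Rightarrow> ('i \<Rightarrow> 'i \<Rightarrow> 't::uc_star) \<Rightarrow> real" where
  "mnorm I x = Inf {t. 0 \<le> t \<and> mle I t x}"

definition mats :: "'i set \<Rightarrow> 't::uc_star set \<Rightarrow> ('i \<Rightarrow> 'i \<Rightarrow> 't) set" where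
  "mats I S = {x. (\<forall>i\<in>I. \<forall>j\<in>I. x i j \<in> S) \<and> (\<forall>i j. i \<notin> I \<or> j \<notin> I \<longrightarrow> x i j = 0)}"

lemma ip_pos: "pos (ip I \<xi> \<xi>)" unfolding ip_def by (intro pos_sum pos_star_mult)

lemma ip_add_left: "ip I (\<lambda>i. \<xi> i + \<eta> i) \<zeta> = ip I \<xi> \<zeta> + ip I \<eta> \<zeta>"
  and ip_add_right: "ip I \<zeta> (\<lambda>i. \<xi> i + \<eta> i) = ip I \<zeta> \<xi> + ip I \<zeta> \<eta>"
  and ip_diff_left: "ip I (\<lambda>i. \<xi> i - \<eta> i) \<zeta> = ip I \<xi> \<zeta> - ip I \<eta> \<zeta>"
  and ip_diff_right: "ip I \<zeta> (\<lambda>i. \<xi> i - \<eta> i) = ip I \<zeta> \<xi> - ip I \<zeta> \<eta>"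
  and ip_scaleR_left: "ip I (\<lambda>i. r *\<^sub>R \<xi> i) \<zeta> = r *\<^sub>R ip I \<xi> \<zeta>"
  and ip_scaleR_right: "ip I \<zeta> (\<lambda>i. r *\<^sub>R \<xi> i) = r *\<^sub>R ip I \<zeta> \<xi>"
  by (simp_all add: ip_def star_add star_diff distrib_left distrib_right left_diff_distrib right_diff_distrib
      sum.distrib sum_subtractf scaleR_sum_right)

lemmas ip_simps = ip_add_left ip_add_right ip_diff_left ip_diff_right ip_scaleR_left ip_scaleR_right

lemma ip_madj: "ip I (mv I x \<eta>) \<xi> = ip I \<eta> (mv I (madj x) \<xi>)"
proof -
  have "ip I (mv I x \<eta>) \<xi> = (\<Sum>i\<in>I. \<Sum>j\<in>I. star (\<eta> j) * (star (x i j) * \<xi> i))"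
    by (simp add: ip_def mv_def star_sum star_mult sum_distrib_right mult.assoc)
  also have "\<dots> = (\<Sum>j\<in>I. \<Sum>i\<in>I. star (\<eta> j) * (star (x i j) * \<xi> i))" by (rule sum.swap)
  finally show ?thesis by (simp add: ip_def mv_def madj_def sum_distrib_left)
qed

lemma madj_madj [simp]: "madj (madj x) = x" by (simp add: madj_def star_star fun_eq_iff)

lemma ip_madj': "ip I \<eta> (mv I x \<xi>) = ip I (mv I (madj x) \<eta>) \<xi>"
  using ip_madj[of I "madj x" \<eta> \<xi>] by simp

lemma mv_mmul: "mv I (mmul I x y) \<xi> = mv I x (mv I y \<xi>)"
proof
  fix i
  have "mv I (mmul I x y) \<xi> i = (\<Sum>j\<in>I. \<Sum>k\<in>I. x i k * (y k j * \<xi> j))"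
    by (simp add: mv_def mmul_def sum_distrib_right mult.assoc)
  also have "\<dots> = (\<Sum>k\<in>I. \<Sum>j\<in>I. x i k * (y k j * \<xi> j))" by (rule sum.swap)
  finally show "mv I (mmul I x y) \<xi> i = mv I x (mv I y \<xi>) i" by (simp add: mv_def sum_distrib_left)
qed

lemma mv_add: "mv I (\<lambda>i j. x i j + y i j) \<xi> = (\<lambda>i. mv I x \<xi> i + mv I y \<xi> i)"
  and mv_scaleC: "mv I (\<lambda>i j. c *\<^sub>C x i j) \<xi> = (\<lambda>i. c *\<^sub>C mv I x \<xi> i)"
  by (simp_all add: mv_def fun_eq_iff distrib_right sum.distrib scaleC_mult_left
      bounded_linear.linear[OF bounded_linear_scaleC, THEN linear_sum])

lemma ip_scaleC: "ip I (\<lambda>i. c *\<^sub>C \<xi> i) (\<lambda>i. c *\<^sub>C \<xi> i) = (cmod c)\<^sup>2 *\<^sub>R ip I \<xi> \<xi>"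
proof -
  have "c * cnj c = of_real ((cmod c)\<^sup>2)" using complex_norm_square[of c] by simp
  then have "star (c *\<^sub>C y) * (c *\<^sub>C y) = (cmod c)\<^sup>2 *\<^sub>R (star y * y)" for y :: 'a
    by (simp add: star_scaleC scaleC_mult_left scaleC_mult_right scaleC_scaleC mult.commute flip: scaleC_of_real)
  then show ?thesis by (simp add: ip_def scaleR_sum_right)
qed

lemma mle_mono: assumes "mle I s x" "0 \<le> s" "s \<le> t" shows "mle I t x"
  unfolding mle_def
proof
  fix \<xi>
  have "s\<^sup>2 \<le> t\<^sup>2" using assms by (simp add: power_mono)
  then have "pos ((s\<^sup>2 *\<^sub>R ip I \<xi> \<xi> - ip I (mv I x \<xi>) (mv I x \<xi>)) + (t\<^sup>2 - s\<^sup>2) *\<^sub>R ip I \<xi> \<xi>)"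
    using assms(1) by (intro pos_add pos_scaleR ip_pos) (auto simp: mle_def)
  then show "pos (t\<^sup>2 *\<^sub>R ip I \<xi> \<xi> - ip I (mv I x \<xi>) (mv I x \<xi>))" by (simp add: scaleR_diff_left)
qed

lemma mle_zero: "mle I 0 (\<lambda>i j. 0)" by (simp add: mle_def mv_def ip_def)

lemma mle_add:
  assumes x: "mle I s x" and y: "mle I t y" and st: "s > 0" "t > 0"
  shows "mle I (s + t) (\<lambda>i j. x i j + y i j)"
  unfolding mle_def mv_add
proof
  fix \<xi>
  define a b where "a = mv I x \<xi>" and "b = mv I y \<xi>"
  define r where "r = sqrt (t / s)"
  have r: "r > 0" "r * r = t / s" using st by (simp_all add: r_def)
  let ?v = "\<lambda>i. r *\<^sub>R a i - (1 / r) *\<^sub>R b i"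
  have "pos ((1 + t / s) *\<^sub>R (s\<^sup>2 *\<^sub>R ip I \<xi> \<xi> - ip I a a) + (1 + s / t) *\<^sub>R (t\<^sup>2 *\<^sub>R ip I \<xi> \<xi> - ip I b b) + ip I ?v ?v)"
    using x y st by (intro pos_add pos_scaleR ip_pos) (auto simp: mle_def a_def b_def)
  also have "(1 + t / s) *\<^sub>R (s\<^sup>2 *\<^sub>R ip I \<xi> \<xi> - ip I a a) + (1 + s / t) *\<^sub>R (t\<^sup>2 *\<^sub>R ip I \<xi> \<xi> - ip I b b) + ip I ?v ?v
    = (s + t)\<^sup>2 *\<^sub>R ip I \<xi> \<xi> - ip I (\<lambda>i. a i + b i) (\<lambda>i. a i + b i)"
  proof -
    have e: "(1 + t / s) * s\<^sup>2 + (1 + s / t) * t\<^sup>2 = (s + t)\<^sup>2"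
      using st by (simp add: field_simps power2_eq_square)
    have f: "inverse r * inverse r = s / t"
      using r(2) st by (metis inverse_divide inverse_mult_distrib)
    have "ip I ?v ?v = (t / s) *\<^sub>R ip I a a - ip I a b - ip I b a + (s / t) *\<^sub>R ip I b b"
      using r f by (simp add: ip_simps r(2)[symmetric] f[symmetric] divide_inverse algebra_simps)
    moreover have "(1 + t / s) *\<^sub>R (s\<^sup>2 *\<^sub>R ip I \<xi> \<xi>) + (1 + s / t) *\<^sub>R (t\<^sup>2 *\<^sub>R ip I \<xi> \<xi>) = (s + t)\<^sup>2 *\<^sub>R ip I \<xi> \<xi>"
      unfolding e[symmetric] by (simp add: scaleR_left_distrib)
    ultimately show ?thesis by (simp add: ip_simps scaleR_diff_right algebra_simps)
  qed
  finally show "pos ((s + t)\<^sup>2 *\<^sub>R ip I \<xi> \<xi> - ip I (\<lambda>i. mv I x \<xi> i + mv I y \<xi> i) (\<lambda>i. mv I x \<xi> i + mv I y \<xi> i))"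
    by (simp add: a_def b_def)
qed

definition munit :: "'i \<Rightarrow> 'i \<Rightarrow> 't::uc_star \<Rightarrow> 'i \<Rightarrow> 'i \<Rightarrow> 't" where
  "munit i j a k l = (if k = i \<and> l = j then a else 0)"

lemma pos_le_sum: "finite I \<Longrightarrow> j \<in> I \<Longrightarrow> (\<And>i. i \<in> I \<Longrightarrow> pos (f i)) \<Longrightarrow> pos (sum f I - f j)"
  by (simp add: sum.remove[of I j f]) (rule pos_sum, simp)

lemma mle_munit:
  assumes I: "finite I" "i \<in> I" "j \<in> I" shows "mle I (norm a) (munit i j a)"
  unfolding mle_def
proof
  fix \<xi>
  have m: "mv I (munit i j a) \<xi> k = (if k = i then a * \<xi> j else 0)" for k
  proof -
    have "mv I (munit i j a) \<xi> k = (\<Sum>l\<in>I. if l = j then munit i j a k l * \<xi> l else 0)"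
      unfolding mv_def by (rule sum.cong) (auto simp: munit_def)
    then show ?thesis using I by (simp add: munit_def)
  qed
  have "ip I (mv I (munit i j a) \<xi>) (mv I (munit i j a) \<xi>) = (\<Sum>k\<in>I. if k = i then star (a * \<xi> j) * (a * \<xi> j) else 0)"
    unfolding ip_def by (rule sum.cong) (auto simp: m)
  then have 1: "ip I (mv I (munit i j a) \<xi>) (mv I (munit i j a) \<xi>) = star (\<xi> j) * (star a * a) * \<xi> j"
    using I by (simp add: star_mult mult.assoc)
  have "pos ((norm a)\<^sup>2 *\<^sub>R 1 - star a * a)"
    by (rule pos_norm_diff) (simp_all add: star_mult star_star norm_star_mult)
  then have "pos (star (\<xi> j) * ((norm a)\<^sup>2 *\<^sub>R 1 - star a * a) * \<xi> j)" by (rule pos_conj)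
  moreover have "pos ((norm a)\<^sup>2 *\<^sub>R (ip I \<xi> \<xi> - star (\<xi> j) * \<xi> j))"
    unfolding ip_def using I by (intro pos_scaleR pos_le_sum[where f="\<lambda>i. star (\<xi> i) * \<xi> i"] pos_star_mult) auto
  ultimately have "pos (star (\<xi> j) * ((norm a)\<^sup>2 *\<^sub>R 1 - star a * a) * \<xi> j + (norm a)\<^sup>2 *\<^sub>R (ip I \<xi> \<xi> - star (\<xi> j) * \<xi> j))"
    by (rule pos_add)
  then show "pos ((norm a)\<^sup>2 *\<^sub>R ip I \<xi> \<xi> - ip I (mv I (munit i j a) \<xi>) (mv I (munit i j a) \<xi>))"
    unfolding 1 by (simp add: algebra_simps)
qed

lemma mat_decomp:
  assumes "finite I" "x \<in> mats I S"
  shows "x = (\<lambda>k l. \<Sum>p\<in>I\<times>I. munit (fst p) (snd p) (x (fst p) (snd p)) k l)"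
proof (intro ext)
  fix k l
  have "(\<Sum>p\<in>I\<times>I. munit (fst p) (snd p) (x (fst p) (snd p)) k l) = (\<Sum>p\<in>I\<times>I. if p = (k, l) then x k l else 0)"
    by (rule sum.cong) (auto simp: munit_def)
  also have "\<dots> = x k l" using assms by (auto simp: mats_def)
  finally show "x k l = (\<Sum>p\<in>I\<times>I. munit (fst p) (snd p) (x (fst p) (snd p)) k l)" by simp
qed

lemma mle_exists:
  assumes I: "finite I" and x: "x \<in> mats I S" obtains t where "t > 0" "mle I t x"
proof -
  have "\<exists>t>0. mle I t (\<lambda>k l. \<Sum>p\<in>P. munit (fst p) (snd p) (x (fst p) (snd p)) k l)" if "finite P" "P \<subseteq> I \<times> I" for P
    using that
  proof (induction P rule: finite_induct)
    case empty then show ?case using mle_mono[OF mle_zero, of 1] by (auto intro!: exI[of _ 1])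
  next
    case (insert p P)
    then obtain t where t: "t > 0" "mle I t (\<lambda>k l. \<Sum>p\<in>P. munit (fst p) (snd p) (x (fst p) (snd p)) k l)" by auto
    have "mle I (norm (x (fst p) (snd p)) + 1) (munit (fst p) (snd p) (x (fst p) (snd p)))"
      using insert.prems by (intro mle_mono[OF mle_munit[OF I]]) auto
    from mle_add[OF this t(2) _ t(1)] show ?case using insert.hyps t(1)
      by (intro exI[of _ "norm (x (fst p) (snd p)) + 1 + t"]) (auto simp: add_pos_pos add_nonneg_pos)
  qed
  from this[of "I \<times> I"] show ?thesis using that I mat_decomp[OF I x] by auto
qed

lemma closed_mle: "closed {t. mle I t (x :: 'i \<Rightarrow> 'i \<Rightarrow> 't::uc_star)}"
proof -
  have "closed {t::real. pos (t\<^sup>2 *\<^sub>R ip I \<xi> \<xi> - ip I (mv I x \<xi>) (mv I x \<xi>))}" for \<xi> :: "'i \<Rightarrow> 't"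
    using closed_vimage[OF closed_pos, of "\<lambda>t::real. t\<^sup>2 *\<^sub>R ip I \<xi> \<xi> - ip I (mv I x \<xi>) (mv I x \<xi>)"]
    by (simp add: vimage_def continuous_intros)
  then have "closed (\<Inter>\<xi>. {t::real. pos (t\<^sup>2 *\<^sub>R ip I \<xi> \<xi> - ip I (mv I x \<xi>) (mv I x \<xi>))})" by (intro closed_INT) auto
  moreover have "(\<Inter>\<xi>. {t::real. pos (t\<^sup>2 *\<^sub>R ip I \<xi> \<xi> - ip I (mv I x \<xi>) (mv I x \<xi>))}) = {t. mle I t x}"
    by (auto simp: mle_def)
  ultimately show ?thesis by simp
qed

context
  fixes I :: "'i set"
  assumes I: "finite I"
begin

lemma mnorm_attained:
  assumes x: "x \<in> mats I S" shows "0 \<le> mnorm I x" "mle I (mnorm I x) x"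
proof -
  let ?T = "{t. 0 \<le> t \<and> mle I t x}"
  have ne: "?T \<noteq> {}" using mle_exists[OF I x] less_imp_le by blast
  have bb: "bdd_below ?T" by (rule bdd_belowI[of _ 0]) auto
  have "?T = {0..} \<inter> {t. mle I t x}" by auto
  then have "closed ?T" using closed_mle[of I x] by (simp add: closed_Int)
  then have "Inf ?T \<in> ?T" using closed_contains_Inf[OF ne bb] by simp
  then show "0 \<le> mnorm I x" "mle I (mnorm I x) x" by (auto simp: mnorm_def)
qed

lemma mnorm_le_iff:
  assumes x: "x \<in> mats I S" and t: "0 \<le> t" shows "mnorm I x \<le> t \<longleftrightarrow> mle I t x"
proof
  show "mnorm I x \<le> t \<Longrightarrow> mle I t x" using mle_mono mnorm_attained[OF x] by blast
  show "mle I t x \<Longrightarrow> mnorm I x \<le> t" unfolding mnorm_def using t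
    by (intro cInf_lower) (auto intro!: bdd_belowI[of _ 0])
qed

lemma mnorm_entry:
  assumes x: "x \<in> mats I S" and ij: "i \<in> I" "j \<in> I" shows "norm (x i j) \<le> mnorm I x"
proof -
  define \<xi> where "\<xi> k = (if k = j then 1 else 0 :: 'a)" for k
  have ip1: "ip I \<xi> \<xi> = 1"
  proof -
    have "ip I \<xi> \<xi> = (\<Sum>k\<in>I. if k = j then 1 else 0)" unfolding ip_def by (rule sum.cong) (auto simp: \<xi>_def)
    then show ?thesis using I ij by simp
  qed
  have mvx: "mv I x \<xi> k = x k j" for k
  proof -
    have "mv I x \<xi> k = (\<Sum>l\<in>I. if l = j then x k j else 0)" unfolding mv_def by (rule sum.cong) (auto simp: \<xi>_def)
    then show ?thesis using I ij by simp
  qed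
  have p: "pos ((mnorm I x)\<^sup>2 *\<^sub>R 1 - ip I (mv I x \<xi>) (mv I x \<xi>))"
    using mnorm_attained(2)[OF x] ip1 unfolding mle_def by metis
  moreover have "pos (ip I (mv I x \<xi>) (mv I x \<xi>) - star (x i j) * x i j)"
    unfolding ip_def mvx using pos_le_sum[OF I ij(1), of "\<lambda>k. star (x k j) * x k j"] pos_star_mult by blast
  ultimately have "pos ((mnorm I x)\<^sup>2 *\<^sub>R 1 - star (x i j) * x i j)" using pos_add by fastforce
  then have "norm (star (x i j) * x i j) \<le> norm ((mnorm I x)\<^sup>2 *\<^sub>R (1::'a))" by (rule pos_le_norm_le[OF pos_star_mult])
  then have "(norm (x i j))\<^sup>2 \<le> (mnorm I x)\<^sup>2" by (simp add: norm_star_mult)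
  then show ?thesis by (rule power2_le_imp_le) (rule mnorm_attained(1)[OF x])
qed

lemma mle_mmul: assumes "mle I s x" "mle I t y" shows "mle I (s * t) (mmul I x y)"
  unfolding mle_def mv_mmul
proof
  fix \<xi>
  have "pos ((s\<^sup>2 *\<^sub>R ip I (mv I y \<xi>) (mv I y \<xi>) - ip I (mv I x (mv I y \<xi>)) (mv I x (mv I y \<xi>)))
     + s\<^sup>2 *\<^sub>R (t\<^sup>2 *\<^sub>R ip I \<xi> \<xi> - ip I (mv I y \<xi>) (mv I y \<xi>)))"
    using assms by (intro pos_add pos_scaleR) (auto simp: mle_def)
  then show "pos ((s * t)\<^sup>2 *\<^sub>R ip I \<xi> \<xi> - ip I (mv I x (mv I y \<xi>)) (mv I x (mv I y \<xi>)))"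
    by (simp add: scaleR_diff_right power_mult_distrib)
qed

lemma mle_scaleC: assumes "mle I s x" shows "mle I (cmod c * s) (\<lambda>i j. c *\<^sub>C x i j)"
  unfolding mle_def mv_scaleC ip_scaleC
proof
  fix \<xi>
  have "pos ((cmod c)\<^sup>2 *\<^sub>R (s\<^sup>2 *\<^sub>R ip I \<xi> \<xi> - ip I (mv I x \<xi>) (mv I x \<xi>)))"
    using assms by (intro pos_scaleR) (auto simp: mle_def)
  then show "pos ((cmod c * s)\<^sup>2 *\<^sub>R ip I \<xi> \<xi> - (cmod c)\<^sup>2 *\<^sub>R ip I (mv I x \<xi>) (mv I x \<xi>))"
    by (simp add: scaleR_diff_right power_mult_distrib)
qed

text \<open>Expands the inner square of \<open>t\<^sup>2 \<xi> - x (madj x) \<xi>\<close>, which is positive.\<close>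
lemma mle_madj: assumes x: "mle I t x" and t: "t > 0" shows "mle I t (madj x)"
  unfolding mle_def
proof
  fix \<xi>
  define \<eta> where "\<eta> = mv I (madj x) \<xi>"
  define h where "h = mv I x \<eta>"
  have xh: "ip I \<xi> h = ip I \<eta> \<eta>" "ip I h \<xi> = ip I \<eta> \<eta>"
    unfolding h_def by (subst ip_madj', simp add: \<eta>_def, subst ip_madj, simp add: \<eta>_def)
  have e: "ip I (\<lambda>i. t\<^sup>2 *\<^sub>R \<xi> i - h i) (\<lambda>i. t\<^sup>2 *\<^sub>R \<xi> i - h i) + (t\<^sup>2 *\<^sub>R ip I \<eta> \<eta> - ip I h h)
    = t\<^sup>2 *\<^sub>R (t\<^sup>2 *\<^sub>R ip I \<xi> \<xi> - ip I \<eta> \<eta>)"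
    by (simp add: ip_simps xh algebra_simps)
  have "pos (ip I (\<lambda>i. t\<^sup>2 *\<^sub>R \<xi> i - h i) (\<lambda>i. t\<^sup>2 *\<^sub>R \<xi> i - h i) + (t\<^sup>2 *\<^sub>R ip I \<eta> \<eta> - ip I h h))"
    using x by (intro pos_add ip_pos) (auto simp: mle_def h_def)
  from pos_scaleR[OF this[unfolded e], of "1 / t\<^sup>2"] show "pos (t\<^sup>2 *\<^sub>R ip I \<xi> \<xi> - ip I (mv I (madj x) \<xi>) (mv I (madj x) \<xi>))" using t by (simp add: \<eta>_def)
qed

text \<open>Expands the inner square of \<open>s \<xi> - (madj x) x \<xi>\<close>, which is positive. This is the difficult half of the
  C*-identity for the matrix norm.\<close>
lemma mle_cstar: assumes k: "mle I s (mmul I (madj x) x)" and s: "s > 0" shows "mle I (sqrt s) x"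
  unfolding mle_def
proof
  fix \<xi>
  define h where "h = mv I (mmul I (madj x) x) \<xi>"
  define \<eta> where "\<eta> = mv I x \<xi>"
  have h: "h = mv I (madj x) \<eta>" by (simp add: h_def \<eta>_def mv_mmul)
  have xh: "ip I \<xi> h = ip I \<eta> \<eta>" "ip I h \<xi> = ip I \<eta> \<eta>"
    unfolding h by (subst ip_madj', simp add: \<eta>_def, subst ip_madj, simp add: \<eta>_def)
  have e: "ip I (\<lambda>i. s *\<^sub>R \<xi> i - h i) (\<lambda>i. s *\<^sub>R \<xi> i - h i) + (s\<^sup>2 *\<^sub>R ip I \<xi> \<xi> - ip I h h)
    = (2 * s) *\<^sub>R (s *\<^sub>R ip I \<xi> \<xi> - ip I \<eta> \<eta>)"
    by (simp add: ip_simps xh algebra_simps power2_eq_square scaleR_2 flip: scaleR_scaleR)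
  have "pos (ip I (\<lambda>i. s *\<^sub>R \<xi> i - h i) (\<lambda>i. s *\<^sub>R \<xi> i - h i) + (s\<^sup>2 *\<^sub>R ip I \<xi> \<xi> - ip I h h))"
    using k by (intro pos_add ip_pos) (auto simp: mle_def h_def)
  from pos_scaleR[OF this[unfolded e], of "1 / (2 * s)"] show "pos ((sqrt s)\<^sup>2 *\<^sub>R ip I \<xi> \<xi> - ip I (mv I x \<xi>) (mv I x \<xi>))" using s by (simp add: \<eta>_def)
qed

end

definition matalg :: "'i set \<Rightarrow> 't::uc_star set \<Rightarrow> ('i \<Rightarrow> 'i \<Rightarrow> 't) cstar" where
  "matalg I S = \<lparr>carrier = mats I S, mult = mmul I, one = (\<lambda>i j. if i = j \<and> i \<in> I then 1 else 0),
     zero = (\<lambda>i j. 0), add = (\<lambda>x y i j. x i j + y i j), smult = (\<lambda>c x i j. c *\<^sub>C x i j),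
     adj = madj, cnorm = mnorm I\<rparr>"

lemma matalg_simps [simp]:
  "carrier (matalg I S) = mats I S" "x \<otimes>\<^bsub>matalg I S\<^esub> y = mmul I x y" "\<zero>\<^bsub>matalg I S\<^esub> = (\<lambda>i j. 0)"
  "x \<oplus>\<^bsub>matalg I S\<^esub> y = (\<lambda>i j. x i j + y i j)" "c \<odot>\<^bsub>matalg I S\<^esub> x = (\<lambda>i j. c *\<^sub>C x i j)"
  "adj (matalg I S) x = madj x" "cnorm (matalg I S) x = mnorm I x"
  "\<one>\<^bsub>matalg I S\<^esub> = (\<lambda>i j. if i = j \<and> i \<in> I then 1 else 0)"
  by (simp_all add: matalg_def)

context
  fixes I :: "'i set" and S :: "'t::uc_star set"
  assumes I: "finite I" and S: "csub S"
begin

lemma mats_mem: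
  "(\<lambda>i j. 0) \<in> mats I S" "x \<in> mats I S \<Longrightarrow> y \<in> mats I S \<Longrightarrow> (\<lambda>i j. x i j + y i j) \<in> mats I S"
  "x \<in> mats I S \<Longrightarrow> y \<in> mats I S \<Longrightarrow> (\<lambda>i j. x i j - y i j) \<in> mats I S"
  "x \<in> mats I S \<Longrightarrow> (\<lambda>i j. - x i j) \<in> mats I S"
  "x \<in> mats I S \<Longrightarrow> y \<in> mats I S \<Longrightarrow> mmul I x y \<in> mats I S"
  "x \<in> mats I S \<Longrightarrow> (\<lambda>i j. c *\<^sub>C x i j) \<in> mats I S"
  "x \<in> mats I S \<Longrightarrow> madj x \<in> mats I S"
  using S by (auto simp: mats_def mmul_def madj_def csub_mem intro!: csub_sum)

lemma munit_mem: "i \<in> I \<Longrightarrow> j \<in> I \<Longrightarrow> a \<in> S \<Longrightarrow> munit i j a \<in> mats I S"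
  using S by (auto simp: mats_def munit_def csub_mem)

lemma mnorm_triangle:
  assumes x: "x \<in> mats I S" and y: "y \<in> mats I S"
  shows "mnorm I (\<lambda>i j. x i j + y i j) \<le> mnorm I x + mnorm I y"
proof (rule field_le_epsilon)
  fix e :: real assume e: "e > 0"
  note nx = mnorm_attained[OF I x] and ny = mnorm_attained[OF I y]
  have "mle I ((mnorm I x + e/2) + (mnorm I y + e/2)) (\<lambda>i j. x i j + y i j)"
    using nx ny e by (intro mle_add mle_mono[OF nx(2)] mle_mono[OF ny(2)]) auto
  then have "mnorm I (\<lambda>i j. x i j + y i j) \<le> (mnorm I x + e/2) + (mnorm I y + e/2)"
    using nx ny e by (subst mnorm_le_iff[OF I mats_mem(2)[OF x y]]) auto
  then show "mnorm I (\<lambda>i j. x i j + y i j) \<le> mnorm I x + mnorm I y + e" by simp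
qed

lemma mnorm_mult:
  assumes x: "x \<in> mats I S" and y: "y \<in> mats I S"
  shows "mnorm I (mmul I x y) \<le> mnorm I x * mnorm I y"
  using mnorm_attained[OF I x] mnorm_attained[OF I y]
  by (subst mnorm_le_iff[OF I mats_mem(5)[OF x y]]) (auto intro: mle_mmul[OF I])

lemma mnorm_scaleC:
  assumes x: "x \<in> mats I S" shows "mnorm I (\<lambda>i j. c *\<^sub>C x i j) = cmod c * mnorm I x"
proof -
  have le: "mnorm I (\<lambda>i j. c *\<^sub>C x i j) \<le> cmod c * mnorm I x" if x: "x \<in> mats I S" for x c
    using mnorm_attained[OF I x] by (subst mnorm_le_iff[OF I mats_mem(6)[OF x]]) (auto intro: mle_scaleC[OF I])
  show ?thesis
  proof (cases "c = 0")
    case True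
    then show ?thesis using le[OF x, of 0] mnorm_attained(1)[OF I mats_mem(1)] by simp
  next
    case False
    have "mnorm I x \<le> cmod (inverse c) * mnorm I (\<lambda>i j. c *\<^sub>C x i j)"
      using le[OF mats_mem(6)[OF x], of "inverse c" c] False by (simp add: scaleC_scaleC)
    then have "cmod c * mnorm I x \<le> mnorm I (\<lambda>i j. c *\<^sub>C x i j)"
      using mult_left_mono[of "mnorm I x" _ "cmod c"] False
      by (smt (verit) mult.assoc mult_cancel_right1 norm_ge_zero norm_mult norm_one right_inverse)
    then show ?thesis using le[OF x, of c] by simp
  qed
qed

lemma mnorm_eq_0: assumes x: "x \<in> mats I S" shows "mnorm I x = 0 \<longleftrightarrow> x = (\<lambda>i j. 0)"
proof
  assume n: "mnorm I x = 0"
  show "x = (\<lambda>i j. 0)"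
  proof (intro ext)
    fix i j show "x i j = 0"
    proof (cases "i \<in> I \<and> j \<in> I")
      case True then show ?thesis using mnorm_entry[OF I x, of i j] n by simp
    qed (use x in \<open>auto simp: mats_def\<close>)
  qed
next
  assume "x = (\<lambda>i j. 0)"
  then show "mnorm I x = 0"
    using mnorm_le_iff[OF I x, of 0] mle_zero[of I] mnorm_attained(1)[OF I x] by simp
qed

lemma mnorm_madj_le: assumes x: "x \<in> mats I S" shows "mnorm I (madj x) \<le> mnorm I x"
proof (rule field_le_epsilon)
  fix e :: real assume e: "e > 0"
  have "mle I (mnorm I x + e) (madj x)"
    using mnorm_attained[OF I x] e by (intro mle_madj[OF I] mle_mono[OF mnorm_attained(2)[OF I x]]) auto
  then show "mnorm I (madj x) \<le> mnorm I x + e"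
    using mnorm_attained[OF I x] e by (subst mnorm_le_iff[OF I mats_mem(7)[OF x]]) auto
qed

lemma mnorm_cstar: assumes x: "x \<in> mats I S" shows "mnorm I (mmul I (madj x) x) = (mnorm I x)\<^sup>2"
proof (rule antisym)
  have "mnorm I (mmul I (madj x) x) \<le> mnorm I (madj x) * mnorm I x" by (rule mnorm_mult[OF mats_mem(7)[OF x] x])
  also have "\<dots> \<le> mnorm I x * mnorm I x"
    by (rule mult_right_mono[OF mnorm_madj_le[OF x] mnorm_attained(1)[OF I x]])
  finally show "mnorm I (mmul I (madj x) x) \<le> (mnorm I x)\<^sup>2" by (simp add: power2_eq_square)
  show "(mnorm I x)\<^sup>2 \<le> mnorm I (mmul I (madj x) x)"
  proof (rule field_le_epsilon)
    fix e :: real assume e: "e > 0"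
    define s where "s = mnorm I (mmul I (madj x) x) + e"
    have xx: "mmul I (madj x) x \<in> mats I S" by (intro mats_mem x)
    have s: "s > 0" using mnorm_attained(1)[OF I xx] e by (simp add: s_def)
    have "mle I s (mmul I (madj x) x)"
      by (rule mle_mono[OF mnorm_attained(2)[OF I xx] mnorm_attained(1)[OF I xx]]) (use e in \<open>simp add: s_def\<close>)
    then have "mle I (sqrt s) x" by (rule mle_cstar[OF I _ s])
    then have "mnorm I x \<le> sqrt s" using s by (subst mnorm_le_iff[OF I x]) auto
    then have "(mnorm I x)\<^sup>2 \<le> (sqrt s)\<^sup>2" by (rule power_mono) (rule mnorm_attained(1)[OF I x])
    then show "(mnorm I x)\<^sup>2 \<le> mnorm I (mmul I (madj x) x) + e" using s by (simp add: s_def)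
  qed
qed

lemma mnorm_complete:
  assumes f: "\<And>n::nat. f n \<in> mats I S"
    and C: "\<And>e. e > 0 \<Longrightarrow> \<exists>N. \<forall>m\<ge>N. \<forall>n\<ge>N. mnorm I (\<lambda>i j. f m i j - f n i j) < e"
  shows "\<exists>l\<in>mats I S. (\<lambda>n. mnorm I (\<lambda>i j. f n i j - l i j)) \<longlonglongrightarrow> 0"
proof -
  have fd: "(\<lambda>i j. f m i j - f n i j) \<in> mats I S" for m n by (intro mats_mem f)
  have "\<exists>l\<in>S. (\<lambda>n. f n i j) \<longlonglongrightarrow> l" if ij: "i \<in> I" "j \<in> I" for i j
  proof -
    have "Cauchy (\<lambda>n. f n i j)"
    proof (rule metric_CauchyI)
      fix e :: real assume "e > 0"
      then obtain N where N: "\<forall>m\<ge>N. \<forall>n\<ge>N. mnorm I (\<lambda>i j. f m i j - f n i j) < e" using C by blast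
      have "dist (f m i j) (f n i j) < e" if mn: "m \<ge> N" "n \<ge> N" for m n
      proof -
        have "dist (f m i j) (f n i j) \<le> mnorm I (\<lambda>i j. f m i j - f n i j)"
          using mnorm_entry[OF I fd ij, of m n] by (simp add: dist_norm)
        also have "\<dots> < e" using N mn by blast
        finally show ?thesis .
      qed
      then show "\<exists>M. \<forall>m\<ge>M. \<forall>n\<ge>M. dist (f m i j) (f n i j) < e" by blast
    qed
    then obtain l where l: "(\<lambda>n. f n i j) \<longlonglongrightarrow> l" using Cauchy_convergent convergent_def by blast
    have "l \<in> S" by (rule csub_limit[OF S l]) (use f ij in \<open>auto simp: mats_def\<close>)
    then show ?thesis using l by blast
  qed
  then have "\<forall>i\<in>I. \<forall>j\<in>I. \<exists>l. l \<in> S \<and> (\<lambda>n. f n i j) \<longlonglongrightarrow> l" by blast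
  then obtain l0 where l0: "\<And>i j. i \<in> I \<Longrightarrow> j \<in> I \<Longrightarrow> l0 i j \<in> S \<and> (\<lambda>n. f n i j) \<longlonglongrightarrow> l0 i j" by metis
  define l where "l i j = (if i \<in> I \<and> j \<in> I then l0 i j else 0)" for i j
  have l: "l \<in> mats I S" using l0 by (auto simp: l_def mats_def)
  have lim: "(\<lambda>n. f n i j) \<longlonglongrightarrow> l i j" for i j
    using l0[of i j] f by (auto simp: l_def mats_def)
  have "(\<lambda>n. mnorm I (\<lambda>i j. f n i j - l i j)) \<longlonglongrightarrow> 0"
    unfolding LIMSEQ_def
  proof (intro allI impI)
    fix r :: real assume "r > 0"
    then obtain N where N: "\<forall>m\<ge>N. \<forall>n\<ge>N. mnorm I (\<lambda>i j. f m i j - f n i j) < r / 2"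
      using C[of "r/2"] by auto
    have "mnorm I (\<lambda>i j. f n i j - l i j) \<le> r / 2" if n: "n \<ge> N" for n
    proof -
      have "mle I (r / 2) (\<lambda>i j. f n i j - l i j)"
        unfolding mle_def
      proof
        fix \<xi>
        let ?F = "\<lambda>y. (r/2)\<^sup>2 *\<^sub>R ip I \<xi> \<xi> - ip I (mv I (\<lambda>i j. f n i j - y i j) \<xi>) (mv I (\<lambda>i j. f n i j - y i j) \<xi>)"
        have p: "pos (?F (f (m + N)))" for m
        proof -
          have "mnorm I (\<lambda>i j. f n i j - f (m + N) i j) \<le> r / 2" using N n by (simp add: less_imp_le)
          then have "mle I (r / 2) (\<lambda>i j. f n i j - f (m + N) i j)"
            using \<open>r > 0\<close> by (subst (asm) mnorm_le_iff[OF I fd]) auto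
          then show ?thesis by (simp add: mle_def)
        qed
        have lm: "(\<lambda>m. f (m + N) i j) \<longlonglongrightarrow> l i j" for i j by (rule LIMSEQ_ignore_initial_segment[OF lim])
        have "(\<lambda>m. ?F (f (m + N))) \<longlonglongrightarrow> ?F l"
          unfolding ip_def mv_def by (intro tendsto_intros lm)
        then have "?F l \<in> {a. pos a}" by (rule closed_sequentially[OF closed_pos, rotated]) (use p in simp)
        then show "pos (?F l)" by simp
      qed
      then show ?thesis using \<open>r > 0\<close> by (subst mnorm_le_iff[OF I mats_mem(3)[OF f l]]) auto
    qed
    note le = this
    have "dist (mnorm I (\<lambda>i j. f n i j - l i j)) 0 < r" if "n \<ge> N" for n
    proof -
      have "dist (mnorm I (\<lambda>i j. f n i j - l i j)) 0 = mnorm I (\<lambda>i j. f n i j - l i j)"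
        using mnorm_attained(1)[OF I mats_mem(3)[OF f l], of n] by simp
      also have "\<dots> \<le> r / 2" using that by (rule le)
      also have "\<dots> < r" using \<open>r > 0\<close> by simp
      finally show ?thesis .
    qed
    then show "\<exists>N. \<forall>n\<ge>N. dist (mnorm I (\<lambda>i j. f n i j - l i j)) 0 < r" by blast
  qed
  then show ?thesis using l by blast
qed

lemma abelian_group_matalg: "abelian_group (matalg I S)"
proof (rule abelian_groupI)
  fix x assume x: "x \<in> carrier (matalg I S)"
  show "\<exists>y\<in>carrier (matalg I S). y \<oplus>\<^bsub>matalg I S\<^esub> x = \<zero>\<^bsub>matalg I S\<^esub>"
    using x mats_mem(4) by (intro bexI[of _ "\<lambda>i j. - x i j"]) auto
qed (auto simp: mats_mem ac_simps)

lemma matalg_minus: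
  assumes "x \<in> mats I S" "y \<in> mats I S" shows "x \<ominus>\<^bsub>matalg I S\<^esub> y = (\<lambda>i j. x i j - y i j)"
proof -
  interpret abelian_group "matalg I S" by (rule abelian_group_matalg)
  have "\<ominus>\<^bsub>matalg I S\<^esub> y = (\<lambda>i j. - y i j)" using assms mats_mem(4) by (intro minus_equality) auto
  then show ?thesis by (simp add: minus_eq)
qed

lemma mmul_assoc: "mmul I (mmul I x y) z = mmul I x (mmul I y z)"
proof (intro ext)
  fix i j
  have "mmul I (mmul I x y) z i j = (\<Sum>k\<in>I. \<Sum>l\<in>I. x i l * (y l k * z k j))"
    by (simp add: mmul_def sum_distrib_right mult.assoc)
  also have "\<dots> = (\<Sum>l\<in>I. \<Sum>k\<in>I. x i l * (y l k * z k j))" by (rule sum.swap)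
  finally show "mmul I (mmul I x y) z i j = mmul I x (mmul I y z) i j" by (simp add: mmul_def sum_distrib_left)
qed

lemma madj_mmul: "madj (mmul I x y) = mmul I (madj y) (madj x)"
  by (simp add: madj_def mmul_def star_sum star_mult fun_eq_iff)

lemma mmul_linear:
  "mmul I (\<lambda>i j. x i j + y i j) z = (\<lambda>i j. mmul I x z i j + mmul I y z i j)"
  "mmul I z (\<lambda>i j. x i j + y i j) = (\<lambda>i j. mmul I z x i j + mmul I z y i j)"
  "mmul I (\<lambda>i j. c *\<^sub>C x i j) z = (\<lambda>i j. c *\<^sub>C mmul I x z i j)"
  "mmul I z (\<lambda>i j. c *\<^sub>C x i j) = (\<lambda>i j. c *\<^sub>C mmul I z x i j)"
  by (simp_all add: mmul_def fun_eq_iff distrib_left distrib_right sum.distrib scaleC_mult_left scaleC_mult_right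
      bounded_linear.linear[OF bounded_linear_scaleC, THEN linear_sum])

lemma madj_linear:
  "madj (\<lambda>i j. x i j + y i j) = (\<lambda>i j. madj x i j + madj y i j)"
  "madj (\<lambda>i j. c *\<^sub>C x i j) = (\<lambda>i j. cnj c *\<^sub>C madj x i j)"
  by (simp_all add: madj_def star_add star_scaleC fun_eq_iff)

lemma cstar_algebra_matalg: "cstar_algebra (matalg I S)"
proof -
  let ?M = "matalg I S"
  have cd: "cdist ?M x y = mnorm I (\<lambda>i j. x i j - y i j)" if "x \<in> mats I S" "y \<in> mats I S" for x y
    using that by (simp add: cdist_def matalg_minus)
  have sym: "mnorm I (\<lambda>i j. x i j - y i j) = mnorm I (\<lambda>i j. y i j - x i j)" if "x \<in> mats I S" "y \<in> mats I S" for x y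
    using mnorm_scaleC[OF mats_mem(3)[OF that], of "-1"] by (simp add: scaleC_minus_one)
  have M: "Metric_space (carrier ?M) (cdist ?M)"
  proof
    show "0 \<le> cdist ?M x y" for x y
      using mnorm_attained(1)[OF I mats_mem(3)] by (cases "x \<in> mats I S \<and> y \<in> mats I S") (auto simp: cd, auto simp: cdist_def)
    show "cdist ?M x y = cdist ?M y x" for x y
      using sym by (cases "x \<in> mats I S \<and> y \<in> mats I S") (auto simp: cd, auto simp: cdist_def)
    show "cdist ?M x y = 0 \<longleftrightarrow> x = y" if "x \<in> carrier ?M" "y \<in> carrier ?M" for x y
      using that mnorm_eq_0[OF mats_mem(3)] by (auto simp: cd fun_eq_iff)
    show "cdist ?M x z \<le> cdist ?M x y + cdist ?M y z" if "x \<in> carrier ?M" "y \<in> carrier ?M" "z \<in> carrier ?M" for x y z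
      using that mnorm_triangle[OF mats_mem(3)[of x y] mats_mem(3)[of y z]] by (simp add: cd)
  qed
  have comp: "Metric_space.mcomplete (carrier ?M) (cdist ?M)"
  proof (rule mcompleteI[OF M])
    fix f :: "nat \<Rightarrow> 'i \<Rightarrow> 'i \<Rightarrow> 't" assume f: "\<And>n. f n \<in> carrier ?M"
      and C: "\<And>e. e > 0 \<Longrightarrow> \<exists>N. \<forall>m\<ge>N. \<forall>n\<ge>N. cnorm ?M (f m \<ominus>\<^bsub>?M\<^esub> f n) < e"
    have "\<exists>l\<in>mats I S. (\<lambda>n. mnorm I (\<lambda>i j. f n i j - l i j)) \<longlonglongrightarrow> 0"
      by (rule mnorm_complete) (use f C in \<open>simp_all add: matalg_minus\<close>)
    then show "\<exists>l\<in>carrier ?M. (\<lambda>n. cnorm ?M (f n \<ominus>\<^bsub>?M\<^esub> l)) \<longlonglongrightarrow> 0" using f by (simp add: matalg_minus)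
  qed
  show ?thesis
    unfolding cstar_algebra_def cstar_algebra_axioms_def
  proof (intro conjI allI impI abelian_group_matalg comp)
    fix x y z :: "'i \<Rightarrow> 'i \<Rightarrow> 't"
    show "x \<otimes>\<^bsub>?M\<^esub> y \<otimes>\<^bsub>?M\<^esub> z = x \<otimes>\<^bsub>?M\<^esub> (y \<otimes>\<^bsub>?M\<^esub> z)" by (simp add: mmul_assoc)
    show "adj ?M (x \<otimes>\<^bsub>?M\<^esub> y) = adj ?M y \<otimes>\<^bsub>?M\<^esub> adj ?M x" by (simp add: madj_mmul)
  qed (simp_all add: mats_mem mnorm_triangle mnorm_mult mnorm_scaleC mnorm_eq_0 mnorm_cstar mnorm_attained(1)[OF I]
      mmul_linear madj_linear scaleC_add_left scaleC_add_right scaleC_scaleC)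
qed

end

section \<open>Corners\<close>

text \<open>A Neumann series, which also keeps the inverse inside every closed unital algebra containing \<open>y\<close>.\<close>
lemma invertible_add_pos:
  fixes y :: "'t::uc_star"
  assumes y: "pos y" and s: "s > 0"
  obtains p where "p * (s *\<^sub>R 1 + y) = 1" "(s *\<^sub>R 1 + y) * p = 1"
    "\<And>W. \<lbrakk>closed W; 1 \<in> W; y \<in> W; \<And>u v. u \<in> W \<Longrightarrow> v \<in> W \<Longrightarrow> u + v \<in> W \<and> u * v \<in> W; \<And>u r. u \<in> W \<Longrightarrow> r *\<^sub>R u \<in> W\<rbrakk> \<Longrightarrow> p \<in> W"
proof -
  define t where "t = s + norm y"
  have t: "t > 0" using s by (simp add: t_def add_pos_nonneg)
  define b where "b = (1/t) *\<^sub>R (norm y *\<^sub>R 1 - y)"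
  have "t *\<^sub>R b = norm y *\<^sub>R 1 - y" using t by (simp add: b_def)
  then have sy: "s *\<^sub>R 1 + y = t *\<^sub>R (1 - b)"
    by (simp add: scaleR_right_diff_distrib) (simp add: t_def scaleR_left_distrib)
  have "norm b \<le> norm y / t" using pos_norm_minus[OF y order_refl] t by (simp add: b_def divide_right_mono)
  also have "\<dots> < 1" using s t by (simp add: t_def)
  finally have nb: "norm b < 1" .
  have sm: "summable (\<lambda>n. b ^ n)"
    by (rule summable_norm_cancel, rule summable_comparison_test[of _ "\<lambda>n. norm b ^ n"])
      (use nb in \<open>auto intro!: exI[of _ 0] norm_power_ineq summable_geometric\<close>)
  define q where "q = suminf (\<lambda>n. b ^ n)"
  have lim: "(\<lambda>n. \<Sum>k<n. b ^ k) \<longlonglongrightarrow> q" unfolding q_def by (rule summable_LIMSEQ[OF sm])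
  have bn: "(\<lambda>n. b ^ n) \<longlonglongrightarrow> 0" by (rule summable_LIMSEQ_zero[OF sm])
  have g: "(\<Sum>k<n. b ^ k) * (1 - b) = 1 - b ^ n \<and> (1 - b) * (\<Sum>k<n. b ^ k) = 1 - b ^ n" for n
  proof (induction n)
    case (Suc n)
    have A: "(\<Sum>k<Suc n. b ^ k) * (1 - b) = (\<Sum>k<n. b ^ k) * (1 - b) + b ^ n * (1 - b)"
      "(1 - b) * (\<Sum>k<Suc n. b ^ k) = (1 - b) * (\<Sum>k<n. b ^ k) + (1 - b) * b ^ n"
      by (simp_all add: distrib_right distrib_left)
    show ?case unfolding A Suc[THEN conjunct1] Suc[THEN conjunct2]
      by (simp add: right_diff_distrib left_diff_distrib power_commutes)
  qed simp
  have "(\<lambda>n. (\<Sum>k<n. b ^ k) * (1 - b)) \<longlonglongrightarrow> q * (1 - b)" "(\<lambda>n. (1 - b) * (\<Sum>k<n. b ^ k)) \<longlonglongrightarrow> (1 - b) * q"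
    by (intro tendsto_intros lim)+
  moreover have "(\<lambda>n. 1 - b ^ n) \<longlonglongrightarrow> 1 - 0" by (intro tendsto_intros bn)
  ultimately have q: "q * (1 - b) = 1" "(1 - b) * q = 1"
    unfolding g[THEN conjunct1] g[THEN conjunct2] using LIMSEQ_unique by (metis diff_zero)+
  show ?thesis
  proof (rule that[of "(1/t) *\<^sub>R q"])
    show "(1/t) *\<^sub>R q * (s *\<^sub>R 1 + y) = 1" "(s *\<^sub>R 1 + y) * ((1/t) *\<^sub>R q) = 1"
      unfolding sy using q t by simp_all
    fix W assume W: "closed W" "1 \<in> W" "y \<in> W" "\<And>u v. u \<in> W \<Longrightarrow> v \<in> W \<Longrightarrow> u + v \<in> W \<and> u * v \<in> W"
      "\<And>u r. u \<in> W \<Longrightarrow> r *\<^sub>R u \<in> W"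
    have "b = (1/t) *\<^sub>R (norm y *\<^sub>R 1 + (-1) *\<^sub>R y)" by (simp add: b_def)
    then have "b \<in> W" using W by metis
    then have pw: "b ^ n \<in> W" for n by (induction n) (use W in auto)
    have "0 \<in> W" using W(5)[OF W(2), of 0] by simp
    then have "(\<Sum>k<n. b ^ k) \<in> W" for n by (induction n) (use W pw in auto)
    then have "q \<in> W" by (rule closed_sequentially[OF W(1) _ lim])
    then show "(1/t) *\<^sub>R q \<in> W" by (rule W(5))
  qed
qed

text \<open>Here \<open>q = (2 k - 1)\<^sub>+\<close>, and \<open>r\<close> is the square root of \<open>2 (1 + q) ^ (-1)\<close>. On the spectrum of \<open>k\<close> the
  element \<open>r k r = 2 k / (1 + q)\<close> is \<open>min (2 k) 1\<close>, so it equals 1 wherever \<open>q\<close> is nonzero and acts as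
  a unit on \<open>q\<close>. All identities follow from \<open>q\<^sup>2 = (2 k - 1) q\<close>.\<close>
lemma spectral_cutoff:
  fixes A :: "'t::uc_star set"
  assumes A: "csub A" and k: "k \<in> A" "pos k" "norm k = 1"
  obtains q r where "q \<in> A" "star q = q" "q \<noteq> 0" "star r = r" "\<And>a. a \<in> A \<Longrightarrow> r * a \<in> A \<and> a * r \<in> A"
    "(r * k * r) * q = q" "q * (r * k * r) = q" "r * k * r \<in> A"
proof -
  define W where "W = {y. \<forall>s\<in>A. y * s \<in> A \<and> s * y \<in> A}"
  have W: "sq_closed W" unfolding W_def by (rule sq_closed_idealizer[OF A])
  have WA: "w * a \<in> A" "a * w \<in> A" if "w \<in> W" "a \<in> A" for w a using that by (auto simp: W_def)
  have Wm: "u + v \<in> W \<and> u * v \<in> W" if "u \<in> W" "v \<in> W" for u v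
    using that A by (auto simp: W_def csub_mem distrib_left distrib_right mult.assoc) (metis mult.assoc)
  have Wr: "c *\<^sub>R u \<in> W" if "u \<in> W" for u c using that W by (auto simp: sq_closed_def)
  have AW: "a \<in> W" if "a \<in> A" for a using that A by (auto simp: W_def csub_mem)
  have W1: "1 \<in> W" "closed W" using W by (auto simp: sq_closed_def)
  define x where "x = 2 *\<^sub>R k - 1"
  have sx: "star x = x" using k by (simp add: x_def star_diff pos_star)
  have "x = 2 *\<^sub>R k + (-1) *\<^sub>R 1" by (simp add: x_def)
  also have "\<dots> \<in> W" by (intro Wr Wm[THEN conjunct1] AW k W1)
  finally have xW: "x \<in> W" .
  have kx: "x * x * k = k * (x * x)" by (simp add: x_def algebra_simps)
  obtain m where m: "pos m" "m * m = x * x" "\<And>V. sq_closed V \<Longrightarrow> x * x \<in> V \<Longrightarrow> m \<in> V"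
    using pos_sqrt[OF pos_sq[OF sx]] by metis
  have mk: "m * k = k * m" by (rule pos_sqrt_commute[OF pos_sq[OF sx] m(2,3) kx])
  then have mx: "m * x = x * m" by (simp add: x_def algebra_simps)
  have mW: "m \<in> W" by (rule m(3)[OF W]) (use Wm[OF xW xW] in simp)
  define q where "q = (1/2) *\<^sub>R (m + x)"
  define y where "y = (1/2) *\<^sub>R (m + 2 *\<^sub>R k)"
  have yq: "(1/2) *\<^sub>R 1 + y = 1 + q"
  proof -
    have "q = y - (1/2) *\<^sub>R 1" by (simp add: q_def y_def x_def scaleR_add_right scaleR_diff_right)
    moreover have "1 = (1/2) *\<^sub>R (1::'t) + (1/2) *\<^sub>R 1" by (simp flip: scaleR_left_distrib)
    ultimately show ?thesis by (metis add.assoc add.commute diff_add_cancel)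
  qed
  have py: "pos y" unfolding y_def by (intro pos_scaleR pos_add m k) auto
  have yW: "y \<in> W" unfolding y_def by (intro Wr Wm[THEN conjunct1] mW AW k)
  obtain p where p': "p * ((1/2) *\<^sub>R 1 + y) = 1" "((1/2) *\<^sub>R 1 + y) * p = 1"
    "\<And>W. \<lbrakk>closed W; 1 \<in> W; y \<in> W; \<And>u v. u \<in> W \<Longrightarrow> v \<in> W \<Longrightarrow> u + v \<in> W \<and> u * v \<in> W; \<And>u r. u \<in> W \<Longrightarrow> r *\<^sub>R u \<in> W\<rbrakk> \<Longrightarrow> p \<in> W"
    by (rule invertible_add_pos[OF py, of "1/2"]) simp_all
  have "p \<in> W" by (rule p'(3)[OF W1(2,1) yW Wm Wr])
  then have p: "p * (1 + q) = 1" "(1 + q) * p = 1" "p \<in> W" using p'(1,2) by (simp_all add: yq)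
  have sq: "star q = q" using m sx by (simp add: q_def star_add pos_star)
  have qW: "q \<in> W" unfolding q_def by (intro Wr Wm[THEN conjunct1] mW xW)
  have qq: "q * q = x * q"
  proof -
    have "(m + x) * (m + x) = 2 *\<^sub>R (x * (m + x))" using m(2) mx by (simp add: algebra_simps scaleR_2)
    then show ?thesis by (simp add: q_def)
  qed
  have q1: "q * (1 + q) = 2 *\<^sub>R (k * q)" using qq by (simp add: x_def algebra_simps)
  have qk: "q * k = k * q" using mk by (simp add: q_def x_def algebra_simps)
  have qA: "q \<in> A"
  proof -
    have "q = q * (1 + q) * p" using p(2) by (simp add: mult.assoc)
    also have "\<dots> = (2 *\<^sub>R (k * q)) * p" by (simp add: q1)
    also have "\<dots> \<in> A" by (intro WA csub_scaleR A k qW p)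
    finally show ?thesis .
  qed
  have q0: "q \<noteq> 0"
  proof
    assume "q = 0"
    then have "m + x = 0" using scaleR_eq_0_iff[of "1/2" "m + x"] by (simp add: q_def)
    then have "m = 1 - 2 *\<^sub>R k" unfolding x_def by (simp add: algebra_simps add_eq_0_iff)
    then have "pos (1 - 2 *\<^sub>R k)" using m(1) by simp
    then have "norm (2 *\<^sub>R k) \<le> norm (1::'t)" using k by (intro pos_le_norm_le pos_scaleR) auto
    then show False using k by simp
  qed
  have pk: "p * k = k * p"
  proof -
    have "p * k = p * k * ((1 + q) * p)" by (simp add: p)
    also have "\<dots> = p * (1 + q) * k * p" using qk by (simp add: algebra_simps)
    finally show ?thesis by (simp add: p)
  qed
  have sp: "star p = p"
  proof -
    have "star p * (1 + q) = 1" using arg_cong[OF p(2), of star] by (simp add: star_mult star_add sq)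
    then have "star p = star p * ((1 + q) * p)" "star p * ((1 + q) * p) = p" using p(2) by (simp, metis mult.assoc mult_1_left)
    then show ?thesis by simp
  qed
  have "pos (star p * (1 + q) * p)"
    unfolding yq[symmetric] by (intro pos_conj pos_add py pos_scaleR) auto
  then have pp: "pos (2 *\<^sub>R p)" using p sp by (simp add: mult.assoc pos_scaleR)
  obtain r where r: "pos r" "r * r = 2 *\<^sub>R p" "\<And>V. sq_closed V \<Longrightarrow> 2 *\<^sub>R p \<in> V \<Longrightarrow> r \<in> V"
    using pos_sqrt[OF pp] by metis
  have rW: "r \<in> W" by (rule r(3)[OF W]) (rule Wr[OF p(3)])
  have "2 *\<^sub>R p * k = 2 *\<^sub>R (p * k)" by (rule mult_scaleR_left)
  also have "\<dots> = 2 *\<^sub>R (k * p)" by (rule arg_cong[OF pk])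
  also have "\<dots> = k * 2 *\<^sub>R p" by (rule mult_scaleR_right[symmetric])
  finally have "2 *\<^sub>R p * k = k * 2 *\<^sub>R p" .
  from pos_sqrt_commute[OF pp r(2,3) this] have rk: "r * k = k * r" .
  have rkr: "r * k * r = 2 *\<^sub>R (k * p)" using rk r(2) by (simp add: mult.assoc)
  have l: "r * k * r = 2 *\<^sub>R k - q"
  proof -
    have "(2 *\<^sub>R k - q) * (1 + q) = 2 *\<^sub>R k" using q1 by (simp add: algebra_simps)
    then have "(2 *\<^sub>R k - q) * (1 + q) * p = 2 *\<^sub>R (k * p)" by simp
    then show ?thesis unfolding rkr by (simp add: p(2) mult.assoc)
  qed
  have lq: "(2 *\<^sub>R k - q) * q = q" using qq by (simp add: x_def algebra_simps)
  show ?thesis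
  proof (rule that[of q r])
    show "(r * k * r) * q = q" unfolding l by (rule lq)
    show "q * (r * k * r) = q" unfolding l using lq qk by (simp add: algebra_simps)
    show "r * k * r \<in> A" unfolding l using A k(1) qA by (simp add: csub_mem)
  qed (use qA sq q0 r(1) rW WA in \<open>auto simp: pos_star\<close>)
qed

text \<open>Fullness gives \<open>c = b a \<noteq> 0\<close> with \<open>b \<in> B\<close> and \<open>a\<close> in a corner. With \<open>r\<close> and \<open>q\<close> cut off from \<open>star c * c\<close>
  and \<open>v = c r\<close>, the element \<open>star v * v\<close> acts as a unit on the hereditary subalgebra \<open>K\<close> of the corner
  generated by \<open>q\<close>, so \<open>x \<mapsto> v x v\<^sup>*\<close> is an embedding of \<open>K\<close>. Its values have the form
  \<open>b (\<dots>) b\<^sup>*\<close> and lie in \<open>B\<close>.\<close>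
theorem hered_corners:
  fixes Q :: "'t::uc_star set" and \<C> :: "'c cstar set" and \<iota> :: "'t \<Rightarrow> 'c"
  assumes C: "upwards_directed \<C>" and Q: "csub Q" "inj_on \<iota> Q"
    and A: "\<And>j. j \<in> I \<Longrightarrow> her (A j) Q" "\<And>j. j \<in> I \<Longrightarrow> hered \<C> (A j)"
    and full: "\<And>b. b \<in> Q \<Longrightarrow> (\<And>j a. j \<in> I \<Longrightarrow> a \<in> A j \<Longrightarrow> b * a = 0) \<Longrightarrow> b = 0"
  shows "hered \<C> Q"
proof -
  have "in_class \<C> (crec B)" if B: "her B Q" "B \<noteq> {0}" for B
  proof -
    have cB: "csub B" and BQ: "B \<subseteq> Q" using B(1) by (auto simp: her_def)
    have i: "inj_on \<iota> B" by (rule inj_on_subset[OF Q(2) BQ])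
    obtain b where b: "b \<in> B" "b \<noteq> 0" using B(2) csub_0[OF cB] by blast
    then obtain j a0 where j: "j \<in> I" "a0 \<in> A j" "b * a0 \<noteq> 0" using full BQ by blast
    have cA: "csub (A j)" and AQ: "A j \<subseteq> Q" using A(1)[OF j(1)] by (auto simp: her_def)
    define a where "a = (1 / norm (b * a0)) *\<^sub>R a0"
    define c where "c = b * a"
    have aA: "a \<in> A j" using j(2) cA by (simp add: a_def csub_mem)
    have nc: "norm c = 1" using j(3) by (simp add: c_def a_def)
    define k where "k = star c * c"
    have kA: "k \<in> A j"
    proof -
      have "star a * (star b * b) * a \<in> A j"
        using b BQ aA Q cA by (intro her_mem[OF A(1)[OF j(1)]]) (auto intro: csub_mem)
      then show ?thesis by (simp add: k_def c_def star_mult mult.assoc)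
    qed
    have "pos k" "norm k = 1" using nc by (simp_all add: k_def pos_star_mult norm_star_mult)
    then obtain q r where q: "q \<in> A j" "star q = q" "q \<noteq> 0" and r: "star r = r"
        "\<And>a. a \<in> A j \<Longrightarrow> r * a \<in> A j \<and> a * r \<in> A j"
      and l: "(r * k * r) * q = q" "q * (r * k * r) = q" "r * k * r \<in> A j"
      using spectral_cutoff[OF cA kA] by metis
    define v where "v = c * r"
    define e where "e = r * k * r"
    have vv: "star v * v = e" by (simp add: v_def e_def k_def star_mult r(1) mult.assoc)
    define K where "K = hclos q (A j)"
    have K: "her K (A j)" "K \<noteq> {0}" unfolding K_def using her_hclos[OF cA q(1,2)] hclos_nonzero[OF cA q] by auto
    have cK: "csub K" and KA: "K \<subseteq> A j" using K(1) by (auto simp: her_def)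
    have ex: "e * x = x" if x: "x \<in> K" for x
    proof -
      have "closed {x. e * x = x}" by (intro closed_Collect_eq continuous_intros)
      moreover have "e * (q * s * q) = q * s * q" for s using l(1) by (simp add: e_def flip: mult.assoc)
      ultimately have "closure ((\<lambda>s. q * s * q) ` A j) \<subseteq> {x. e * x = x}" by (intro closure_minimal) auto
      then show ?thesis using x by (auto simp: K_def hclos_def)
    qed
    have se: "star e = e" by (simp add: vv[symmetric] star_mult star_star)
    have xe: "x * e = x" if x: "x \<in> K" for x
    proof -
      have "star (e * star x) = star (star x)" using ex[OF csub_star[OF cK x]] by simp
      then show ?thesis by (simp add: star_mult star_star se)
    qed
    define \<phi> where "\<phi> x = v * x * star v" for x
    have h: "chom K \<phi>"
    proof -
      have "\<phi> (x * y) = \<phi> x * \<phi> y" if "x \<in> K" "y \<in> K" for x y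
      proof -
        have "\<phi> x * \<phi> y = v * (x * (star v * v)) * y * star v" by (simp add: \<phi>_def mult.assoc)
        then show ?thesis using xe[OF that(1)] by (simp add: vv \<phi>_def mult.assoc)
      qed
      then show ?thesis
        by (auto simp: chom_def \<phi>_def distrib_left distrib_right star_mult star_star mult.assoc
            scaleC_mult_left scaleC_mult_right)
    qed
    have "x = 0" if x: "x \<in> K" "\<phi> x = 0" for x
    proof -
      have "star v * \<phi> x * v = e * x * e" by (simp add: \<phi>_def vv[symmetric] mult.assoc)
      then show ?thesis using x by (simp add: ex xe)
    qed
    then have inj: "inj_on \<phi> K" by (rule chom_inj_onI[OF cK h])
    have sub: "\<phi> ` K \<subseteq> B"
    proof
      fix z assume "z \<in> \<phi> ` K"
      then obtain x where x: "x \<in> K" "z = \<phi> x" by blast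
      have "a * (r * x * r) * star a \<in> A j" 
      proof -
        have "x \<in> A j" using x(1) KA by blast
        then have "r * x * r \<in> A j" using r(2) by blast
        from csub_mult[OF cA csub_mult[OF cA aA this] csub_star[OF cA aA]] show ?thesis .
      qed
      then have "b * (a * (r * x * r) * star a) * star b \<in> B"
        using her_mem[OF B(1) b(1) _ csub_star[OF cB b(1)]] AQ by blast
      then show "z \<in> B" by (simp add: x(2) \<phi>_def v_def c_def star_mult r(1) mult.assoc)
    qed
    have "in_class \<C> (crec K)" using A(2)[OF j(1)] K by (simp add: hered_def)
    from in_class_if_contains[OF C cB i this cK h inj sub] show ?thesis .
  qed
  then show ?thesis using Q(1) by (simp add: hered_def)
qed

section \<open>Finite families of commuting automorphisms\<close>

lemma chom_funpow:
  assumes "chom S \<sigma>" "\<And>x. x \<in> S \<Longrightarrow> \<sigma> x \<in> S"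
  shows "chom S (\<sigma> ^^ n) \<and> (\<forall>x\<in>S. (\<sigma> ^^ n) x \<in> S)"
  by (induction n) (use assms in \<open>auto simp: chom_def\<close>)

text \<open>If \<open>\<sigma>\<close> has order \<open>2 ^ (k + 1)\<close>, then \<open>\<sigma> ^^ (2 ^ k)\<close> is an involution, and on its fixed algebra \<open>\<sigma>\<close>
  has order dividing \<open>2 ^ k\<close>.\<close>
lemma fixed_two_power_order:
  fixes P :: "'t::uc_star set \<Rightarrow> bool"
  assumes stable: "\<And>S \<sigma>. invol \<sigma> S \<Longrightarrow> P S \<Longrightarrow> P (fixed \<sigma> S)"
    and S: "csub S" "P S" and h: "chom S \<sigma>" "\<And>x. x \<in> S \<Longrightarrow> \<sigma> x \<in> S"
    and n: "\<And>x. x \<in> S \<Longrightarrow> (\<sigma> ^^ (2 ^ k)) x = x"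
  shows "P (fixed \<sigma> S)"
  using S h n
proof (induction k arbitrary: S)
  case 0
  then have "fixed \<sigma> S = S" by (auto simp: fixed_def)
  then show ?case using 0 by simp
next
  case (Suc k)
  define \<tau> where "\<tau> = \<sigma> ^^ (2 ^ k)"
  have t: "chom S \<tau>" "\<And>x. x \<in> S \<Longrightarrow> \<tau> x \<in> S" using chom_funpow[OF Suc.prems(3,4)] by (auto simp: \<tau>_def)
  have "\<tau> (\<tau> x) = x" if "x \<in> S" for x
    using Suc.prems(5)[OF that] by (simp add: \<tau>_def mult_2 funpow_add)
  then have i: "invol \<tau> S" using Suc.prems(1) t by (simp add: invol_def)
  let ?S' = "fixed \<tau> S"
  have "\<tau> (\<sigma> x) = \<sigma> (\<tau> x)" for x by (simp add: \<tau>_def funpow_swap1)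
  then have "\<sigma> x \<in> ?S'" if "x \<in> ?S'" for x using that Suc.prems(4) by (simp add: fixed_def)
  moreover have "chom ?S' \<sigma>" by (rule chom_subset[OF Suc.prems(3)]) (auto simp: fixed_def)
  moreover have "(\<sigma> ^^ (2 ^ k)) x = x" if "x \<in> ?S'" for x using that by (simp add: fixed_def \<tau>_def)
  ultimately have "P (fixed \<sigma> ?S')"
    by (intro Suc.IH csub_fixed[OF Suc.prems(1) t(1)] stable[OF i Suc.prems(2)]) auto
  moreover have "fixed \<sigma> ?S' = fixed \<sigma> S"
  proof -
    have "(\<sigma> ^^ n) x = x" if "\<sigma> x = x" for x n by (induction n) (use that in auto)
    then show ?thesis by (auto simp: fixed_def \<tau>_def)
  qed
  ultimately show ?case by simp
qed

lemma fixed_commuting_family: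
  fixes P :: "'t::uc_star set \<Rightarrow> bool"
  assumes stable: "\<And>S \<sigma>. invol \<sigma> S \<Longrightarrow> P S \<Longrightarrow> P (fixed \<sigma> S)"
    and S: "csub S" "P S" and F: "finite F"
    and h: "\<And>g. g \<in> F \<Longrightarrow> chom S (\<alpha> g)" "\<And>g x. g \<in> F \<Longrightarrow> x \<in> S \<Longrightarrow> \<alpha> g x \<in> S"
    and n: "\<And>g x. g \<in> F \<Longrightarrow> x \<in> S \<Longrightarrow> (\<alpha> g ^^ (2 ^ k)) x = x"
    and c: "\<And>g h x. g \<in> F \<Longrightarrow> h \<in> F \<Longrightarrow> x \<in> S \<Longrightarrow> \<alpha> g (\<alpha> h x) = \<alpha> h (\<alpha> g x)"
  shows "csub {x\<in>S. \<forall>g\<in>F. \<alpha> g x = x} \<and> P {x\<in>S. \<forall>g\<in>F. \<alpha> g x = x}"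
  using F h n c
proof (induction F rule: finite_induct)
  case empty then show ?case using S by simp
next
  case (insert g F)
  let ?T = "{x\<in>S. \<forall>g\<in>F. \<alpha> g x = x}"
  have T: "csub ?T" "P ?T" using insert.IH insert.prems by auto
  have h: "chom ?T (\<alpha> g)" by (rule chom_subset[OF insert.prems(1)]) auto
  have m: "\<alpha> g x \<in> ?T" if x: "x \<in> ?T" for x
  proof -
    have "\<alpha> f (\<alpha> g x) = \<alpha> g x" if "f \<in> F" for f
      using insert.prems(4)[of f g x] that x by auto
    then show ?thesis using x insert.prems(2) by auto
  qed
  have "P (fixed (\<alpha> g) ?T)"
    by (rule fixed_two_power_order[OF stable T h m, where k = k]) (use insert.prems(3) in auto)
  moreover have "fixed (\<alpha> g) ?T = {x\<in>S. \<forall>h\<in>insert g F. \<alpha> h x = x}" by (auto simp: fixed_def)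
  ultimately show ?case using csub_fixed[OF T(1) h] by simp
qed

section \<open>Matrices over a class\<close>

text \<open>Finite families over an infinite set are no more numerous than its elements. This provides copies of
  matrix algebras on the types of the entries and of the class.\<close>
lemma infinite_PiE_inj:
  assumes S: "infinite S" and P: "finite P"
  obtains f where "inj_on f (P \<rightarrow>\<^sub>E S)" "f ` (P \<rightarrow>\<^sub>E S) \<subseteq> S"
proof -
  obtain h where h: "bij_betw h (S \<times> S) S"
    using card_of_Times_same_infinite[OF S] card_of_ordIso by blast
  have "\<exists>f. inj_on f (P \<rightarrow>\<^sub>E S) \<and> f ` (P \<rightarrow>\<^sub>E S) \<subseteq> S"
    using P
  proof (induction P rule: finite_induct)
    case empty
    obtain s where "s \<in> S" using S by fastforce
    then show ?case by (intro exI[of _ "\<lambda>_. s"]) auto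
  next
    case (insert p P)
    then obtain f where f: "inj_on f (P \<rightarrow>\<^sub>E S)" "f ` (P \<rightarrow>\<^sub>E S) \<subseteq> S" by blast
    define F where "F x = h (x p, f (restrict x P))" for x
    have r: "restrict x P \<in> P \<rightarrow>\<^sub>E S" "x p \<in> S" if "x \<in> insert p P \<rightarrow>\<^sub>E S" for x using that by auto
    have m: "(x p, f (restrict x P)) \<in> S \<times> S" if "x \<in> insert p P \<rightarrow>\<^sub>E S" for x using r[OF that] f(2) by auto
    have "inj_on F (insert p P \<rightarrow>\<^sub>E S)"
    proof (rule inj_onI)
      fix x y assume x: "x \<in> insert p P \<rightarrow>\<^sub>E S" and y: "y \<in> insert p P \<rightarrow>\<^sub>E S" and e: "F x = F y"
      then have "(x p, f (restrict x P)) = (y p, f (restrict y P))"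
        using h m[OF x] m[OF y] unfolding F_def bij_betw_def by (auto dest: inj_onD)
      then have e1: "x p = y p" and e2: "f (restrict x P) = f (restrict y P)" by auto
      note e3 = inj_onD[OF f(1) e2 r(1)[OF x] r(1)[OF y]]
      have "x i = y i" if i: "i \<in> insert p P" for i
      proof (cases "i = p")
        case False
        have "restrict x P i = restrict y P i" by (simp only: e3)
        then show ?thesis using i False by simp
      qed (simp add: e1)
      then show "x = y" using x y by (intro PiE_ext) auto
    qed
    moreover have "F ` (insert p P \<rightarrow>\<^sub>E S) \<subseteq> S" using m h unfolding F_def bij_betw_def by blast
    ultimately show ?case by blast
  qed
  then show ?thesis using that by blast
qed

lemma csub_infinite:
  assumes "csub S" "S \<noteq> {0}" shows "infinite (S :: 't::nc_star set)"
proof -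
  obtain s where s: "s \<in> S" "s \<noteq> 0" using assms csub_0 by blast
  have "inj (\<lambda>r::real. r *\<^sub>R s)" using s(2) by (auto intro: injI)
  moreover have "range (\<lambda>r::real. r *\<^sub>R s) \<subseteq> S" using s(1) csub_scaleR[OF assms(1)] by auto
  ultimately show ?thesis using infinite_UNIV_char_0 finite_subset finite_imageD by blast
qed

lemma mats_inj:
  assumes S: "infinite S" and I: "finite I"
  obtains f where "inj_on f (mats I S)" "f ` mats I S \<subseteq> (S :: 't::uc_star set)"
proof -
  obtain f where f: "inj_on f ((I \<times> I) \<rightarrow>\<^sub>E S)" "f ` ((I \<times> I) \<rightarrow>\<^sub>E S) \<subseteq> S"
    using infinite_PiE_inj[OF S, of "I \<times> I"] I by auto
  define r where "r x = restrict (\<lambda>p. x (fst p) (snd p)) (I \<times> I)" for x :: "'a \<Rightarrow> 'a \<Rightarrow> 't"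
  have r: "r x \<in> (I \<times> I) \<rightarrow>\<^sub>E S" if "x \<in> mats I S" for x using that by (auto simp: r_def mats_def)
  have "inj_on r (mats I S)"
  proof (rule inj_onI, intro ext)
    fix x y i j assume x: "x \<in> mats I S" and y: "y \<in> mats I S" and e: "r x = r y"
    show "x i j = y i j"
    proof (cases "i \<in> I \<and> j \<in> I")
      case True then show ?thesis using fun_cong[OF e, of "(i, j)"] by (simp add: r_def)
    qed (use x y in \<open>auto simp: mats_def\<close>)
  qed
  moreover have "inj_on f (r ` mats I S)" by (rule inj_on_subset[OF f(1)]) (use r in auto)
  ultimately have "inj_on (f \<circ> r) (mats I S)" by (rule comp_inj_on)
  moreover have "(f \<circ> r) ` mats I S \<subseteq> S" using f(2) r by auto
  ultimately show ?thesis by (rule that)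
qed

lemma mmul_munit_left: "finite I \<Longrightarrow> j \<in> I \<Longrightarrow> mmul I (munit i j a) x k l = (if k = i then a * x j l else 0)"
proof -
  assume I: "finite I" "j \<in> I"
  have "mmul I (munit i j a) x k l = (\<Sum>m\<in>I. if m = j then (if k = i then a * x j l else 0) else 0)"
    unfolding mmul_def by (rule sum.cong) (auto simp: munit_def)
  then show ?thesis using I by simp
qed

lemma mmul_munit_right: "finite I \<Longrightarrow> i \<in> I \<Longrightarrow> mmul I x (munit i j a) k l = (if l = j then x k i * a else 0)"
proof -
  assume I: "finite I" "i \<in> I"
  have "mmul I x (munit i j a) k l = (\<Sum>m\<in>I. if m = i then (if l = j then x k i * a else 0) else 0)"
    unfolding mmul_def by (rule sum.cong) (auto simp: munit_def)
  then show ?thesis using I by simp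
qed

context
  fixes I :: "'i set" and S :: "'t::uc_star set"
  assumes I: "finite I" and S: "csub S"
begin

definition "memb = emb (matalg I S)"

lemma memb: "star_embedding (matalg I S) memb"
  unfolding memb_def by (rule star_embedding_emb[OF cstar_algebra_matalg[OF I S]])

lemmas membD = star_embeddingD[OF memb, unfolded matalg_simps]

lemma chom_memb_munit: assumes j: "j \<in> I" shows "chom S (\<lambda>a. memb (munit j j a))"
proof -
  have m: "munit j j a \<in> mats I S" if "a \<in> S" for a using munit_mem[OF I S j j that] .
  have 1: "munit j j (a + b) = (\<lambda>k l. munit j j a k l + munit j j b k l)" for a b :: 't by (auto simp: munit_def fun_eq_iff)
  have 2: "munit j j (a * b) = mmul I (munit j j a) (munit j j b)" for a b :: 't
    by (auto simp: mmul_munit_left[OF I j] fun_eq_iff) (auto simp: munit_def)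
  have 3: "munit j j (star a) = madj (munit j j a)" for a :: 't by (auto simp: munit_def madj_def fun_eq_iff)
  have 4: "munit j j (c *\<^sub>C a) = (\<lambda>k l. c *\<^sub>C munit j j a k l)" for a :: 't and c by (auto simp: munit_def fun_eq_iff)
  show ?thesis unfolding chom_def 1 2 3 4 using m membD(7,8,11,12) by simp
qed

lemma inj_memb_munit: assumes j: "j \<in> I" shows "inj_on (\<lambda>a. memb (munit j j a)) S"
proof (rule inj_onI)
  fix a b assume ab: "a \<in> S" "b \<in> S" "memb (munit j j a) = memb (munit j j b)"
  then have "munit j j a = munit j j b" using inj_onD[OF membD(1)] munit_mem[OF I S j j] by blast
  then have "munit j j a j j = munit j j b j j" by simp
  then show "a = b" by (simp add: munit_def)
qed

text \<open>Formulated for homomorphic images of the matrix algebra, so that it serves quotients as well. The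
  diagonal corners are full: an element \<open>b\<close> annihilating them annihilates the image of every matrix
  unit, since \<open>w * star w = 0\<close> for the product \<open>w\<close>, and every matrix is a sum of matrix units.\<close>
lemma hered_mats_image:
  fixes \<psi> :: "('i \<Rightarrow> 'i \<Rightarrow> 't) uni \<Rightarrow> 'v::uc_star" and \<C> :: "'c cstar set" and \<iota> :: "'t \<Rightarrow> 'c"
  assumes C: "upwards_directed \<C>" and i: "inj_on \<iota> S" and S0: "S \<noteq> {0}"
    and h: "chom (memb ` mats I S) \<psi>" and A: "\<And>j. j \<in> I \<Longrightarrow> hered \<C> ((\<lambda>a. \<psi> (memb (munit j j a))) ` S)"
  shows "hered \<C> (\<psi> ` memb ` mats I S)"
proof -
  let ?M = "memb ` mats I S"
  have cM: "csub ?M" using membD(2) .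
  have mm: "memb x \<in> ?M" if "x \<in> mats I S" for x using that by simp
  define p where "p x = \<psi> (memb x)" for x
  have pm: "p (mmul I x y) = p x * p y" if "x \<in> mats I S" "y \<in> mats I S" for x y
    using that membD(8) chom_mult[OF h mm mm] by (simp add: p_def)
  have pa: "p (\<lambda>i j. x i j + y i j) = p x + p y" if "x \<in> mats I S" "y \<in> mats I S" for x y
    using that membD(7) chom_add[OF h mm mm] by (simp add: p_def)
  have ps: "p (madj x) = star (p x)" if "x \<in> mats I S" for x
    using that membD(11) chom_star[OF h mm] by (simp add: p_def)
  have p0: "p (\<lambda>i j. 0) = 0" using membD(4) chom_0[OF cM h] by (simp add: p_def)
  have mu: "munit j k a \<in> mats I S" if "j \<in> I" "k \<in> I" "a \<in> S" for j k a using munit_mem[OF I S that] .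
  obtain f where f: "inj_on f (mats I S)" "f ` mats I S \<subseteq> S" using mats_inj[OF csub_infinite[OF S S0] I] .
  have "inj_on (\<iota> \<circ> f) (mats I S)" by (rule comp_inj_on[OF f(1) inj_on_subset[OF i f(2)]])
  then have fits: "inj_on ((\<iota> \<circ> f) \<circ> inv_into (mats I S) p) (p ` mats I S)" by (rule inj_on_comp_inv_into)
  have img: "\<psi> ` ?M = p ` mats I S" by (simp add: p_def image_image)
  show ?thesis
    unfolding img
  proof (rule hered_corners[OF C _ fits, where I = I and A = "\<lambda>j. (\<lambda>a. p (munit j j a)) ` S"])
    show cQ: "csub (p ` mats I S)" using csub_image[OF cM h] by (simp add: img)
    fix j assume j: "j \<in> I"
    show hA: "hered \<C> ((\<lambda>a. p (munit j j a)) ` S)" using A[OF j] by (simp add: p_def)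
    have "u * v * w \<in> (\<lambda>a. p (munit j j a)) ` S"
      if "u \<in> (\<lambda>a. p (munit j j a)) ` S" "v \<in> p ` mats I S" "w \<in> (\<lambda>a. p (munit j j a)) ` S" for u v w
    proof -
      from that obtain a x b where a: "a \<in> S" "x \<in> mats I S" "b \<in> S" "u = p (munit j j a)" "v = p x" "w = p (munit j j b)" by auto
      have "mmul I (mmul I (munit j j a) x) (munit j j b) = munit j j (a * x j j * b)"
        by (auto simp: mmul_munit_left[OF I j] mmul_munit_right[OF I j] fun_eq_iff) (auto simp: munit_def)
      then have "u * v * w = p (munit j j (a * x j j * b))"
        using a mu[OF j j] mats_mem(5)[OF I S] by (simp flip: pm)
      moreover have "a * x j j * b \<in> S" using a j S by (auto simp: mats_def csub_mem)
      ultimately show ?thesis by simp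
    qed
    then show "her ((\<lambda>a. p (munit j j a)) ` S) (p ` mats I S)"
      using hered_csub[OF hA] mu[OF j j] by (auto simp: her_def)
  next
    fix b assume "b \<in> p ` mats I S" and z: "\<And>j a. j \<in> I \<Longrightarrow> a \<in> (\<lambda>a. p (munit j j a)) ` S \<Longrightarrow> b * a = 0"
    then obtain x where x: "x \<in> mats I S" "b = p x" by blast
    have 1: "b * p (munit j k y) = 0" if jk: "j \<in> I" "k \<in> I" and y: "y \<in> S" for j k y
    proof -
      define w where "w = b * p (munit j k y)"
      have "mmul I (munit j k y) (madj (munit j k y)) = munit j j (y * star y)"
        by (auto simp: mmul_munit_left[OF I jk(2)] fun_eq_iff) (auto simp: munit_def madj_def)
      then have "p (munit j k y) * star (p (munit j k y)) = p (munit j j (y * star y))"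
        using mu[OF jk y] mats_mem(7)[OF I S] by (simp flip: ps pm)
      then have "w * star w = b * p (munit j j (y * star y)) * star b"
        by (simp add: w_def star_mult mult.assoc) (simp flip: mult.assoc)
      also have "b * p (munit j j (y * star y)) = 0" using y S by (intro z[OF jk(1)]) (auto simp: csub_mem)
      finally have "w * star w = 0" by simp
      then have "norm w = 0" using norm_mult_star[of w] by simp
      then show ?thesis by (simp add: w_def)
    qed
    have 2: "b * p y = 0" if y: "y \<in> mats I S" for y
    proof -
      have "(\<lambda>k l. \<Sum>q\<in>P. munit (fst q) (snd q) (y (fst q) (snd q)) k l) \<in> mats I S \<and>
        b * p (\<lambda>k l. \<Sum>q\<in>P. munit (fst q) (snd q) (y (fst q) (snd q)) k l) = 0" if "finite P" "P \<subseteq> I \<times> I" for P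
        using that
      proof (induction P rule: finite_induct)
        case empty then show ?case using mats_mem(1)[OF I S] p0 by simp
      next
        case (insert q P)
        have q: "fst q \<in> I" "snd q \<in> I" "y (fst q) (snd q) \<in> S" using insert.prems y by (auto simp: mats_def)
        show ?case using insert.IH insert.prems insert.hyps mu[OF q] 1[OF q]
          by (simp add: mats_mem(2)[OF I S] pa distrib_left)
      qed
      from this[of "I \<times> I"] show ?thesis using I mat_decomp[OF I y] by auto
    qed
    have "b * star b = 0" using 2[OF mats_mem(7)[OF I S x(1)]] x by (simp add: ps)
    then have "norm b = 0" using norm_mult_star[of b] by simp
    then show "b = 0" by simp
  qed
qed

lemma memb_zero: "S = {0} \<Longrightarrow> memb ` mats I S = {0}"
proof -
  assume z: "S = {0}"
  have "x = (\<lambda>i j. 0)" if "x \<in> mats I S" for x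
  proof (intro ext)
    show "x i j = 0" for i j using that z by (cases "i \<in> I \<and> j \<in> I") (auto simp: mats_def)
  qed
  then have "mats I S = {\<lambda>i j. 0}" using mats_mem(1)[OF I S] by blast
  then show ?thesis using membD(4) by simp
qed

lemma hered_mats:
  fixes \<C> :: "'c cstar set"
  assumes C: "upwards_directed \<C>" and h: "hered \<C> S" shows "hered \<C> (memb ` mats I S)"
proof (cases "S = {0}")
  case True then show ?thesis using memb_zero hered_trivial by metis
next
  case False
  then have "in_class \<C> (crec S)" using h her_self[OF S] by (simp add: hered_def)
  then obtain \<iota> :: "'t \<Rightarrow> 'c" where "inj_on \<iota> (carrier (crec S))" by (rule in_class_inj)
  then have i: "inj_on \<iota> S" by simp
  have "hered \<C> ((\<lambda>x. x) ` memb ` mats I S)"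
    by (rule hered_mats_image[OF C i False chom_id]) (rule hered_inj_image[OF h chom_memb_munit inj_memb_munit])
  then show ?thesis by simp
qed

lemma reshered_mats:
  fixes \<C> :: "'c cstar set"
  assumes C: "upwards_directed \<C>" and h: "reshered \<C> S" shows "reshered \<C> (memb ` mats I S)"
  unfolding reshered_def
proof (intro conjI allI impI membD(2), elim conjE)
  let ?M = "memb ` mats I S"
  fix J assume J: "cideal J ?M" "J \<noteq> ?M"
  have "S \<noteq> {0}"
  proof
    assume "S = {0}"
    then have "?M = {0}" by (rule memb_zero)
    then show False using J unfolding cideal_def by auto
  qed
  moreover from this have "in_class \<C> (crec S)" using reshered_hered[OF h] her_self[OF S] by (simp add: hered_def)
  then obtain \<iota> :: "'t \<Rightarrow> 'c" where "inj_on \<iota> (carrier (crec S))" by (rule in_class_inj)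
  then have "inj_on \<iota> S" by simp
  moreover note q = chom_qhom[OF membD(2) J(1)]
  moreover have "hered \<C> ((\<lambda>a. qhom ?M J (memb (munit j j a))) ` S)" if j: "j \<in> I" for j
  proof -
    have "chom S (qhom ?M J \<circ> (\<lambda>a. memb (munit j j a)))"
      by (rule chom_comp[OF chom_memb_munit[OF j] q]) (use munit_mem[OF I S j j] in auto)
    from reshered_image[OF h this] show ?thesis by (simp add: comp_def)
  qed
  ultimately show "hered \<C> (qhom ?M J ` ?M)" using hered_mats_image[OF C] by blast
qed

end

section \<open>Actions of abelian 2-groups\<close>

lemma hom_transport:
  assumes f: "star_embedding B f" and h: "\<phi> \<in> star_hom B B'" and g: "star_embedding B' g"
  shows "chom (f ` carrier B) (\<lambda>y. g (\<phi> (inv_into (carrier B) f y)))"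
proof -
  note D = star_embeddingD[OF f] and E = star_embeddingD[OF g]
  have i: "inv_into (carrier B) f (f x) = x" if "x \<in> carrier B" for x by (rule inv_into_f_f[OF D(1) that])
  have H: "\<phi> x \<in> carrier B'" "\<phi> (x \<oplus>\<^bsub>B\<^esub> y) = \<phi> x \<oplus>\<^bsub>B'\<^esub> \<phi> y" "\<phi> (x \<otimes>\<^bsub>B\<^esub> y) = \<phi> x \<otimes>\<^bsub>B'\<^esub> \<phi> y"
    "\<phi> (c \<odot>\<^bsub>B\<^esub> x) = c \<odot>\<^bsub>B'\<^esub> \<phi> x" "\<phi> (adj B x) = adj B' (\<phi> x)" if "x \<in> carrier B" "y \<in> carrier B" for x y c
    using h that by (auto simp: star_hom_def)
  show ?thesis
    unfolding chom_def by (auto simp: i H D E simp flip: D(7,8,11,12))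
qed

text \<open>Transports the action to the image of the embedding and treats one group element after another. The
  property \<open>P\<close> is kept general because the theorem serves hereditary and residually hereditary
  membership alike.\<close>
theorem fixed_points_stable:
  fixes P :: "'t::uc_star set \<Rightarrow> bool" and f :: "'b \<Rightarrow> 't" and G (structure)
  assumes stable: "\<And>S \<sigma>. invol \<sigma> S \<Longrightarrow> P S \<Longrightarrow> P (fixed \<sigma> S)"
    and f: "star_embedding B f" and P: "P (f ` carrier B)"
    and G: "comm_group G" "finite (carrier G)" "order G = 2 ^ k"
    and a: "\<And>g. g \<in> carrier G \<Longrightarrow> \<alpha> g \<in> star_hom B B"
      "\<And>g h x. g \<in> carrier G \<Longrightarrow> h \<in> carrier G \<Longrightarrow> x \<in> carrier B \<Longrightarrow> \<alpha> g (\<alpha> h x) = \<alpha> (g \<otimes> h) x"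
      "\<And>x. x \<in> carrier B \<Longrightarrow> \<alpha> \<one> x = x"
  defines "F \<equiv> {x\<in>carrier B. \<forall>g\<in>carrier G. \<alpha> g x = x}"
  shows "star_embedding (B\<lparr>carrier := F\<rparr>) f \<and> P (f ` F)"
proof -
  interpret comm_group G by (rule G(1))
  note D = star_embeddingD[OF f]
  define \<tau> where "\<tau> g y = f (\<alpha> g (inv_into (carrier B) f y))" for g y
  have ac: "\<alpha> g x \<in> carrier B" if "g \<in> carrier G" "x \<in> carrier B" for g x
    using a(1)[OF that(1)] that(2) by (auto simp: star_hom_def)
  have t: "\<tau> g (f x) = f (\<alpha> g x)" if "x \<in> carrier B" for g x
    using that by (simp add: \<tau>_def inv_into_f_f[OF D(1)])
  have pw: "(\<tau> g ^^ m) (f x) = f (\<alpha> (g [^] m) x)" if "g \<in> carrier G" "x \<in> carrier B" for g x and m :: nat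
  proof (induction m)
    case (Suc m)
    have "(\<tau> g ^^ Suc m) (f x) = f (\<alpha> (g \<otimes> g [^] m) x)" using that Suc by (simp add: t ac a(2))
    then show ?case using that nat_pow_Suc2 by simp
  qed (use that a(3) in simp)
  have "csub {y\<in>f ` carrier B. \<forall>g\<in>carrier G. \<tau> g y = y} \<and> P {y\<in>f ` carrier B. \<forall>g\<in>carrier G. \<tau> g y = y}"
  proof (rule fixed_commuting_family[OF stable D(2) P G(2), where k = k])
    fix g assume g: "g \<in> carrier G"
    show "chom (f ` carrier B) (\<tau> g)" unfolding \<tau>_def by (rule hom_transport[OF f a(1)[OF g] f])
    fix y assume "y \<in> f ` carrier B"
    then obtain x where x: "x \<in> carrier B" "y = f x" by blast
    show "\<tau> g y \<in> f ` carrier B" using x g ac by (simp add: t)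
    show "(\<tau> g ^^ (2 ^ k)) y = y"
      using x g pw[OF g x(1), of "2 ^ k"] power_order_eq_one[OF G(2) g] G(3)[unfolded order_def] a(3) by simp
    fix h assume h: "h \<in> carrier G"
    show "\<tau> g (\<tau> h y) = \<tau> h (\<tau> g y)" using x g h ac by (simp add: t a(2) m_comm)
  qed
  moreover have "{y\<in>f ` carrier B. \<forall>g\<in>carrier G. \<tau> g y = y} = f ` F"
    using ac inj_on_eq_iff[OF D(1)] by (auto simp: F_def t)
  ultimately have "csub (f ` F)" "P (f ` F)" by auto
  then show ?thesis using star_embedding_restrict[OF f, of F] by (simp add: F_def)
qed

section \<open>Crossed products as fixed points of matrix algebras\<close>

lemma star_embedding_finsum:
  assumes g: "star_embedding B g" and I: "finite I" "h \<in> I \<rightarrow> carrier B"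
  shows "(\<Oplus>\<^bsub>B\<^esub>i\<in>I. h i) \<in> carrier B \<and> g (\<Oplus>\<^bsub>B\<^esub>i\<in>I. h i) = (\<Sum>i\<in>I. g (h i))"
proof -
  interpret abelian_group B by (rule star_embedding_abelian_group[OF g])
  note D = star_embeddingD[OF g]
  show ?thesis using I
  proof (induction I rule: finite_induct)
    case (insert i I)
    then have "(\<Oplus>\<^bsub>B\<^esub>i\<in>insert i I. h i) = h i \<oplus>\<^bsub>B\<^esub> (\<Oplus>\<^bsub>B\<^esub>i\<in>I. h i)" by (intro finsum_insert) auto
    then show ?case using insert by (simp add: D)
  qed (simp add: D)
qed

lemma sum_reindex_group:
  fixes G (structure)
  assumes "group G" "g \<in> carrier G"
  shows "(\<Sum>k\<in>carrier G. F k) = (\<Sum>k\<in>carrier G. F (k \<otimes> g))" "(\<Sum>k\<in>carrier G. F k) = (\<Sum>k\<in>carrier G. F (g \<otimes> k))"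
    "(\<Sum>k\<in>carrier G. F k) = (\<Sum>k\<in>carrier G. F (inv k))"
proof -
  interpret group G by (rule assms(1))
  have g: "g \<in> carrier G" by (rule assms(2))
  show "(\<Sum>k\<in>carrier G. F k) = (\<Sum>k\<in>carrier G. F (k \<otimes> g))"
    using g by (intro sum.reindex_bij_witness[of _ "\<lambda>k. k \<otimes> g" "\<lambda>k. k \<otimes> inv g"]) (auto simp: m_assoc)
  show "(\<Sum>k\<in>carrier G. F k) = (\<Sum>k\<in>carrier G. F (g \<otimes> k))"
    using g by (intro sum.reindex_bij_witness[of _ "\<lambda>k. g \<otimes> k" "\<lambda>k. inv g \<otimes> k"]) (auto simp: m_assoc[symmetric])
  show "(\<Sum>k\<in>carrier G. F k) = (\<Sum>k\<in>carrier G. F (inv k))"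
    by (intro sum.reindex_bij_witness[of _ "\<lambda>k. inv k" "\<lambda>k. inv k"]) auto
qed

text \<open>Throughout, \<open>e\<close> embeds \<open>A\<close> into a type, \<open>S\<close> is its image, and \<open>\<tau>\<close> is the action transported to \<open>S\<close>.\<close>
locale finite_action = group G for G :: "('g, 'm) monoid_scheme" (structure) +
  fixes A :: "'a cstar" and \<alpha> :: "'g \<Rightarrow> 'a \<Rightarrow> 'a"
  assumes finG: "finite (carrier G)" and A: "cstar_algebra A" and act: "cstar_action G A \<alpha>"
begin

definition "e = emb A"
definition "S = e ` carrier A"

lemma e: "star_embedding A e" unfolding e_def by (rule star_embedding_emb[OF A])
lemmas eD = star_embeddingD[OF e]
lemma S: "csub S" using eD(2) by (simp add: S_def)

lemma act_hom: "g \<in> carrier G \<Longrightarrow> \<alpha> g \<in> star_hom A A" using act by (simp add: cstar_action_def)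
lemma act_mem: "g \<in> carrier G \<Longrightarrow> x \<in> carrier A \<Longrightarrow> \<alpha> g x \<in> carrier A" using act_hom by (fastforce simp: star_hom_def)
lemma act_comp: "g \<in> carrier G \<Longrightarrow> h \<in> carrier G \<Longrightarrow> x \<in> carrier A \<Longrightarrow> \<alpha> g (\<alpha> h x) = \<alpha> (g \<otimes> h) x"
  using act group_action.composition_rule[of G "carrier A" \<alpha> x g h] by (simp add: cstar_action_def)
lemma act_one: "x \<in> carrier A \<Longrightarrow> \<alpha> \<one> x = x"
  using act group_action.id_eq_one[of G "carrier A" \<alpha>] by (metis cstar_action_def restrict_apply)
lemma act_simps:
  "g \<in> carrier G \<Longrightarrow> x \<in> carrier A \<Longrightarrow> y \<in> carrier A \<Longrightarrow> \<alpha> g (x \<oplus>\<^bsub>A\<^esub> y) = \<alpha> g x \<oplus>\<^bsub>A\<^esub> \<alpha> g y"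
  "g \<in> carrier G \<Longrightarrow> x \<in> carrier A \<Longrightarrow> y \<in> carrier A \<Longrightarrow> \<alpha> g (x \<otimes>\<^bsub>A\<^esub> y) = \<alpha> g x \<otimes>\<^bsub>A\<^esub> \<alpha> g y"
  "g \<in> carrier G \<Longrightarrow> x \<in> carrier A \<Longrightarrow> \<alpha> g (c \<odot>\<^bsub>A\<^esub> x) = c \<odot>\<^bsub>A\<^esub> \<alpha> g x"
  "g \<in> carrier G \<Longrightarrow> x \<in> carrier A \<Longrightarrow> \<alpha> g (adj A x) = adj A (\<alpha> g x)"
  using act_hom[of g] by (auto simp: star_hom_def)

definition \<tau> :: "'g \<Rightarrow> 'a uni \<Rightarrow> 'a uni" where "\<tau> g y = e (\<alpha> g (inv_into (carrier A) e y))"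

lemma tau: "x \<in> carrier A \<Longrightarrow> \<tau> g (e x) = e (\<alpha> g x)"
  by (simp add: \<tau>_def inv_into_f_f[OF eD(1)])
lemma tau_chom: "g \<in> carrier G \<Longrightarrow> chom S (\<tau> g)"
  unfolding \<tau>_def S_def by (rule hom_transport[OF e act_hom e])
lemma tau_mem: "g \<in> carrier G \<Longrightarrow> x \<in> S \<Longrightarrow> \<tau> g x \<in> S" by (auto simp: S_def tau act_mem)
lemma tau_comp: "g \<in> carrier G \<Longrightarrow> h \<in> carrier G \<Longrightarrow> x \<in> S \<Longrightarrow> \<tau> g (\<tau> h x) = \<tau> (g \<otimes> h) x"
  by (auto simp: S_def tau act_mem act_comp)
lemma tau_one: "x \<in> S \<Longrightarrow> \<tau> \<one> x = x" by (auto simp: S_def tau act_one)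

abbreviation "I \<equiv> carrier G"

text \<open>The action on matrices indexed by \<open>G\<close> that combines \<open>\<alpha>\<close> with the right translation of both
  indices.\<close>
definition \<beta> :: "'g \<Rightarrow> ('g \<Rightarrow> 'g \<Rightarrow> 'a uni) \<Rightarrow> 'g \<Rightarrow> 'g \<Rightarrow> 'a uni" where
  "\<beta> g x s t = (if s \<in> I \<and> t \<in> I then \<tau> g (x (s \<otimes> g) (t \<otimes> g)) else 0)"

lemma beta_mem: "g \<in> I \<Longrightarrow> x \<in> mats I S \<Longrightarrow> \<beta> g x \<in> mats I S"
  by (auto simp: mats_def \<beta>_def tau_mem)

lemma mats_entry: "x \<in> mats I S \<Longrightarrow> s \<in> I \<Longrightarrow> t \<in> I \<Longrightarrow> x s t \<in> S" by (auto simp: mats_def)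

lemma beta_hom: assumes g: "g \<in> I" shows "\<beta> g \<in> star_hom (matalg I S) (matalg I S)"
proof -
  note h = chom_add[OF tau_chom[OF g]] chom_mult[OF tau_chom[OF g]] chom_star[OF tau_chom[OF g]] chom_scaleC[OF tau_chom[OF g]]
  have "\<beta> g (mmul I x y) = mmul I (\<beta> g x) (\<beta> g y)" if x: "x \<in> mats I S" and y: "y \<in> mats I S" for x y
  proof (intro ext)
    fix s t
    show "\<beta> g (mmul I x y) s t = mmul I (\<beta> g x) (\<beta> g y) s t"
    proof (cases "s \<in> I \<and> t \<in> I")
      case True
      have xs: "x (s \<otimes> g) k \<in> S" "y k (t \<otimes> g) \<in> S" if "k \<in> I" for k using that True g x y by (auto intro: mats_entry)
      have "\<beta> g (mmul I x y) s t = (\<Sum>k\<in>I. \<tau> g (x (s \<otimes> g) k) * \<tau> g (y k (t \<otimes> g)))"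
        using True xs S by (simp add: \<beta>_def mmul_def chom_sum[OF S tau_chom[OF g]] csub_mult h)
      also have "\<dots> = (\<Sum>k\<in>I. \<tau> g (x (s \<otimes> g) (k \<otimes> g)) * \<tau> g (y (k \<otimes> g) (t \<otimes> g)))"
        by (rule sum_reindex_group(1)[OF group_axioms g])
      also have "\<dots> = mmul I (\<beta> g x) (\<beta> g y) s t" using True by (simp add: mmul_def \<beta>_def)
      finally show ?thesis .
    qed (auto simp: \<beta>_def mmul_def intro!: sum.neutral)
  qed
  moreover have "\<beta> g (\<lambda>i j. x i j + y i j) = (\<lambda>i j. \<beta> g x i j + \<beta> g y i j)" if "x \<in> mats I S" "y \<in> mats I S" for x y
    using that g by (auto simp: \<beta>_def fun_eq_iff h mats_entry)
  moreover have "\<beta> g (\<lambda>i j. c *\<^sub>C x i j) = (\<lambda>i j. c *\<^sub>C \<beta> g x i j)" "\<beta> g (madj x) = madj (\<beta> g x)" if "x \<in> mats I S" for x c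
    using that g by (auto simp: \<beta>_def fun_eq_iff h mats_entry madj_def)
  ultimately show ?thesis using beta_mem[OF g] by (auto simp: star_hom_def)
qed

lemma beta_comp: "g \<in> I \<Longrightarrow> h \<in> I \<Longrightarrow> x \<in> mats I S \<Longrightarrow> \<beta> g (\<beta> h x) = \<beta> (g \<otimes> h) x"
  by (auto simp: \<beta>_def fun_eq_iff tau_comp mats_entry m_assoc)

lemma beta_one: "x \<in> mats I S \<Longrightarrow> \<beta> \<one> x = x"
  by (intro ext) (auto simp: \<beta>_def tau_one mats_entry, auto simp: mats_def)

text \<open>The regular representation: the convolution operator of \<open>f\<close> as a matrix of elements of \<open>A\<close>.\<close>
definition \<Phi> :: "('g \<Rightarrow> 'a) \<Rightarrow> 'g \<Rightarrow> 'g \<Rightarrow> 'a uni" where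
  "\<Phi> f s t = (if s \<in> I \<and> t \<in> I then e (\<alpha> (inv s) (f (s \<otimes> inv t))) else 0)"

text \<open>The crossed product with the matrix norm instead of the universal norm. The two norms agree, but the
  comparison uses that this structure is already a C*-algebra.\<close>
definition "mcross = (crossed_product G A \<alpha>)\<lparr>cnorm := \<lambda>f. mnorm I (\<Phi> f)\<rparr>"

lemma mcross_simps [simp]:
  "carrier mcross = I \<rightarrow>\<^sub>E carrier A"
  "f \<otimes>\<^bsub>mcross\<^esub> h = (\<lambda>t\<in>I. \<Oplus>\<^bsub>A\<^esub>s\<in>I. f s \<otimes>\<^bsub>A\<^esub> \<alpha> s (h (inv s \<otimes> t)))"
  "\<zero>\<^bsub>mcross\<^esub> = (\<lambda>t\<in>I. \<zero>\<^bsub>A\<^esub>)" "f \<oplus>\<^bsub>mcross\<^esub> h = (\<lambda>t\<in>I. f t \<oplus>\<^bsub>A\<^esub> h t)" "c \<odot>\<^bsub>mcross\<^esub> f = (\<lambda>t\<in>I. c \<odot>\<^bsub>A\<^esub> f t)"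
  "adj mcross f = (\<lambda>t\<in>I. \<alpha> t (adj A (f (inv t))))" "cnorm mcross f = mnorm I (\<Phi> f)"
  by (simp_all add: mcross_def crossed_product_def)

lemma cp_mem: "f \<in> carrier mcross \<Longrightarrow> s \<in> I \<Longrightarrow> f s \<in> carrier A" by auto

lemma cp_mult_term:
  assumes f: "f \<in> carrier mcross" and h: "h \<in> carrier mcross" and t: "t \<in> I"
  shows "(\<lambda>s. f s \<otimes>\<^bsub>A\<^esub> \<alpha> s (h (inv s \<otimes> t))) \<in> I \<rightarrow> carrier A"
proof (rule Pi_I)
  fix s assume s: "s \<in> I"
  then have "inv s \<otimes> t \<in> I" using t by simp
  from eD(6)[OF cp_mem[OF f s] act_mem[OF s cp_mem[OF h this]]]
  show "f s \<otimes>\<^bsub>A\<^esub> \<alpha> s (h (inv s \<otimes> t)) \<in> carrier A" .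
qed

lemma e_cp_mult:
  assumes "f \<in> carrier mcross" "h \<in> carrier mcross" "t \<in> I"
  shows "(f \<otimes>\<^bsub>mcross\<^esub> h) t \<in> carrier A"
    "g \<in> I \<Longrightarrow> e (\<alpha> g ((f \<otimes>\<^bsub>mcross\<^esub> h) t)) = (\<Sum>s\<in>I. e (\<alpha> g (f s)) * e (\<alpha> (g \<otimes> s) (h (inv s \<otimes> t))))"
proof -
  note F = star_embedding_finsum[OF e finG cp_mult_term[OF assms]]
  show "(f \<otimes>\<^bsub>mcross\<^esub> h) t \<in> carrier A" using F assms by simp
  assume g: "g \<in> I"
  have m: "f s \<in> carrier A" "h (inv s \<otimes> t) \<in> carrier A" if "s \<in> I" for s
    by (rule cp_mem[OF assms(1) that], rule cp_mem[OF assms(2)]) (use that assms(3) in simp)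
  have "e (\<alpha> g ((f \<otimes>\<^bsub>mcross\<^esub> h) t)) = \<tau> g (\<Sum>s\<in>I. e (f s \<otimes>\<^bsub>A\<^esub> \<alpha> s (h (inv s \<otimes> t))))"
    using F assms(3) by (simp add: tau[symmetric])
  also have "\<dots> = (\<Sum>s\<in>I. \<tau> g (e (f s \<otimes>\<^bsub>A\<^esub> \<alpha> s (h (inv s \<otimes> t)))))"
    by (rule chom_sum[OF S tau_chom[OF g]]) (auto simp: S_def m eD(6) act_mem)
  also have "\<dots> = (\<Sum>s\<in>I. e (\<alpha> g (f s)) * e (\<alpha> (g \<otimes> s) (h (inv s \<otimes> t))))"
  proof (rule sum.cong[OF refl])
    fix s assume s: "s \<in> I"
    have "\<tau> g (e (f s \<otimes>\<^bsub>A\<^esub> \<alpha> s (h (inv s \<otimes> t)))) = e (\<alpha> g (f s \<otimes>\<^bsub>A\<^esub> \<alpha> s (h (inv s \<otimes> t))))"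
      by (rule tau) (use m[OF s] s in \<open>simp add: eD(6) act_mem\<close>)
    then show "\<tau> g (e (f s \<otimes>\<^bsub>A\<^esub> \<alpha> s (h (inv s \<otimes> t)))) = e (\<alpha> g (f s)) * e (\<alpha> (g \<otimes> s) (h (inv s \<otimes> t)))"
      using g s m[OF s] by (simp add: act_simps act_comp act_mem eD(8))
  qed
  finally show "e (\<alpha> g ((f \<otimes>\<^bsub>mcross\<^esub> h) t)) = (\<Sum>s\<in>I. e (\<alpha> g (f s)) * e (\<alpha> (g \<otimes> s) (h (inv s \<otimes> t))))" .
qed

lemma inv_cancel: "s \<in> I \<Longrightarrow> y \<in> I \<Longrightarrow> inv s \<otimes> (s \<otimes> y) = y"
  by (simp add: m_assoc[symmetric])

lemma Phi_mem: "f \<in> carrier mcross \<Longrightarrow> \<Phi> f \<in> mats I S"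
  by (auto simp: mats_def \<Phi>_def S_def intro!: imageI act_mem)

lemma Phi_mult:
  assumes f: "f \<in> carrier mcross" and h: "h \<in> carrier mcross"
  shows "\<Phi> (f \<otimes>\<^bsub>mcross\<^esub> h) = mmul I (\<Phi> f) (\<Phi> h)"
proof (intro ext)
  fix s t
  show "\<Phi> (f \<otimes>\<^bsub>mcross\<^esub> h) s t = mmul I (\<Phi> f) (\<Phi> h) s t"
  proof (cases "s \<in> I \<and> t \<in> I")
    case True
    then have st: "s \<in> I" "t \<in> I" by auto
    have "\<Phi> (f \<otimes>\<^bsub>mcross\<^esub> h) s t = (\<Sum>q\<in>I. e (\<alpha> (inv s) (f q)) * e (\<alpha> (inv s \<otimes> q) (h (inv q \<otimes> (s \<otimes> inv t)))))"
      using e_cp_mult(2)[OF f h, of "s \<otimes> inv t" "inv s"] st by (simp add: \<Phi>_def del: mcross_simps)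
    also have "\<dots> = (\<Sum>q\<in>I. e (\<alpha> (inv s) (f (s \<otimes> inv q))) * e (\<alpha> (inv s \<otimes> (s \<otimes> inv q)) (h (inv (s \<otimes> inv q) \<otimes> (s \<otimes> inv t)))))"
      by (subst sum_reindex_group(2)[OF group_axioms st(1)], subst sum_reindex_group(3)[OF group_axioms st(1)]) simp
    also have "\<dots> = (\<Sum>q\<in>I. \<Phi> f s q * \<Phi> h q t)"
    proof (rule sum.cong[OF refl])
      fix q assume q: "q \<in> I"
      have 1: "inv s \<otimes> (s \<otimes> inv q) = inv q" using st q by (simp add: m_assoc[symmetric])
      have 2: "inv (s \<otimes> inv q) \<otimes> (s \<otimes> inv t) = q \<otimes> inv t"
        using st q by (simp add: inv_mult_group m_assoc inv_cancel)
      show "e (\<alpha> (inv s) (f (s \<otimes> inv q))) * e (\<alpha> (inv s \<otimes> (s \<otimes> inv q)) (h (inv (s \<otimes> inv q) \<otimes> (s \<otimes> inv t)))) = \<Phi> f s q * \<Phi> h q t"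
        unfolding 1 2 using st q by (simp add: \<Phi>_def)
    qed
    finally show ?thesis by (simp add: mmul_def)
  qed (auto simp: \<Phi>_def mmul_def intro!: sum.neutral)
qed

lemma Phi_simps:
  "f \<in> carrier mcross \<Longrightarrow> h \<in> carrier mcross \<Longrightarrow> \<Phi> (f \<oplus>\<^bsub>mcross\<^esub> h) = (\<lambda>i j. \<Phi> f i j + \<Phi> h i j)"
  "f \<in> carrier mcross \<Longrightarrow> \<Phi> (c \<odot>\<^bsub>mcross\<^esub> f) = (\<lambda>i j. c *\<^sub>C \<Phi> f i j)"
  "f \<in> carrier mcross \<Longrightarrow> \<Phi> (adj mcross f) = madj (\<Phi> f)"
  "\<Phi> \<zero>\<^bsub>mcross\<^esub> = (\<lambda>i j. 0)"
proof -
  assume f: "f \<in> carrier mcross"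
  note m = cp_mem[OF f]
  show "\<Phi> (f \<oplus>\<^bsub>mcross\<^esub> h) = (\<lambda>i j. \<Phi> f i j + \<Phi> h i j)" if "h \<in> carrier mcross"
    using m cp_mem[OF that] by (auto simp: \<Phi>_def fun_eq_iff act_simps eD act_mem simp del: PiE_iff)
  show "\<Phi> (c \<odot>\<^bsub>mcross\<^esub> f) = (\<lambda>i j. c *\<^sub>C \<Phi> f i j)"
    using m by (auto simp: \<Phi>_def fun_eq_iff act_simps eD act_mem)
  show "\<Phi> (adj mcross f) = madj (\<Phi> f)"
  proof (intro ext)
    fix s t
    show "\<Phi> (adj mcross f) s t = madj (\<Phi> f) s t"
    proof (cases "s \<in> I \<and> t \<in> I")
      case True
      have a: "inv (s \<otimes> inv t) = t \<otimes> inv s" "inv s \<otimes> (s \<otimes> inv t) = inv t"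
        using True by (simp_all add: inv_mult_group inv_cancel)
      have "\<Phi> (adj mcross f) s t = e (\<alpha> (inv s) (\<alpha> (s \<otimes> inv t) (adj A (f (t \<otimes> inv s)))))"
        using True by (simp add: \<Phi>_def a)
      also have "\<dots> = e (\<alpha> (inv t) (adj A (f (t \<otimes> inv s))))"
        using True m by (simp add: act_comp eD a)
      also have "\<dots> = madj (\<Phi> f) s t" using True m by (simp add: \<Phi>_def madj_def act_simps eD act_mem)
      finally show ?thesis .
    qed (auto simp: \<Phi>_def madj_def)
  qed
next
  have "\<alpha> g \<zero>\<^bsub>A\<^esub> = \<zero>\<^bsub>A\<^esub>" if "g \<in> I" for g
  proof -
    have "\<tau> g 0 = 0" by (rule chom_0[OF S tau_chom[OF that]])
    then have "e (\<alpha> g \<zero>\<^bsub>A\<^esub>) = e \<zero>\<^bsub>A\<^esub>" using tau[OF eD(3)] eD(4) by simp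
    then show ?thesis by (rule inj_onD[OF eD(1) _ act_mem[OF that eD(3)] eD(3)])
  qed
  then show "\<Phi> \<zero>\<^bsub>mcross\<^esub> = (\<lambda>i j. 0)" by (auto simp: \<Phi>_def fun_eq_iff eD)
qed

lemma inj_Phi: "inj_on \<Phi> (carrier mcross)"
proof (rule inj_onI)
  fix f h assume f: "f \<in> carrier mcross" and h: "h \<in> carrier mcross" and eq: "\<Phi> f = \<Phi> h"
  have "f q = h q" if q: "q \<in> I" for q
  proof -
    have "e (\<alpha> \<one> (f q)) = e (\<alpha> \<one> (h q))" using fun_cong[OF fun_cong[OF eq, of \<one>], of "inv q"] q by (simp add: \<Phi>_def)
    then have "e (f q) = e (h q)" using act_one cp_mem[OF f q] cp_mem[OF h q] by simp
    then show ?thesis by (rule inj_onD[OF eD(1) _ cp_mem[OF f q] cp_mem[OF h q]])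
  qed
  then show "f = h" using f h by (intro PiE_ext[of f I "\<lambda>_. carrier A" h]) auto
qed

end

text \<open>Star-homomorphisms out of an embedded structure are contractive.\<close>
lemma alg_hom_norm_le:
  fixes f :: "'b \<Rightarrow> 's::uc_star" and \<theta> :: "'b \<Rightarrow> 't::uc_star"
  assumes f: "star_embedding B f"
    and h: "\<And>x y. x \<in> carrier B \<Longrightarrow> y \<in> carrier B \<Longrightarrow> \<theta> (x \<oplus>\<^bsub>B\<^esub> y) = \<theta> x + \<theta> y"
      "\<And>x y. x \<in> carrier B \<Longrightarrow> y \<in> carrier B \<Longrightarrow> \<theta> (x \<otimes>\<^bsub>B\<^esub> y) = \<theta> x * \<theta> y"
      "\<And>x. x \<in> carrier B \<Longrightarrow> \<theta> (adj B x) = star (\<theta> x)"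
      "\<And>x c. x \<in> carrier B \<Longrightarrow> \<theta> (c \<odot>\<^bsub>B\<^esub> x) = c *\<^sub>C \<theta> x"
    and x: "x \<in> carrier B"
  shows "norm (\<theta> x) \<le> cnorm B x"
proof -
  note D = star_embeddingD[OF f]
  have i: "inv_into (carrier B) f (f x) = x" if "x \<in> carrier B" for x by (rule inv_into_f_f[OF D(1) that])
  have "chom (f ` carrier B) (\<lambda>y. \<theta> (inv_into (carrier B) f y))"
    unfolding chom_def by (auto simp: i h D simp flip: D(7,8,11,12))
  from chom_norm_le[OF D(2) this] x have "norm (\<theta> (inv_into (carrier B) f (f x))) \<le> norm (f x)" by blast
  then show ?thesis using D(13)[OF x] i[OF x] by simp
qed

lemma scaleC_sum: "c *\<^sub>C sum f I = (\<Sum>i\<in>I. c *\<^sub>C (f i :: 'a::nc_star))"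
  by (induction I rule: infinite_finite_induct) (auto simp: scaleC_add_right)

context finite_action
begin

lemma cancel_inv: "s \<in> I \<Longrightarrow> y \<in> I \<Longrightarrow> s \<otimes> (inv s \<otimes> y) = y"
  by (simp add: m_assoc[symmetric])

text \<open>A matrix fixed by the action is determined by its row at the identity, since applying the element
  \<open>s ^ (-1)\<close> gives \<open>x s t = \<tau> (s ^ (-1)) (x 1 (t s ^ (-1)))\<close>.\<close>
lemma Phi_image: "\<Phi> ` carrier mcross = {x \<in> mats I S. \<forall>g\<in>I. \<beta> g x = x}"
proof (intro subset_antisym subsetI)
  fix x assume "x \<in> \<Phi> ` carrier mcross"
  then obtain f where f: "f \<in> carrier mcross" "x = \<Phi> f" by blast
  have "\<beta> g (\<Phi> f) = \<Phi> f" if g: "g \<in> I" for g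
  proof (intro ext)
    fix s t
    show "\<beta> g (\<Phi> f) s t = \<Phi> f s t"
    proof (cases "s \<in> I \<and> t \<in> I")
      case True
      then have st: "s \<in> I" "t \<in> I" by auto
      have 1: "(s \<otimes> g) \<otimes> inv (t \<otimes> g) = s \<otimes> inv t" "g \<otimes> inv (s \<otimes> g) = inv s"
        using st g by (simp_all add: inv_mult_group m_assoc cancel_inv)
      have m: "f (s \<otimes> inv t) \<in> carrier A" using st by (intro cp_mem[OF f(1)]) simp
      have "\<beta> g (\<Phi> f) s t = \<tau> g (e (\<alpha> (inv (s \<otimes> g)) (f (s \<otimes> inv t))))"
        using st g by (simp add: \<beta>_def \<Phi>_def 1)
      also have "\<dots> = e (\<alpha> g (\<alpha> (inv (s \<otimes> g)) (f (s \<otimes> inv t))))" using st g m by (intro tau act_mem) auto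
      also have "\<dots> = \<Phi> f s t" using st g m by (simp add: act_comp 1 \<Phi>_def)
      finally show ?thesis .
    qed (auto simp: \<beta>_def \<Phi>_def)
  qed
  then show "x \<in> {x \<in> mats I S. \<forall>g\<in>I. \<beta> g x = x}" using f Phi_mem by simp
next
  fix x assume "x \<in> {x \<in> mats I S. \<forall>g\<in>I. \<beta> g x = x}"
  then have x: "x \<in> mats I S" and fx: "\<And>g. g \<in> I \<Longrightarrow> \<beta> g x = x" by auto
  define f where "f = (\<lambda>q\<in>I. inv_into (carrier A) e (x \<one> (inv q)))"
  have xm: "x \<one> (inv q) \<in> e ` carrier A" if "q \<in> I" for q using mats_entry[OF x, of \<one> "inv q"] that by (simp add: S_def)
  have fA: "f q \<in> carrier A" "e (f q) = x \<one> (inv q)" if "q \<in> I" for q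
    using inv_into_into[OF xm[OF that]] f_inv_into_f[OF xm[OF that]] that by (simp_all add: f_def)
  have f: "f \<in> carrier mcross" using fA(1) by (auto simp: f_def)
  have "\<Phi> f s t = x s t" for s t
  proof (cases "s \<in> I \<and> t \<in> I")
    case True
    then have st: "s \<in> I" "t \<in> I" "s \<otimes> inv t \<in> I" by auto
    have "\<Phi> f s t = \<tau> (inv s) (x \<one> (inv (s \<otimes> inv t)))"
      using st fA[OF st(3)] by (simp add: \<Phi>_def tau flip: fA(2)[OF st(3)])
    also have "\<dots> = \<beta> (inv s) x s t" using st by (simp add: \<beta>_def inv_mult_group)
    finally show ?thesis using fx st by simp
  qed (use x in \<open>auto simp: \<Phi>_def mats_def\<close>)
  then have "x = \<Phi> f" by (intro ext) simp
  then show "x \<in> \<Phi> ` carrier mcross" using f by blast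
qed

lemma mcross_closed:
  "\<zero>\<^bsub>mcross\<^esub> \<in> carrier mcross"
  "f \<in> carrier mcross \<Longrightarrow> h \<in> carrier mcross \<Longrightarrow> f \<oplus>\<^bsub>mcross\<^esub> h \<in> carrier mcross"
  "f \<in> carrier mcross \<Longrightarrow> h \<in> carrier mcross \<Longrightarrow> f \<otimes>\<^bsub>mcross\<^esub> h \<in> carrier mcross"
  "f \<in> carrier mcross \<Longrightarrow> adj mcross f \<in> carrier mcross"
  "f \<in> carrier mcross \<Longrightarrow> c \<odot>\<^bsub>mcross\<^esub> f \<in> carrier mcross"
proof -
  show "\<zero>\<^bsub>mcross\<^esub> \<in> carrier mcross" by (auto simp: eD)
  assume f: "f \<in> carrier mcross"
  note m = cp_mem[OF f]
  show "f \<oplus>\<^bsub>mcross\<^esub> h \<in> carrier mcross" if "h \<in> carrier mcross" using m cp_mem[OF that] by (auto intro: eD)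
  show "f \<otimes>\<^bsub>mcross\<^esub> h \<in> carrier mcross" if h: "h \<in> carrier mcross"
    using e_cp_mult(1)[OF f h] by auto
  show "adj mcross f \<in> carrier mcross" using m by (auto intro!: act_mem eD)
  show "c \<odot>\<^bsub>mcross\<^esub> f \<in> carrier mcross" using m by (auto intro: eD)
qed

lemma crossed_embedding_stable:
  fixes P :: "('g \<Rightarrow> 'g \<Rightarrow> 'a uni) uni set \<Rightarrow> bool"
  assumes G: "comm_group G" "order G = 2 ^ k"
    and stable: "\<And>S \<sigma>. invol \<sigma> S \<Longrightarrow> P S \<Longrightarrow> P (fixed \<sigma> S)" and P: "P (memb I S ` mats I S)"
  shows "star_embedding mcross (\<lambda>f. memb I S (\<Phi> f))" "P ((\<lambda>f. memb I S (\<Phi> f)) ` carrier mcross)"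
proof -
  note D = membD[OF finG S]
  let ?F = "{x \<in> carrier (matalg I S). \<forall>g\<in>I. \<beta> g x = x}"
  have "star_embedding (matalg I S\<lparr>carrier := ?F\<rparr>) (memb I S) \<and> P (memb I S ` ?F)"
    by (rule fixed_points_stable[where P = P, OF stable memb[OF finG S] _ G(1) finG G(2) beta_hom])
      (use P in \<open>auto simp: beta_comp beta_one\<close>)
  moreover have "memb I S ` ?F = (\<lambda>f. memb I S (\<Phi> f)) ` carrier mcross"
    using Phi_image by (simp add: image_image[symmetric] del: mcross_simps)
  ultimately have *: "csub ((\<lambda>f. memb I S (\<Phi> f)) ` carrier mcross)" "P ((\<lambda>f. memb I S (\<Phi> f)) ` carrier mcross)"
    using star_embeddingD(2)[of "matalg I S\<lparr>carrier := ?F\<rparr>" "memb I S"] by (auto simp del: mcross_simps)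
  show "P ((\<lambda>f. memb I S (\<Phi> f)) ` carrier mcross)" by (rule *(2))
  have "inj_on (memb I S \<circ> \<Phi>) (carrier mcross)"
    by (rule comp_inj_on[OF inj_Phi inj_on_subset[OF D(1)]]) (use Phi_mem in blast)
  then have inj: "inj_on (\<lambda>f. memb I S (\<Phi> f)) (carrier mcross)" by (simp add: comp_def)
  show "star_embedding mcross (\<lambda>f. memb I S (\<Phi> f))"
    unfolding star_embedding_def
    using inj *(1) by (simp add: mcross_closed Phi_simps Phi_mult Phi_mem D del: mcross_simps(1-6))
qed

section \<open>The universal norm\<close>

text \<open>The integrated form of a covariant representation is a star-homomorphism. Covariance moves \<open>u s\<close> past
  the values of \<open>\<phi>\<close>, and the sums over the group are reindexed by translation and inversion.\<close>
lemma norm_integrated_form_le: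
  fixes B :: "'b cstar"
  assumes E: "star_embedding mcross (\<Psi> :: _ \<Rightarrow> 't::uc_star)"
    and r: "covariant_rep G A \<alpha> B \<phi> u" and f: "f \<in> carrier mcross"
  shows "cnorm B (integrated_form G B \<phi> u f) \<le> mnorm I (\<Phi> f)"
proof -
  have B: "cstar_algebra B" and un: "unital B" and ph: "\<phi> \<in> star_hom A B" and u: "u \<in> hom G B"
    and uu: "\<And>s. s \<in> I \<Longrightarrow> adj B (u s) \<otimes>\<^bsub>B\<^esub> u s = \<one>\<^bsub>B\<^esub> \<and> u s \<otimes>\<^bsub>B\<^esub> adj B (u s) = \<one>\<^bsub>B\<^esub>"
    and cov: "\<And>s a. s \<in> I \<Longrightarrow> a \<in> carrier A \<Longrightarrow> u s \<otimes>\<^bsub>B\<^esub> \<phi> a \<otimes>\<^bsub>B\<^esub> adj B (u s) = \<phi> (\<alpha> s a)"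
    using r by (auto simp: covariant_rep_def)
  define g where "g = emb B"
  have g: "star_embedding B g" unfolding g_def by (rule star_embedding_emb[OF B])
  note D = star_embeddingD[OF g]
  define \<psi> where "\<psi> y = g (\<phi> (inv_into (carrier A) e y))" for y
  have psi: "chom S \<psi>" unfolding \<psi>_def S_def by (rule hom_transport[OF e ph g])
  define F where "F a = \<psi> (e a)" for a
  have phm: "\<phi> a \<in> carrier B" if "a \<in> carrier A" for a using ph that by (auto simp: star_hom_def)
  have F: "g (\<phi> a) = F a" if "a \<in> carrier A" for a by (simp add: F_def \<psi>_def inv_into_f_f[OF eD(1) that])
  have eS: "e a \<in> S" if "a \<in> carrier A" for a using that by (simp add: S_def)
  have F_add: "F (a \<oplus>\<^bsub>A\<^esub> b) = F a + F b" and F_mult: "F (a \<otimes>\<^bsub>A\<^esub> b) = F a * F b"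
    and F_adj: "F (adj A a) = star (F a)" and F_smult: "F (c \<odot>\<^bsub>A\<^esub> a) = c *\<^sub>C F a"
    if "a \<in> carrier A" "b \<in> carrier A" for a b c
    using that eS chom_add[OF psi] chom_mult[OF psi] chom_star[OF psi] chom_scaleC[OF psi] by (simp_all add: F_def eD)
  define U where "U s = g (u s)" for s
  have um: "u s \<in> carrier B" if "s \<in> I" for s using u that by (auto simp: hom_def)
  define j where "j = g \<one>\<^bsub>B\<^esub>"
  have jm: "\<one>\<^bsub>B\<^esub> \<in> carrier B" using un by (simp add: unital_def)
  have j: "j * g b = g b" "g b * j = g b" if "b \<in> carrier B" for b
    using un that by (simp_all add: j_def unital_def flip: D(8))
  have UU: "star (U s) * U s = j" "U s * star (U s) = j" if "s \<in> I" for s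
    using uu[OF that] um[OF that] D(9) by (simp_all add: U_def j_def flip: D(8,11))
  have Um: "U (s \<otimes> t) = U s * U t" if "s \<in> I" "t \<in> I" for s t
    using u that um by (simp add: U_def hom_mult flip: D(8))
  have jU: "j * U s = U s" "U s * j = U s" "j * star (U s) = star (U s)" if "s \<in> I" for s
    using j um[OF that] D(9)[OF um[OF that]] by (simp_all add: U_def flip: D(11))
  have U1: "U \<one> = j"
  proof -
    have "j * U \<one> = star (U \<one>) * (U \<one> * U \<one>)" using UU(1)[of \<one>] by (simp add: mult.assoc[symmetric])
    then show ?thesis using Um[of \<one> \<one>] jU(1)[of \<one>] UU(1)[of \<one>] by simp
  qed
  have Uinv: "U (inv s) = star (U s)" if s: "s \<in> I" for s
  proof -
    have "U (inv s) = U (inv s) * (U s * star (U s))" using jU(2)[of "inv s"] UU(2)[OF s] s by simp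
    also have "\<dots> = U (inv s \<otimes> s) * star (U s)" using s by (simp only: Um inv_closed mult.assoc)
    finally show ?thesis using s by (simp add: U1 jU)
  qed
  have UF: "U s * F a = F (\<alpha> s a) * U s" if s: "s \<in> I" and a: "a \<in> carrier A" for s a
  proof -
    have "F (\<alpha> s a) = U s * F a * star (U s)"
      unfolding F[OF act_mem[OF s a], symmetric] cov[OF s a, symmetric] F[OF a, symmetric] U_def
      using um[OF s] phm[OF a] by (simp add: D)
    then have "F (\<alpha> s a) * U s = U s * (F a * j)" using UU(1)[OF s] by (simp add: mult.assoc)
    also have "F a * j = F a" using j(2)[OF phm[OF a]] F[OF a] by simp
    finally show ?thesis by simp
  qed
  define \<theta> where "\<theta> f = g (integrated_form G B \<phi> u f)" for f
  have IFm: "integrated_form G B \<phi> u f \<in> carrier B" and \<theta>: "\<theta> f = (\<Sum>s\<in>I. F (f s) * U s)" if f: "f \<in> carrier mcross" for f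
  proof -
    have "(\<lambda>s. \<phi> (f s) \<otimes>\<^bsub>B\<^esub> u s) \<in> I \<rightarrow> carrier B" by (rule Pi_I, intro D(6) phm um cp_mem[OF f])
    note s = star_embedding_finsum[OF g finG this]
    show "integrated_form G B \<phi> u f \<in> carrier B" using s by (simp add: integrated_form_def)
    have "\<theta> f = (\<Sum>s\<in>I. g (\<phi> (f s) \<otimes>\<^bsub>B\<^esub> u s))" using s by (simp add: integrated_form_def \<theta>_def)
    also have "\<dots> = (\<Sum>s\<in>I. F (f s) * U s)"
      by (rule sum.cong[OF refl]) (simp add: D(8)[OF phm[OF cp_mem[OF f]] um] F[OF cp_mem[OF f]] U_def)
    finally show "\<theta> f = (\<Sum>s\<in>I. F (f s) * U s)" .
  qed
  have "norm (\<theta> f) \<le> cnorm mcross f"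
  proof (rule alg_hom_norm_le[OF E _ _ _ _ f])
    fix f h c assume f: "f \<in> carrier mcross" and h: "h \<in> carrier mcross"
    note mf = cp_mem[OF f] and mh = cp_mem[OF h]
    show "\<theta> (f \<oplus>\<^bsub>mcross\<^esub> h) = \<theta> f + \<theta> h"
      unfolding \<theta>[OF f] \<theta>[OF h] \<theta>[OF mcross_closed(2)[OF f h]] sum.distrib[symmetric]
      by (rule sum.cong[OF refl]) (simp add: F_add[OF mf mh] distrib_right)
    have "\<theta> (f \<otimes>\<^bsub>mcross\<^esub> h) = (\<Sum>t\<in>I. \<Sum>s\<in>I. F (f s) * F (\<alpha> s (h (inv s \<otimes> t))) * U t)"
      unfolding \<theta>[OF mcross_closed(3)[OF f h]]
    proof (rule sum.cong[OF refl])
      fix t assume t: "t \<in> I"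
      have hm: "h (inv s \<otimes> t) \<in> carrier A" if "s \<in> I" for s using mh that t by simp
      have "e ((f \<otimes>\<^bsub>mcross\<^esub> h) t) = e (\<alpha> \<one> ((f \<otimes>\<^bsub>mcross\<^esub> h) t))" by (simp only: act_one[OF e_cp_mult(1)[OF f h t]])
      also have "\<dots> = (\<Sum>s\<in>I. e (f s) * e (\<alpha> s (h (inv s \<otimes> t))))"
        unfolding e_cp_mult(2)[OF f h t one_closed]
        by (rule sum.cong[OF refl]) (simp add: act_one[OF mf])
      finally have "F ((f \<otimes>\<^bsub>mcross\<^esub> h) t) = \<psi> (\<Sum>s\<in>I. e (f s) * e (\<alpha> s (h (inv s \<otimes> t))))" by (simp only: F_def)
      also have "\<dots> = (\<Sum>s\<in>I. \<psi> (e (f s) * e (\<alpha> s (h (inv s \<otimes> t)))))"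
        by (rule chom_sum[OF S psi]) (intro csub_mult[OF S] eS mf act_mem hm)
      also have "\<dots> = (\<Sum>s\<in>I. F (f s) * F (\<alpha> s (h (inv s \<otimes> t))))"
        unfolding F_def by (rule sum.cong[OF refl]) (intro chom_mult[OF psi] eS mf act_mem hm)
      finally show "F ((f \<otimes>\<^bsub>mcross\<^esub> h) t) * U t = (\<Sum>s\<in>I. F (f s) * F (\<alpha> s (h (inv s \<otimes> t))) * U t)"
        by (simp only: sum_distrib_right)
    qed
    also have "\<dots> = (\<Sum>s\<in>I. \<Sum>t\<in>I. F (f s) * F (\<alpha> s (h (inv s \<otimes> t))) * U t)" by (rule sum.swap)
    also have "\<dots> = (\<Sum>s\<in>I. \<Sum>t\<in>I. F (f s) * U s * (F (h t) * U t))"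
    proof (rule sum.cong[OF refl])
      fix s assume s: "s \<in> I"
      have "(\<Sum>t\<in>I. F (f s) * F (\<alpha> s (h (inv s \<otimes> t))) * U t) = (\<Sum>t\<in>I. F (f s) * F (\<alpha> s (h (inv s \<otimes> (s \<otimes> t)))) * U (s \<otimes> t))"
        by (rule sum_reindex_group(2)[OF group_axioms s])
      also have "\<dots> = (\<Sum>t\<in>I. F (f s) * U s * (F (h t) * U t))"
      proof (rule sum.cong[OF refl])
        fix t assume t: "t \<in> I"
        have "F (f s) * F (\<alpha> s (h t)) * (U s * U t) = F (f s) * (F (\<alpha> s (h t)) * U s) * U t" by (simp only: mult.assoc)
        then show "F (f s) * F (\<alpha> s (h (inv s \<otimes> (s \<otimes> t)))) * U (s \<otimes> t) = F (f s) * U s * (F (h t) * U t)"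
          using s t by (simp only: inv_cancel Um UF[OF s mh[OF t], symmetric] mult.assoc)
      qed
      finally show "(\<Sum>t\<in>I. F (f s) * F (\<alpha> s (h (inv s \<otimes> t))) * U t) = (\<Sum>t\<in>I. F (f s) * U s * (F (h t) * U t))" .
    qed
    also have "\<dots> = \<theta> f * \<theta> h" unfolding \<theta>[OF f] \<theta>[OF h] by (rule sum_product[symmetric])
    finally show "\<theta> (f \<otimes>\<^bsub>mcross\<^esub> h) = \<theta> f * \<theta> h" .
  next
    fix f c assume f: "f \<in> carrier mcross"
    note mf = cp_mem[OF f]
    show "\<theta> (c \<odot>\<^bsub>mcross\<^esub> f) = c *\<^sub>C \<theta> f"
      unfolding \<theta>[OF f] \<theta>[OF mcross_closed(5)[OF f]] scaleC_sum
      by (rule sum.cong[OF refl]) (simp add: F_smult[OF mf mf] scaleC_mult_left)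
    have "\<theta> (adj mcross f) = (\<Sum>t\<in>I. U t * star (F (f (inv t))))"
      unfolding \<theta>[OF mcross_closed(4)[OF f]]
    proof (rule sum.cong[OF refl])
      fix t assume t: "t \<in> I"
      then have m: "f (inv t) \<in> carrier A" using mf by simp
      have "adj mcross f t = \<alpha> t (adj A (f (inv t)))" using t by simp
      then show "F (adj mcross f t) * U t = U t * star (F (f (inv t)))"
        using UF[OF t eD(9)[OF m]] F_adj[OF m m] by simp
    qed
    also have "\<dots> = (\<Sum>t\<in>I. U (inv t) * star (F (f (inv (inv t)))))" by (rule sum_reindex_group(3)[OF group_axioms one_closed])
    also have "\<dots> = (\<Sum>t\<in>I. star (F (f t) * U t))" by (rule sum.cong[OF refl]) (simp add: Uinv star_mult)
    also have "\<dots> = star (\<theta> f)" unfolding \<theta>[OF f] by (rule star_sum[symmetric])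
    finally show "\<theta> (adj mcross f) = star (\<theta> f)" .
  qed
  then show ?thesis using D(13)[OF IFm[OF f]] by (simp add: \<theta>_def)
qed

end

text \<open>The algebra generated by \<open>S\<close> and the unit inside a unitization.\<close>
definition unitized :: "'b::nc_star unitz set \<Rightarrow> 'b unitz set" where
  "unitized S = {y. Unitz (nonunital_part y) 0 \<in> S}"

lemma closed_unitized: assumes "closed S" shows "closed (unitized (S :: 'b::nc_star unitz set))"
proof -
  have 1: "bounded_linear (scalar_part :: 'b unitz \<Rightarrow> complex)"
    by (rule bounded_linear_intro[where K = 1])
      (use cmod_scalar_part_le in \<open>auto simp: unitz_defs scaleR_conv_of_real\<close>)
  have 2: "bounded_linear (\<lambda>c. c *\<^sub>C (1 :: 'b unitz))"
    by (rule bounded_linear_intro[where K = 1])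
      (auto simp: scaleC_add_left norm_scaleC scaleR_conv_of_real[where 'a = complex] scaleC_scaleC simp flip: scaleC_of_real)
  have "bounded_linear (\<lambda>y :: 'b unitz. y - scalar_part y *\<^sub>C 1)"
    by (rule bounded_linear_sub[OF bounded_linear_ident bounded_linear_compose[OF 2 1]])
  then have "closed ((\<lambda>y. y - scalar_part y *\<^sub>C 1) -` S)"
    by (intro continuous_closed_vimage assms linear_continuous_at)
  moreover have "y - scalar_part y *\<^sub>C 1 = Unitz (nonunital_part y) 0" for y :: "'b unitz"
    by (cases y) (simp add: unitz_star_defs)
  ultimately show ?thesis by (simp add: unitized_def vimage_def)
qed

lemma csub_unitized:
  assumes S: "csub (S :: 'b::nc_star unitz set)" and sc: "\<And>y. y \<in> S \<Longrightarrow> scalar_part y = 0"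
  shows "csub (unitized S)" "S \<subseteq> unitized S" "1 \<in> unitized S"
proof -
  let ?p = "\<lambda>y :: 'b unitz. Unitz (nonunital_part y) 0"
  have p: "?p (x + y) = ?p x + ?p y" "?p (x * y) = ?p x * ?p y + scalar_part x *\<^sub>C ?p y + scalar_part y *\<^sub>C ?p x"
    "?p (star x) = star (?p x)" "?p (c *\<^sub>C x) = c *\<^sub>C ?p x" "?p 0 = 0" "?p 1 = 0" for x y c
    by (simp_all add: unitz_star_defs)
  show "csub (unitized S)"
    unfolding csub_def using closed_unitized[OF csub_closed[OF S]] S
    by (simp add: unitized_def p csub_mem)
  show "1 \<in> unitized S" using csub_0[OF S] by (simp add: unitized_def p)
  show "S \<subseteq> unitized S"
  proof
    fix y assume y: "y \<in> S"
    then have "?p y = y" using sc[OF y] by (cases y) simp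
    then show "y \<in> unitized S" using y by (simp add: unitized_def)
  qed
qed

lemma unitized_inj:
  assumes S: "csub S" "S \<noteq> {0}"
  obtains k where "inj_on k (unitized S)" "k ` unitized S \<subseteq> (S :: 'b::nc_star unitz set)"
proof -
  obtain h where h: "bij_betw h (S \<times> S) S"
    using card_of_Times_same_infinite[OF csub_infinite[OF S]] card_of_ordIso by blast
  obtain s where s: "s \<in> S" "s \<noteq> 0" using S csub_0 by blast
  define k where "k y = h (Unitz (nonunital_part y) 0, scalar_part y *\<^sub>C s)" for y
  have m: "(Unitz (nonunital_part y) 0, scalar_part y *\<^sub>C s) \<in> S \<times> S" if "y \<in> unitized S" for y
    using that s S by (auto simp: unitized_def csub_mem)
  have "inj_on k (unitized S)"
  proof (rule inj_onI)
    fix x y assume x: "x \<in> unitized S" and y: "y \<in> unitized S" and e: "k x = k y"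
    have "(Unitz (nonunital_part x) 0, scalar_part x *\<^sub>C s) = (Unitz (nonunital_part y) 0, scalar_part y *\<^sub>C s)"
      by (rule inj_onD[OF bij_betw_imp_inj_on[OF h] e[unfolded k_def] m[OF x] m[OF y]])
    then have n: "nonunital_part x = nonunital_part y" and c: "scalar_part x *\<^sub>C s = scalar_part y *\<^sub>C s" by auto
    have "(scalar_part x - scalar_part y) *\<^sub>C s + scalar_part y *\<^sub>C s = scalar_part x *\<^sub>C s"
      by (simp flip: scaleC_add_left)
    then have "(scalar_part x - scalar_part y) *\<^sub>C s = 0" using c by simp
    then have "cmod (scalar_part x - scalar_part y) * norm s = 0" by (simp flip: norm_scaleC)
    then have "scalar_part x = scalar_part y" using s(2) by simp
    then show "x = y" using n by (simp add: unitz.expand)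
  qed
  moreover have "k ` unitized S \<subseteq> S" using m h unfolding k_def bij_betw_def by blast
  ultimately show ?thesis by (rule that)
qed

text \<open>A unital matrix algebra that contains the matrices over \<open>S\<close>, copied to any type into which \<open>S\<close>
  injects. Adjoining scalars and passing to matrices does not raise the cardinality, because a nonzero
  algebra is infinite and contains a complex line.\<close>
lemma small_matrix_algebra:
  fixes \<iota> :: "'b::nc_star unitz \<Rightarrow> 'c" and I :: "'i set"
  assumes I: "finite I" and S: "csub S" "S \<noteq> {0}" and sc: "\<And>y. y \<in> S \<Longrightarrow> scalar_part y = 0" and i: "inj_on \<iota> S"
  shows "\<exists>(B :: 'c cstar) \<kappa> j. star_embedding B j \<and> carrier B = \<kappa> ` mats I (unitized S) \<and>
    (\<forall>x\<in>mats I (unitized S). j (\<kappa> x) = memb I (unitized S) x) \<and>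
    \<one>\<^bsub>B\<^esub> = \<kappa> (\<lambda>i j. if i = j \<and> i \<in> I then 1 else 0)"
proof -
  note U = csub_unitized[OF S(1) sc]
  have nz: "unitized S \<noteq> {0}"
  proof
    assume z: "unitized S = {0}"
    show False using U(3) unfolding z by simp
  qed
  have inf: "infinite (unitized S)" by (rule csub_infinite[OF U(1) nz])
  let ?M = "mats I (unitized S)" and ?m = "memb I (unitized S)"
  obtain f where f: "inj_on f ?M" "f ` ?M \<subseteq> unitized S" using mats_inj[OF inf I] .
  obtain k where k: "inj_on k (unitized S)" "k ` unitized S \<subseteq> S" using unitized_inj[OF S] .
  have "inj_on (k \<circ> f) ?M" by (rule comp_inj_on[OF f(1) inj_on_subset[OF k(1) f(2)]])
  moreover have "(k \<circ> f) ` ?M \<subseteq> S" using f(2) k(2) by auto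
  ultimately have "inj_on (\<iota> \<circ> (k \<circ> f)) ?M" by (rule comp_inj_on[OF _ inj_on_subset[OF i]])
  then have i': "inj_on ((\<iota> \<circ> (k \<circ> f)) \<circ> inv_into ?M ?m) (?m ` ?M)" by (rule inj_on_comp_inv_into)
  define \<iota>' where "\<iota>' = (\<iota> \<circ> (k \<circ> f)) \<circ> inv_into ?M ?m"
  note D = membD[OF I U(1)]
  show ?thesis
  proof (rule exI[of _ "transport \<iota>' (?m ` ?M) (?m (\<lambda>i j. if i = j \<and> i \<in> I then 1 else 0))"],
      rule exI[of _ "\<lambda>x. \<iota>' (?m x)"], rule exI[of _ "inv_into (?m ` ?M) \<iota>'"], intro conjI ballI)
    show "star_embedding (transport \<iota>' (?m ` ?M) (?m (\<lambda>i j. if i = j \<and> i \<in> I then 1 else 0))) (inv_into (?m ` ?M) \<iota>')"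
      by (rule star_embedding_transport[OF D(2) i'[folded \<iota>'_def]])
    show "inv_into (?m ` ?M) \<iota>' (\<iota>' (?m x)) = ?m x" if "x \<in> ?M" for x
      by (rule inv_into_f_f[OF i'[folded \<iota>'_def]]) (use that in simp)
  qed (simp_all add: transport_def Let_def image_image)
qed

lemma memb_sum:
  assumes I: "finite I" and S: "csub S" and P: "\<And>p. p \<in> P \<Longrightarrow> y p \<in> mats I S" "finite P"
  shows "(\<lambda>s t. \<Sum>p\<in>P. y p s t) \<in> mats I S \<and> memb I S (\<lambda>s t. \<Sum>p\<in>P. y p s t) = (\<Sum>p\<in>P. memb I S (y p))"
  using P(2,1)
proof (induction P rule: finite_induct)
  case empty then show ?case using membD(3,4)[OF I S] by simp
next
  case (insert p P)
  then show ?case using membD(5,7)[OF I S] by simp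
qed

context finite_action
begin

text \<open>The regular representation on a type of the size of \<open>A\<close>: \<open>\<phi> a\<close> is the diagonal matrix of the translates
  of \<open>a\<close> and \<open>u g\<close> the permutation matrix of translation by \<open>g\<close>. Its integrated form is the matrix \<open>\<Phi> f\<close>.\<close>
lemma integrated_form_attains:
  assumes ne: "carrier A \<noteq> {\<zero>\<^bsub>A\<^esub>}"
  shows "\<exists>(B :: 'a cstar) \<phi> u. covariant_rep G A \<alpha> B \<phi> u \<and>
    (\<forall>f\<in>carrier mcross. cnorm B (integrated_form G B \<phi> u f) = mnorm I (\<Phi> f))"
proof -
  have S0: "S \<noteq> {0}"
  proof
    assume z: "S = {0}"
    have "x = \<zero>\<^bsub>A\<^esub>" if x: "x \<in> carrier A" for x
    proof (rule inj_onD[OF eD(1) _ x eD(3)])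
      have "e x \<in> S" using x by (simp add: S_def)
      then show "e x = e \<zero>\<^bsub>A\<^esub>" using z eD(4) by simp
    qed
    then show False using ne eD(3) by blast
  qed
  have sc: "scalar_part y = 0" if "y \<in> S" for y using that by (auto simp: S_def e_def emb_def)
  define S1 where "S1 = unitized S"
  note U = csub_unitized[OF S sc, folded S1_def]
  have "inj_on (inv_into (carrier A) e) S" unfolding S_def by (rule inj_on_inv_into) simp
  note small_matrix_algebra[OF finG S S0 sc this, folded S1_def]
  then obtain B :: "'a cstar" and \<kappa> j where B: "star_embedding B j" "carrier B = \<kappa> ` mats I S1"
    "\<And>x. x \<in> mats I S1 \<Longrightarrow> j (\<kappa> x) = memb I S1 x"
    "\<one>\<^bsub>B\<^esub> = \<kappa> (\<lambda>i j. if i = j \<and> i \<in> I then 1 else 0)" by blast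
  note D = star_embeddingD[OF B(1)] and M = membD[OF finG U(1)]
  have km: "\<kappa> x \<in> carrier B" if "x \<in> mats I S1" for x using that B(2) by simp
  have kI: "X = \<kappa> x" if "X \<in> carrier B" "x \<in> mats I S1" "j X = memb I S1 x" for X x
    by (rule inj_onD[OF D(1) _ that(1) km[OF that(2)]]) (simp only: that(3) B(3)[OF that(2)])
  have k: "\<kappa> x \<oplus>\<^bsub>B\<^esub> \<kappa> y = \<kappa> (\<lambda>i j. x i j + y i j)" "\<kappa> x \<otimes>\<^bsub>B\<^esub> \<kappa> y = \<kappa> (mmul I x y)"
    "adj B (\<kappa> x) = \<kappa> (madj x)" "c \<odot>\<^bsub>B\<^esub> \<kappa> x = \<kappa> (\<lambda>i j. c *\<^sub>C x i j)"
    if "x \<in> mats I S1" "y \<in> mats I S1" for x y c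
    using that by (auto intro!: kI simp: D M B(3) km)
  define V :: "'g \<Rightarrow> 'g \<Rightarrow> 'g \<Rightarrow> 'a uni" where "V g s t = (if s \<in> I \<and> t \<in> I \<and> s = g \<otimes> t then 1 else 0)" for g s t
  define \<Delta> where "\<Delta> a s t = (if s \<in> I \<and> s = t then e (\<alpha> (inv s) a) else 0)" for a s t
  have eS: "e a \<in> S1" if "a \<in> carrier A" for a using that U(2) by (auto simp: S_def)
  have Vm: "V g \<in> mats I S1" for g using U(3) csub_0[OF U(1)] by (auto simp: V_def mats_def)
  have Dm: "\<Delta> a \<in> mats I S1" if "a \<in> carrier A" for a
    using that csub_0[OF U(1)] by (auto simp: \<Delta>_def mats_def intro!: eS act_mem)
  have mV1: "mmul I (V g) x s t = (if s \<in> I then x (inv g \<otimes> s) t else 0)" if g: "g \<in> I" for g x s t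
  proof -
    have "mmul I (V g) x s t = (\<Sum>k\<in>I. if k = inv g \<otimes> s then (if s \<in> I then x k t else 0) else 0)"
      unfolding mmul_def
    proof (rule sum.cong[OF refl])
      fix k assume k: "k \<in> I"
      have "s = g \<otimes> k \<longleftrightarrow> k = inv g \<otimes> s" if "s \<in> I" using g k that inv_cancel[OF g k] cancel_inv[OF g that] by metis
      then show "V g s k * x k t = (if k = inv g \<otimes> s then (if s \<in> I then x k t else 0) else 0)" using k by (auto simp: V_def)
    qed
    then show ?thesis using g finG by simp
  qed
  have mV2: "mmul I x (V g) s t = (if t \<in> I then x s (g \<otimes> t) else 0)" if g: "g \<in> I" for g x s t
  proof -
    have "mmul I x (V g) s t = (\<Sum>k\<in>I. if k = g \<otimes> t then (if t \<in> I then x s k else 0) else 0)"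
      unfolding mmul_def by (rule sum.cong[OF refl]) (auto simp: V_def)
    then show ?thesis using g finG by simp
  qed
  have mD: "mmul I (\<Delta> a) x s t = (if s \<in> I then e (\<alpha> (inv s) a) * x s t else 0)" for a x s t
  proof -
    have "mmul I (\<Delta> a) x s t = (\<Sum>k\<in>I. if k = s then e (\<alpha> (inv s) a) * x s t else 0)"
      unfolding mmul_def by (rule sum.cong[OF refl]) (auto simp: \<Delta>_def)
    then show ?thesis using finG by simp
  qed
  have VV: "mmul I (V g) (V h) = V (g \<otimes> h)" if g: "g \<in> I" and h: "h \<in> I" for g h
    using g h by (auto simp: fun_eq_iff mV2[OF h]) (auto simp: V_def m_assoc)
  have V1: "V \<one> = (\<lambda>i j. if i = j \<and> i \<in> I then 1 else 0)" by (auto simp: V_def fun_eq_iff)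
  have Vadj: "madj (V g) = V (inv g)" if g: "g \<in> I" for g
  proof -
    have "t = g \<otimes> s \<longleftrightarrow> s = inv g \<otimes> t" if "s \<in> I" "t \<in> I" for s t
      using inv_cancel[OF g that(1)] cancel_inv[OF g that(2)] by metis
    then show ?thesis by (auto simp: V_def madj_def fun_eq_iff)
  qed
  have cov: "mmul I (mmul I (V g) (\<Delta> a)) (V (inv g)) = \<Delta> (\<alpha> g a)" if g: "g \<in> I" and a: "a \<in> carrier A" for g a
  proof (intro ext)
    fix s t
    show "mmul I (mmul I (V g) (\<Delta> a)) (V (inv g)) s t = \<Delta> (\<alpha> g a) s t"
    proof (cases "s \<in> I \<and> t \<in> I")
      case True
      then have "inv g \<otimes> s = inv g \<otimes> t \<longleftrightarrow> s = t" using g cancel_inv by (metis)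
      moreover have "inv (inv g \<otimes> t) = inv t \<otimes> g" using True g by (simp add: inv_mult_group)
      ultimately show ?thesis using True g a
        by (simp add: mV1[OF g] mV2[OF inv_closed[OF g]]) (simp add: \<Delta>_def act_comp)
    qed (use g in \<open>auto simp: mV1[OF g] mV2[OF inv_closed[OF g]] \<Delta>_def\<close>)
  qed
  have mone: "mmul I (V \<one>) x = x \<and> mmul I x (V \<one>) = x" if "x \<in> mats I S1" for x
    using that by (auto simp: fun_eq_iff mV1[OF one_closed] mV2[OF one_closed]) (auto simp: mats_def)
  define \<phi> where "\<phi> a = \<kappa> (\<Delta> a)" for a
  define u where "u g = \<kappa> (V g)" for g
  have uk: "u g = \<kappa> (V g)" "\<one>\<^bsub>B\<^esub> = \<kappa> (V \<one>)" for g by (simp_all add: u_def V1 B(4))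
  have "unital B" unfolding unital_def uk using km[OF Vm] by (auto simp: B(2) k[OF Vm] k[OF _ Vm] mone)
  moreover have "\<phi> \<in> star_hom A B"
  proof -
    have dl: "mmul I (\<Delta> a) (\<Delta> b) = \<Delta> (a \<otimes>\<^bsub>A\<^esub> b)" "(\<lambda>i j. \<Delta> a i j + \<Delta> b i j) = \<Delta> (a \<oplus>\<^bsub>A\<^esub> b)" "madj (\<Delta> a) = \<Delta> (adj A a)"
      "(\<lambda>i j. c *\<^sub>C \<Delta> a i j) = \<Delta> (c \<odot>\<^bsub>A\<^esub> a)" if "a \<in> carrier A" "b \<in> carrier A" for a b c
      using that by (auto simp: fun_eq_iff mD) (auto simp: \<Delta>_def madj_def act_simps act_mem eD)
    have ad: "adj B (\<phi> a) = \<phi> (adj A a)" "c \<odot>\<^bsub>B\<^esub> \<phi> a = \<phi> (c \<odot>\<^bsub>A\<^esub> a)" if "a \<in> carrier A" for a c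
      unfolding \<phi>_def k(3,4)[OF Dm[OF that] Dm[OF that]] dl(3,4)[OF that that] by (rule refl)+
    have "\<phi> a \<oplus>\<^bsub>B\<^esub> \<phi> b = \<phi> (a \<oplus>\<^bsub>A\<^esub> b)" "\<phi> a \<otimes>\<^bsub>B\<^esub> \<phi> b = \<phi> (a \<otimes>\<^bsub>A\<^esub> b)"
      if "a \<in> carrier A" "b \<in> carrier A" for a b
      unfolding \<phi>_def k(1,2)[OF Dm[OF that(1)] Dm[OF that(2)]] dl(1,2)[OF that] by (rule refl)+
    moreover have "\<phi> a \<in> carrier B" if "a \<in> carrier A" for a unfolding \<phi>_def by (rule km[OF Dm[OF that]])
    ultimately show ?thesis unfolding star_hom_def by (simp add: ad)
  qed
  moreover have "u \<in> hom G B" using km[OF Vm] by (auto simp: hom_def uk k[OF Vm Vm] VV)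
  moreover have "adj B (u g) = u (inv g)" if "g \<in> I" for g by (simp add: uk k[OF Vm Vm] Vadj[OF that])
  ultimately have "covariant_rep G A \<alpha> B \<phi> u"
    unfolding covariant_rep_def using star_embedding_cstar_algebra[OF B(1)]
    by (auto simp: uk k[OF Vm Vm] VV \<phi>_def k[OF Vm Dm] k[OF mats_mem(5)[OF finG U(1) Vm Dm] Vm] cov)
  moreover have "cnorm B (integrated_form G B \<phi> u f) = mnorm I (\<Phi> f)" if f: "f \<in> carrier mcross" for f
  proof -
    note mf = cp_mem[OF f]
    have DV: "\<phi> (f g) \<otimes>\<^bsub>B\<^esub> u g = \<kappa> (mmul I (\<Delta> (f g)) (V g))" "mmul I (\<Delta> (f g)) (V g) \<in> mats I S1" if "g \<in> I" for g
      using k(2)[OF Dm[OF mf[OF that]] Vm] mats_mem(5)[OF finG U(1) Dm[OF mf[OF that]] Vm] by (simp_all add: \<phi>_def u_def)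
    have "(\<lambda>g. \<phi> (f g) \<otimes>\<^bsub>B\<^esub> u g) \<in> I \<rightarrow> carrier B" using DV km by auto
    note s = star_embedding_finsum[OF B(1) finG this]
    have "j (integrated_form G B \<phi> u f) = (\<Sum>g\<in>I. memb I S1 (mmul I (\<Delta> (f g)) (V g)))"
      unfolding integrated_form_def conjunct2[OF s] by (rule sum.cong[OF refl]) (simp add: DV B(3))
    also have "\<dots> = memb I S1 (\<lambda>s t. \<Sum>g\<in>I. mmul I (\<Delta> (f g)) (V g) s t)"
      using memb_sum[OF finG U(1) DV(2) finG] by simp
    also have "(\<lambda>s t. \<Sum>g\<in>I. mmul I (\<Delta> (f g)) (V g) s t) = \<Phi> f"
    proof (intro ext)
      fix s t
      show "(\<Sum>g\<in>I. mmul I (\<Delta> (f g)) (V g) s t) = \<Phi> f s t"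
      proof (cases "s \<in> I \<and> t \<in> I")
        case True
        have "(\<Sum>g\<in>I. mmul I (\<Delta> (f g)) (V g) s t) = (\<Sum>g\<in>I. if g = s \<otimes> inv t then e (\<alpha> (inv s) (f g)) else 0)"
        proof (rule sum.cong[OF refl])
          fix g assume g: "g \<in> I"
          have sg: "s = g \<otimes> t \<longleftrightarrow> g = s \<otimes> inv t" using True g inv_solve_right[of g s t] by auto
          show "mmul I (\<Delta> (f g)) (V g) s t = (if g = s \<otimes> inv t then e (\<alpha> (inv s) (f g)) else 0)"
            unfolding mV2[OF g] \<Delta>_def sg using True by simp
        qed
        then show ?thesis using True finG by (simp add: \<Phi>_def)
      next
        case False
        have "mmul I (\<Delta> (f g)) (V g) s t = 0" if "g \<in> I" for g
          using False by (auto simp: mD V_def)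
        moreover have "\<Phi> f s t = 0" using False by (auto simp: \<Phi>_def)
        ultimately show ?thesis by simp
      qed
    qed
    finally have j: "j (integrated_form G B \<phi> u f) = memb I S1 (\<Phi> f)" .
    have "\<Phi> f \<in> mats I S1" using Phi_mem[OF f] U(2) by (auto simp: mats_def)
    then show ?thesis
      using D(13)[of "integrated_form G B \<phi> u f"] conjunct1[OF s] M(13) by (simp add: integrated_form_def[symmetric] j)
  qed
  ultimately show ?thesis by blast
qed

lemma covariant_rep_zero: "carrier A = {\<zero>\<^bsub>A\<^esub>} \<Longrightarrow> covariant_rep G A \<alpha> (zero_cstar :: 'a cstar) (\<lambda>_. undefined) (\<lambda>_. undefined)"
  using cstar_algebra_zero_cstar
  by (auto simp: covariant_rep_def unital_def star_hom_def hom_def zero_cstar_def)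

text \<open>The matrix norm bounds all integrated forms and is attained. For the zero algebra both sides vanish,
  and the zero representation shows that the supremum is taken over a nonempty set.\<close>
lemma universal_norm_eq:
  assumes E: "star_embedding mcross (\<Psi> :: _ \<Rightarrow> 't::uc_star)" and f: "f \<in> carrier mcross"
  shows "universal_norm G A \<alpha> f = mnorm I (\<Phi> f)"
proof -
  let ?N = "{cnorm B (integrated_form G B \<phi> u f) | (B :: 'a cstar) \<phi> u. covariant_rep G A \<alpha> B \<phi> u}"
  have le: "v \<le> mnorm I (\<Phi> f)" if "v \<in> ?N" for v using that norm_integrated_form_le[OF E _ f] by auto
  have "mnorm I (\<Phi> f) \<in> ?N"
  proof (cases "carrier A = {\<zero>\<^bsub>A\<^esub>}")
    case True
    have "\<Phi> f s t = 0" for s t using cp_mem[OF f] act_mem True eD(4) by (simp add: \<Phi>_def)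
    then have "\<Phi> f = (\<lambda>i j. 0)" by (intro ext)
    then have "mnorm I (\<Phi> f) = 0" using mnorm_eq_0[OF finG S mats_mem(1)[OF finG S]] by simp
    moreover have "cnorm (zero_cstar :: 'a cstar) x = 0" for x by (simp add: zero_cstar_def)
    ultimately show ?thesis using covariant_rep_zero[OF True] by force
  next
    case False
    then show ?thesis using integrated_form_attains f by force
  qed
  then show ?thesis unfolding universal_norm_def using le by (rule cSup_eq_maximum)
qed

lemma crossed_product_embedding:
  assumes E: "star_embedding mcross (\<Psi> :: _ \<Rightarrow> 't::uc_star)"
  shows "star_embedding (crossed_product G A \<alpha>) \<Psi>" "carrier (crossed_product G A \<alpha>) = carrier mcross"
proof -
  let ?C = "crossed_product G A \<alpha>"
  show c: "carrier ?C = carrier mcross" by (simp add: crossed_product_def)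
  have ops: "x \<otimes>\<^bsub>?C\<^esub> y = x \<otimes>\<^bsub>mcross\<^esub> y" "x \<oplus>\<^bsub>?C\<^esub> y = x \<oplus>\<^bsub>mcross\<^esub> y" "\<zero>\<^bsub>?C\<^esub> = \<zero>\<^bsub>mcross\<^esub>" "c \<odot>\<^bsub>?C\<^esub> x = c \<odot>\<^bsub>mcross\<^esub> x" "adj ?C x = adj mcross x" for x y c
    by (simp_all add: crossed_product_def)
  have "cnorm ?C x = norm (\<Psi> x)" if "x \<in> carrier mcross" for x
    using universal_norm_eq[OF E that] star_embeddingD(13)[OF E that] by (simp add: crossed_product_def)
  then show "star_embedding ?C \<Psi>"
    unfolding star_embedding_def ops c using star_embeddingD[OF E] by (simp del: mcross_simps)
qed

end

theorem corollary2p3: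
  fixes \<C> :: "'c cstar set"
    and G :: "('g, 'm) monoid_scheme"
    and A :: "'a cstar"
    and \<alpha> :: "'g \<Rightarrow> 'a \<Rightarrow> 'a"
  assumes "upwards_directed \<C>"
    and "comm_group G" and "finite (carrier G)" and "\<exists>n::nat. order G = 2 ^ n"
    and "cstar_algebra A"
    and "cstar_action G A \<alpha>"
  shows "(hereditarily_in \<C> A \<longrightarrow>
            hereditarily_in \<C> (crossed_product G A \<alpha>) \<and>
            hereditarily_in \<C> (fixed_point_algebra G A \<alpha>)) \<and>
         (residually_hereditarily_in \<C> A \<longrightarrow>
            residually_hereditarily_in \<C> (crossed_product G A \<alpha>) \<and>
            residually_hereditarily_in \<C> (fixed_point_algebra G A \<alpha>))"
proof -
  obtain k where k: "order G = 2 ^ k" using assms(4) by blast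
  interpret comm_group G by (rule assms(2))
  interpret finite_action G A \<alpha> by (intro finite_action.intro finite_action_axioms.intro is_group assms)
  \<comment> \<open>the trivial property isolates the embedding\<close>
  have emb_cross: "star_embedding (crossed_product G A \<alpha>) (\<lambda>f. memb (carrier G) S (\<Phi> f))"
    by (rule crossed_product_embedding(1)[OF crossed_embedding_stable(1)[where P = "\<lambda>_. True", OF assms(2) k]]) auto
  note cross = hereditarily_in_iff[OF emb_cross] residually_hereditarily_in_iff[OF emb_cross]
  note carr = crossed_product_embedding(2)[OF crossed_embedding_stable(1)[where P = "\<lambda>_. True", OF assms(2) k]]
  note base = hereditarily_in_iff[OF e, folded S_def] residually_hereditarily_in_iff[OF e, folded S_def]
  have fp: "star_embedding (fixed_point_algebra G A \<alpha>) e \<and> P (e ` carrier (fixed_point_algebra G A \<alpha>))"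
    if "\<And>S \<sigma>. invol \<sigma> S \<Longrightarrow> P S \<Longrightarrow> P (fixed \<sigma> S)" "P S" for P
    using fixed_points_stable[where P = P, OF that(1) e _ assms(2,3) k act_hom act_comp act_one] that(2)
    by (simp add: S_def fixed_point_algebra_def)
  have cp: "P ((\<lambda>f. memb (carrier G) S (\<Phi> f)) ` carrier (crossed_product G A \<alpha>))"
    if "\<And>S \<sigma>. invol \<sigma> S \<Longrightarrow> P S \<Longrightarrow> P (fixed \<sigma> S)" "P (memb (carrier G) S ` mats (carrier G) S)" for P
    using crossed_embedding_stable(2)[where P = P, OF assms(2) k that] by (simp add: crossed_product_def)
  show ?thesis
  proof (intro conjI impI)
    assume "hereditarily_in \<C> A"
    then have S': "hered \<C> S" by (simp add: base)
    note st = hered_fixed_invol[OF assms(1)]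
    show "hereditarily_in \<C> (crossed_product G A \<alpha>)"
      unfolding cross by (rule cp[where P = "hered \<C>", OF st hered_mats[OF finG S assms(1) S']])
    from fp[where P = "hered \<C>", OF st S'] show "hereditarily_in \<C> (fixed_point_algebra G A \<alpha>)"
      using hereditarily_in_iff by blast
  next
    assume "residually_hereditarily_in \<C> A"
    then have S': "reshered \<C> S" by (simp add: base)
    note st = reshered_fixed_invol[OF assms(1)]
    show "residually_hereditarily_in \<C> (crossed_product G A \<alpha>)"
      unfolding cross by (rule cp[where P = "reshered \<C>", OF st reshered_mats[OF finG S assms(1) S']])
    from fp[where P = "reshered \<C>", OF st S'] show "residually_hereditarily_in \<C> (fixed_point_algebra G A \<alpha>)"
      using residually_hereditarily_in_iff by blast
  qed
qed

end
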